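(* The problem $[3,5]$-CH is $\Pi_2^p$-complete in the class of triangle-free planar graphs of maximum degree at most $12$.
   Context: All graphs are finite and simple. A graph $G=(V,E)$ is $[\ell,k]$-choosable (with $k\ge \ell$) if for every assignment of lists $L(v)\subseteq\{1,\dots,k\}$ with $|L(v)|=\ell$ for all $v\in V$, there is a proper coloring $c$ of $G$ with $c(v)\in L(v)$ for all $v\in V$. $[\ell,k]$-CH is the decision problem: given a graph $G$, decide whether $G$ is $[\ell,k]$-choosable. $\Pi_2^p$ is the usual class of the polynomial hierarchy; completeness is with respect to polynomial-time many-one reductions. *)

theory Defs
  imports "HOL-Analysis.Analysis" "HOL-Computational_Algebra.Polynomial"
begin

section \<open>Graphs\<close>

text \<open>A graph is given by its vertex set \<open>V\<close> and its set \<open>E\<close> of edges, each edge being the set of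
  its two end points.\<close>

definition simple_graph :: "'a set \<Rightarrow> 'a set set \<Rightarrow> bool" where
  "simple_graph V E \<longleftrightarrow> finite V \<and> (\<forall>e\<in>E. e \<subseteq> V \<and> card e = 2)"

definition proper_coloring :: "'a set set \<Rightarrow> ('a \<Rightarrow> nat) \<Rightarrow> bool" where
  "proper_coloring E c \<longleftrightarrow> (\<forall>u v. {u, v} \<in> E \<longrightarrow> u \<noteq> v \<longrightarrow> c u \<noteq> c v)"

definition choosable :: "nat \<Rightarrow> nat \<Rightarrow> 'a set \<Rightarrow> 'a set set \<Rightarrow> bool" where
  "choosable l k V E \<longleftrightarrow>
     (\<forall>L :: 'a \<Rightarrow> nat set. (\<forall>v\<in>V. L v \<subseteq> {1..k} \<and> card (L v) = l) \<longrightarrow>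
       (\<exists>c. proper_coloring E c \<and> (\<forall>v\<in>V. c v \<in> L v)))"

definition triangle_free :: "'a set set \<Rightarrow> bool" where
  "triangle_free E \<longleftrightarrow>
     \<not> (\<exists>u v w. u \<noteq> v \<and> v \<noteq> w \<and> u \<noteq> w \<and> {u, v} \<in> E \<and> {v, w} \<in> E \<and> {u, w} \<in> E)"

definition vdegree :: "'a set set \<Rightarrow> 'a \<Rightarrow> nat" where
  "vdegree E v = card {e \<in> E. v \<in> e}"

text \<open>A graph is planar if it has a drawing in the plane (here \<^typ>\<open>complex\<close>): vertices are distinct
  points, every edge is a simple arc joining its end points, and arcs meet vertices and other arcs
  only in common end points.\<close>

definition planar :: "'a set \<Rightarrow> 'a set set \<Rightarrow> bool" where
  "planar V E \<longleftrightarrow>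
     (\<exists>(pt :: 'a \<Rightarrow> complex) (\<gamma> :: 'a set \<Rightarrow> real \<Rightarrow> complex).
        inj_on pt V \<and>
        (\<forall>e\<in>E. arc (\<gamma> e) \<and> {pathstart (\<gamma> e), pathfinish (\<gamma> e)} = pt ` e \<and>
               path_image (\<gamma> e) \<inter> pt ` V = pt ` e) \<and>
        (\<forall>e\<in>E. \<forall>f\<in>E. e \<noteq> f \<longrightarrow> path_image (\<gamma> e) \<inter> path_image (\<gamma> f) \<subseteq> pt ` (e \<inter> f)))"

text \<open>The graph with vertex set \<open>{..<n}\<close> and edge set \<open>E\<close> is written as \<open>n\<close> in unary, a separator,
  and the adjacency matrix row by row.\<close>

definition enc_graph :: "nat \<Rightarrow> nat set set \<Rightarrow> bool list" where
  "enc_graph n E = replicate n True @ False #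
     concat (map (\<lambda>i. map (\<lambda>j. {i, j} \<in> E) [0..<n]) [0..<n])"

definition graph_problem :: "(nat set \<Rightarrow> nat set set \<Rightarrow> bool) \<Rightarrow> bool list set" where
  "graph_problem P = {enc_graph n E | n E. simple_graph {..<n} E \<and> P {..<n} E}"

abbreviation CH :: "nat \<Rightarrow> nat \<Rightarrow> bool list set" where
  "CH l k \<equiv> graph_problem (choosable l k)"


section \<open>Polynomial-time computation\<close>

text \<open>Deterministic Turing machines with finitely many two-way infinite tapes. A tape consists of its
  contents and the head position. Symbols and states are initial segments of the natural numbers:
  symbol 0 is the blank, 1 and 2 represent the bits; state 0 is the start state, and the
  number \<open>states M\<close>, which is not itself one of the proper states, is the halting state.\<close>

datatype direction = Lft | Stay | Rgt

type_synonym tape = "(int \<Rightarrow> nat) \<times> int"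

record tm =
  tapes :: nat
  symbols :: nat
  states :: nat
  delta :: "nat \<Rightarrow> nat list \<Rightarrow> nat \<times> (nat \<times> direction) list"

definition wf_tm :: "tm \<Rightarrow> bool" where
  "wf_tm M \<longleftrightarrow> tapes M \<ge> 1 \<and> symbols M \<ge> 3 \<and>
     (\<forall>s ys. s < states M \<longrightarrow> length ys = tapes M \<longrightarrow> (\<forall>y\<in>set ys. y < symbols M) \<longrightarrow>
        (case delta M s ys of (s', as) \<Rightarrow>
           s' \<le> states M \<and> length as = tapes M \<and> (\<forall>(y, d)\<in>set as. y < symbols M)))"

fun move :: "direction \<Rightarrow> int \<Rightarrow> int" where
  "move Lft i = i - 1"
| "move Stay i = i"
| "move Rgt i = i + 1"

fun act :: "nat \<times> direction \<Rightarrow> tape \<Rightarrow> tape" where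
  "act (y, d) (t, i) = (t(i := y), move d i)"

fun step :: "tm \<Rightarrow> nat \<times> tape list \<Rightarrow> nat \<times> tape list" where
  "step M (s, tps) =
     (if s < states M
      then (case delta M s (map (\<lambda>(t, i). t i) tps) of (s', as) \<Rightarrow> (s', map2 act as tps))
      else (s, tps))"

definition string_contents :: "bool list \<Rightarrow> int \<Rightarrow> nat" where
  "string_contents x i =
     (if 0 \<le> i \<and> nat i < length x then (if x ! nat i then 2 else 1) else 0)"

definition init_config :: "tm \<Rightarrow> bool list \<Rightarrow> nat \<times> tape list" where
  "init_config M x =
     (0, (string_contents x, 0) # replicate (tapes M - 1) (string_contents [], 0))"

text \<open>The input is on the first tape and the output on the last one; these may coincide.\<close>

definition computes_within :: "tm \<Rightarrow> bool list \<Rightarrow> bool list \<Rightarrow> nat \<Rightarrow> bool" where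
  "computes_within M x y t \<longleftrightarrow>
     (case (step M ^^ t) (init_config M x) of (s, tps) \<Rightarrow>
        s = states M \<and> fst (last tps) = string_contents y)"

definition polytime :: "(bool list \<Rightarrow> bool list) \<Rightarrow> bool" where
  "polytime f \<longleftrightarrow>
     (\<exists>M (p :: nat poly). wf_tm M \<and> (\<forall>x. computes_within M x (f x) (poly p (length x))))"

definition classP :: "bool list set set" where
  "classP = {A. polytime (\<lambda>x. [x \<in> A])}"


section \<open>The second level of the polynomial hierarchy\<close>

text \<open>Each bit of the first component is preceded by \<open>True\<close>; the first component ends at
  the \<open>False\<close> found in such a position.\<close>

fun pair :: "bool list \<Rightarrow> bool list \<Rightarrow> bool list" where
  "pair [] y = False # y"
| "pair (b # x) y = True # b # pair x y"

definition Pi2p :: "bool list set set" where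
  "Pi2p = {A. \<exists>R \<in> classP. \<exists>p :: nat poly. \<forall>x.
     x \<in> A \<longleftrightarrow>
       (\<forall>y. length y \<le> poly p (length x) \<longrightarrow>
         (\<exists>z. length z \<le> poly p (length x) \<and> pair x (pair y z) \<in> R))}"

text \<open>Completeness of the problem \<open>B\<close> restricted to the instances in \<open>I\<close>, where membership of an
  input in \<open>I\<close> is guaranteed: some \<open>\<Pi>\<^sub>2\<^sup>p\<close> language gives the right answer on all of \<open>I\<close>, and the
  reductions only produce instances in \<open>I\<close>.\<close>

definition Pi2p_complete_on :: "bool list set \<Rightarrow> bool list set \<Rightarrow> bool" where
  "Pi2p_complete_on I B \<longleftrightarrow>
     (\<exists>A\<in>Pi2p. \<forall>x\<in>I. x \<in> A \<longleftrightarrow> x \<in> B) \<and>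
     (\<forall>A\<in>Pi2p. \<exists>f. polytime f \<and> (\<forall>x. f x \<in> I \<and> (x \<in> A \<longleftrightarrow> f x \<in> B)))"

end

theory Submission
  imports Defs
begin

text \<open>Membership: a list assignment and a colouring are strings, and a bounded arithmetic formula over the bits of the
  input checks them; such formulas are decidable in polynomial time.

  Hardness: a \<open>\<Pi>\<^sub>2\<^sup>p\<close> language reduces, by the tableau of its verifier, to quantified CNF formulas whose
  clauses are given by bounded arithmetic formulas. For such a formula we build a graph from 5-cycles and copies of a
  gadget. The gadget makes its root lose at most one colour, which the lists determine. Hence the lists let
  every 5-cycle forbid at most one combination of colours of the vertices to which it is attached, and this combination is
  arbitrary. On a grid with a row for each clause and a column for each literal this forces a crossing of vertical wires (truth
  values) and horizontal wires (whether the clause has been satisfied so far). The lists play the universal player, since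
  for a universal variable they can forbid either truth value; they cannot do more than that, whatever they are.

  The graph is planar because it has a two-page book embedding, the edges of both pages being drawn as parabolas above and
  below the real axis, and triangle-free because it has a homomorphism to the 5-cycle.\<close>

section \<open>Counter programs and Turing machines\<close>

text \<open>The mechanism behind the blocks is a fact about odd cycles: if every vertex of a 5-cycle
  keeps at least two colours, it is uncolourable only when all five keep the same two. With lists of
  size 3 a block vertex loses at most one colour, to its gadget or to a key, so only one combination
  of key colours can be fatal; the gadget that every block carries fixes the common pair
  independently of the keys. The obstacle is that the reduction must survive every list assignment,
  not just the intended one. Hence each component is analysed from two sides: a bound on what
  arbitrary lists can do, and one explicit assignment that attains it. Keys carry gadgets too, so
  they keep at least two colours, and exactly two in the worst case, where they act as Boolean
  variables. The degree bound 12 is the sum of 8 gadget neighbours of a root and at most 4 others.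
  On the machine side formulas are compiled only once, to counter programs with a time bound.
  Afterwards the verifier, the tableau and the adjacency relation of the final graph need only be
  shown definable, and polynomial time follows.\<close>

datatype cmd = Skip | Inc nat | Dec nat | GoR | GoL | Out bool
  | IfZ nat cmd cmd | IfSym nat cmd cmd | Seq cmd cmd | While nat cmd

type_synonym pstate = "int \<times> (nat \<Rightarrow> nat) \<times> bool list"

fun cstep :: "bool list \<Rightarrow> cmd list \<times> pstate \<Rightarrow> cmd list \<times> pstate" where
  "cstep x ([], s) = ([], s)"
| "cstep x (Skip # k, s) = (k, s)"
| "cstep x (Inc r # k, h, v, w) = (k, h, v(r := v r + 1), w)"
| "cstep x (Dec r # k, h, v, w) = (k, h, v(r := v r - 1), w)"
| "cstep x (GoR # k, h, v, w) = (k, h + 1, v, w)"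
| "cstep x (GoL # k, h, v, w) = (k, h - 1, v, w)"
| "cstep x (Out b # k, h, v, w) = (k, h, v, w @ [b])"
| "cstep x (IfZ r c d # k, h, v, w) = ((if v r = 0 then c else d) # k, h, v, w)"
| "cstep x (IfSym a c d # k, h, v, w) = ((if string_contents x h = a then c else d) # k, h, v, w)"
| "cstep x (Seq c d # k, s) = (c # d # k, s)"
| "cstep x (While r c # k, h, v, w) = ((if v r = 0 then k else c # While r c # k), h, v, w)"

text \<open>A superset of the control stacks that can occur while \<open>c\<close> runs on top of
  \<open>k\<close>. It is finite because a loop body always returns to the same stack
  \<open>While r c # k\<close>, so it can serve as the state set of a Turing machine.\<close>

fun conts :: "cmd \<Rightarrow> cmd list \<Rightarrow> cmd list set" where
  "conts (Seq c d) k = insert (Seq c d # k) (conts c (d # k) \<union> conts d k)"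
| "conts (IfZ r c d) k = insert (IfZ r c d # k) (conts c k \<union> conts d k)"
| "conts (IfSym r c d) k = insert (IfSym r c d # k) (conts c k \<union> conts d k)"
| "conts (While r c) k = insert (While r c # k) (conts c (While r c # k))"
| "conts c k = {c # k}"

fun regs_below :: "nat \<Rightarrow> cmd \<Rightarrow> bool" where
  "regs_below n (Inc r) = (r < n)"
| "regs_below n (Dec r) = (r < n)"
| "regs_below n (IfZ r c d) = (r < n \<and> regs_below n c \<and> regs_below n d)"
| "regs_below n (IfSym a c d) = (regs_below n c \<and> regs_below n d)"
| "regs_below n (Seq c d) = (regs_below n c \<and> regs_below n d)"
| "regs_below n (While r c) = (r < n \<and> regs_below n c)"
| "regs_below n _ = True"

lemma regs_below_mono: "regs_below m c \<Longrightarrow> m \<le> n \<Longrightarrow> regs_below n c"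
  by (induction c) auto

lemma regs_below_ex: "\<exists>n. regs_below n c"
proof (induction c)
  case (Inc r) show ?case by (auto intro: exI[of _ "Suc r"])
next
  case (Dec r) show ?case by (auto intro: exI[of _ "Suc r"])
next
  case (IfZ r c d)
  then obtain m n where "regs_below m c" "regs_below n d" by auto
  then show ?case by (auto intro!: exI[of _ "Suc r + m + n"] elim: regs_below_mono)
next
  case (IfSym r c d)
  then obtain m n where "regs_below m c" "regs_below n d" by auto
  then show ?case by (auto intro!: exI[of _ "m + n"] elim: regs_below_mono)
next
  case (Seq c d)
  then obtain m n where "regs_below m c" "regs_below n d" by auto
  then show ?case by (auto intro!: exI[of _ "m + n"] elim: regs_below_mono)
next
  case (While r c)
  then obtain m where "regs_below m c" by auto
  then show ?case by (auto intro!: exI[of _ "Suc r + m"] elim: regs_below_mono)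
qed auto

lemma finite_conts: "finite (conts c k)"
  by (induction c arbitrary: k) auto

lemma conts_self: "c # k \<in> conts c k"
  by (cases c) auto

lemma conts_regs: "l \<in> conts c k \<Longrightarrow> regs_below n c \<Longrightarrow> regs_below n (hd l)"
  by (induction c arbitrary: k) auto

text \<open>What a Turing machine sees: \<open>ys\<close> are the scanned symbols. Tape 0 holds the input, tape \<open>r + 1\<close>
  the counter \<open>r\<close> as the head position on a tape whose cell 0 is marked.\<close>

fun nxt :: "nat list \<Rightarrow> cmd list \<Rightarrow> cmd list" where
  "nxt ys (IfZ r c d # k) = (if ys ! Suc r = 1 then c else d) # k"
| "nxt ys (IfSym a c d # k) = (if ys ! 0 = a then c else d) # k"
| "nxt ys (Seq c d # k) = c # d # k"
| "nxt ys (While r c # k) = (if ys ! Suc r = 1 then k else c # While r c # k)"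
| "nxt ys (_ # k) = k"
| "nxt ys [] = []"

fun actn :: "nat \<Rightarrow> nat list \<Rightarrow> cmd \<Rightarrow> nat \<Rightarrow> nat \<times> direction" where
  "actn n ys (Inc r) i = (ys ! i, if i = Suc r then Rgt else Stay)"
| "actn n ys (Dec r) i = (ys ! i, if i = Suc r \<and> ys ! i \<noteq> 1 then Lft else Stay)"
| "actn n ys GoR i = (ys ! i, if i = 0 then Rgt else Stay)"
| "actn n ys GoL i = (ys ! i, if i = 0 then Lft else Stay)"
| "actn n ys (Out b) i = (if i = Suc n then (if b then 2 else 1, Rgt) else (ys ! i, Stay))"
| "actn n ys _ i = (ys ! i, Stay)"

text \<open>Closure of the stack set under a step, with \<open>k\<close> as the only exit; for
  \<open>k = []\<close> the exit is the halting state.\<close>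

lemma nxt_conts: "l \<in> conts c k \<Longrightarrow> nxt ys l \<in> insert k (conts c k)"
proof (induction c arbitrary: k)
  case (Seq c d)
  consider "l = Seq c d # k" | "l \<in> conts c (d # k)" | "l \<in> conts d k" using Seq.prems by auto
  then show ?case
    using Seq.IH(1)[of "d # k"] Seq.IH(2)[of k] conts_self[of d k] conts_self[of c "d # k"] by cases auto
next
  case (IfZ r c d)
  consider "l = IfZ r c d # k" | "l \<in> conts c k" | "l \<in> conts d k" using IfZ.prems by auto
  then show ?case
    using IfZ.IH(1)[of k] IfZ.IH(2)[of k] conts_self[of d k] conts_self[of c k] by cases auto
next
  case (IfSym r c d)
  consider "l = IfSym r c d # k" | "l \<in> conts c k" | "l \<in> conts d k" using IfSym.prems by auto
  then show ?case
    using IfSym.IH(1)[of k] IfSym.IH(2)[of k] conts_self[of d k] conts_self[of c k] by cases auto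
next
  case (While r c)
  consider "l = While r c # k" | "l \<in> conts c (While r c # k)" using While.prems by auto
  then show ?case
    using While.IH[of "While r c # k"] conts_self[of c "While r c # k"] by cases auto
qed auto

definition mark :: "int \<Rightarrow> nat" where
  "mark = (\<lambda>i. if i = 0 then 1 else 0)"

definition prog_tapes :: "bool list \<Rightarrow> nat \<Rightarrow> pstate \<Rightarrow> tape list" where
  "prog_tapes x n s = (case s of (h, v, w) \<Rightarrow>
     (string_contents x, h) # map (\<lambda>r. (mark, int (v r))) [0..<n] @ [(string_contents w, int (length w))])"

lemma string_contents_Nil: "string_contents [] = (\<lambda>i. 0)"
  by (auto simp: string_contents_def)

lemma string_contents_snoc:
  "(string_contents w)(int (length w) := (if b then 2 else 1)) = string_contents (w @ [b])"
  by (rule ext) (auto simp: string_contents_def nth_append)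

lemma string_contents_less: "string_contents w i < 3"
  by (auto simp: string_contents_def)

lemma prog_tapes_nth:
  "i < n + 2 \<Longrightarrow> prog_tapes x n (h, v, w) ! i =
    (if i = 0 then (string_contents x, h) else if i \<le> n then (mark, int (v (i - 1)))
     else (string_contents w, int (length w)))"
  by (cases i) (auto simp: prog_tapes_def nth_append)

lemma length_prog_tapes: "length (prog_tapes x n s) = n + 2"
  by (auto simp: prog_tapes_def split: prod.splits)

lemma prog_tapes_step:
  assumes "regs_below n c" and "(k', s') = cstep x (c # k, s)"
    and ys: "ys = map (\<lambda>(t, i). t i) (prog_tapes x n s)"
  shows "map2 act (map (actn n ys c) [0..<n + 2]) (prog_tapes x n s) = prog_tapes x n s'"
    and "nxt ys (c # k) = k'"
proof -
  obtain h v w where s: "s = (h, v, w)" by (cases s) auto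
  have y: "ys ! i = (if i = 0 then string_contents x h else if i \<le> n then mark (int (v (i - 1)))
     else string_contents w (int (length w)))" if "i < n + 2" for i
    using that by (simp add: ys s length_prog_tapes prog_tapes_nth)
  have m: "(mark (int k) = Suc 0) = (k = 0)" for k by (simp add: mark_def)
  show "nxt ys (c # k) = k'"
    using assms(1,2) by (cases c) (simp_all add: s y m split: if_splits)
  show "map2 act (map (actn n ys c) [0..<n + 2]) (prog_tapes x n s) = prog_tapes x n s'"
  proof (rule nth_equalityI)
    show "length (map2 act (map (actn n ys c) [0..<n + 2]) (prog_tapes x n s)) = length (prog_tapes x n s')"
      by (simp add: length_prog_tapes)
    fix i assume "i < length (map2 act (map (actn n ys c) [0..<n + 2]) (prog_tapes x n s))"
    then have i: "i < n + 2" by (simp add: length_prog_tapes)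
    then have *: "map2 act (map (actn n ys c) [0..<n + 2]) (prog_tapes x n s) ! i
      = act (actn n ys c i) (prog_tapes x n s ! i)"
      by (simp add: length_prog_tapes del: upt_Suc)
    obtain h' v' w' where s': "s' = (h', v', w')" by (cases s') auto
    have i2: "i = 0 \<or> i = n + 1 \<or> (\<exists>r. i = Suc r \<and> r < n)"
      using i by (cases i) auto
    have c': "cstep x (c # k, h, v, w) = (k', h', v', w')" using assms(2) by (simp add: s s')
    consider "i = 0" | "i = n + 1" | r where "i = Suc r" "r < n" using i2 by auto
    then have "act (actn n ys c i) (prog_tapes x n (h, v, w) ! i) = prog_tapes x n (h', v', w') ! i"
    proof cases
      case 1
      with c' show ?thesis by (cases c) (simp_all add: prog_tapes_nth y split: if_splits)
    next
      case 2
      with c' y[of "n + 1"] assms(1) show ?thesis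
        by (cases c) (auto simp add: prog_tapes_nth string_contents_snoc)
    next
      case 3
      then have yr: "ys ! Suc r = mark (int (v r))" by (simp add: y)
      from 3 c' assms(1) show ?thesis
        by (cases c) (auto simp add: prog_tapes_nth yr m of_nat_diff)
    qed
    then show "map2 act (map (actn n ys c) [0..<n + 2]) (prog_tapes x n s) ! i = prog_tapes x n s' ! i"
      using * by (simp add: s s')
  qed
qed

text \<open>State 0 is preparatory: it writes the mark on cell 0 of every counter tape. The other
  proper states are the control stacks, numbered from 1 on, and the empty stack is the halting
  state.\<close>

definition prog_tm :: "nat \<Rightarrow> cmd \<Rightarrow> tm" where
  "prog_tm n c = (let K = conts c []; e = to_nat_on K; q = card K;
     st = (\<lambda>l. if l = [] then Suc q else Suc (e l)) in
   \<lparr>tapes = n + 2, symbols = 3, states = Suc q,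
    delta = (\<lambda>s ys. if s = 0
      then (st [c], map (\<lambda>i. (if 1 \<le> i \<and> i \<le> n then 1 else ys ! i, Stay)) [0..<n + 2])
      else let l = from_nat_into K (s - 1) in (st (nxt ys l), map (actn n ys (hd l)) [0..<n + 2]))\<rparr>)"

definition prog_state :: "cmd \<Rightarrow> cmd list \<Rightarrow> nat" where
  "prog_state c l = (if l = [] then Suc (card (conts c [])) else Suc (to_nat_on (conts c []) l))"

lemma prog_tm_simps:
  "tapes (prog_tm n c) = n + 2" "symbols (prog_tm n c) = 3" "states (prog_tm n c) = Suc (card (conts c []))"
  "delta (prog_tm n c) 0 ys = (prog_state c [c], map (\<lambda>i. (if 1 \<le> i \<and> i \<le> n then 1 else ys ! i, Stay)) [0..<n + 2])"
  "delta (prog_tm n c) (Suc j) ys = (let l = from_nat_into (conts c []) j in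
     (prog_state c (nxt ys l), map (actn n ys (hd l)) [0..<n + 2]))"
  by (simp_all add: prog_tm_def prog_state_def Let_def)

lemma to_nat_on_less:
  assumes "l \<in> conts c []" shows "to_nat_on (conts c []) l < card (conts c [])"
  using to_nat_on_finite[OF finite_conts[of c "[]"]] assms by (auto simp: bij_betw_def)

lemma prog_state_le: "l \<in> insert [] (conts c []) \<Longrightarrow> prog_state c l \<le> Suc (card (conts c []))"
  using to_nat_on_less by (force simp: prog_state_def)

lemma from_nat_into_conts: "from_nat_into (conts c []) j \<in> conts c []"
  using conts_self[of c "[]"] by (intro from_nat_into) auto

lemma actn_less: "i < length ys \<Longrightarrow> \<forall>y\<in>set ys. y < 3 \<Longrightarrow> fst (actn n ys c i) < 3"
  by (cases c) auto

lemma wf_prog_tm: "wf_tm (prog_tm n c)"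
  unfolding wf_tm_def
proof (intro conjI allI impI)
  fix s ys assume s: "s < states (prog_tm n c)" "length ys = tapes (prog_tm n c)" "\<forall>y\<in>set ys. y < symbols (prog_tm n c)"
  then have y: "length ys = n + 2" "\<forall>y\<in>set ys. y < 3" by (auto simp: prog_tm_simps)
  show "case delta (prog_tm n c) s ys of (s', as) \<Rightarrow> s' \<le> states (prog_tm n c) \<and> length as = tapes (prog_tm n c) \<and> (\<forall>(y, d)\<in>set as. y < symbols (prog_tm n c))"
  proof (cases s)
    case 0
    have "prog_state c [c] \<le> Suc (card (conts c []))"
      using conts_self[of c "[]"] by (intro prog_state_le) auto
    then show ?thesis using y by (auto simp: 0 prog_tm_simps simp del: upt_Suc)
  next
    case (Suc j)
    have "prog_state c (nxt ys (from_nat_into (conts c []) j)) \<le> Suc (card (conts c []))"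
      by (intro prog_state_le nxt_conts from_nat_into_conts)
    moreover have "\<forall>z\<in>set (map (actn n ys (hd (from_nat_into (conts c []) j))) [0..<n + 2]). fst z < 3"
      using y by (auto simp del: upt_Suc intro!: actn_less)
    ultimately show ?thesis using y by (auto simp: Suc prog_tm_simps Let_def simp del: upt_Suc)
  qed
qed (auto simp: prog_tm_simps)

lemma step_prog_tm:
  assumes "regs_below n c" "l \<in> insert [] (conts c [])"
  shows "step (prog_tm n c) (prog_state c l, prog_tapes x n s) =
    (case cstep x (l, s) of (l', s') \<Rightarrow> (prog_state c l', prog_tapes x n s'))"
    "fst (cstep x (l, s)) \<in> insert [] (conts c [])"
proof -
  have "step (prog_tm n c) (prog_state c l, prog_tapes x n s) =
    (case cstep x (l, s) of (l', s') \<Rightarrow> (prog_state c l', prog_tapes x n s')) \<and> fst (cstep x (l, s)) \<in> insert [] (conts c [])"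
  proof (cases "l = []")
    case True
    then show ?thesis by (cases s) (simp add: prog_state_def prog_tm_simps)
  next
    case False
    then have l: "l \<in> conts c []" using assms by auto
    obtain d k where dk: "l = d # k" using False by (cases l) auto
    obtain k' s' where c': "(k', s') = cstep x (d # k, s)" by (metis surj_pair)
    have rb: "regs_below n d" using conts_regs[OF l assms(1)] dk by simp
    define ys where "ys = map (\<lambda>(t, i). t i) (prog_tapes x n s)"
    note st = prog_tapes_step[OF rb c' ys_def]
    have "to_nat_on (conts c []) l < card (conts c [])" using to_nat_on_less[OF l] .
    moreover have "from_nat_into (conts c []) (to_nat_on (conts c []) l) = l"
      using l by (simp add: countable_finite finite_conts)
    moreover have "nxt ys l \<in> insert [] (conts c [])" using nxt_conts[OF l] .
    ultimately show ?thesis using st c' dk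
      by (simp add: prog_state_def[of c "d # k"] prog_tm_simps Let_def ys_def[symmetric] c'[symmetric] del: upt_Suc)
  qed
  then show "step (prog_tm n c) (prog_state c l, prog_tapes x n s) =
    (case cstep x (l, s) of (l', s') \<Rightarrow> (prog_state c l', prog_tapes x n s'))"
    "fst (cstep x (l, s)) \<in> insert [] (conts c [])" by auto
qed

lemma steps_prog_tm:
  assumes "regs_below n c" "l \<in> insert [] (conts c [])"
  shows "(step (prog_tm n c) ^^ t) (prog_state c l, prog_tapes x n s) =
    (case (cstep x ^^ t) (l, s) of (l', s') \<Rightarrow> (prog_state c l', prog_tapes x n s')) \<and>
    fst ((cstep x ^^ t) (l, s)) \<in> insert [] (conts c [])"
proof (induction t)
  case 0 then show ?case using assms by simp
next
  case (Suc t)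
  obtain l' s' where e: "(cstep x ^^ t) (l, s) = (l', s')" by (metis surj_pair)
  then have "l' \<in> insert [] (conts c [])" using Suc by simp
  from step_prog_tm[OF assms(1) this, of x s'] Suc e show ?case by auto
qed

lemma step_init_prog_tm:
  "step (prog_tm n c) (init_config (prog_tm n c) x) = (prog_state c [c], prog_tapes x n (0, \<lambda>_. 0, []))"
proof -
  let ?tp = "(string_contents x, 0 :: int) # replicate (Suc n) (string_contents [], 0)"
  define ys where "ys = map (\<lambda>(t, i). t i) ?tp"
  have "map2 act (map (\<lambda>i. (if 1 \<le> i \<and> i \<le> n then 1 else ys ! i, Stay)) [0..<n + 2]) ?tp
    = prog_tapes x n (0, \<lambda>_. 0, [])"
  proof (rule nth_equalityI)
    fix i assume "i < length (map2 act (map (\<lambda>i. (if 1 \<le> i \<and> i \<le> n then 1 else ys ! i, Stay)) [0..<n + 2]) ?tp)"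
    then have i: "i < n + 2" by simp
    show "map2 act (map (\<lambda>i. (if 1 \<le> i \<and> i \<le> n then 1 else ys ! i, Stay)) [0..<n + 2]) ?tp ! i
      = prog_tapes x n (0, \<lambda>_. 0, []) ! i"
      using i by (cases i) (auto simp: ys_def prog_tapes_nth mark_def string_contents_Nil nth_append fun_eq_iff simp del: upt_Suc replicate_Suc)
  qed (simp add: length_prog_tapes)
  moreover have "init_config (prog_tm n c) x = (0, ?tp)"
    by (simp add: init_config_def prog_tm_simps)
  ultimately show ?thesis
    by (simp only: step.simps ys_def[symmetric] prog_tm_simps split_conv if_True zero_less_Suc)
qed

lemma cstep_halted: "(cstep x ^^ t) ([], s) = ([], s)"
  by (induction t) auto

lemma polytime_prog:
  assumes run: "\<And>x. \<exists>t h v. t \<le> poly p (length x) \<and> (cstep x ^^ t) ([c], (0, \<lambda>_. 0, [])) = ([], (h, v, f x))"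
  shows "polytime f"
proof -
  obtain n where n: "regs_below n c" using regs_below_ex by blast
  have "computes_within (prog_tm n c) x (f x) (poly (p + 1) (length x))" for x
  proof -
    obtain t h v where t: "t \<le> poly p (length x)" "(cstep x ^^ t) ([c], (0, \<lambda>_. 0, [])) = ([], (h, v, f x))"
      using run by blast
    \<comment> \<open>\<open>computes_within\<close> fixes the number of steps exactly; the halted
      run is padded to the full bound. The extra step in \<open>p + 1\<close> is the one that writes
      the marks.\<close>
    have "(cstep x ^^ (poly p (length x) - t + t)) ([c], (0, \<lambda>_. 0, [])) = ([], (h, v, f x))"
      unfolding funpow_add o_apply t(2) by (rule cstep_halted)
    then have c: "(cstep x ^^ poly p (length x)) ([c], (0, \<lambda>_. 0, [])) = ([], (h, v, f x))"
      using t(1) by simp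
    have "(step (prog_tm n c) ^^ Suc (poly p (length x))) (init_config (prog_tm n c) x)
      = (prog_state c [], prog_tapes x n (h, v, f x))"
      unfolding funpow_Suc_right o_apply step_init_prog_tm
      using steps_prog_tm[OF n, of "[c]" "poly p (length x)" x "(0, \<lambda>_. 0, [])"] conts_self[of c "[]"] c by simp
    then show ?thesis
      by (simp add: computes_within_def prog_state_def prog_tm_simps prog_tapes_def)
  qed
  then show ?thesis unfolding polytime_def using wf_prog_tm by blast
qed

section \<open>Bounded arithmetic formulas are decidable in polynomial time\<close>

text \<open>A big-step judgement with a time bound. The step count is chosen before the remaining
  stack \<open>k\<close>, so one count serves every context; this is what lets judgements be
  composed.\<close>

definition rb :: "bool list \<Rightarrow> cmd \<Rightarrow> pstate \<Rightarrow> nat \<Rightarrow> pstate \<Rightarrow> bool" where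
  "rb x c s T s' \<longleftrightarrow> (\<exists>t\<le>T. \<forall>k. (cstep x ^^ t) (c # k, s) = (k, s'))"

lemma rb_step:
  assumes "\<And>k. cstep x (c # k, s) = (k, s')" shows "rb x c s 1 s'"
  unfolding rb_def by (rule exI[of _ 1]) (simp add: assms)

lemma rb_Inc: "v' = v(r := v r + 1) \<Longrightarrow> rb x (Inc r) (h, v, w) 1 (h, v', w)"
  and rb_Dec: "v' = v(r := v r - 1) \<Longrightarrow> rb x (Dec r) (h, v, w) 1 (h, v', w)"
  and rb_GoR: "h' = h + 1 \<Longrightarrow> v' = v \<Longrightarrow> rb x GoR (h, v, w) 1 (h', v', w)"
  and rb_GoL: "h' = h - 1 \<Longrightarrow> v' = v \<Longrightarrow> rb x GoL (h, v, w) 1 (h', v', w)"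
  and rb_Out: "rb x (Out b) (h, v, w) 1 (h, v, w @ [b])"
  and rb_Skip: "rb x Skip s 1 s"
  by (intro rb_step; simp)+

lemma rb_Skip_eq: "v' = v \<Longrightarrow> rb x Skip (h, v, w) 1 (h, v', w)"
  using rb_Skip by simp

lemma rb_mono: "rb x c s T s' \<Longrightarrow> T \<le> T' \<Longrightarrow> rb x c s T' s'"
  unfolding rb_def using order_trans by blast

lemma rb_post:
  "rb x c s T (h1, v1, w1) \<Longrightarrow> v1 = v1' \<Longrightarrow> T \<le> T' \<Longrightarrow> rb x c s T' (h1, v1', w1)"
  using rb_mono by blast

lemma rb_Seq:
  assumes "rb x c s T s1" "rb x d s1 T' s2"
  shows "rb x (Seq c d) s (T + T' + 1) s2"
proof -
  obtain t t' where t: "t \<le> T" "\<And>k. (cstep x ^^ t) (c # k, s) = (k, s1)"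
    "t' \<le> T'" "\<And>k. (cstep x ^^ t') (d # k, s1) = (k, s2)"
    using assms unfolding rb_def by blast
  have "(cstep x ^^ (t' + t + 1)) (Seq c d # k, s) = (k, s2)" for k
    by (simp only: One_nat_def add_Suc_right add_0_right funpow_Suc_right funpow_add o_apply) (simp add: t)
  then show ?thesis unfolding rb_def using t(1,3) by (intro exI[of _ "t' + t + 1"]) auto
qed

lemma rb_prefix:
  assumes "\<And>k. cstep x (c # k, s) = (d # k, s1)" "rb x d s1 T s2"
  shows "rb x c s (T + 1) s2"
proof -
  obtain t where t: "t \<le> T" "\<And>k. (cstep x ^^ t) (d # k, s1) = (k, s2)"
    using assms unfolding rb_def by blast
  have "(cstep x ^^ (t + 1)) (c # k, s) = (k, s2)" for k
    by (simp only: One_nat_def add_Suc_right add_0_right funpow_Suc_right funpow_add o_apply) (simp add: t assms(1))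
  then show ?thesis unfolding rb_def using t(1) by (intro exI[of _ "t + 1"]) auto
qed

lemma rb_IfZ:
  assumes "v r = 0 \<Longrightarrow> rb x c (h, v, w) T s2" "v r \<noteq> 0 \<Longrightarrow> rb x d (h, v, w) T s2"
  shows "rb x (IfZ r c d) (h, v, w) (T + 1) s2"
  by (rule rb_prefix[where d = "if v r = 0 then c else d"]) (use assms in auto)

lemma rb_IfSym:
  assumes "string_contents x h = a \<Longrightarrow> rb x c (h, v, w) T s2" "string_contents x h \<noteq> a \<Longrightarrow> rb x d (h, v, w) T s2"
  shows "rb x (IfSym a c d) (h, v, w) (T + 1) s2"
  by (rule rb_prefix[where d = "if string_contents x h = a then c else d"]) (use assms in auto)

lemma rb_While_0: "v r = 0 \<Longrightarrow> rb x (While r c) (h, v, w) 1 (h, v, w)"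
  by (rule rb_step) simp

lemma rb_While_step:
  assumes "v r \<noteq> 0" "rb x c (h, v, w) T s1" "rb x (While r c) s1 T' s2"
  shows "rb x (While r c) (h, v, w) (T + T' + 1) s2"
proof -
  obtain t t' where t: "t \<le> T" "\<And>k. (cstep x ^^ t) (c # k, (h, v, w)) = (k, s1)"
    "t' \<le> T'" "\<And>k. (cstep x ^^ t') (While r c # k, s1) = (k, s2)"
    using assms unfolding rb_def by blast
  have "(cstep x ^^ (t' + t + 1)) (While r c # k, (h, v, w)) = (k, s2)" for k
    by (simp only: One_nat_def add_Suc_right add_0_right funpow_Suc_right funpow_add o_apply) (simp add: t assms(1))
  then show ?thesis unfolding rb_def using t(1,3) by (intro exI[of _ "t' + t + 1"]) auto
qed

text \<open>Loops count down: \<open>st i\<close> is the state in which the loop register holds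
  \<open>i\<close>, so the family \<open>st\<close> takes the place of an invariant.\<close>

lemma rb_While:
  assumes "\<And>i. i < n \<Longrightarrow> rb x c (st (Suc i)) T (st i)" and r: "\<And>i. i \<le> n \<Longrightarrow> fst (snd (st i)) r = i"
  shows "rb x (While r c) (st n) (n * (T + 1) + 1) (st 0)"
  using assms
proof (induction n)
  case 0
  then show ?case by (cases "st 0") (auto intro!: rb_While_0[unfolded One_nat_def])
next
  case (Suc n)
  obtain h v w where s: "st (Suc n) = (h, v, w)" by (cases "st (Suc n)") auto
  have "rb x (While r c) (st n) (n * (T + 1) + 1) (st 0)" "rb x c (h, v, w) T (st n)" "v r \<noteq> 0"
    using Suc.IH Suc.prems(1)[of n] Suc.prems(1) Suc.prems(2) Suc.prems(2)[of "Suc n"] s by auto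
  from rb_While_step[OF this(3,2,1)] show ?case unfolding s by (rule rb_mono) auto
qed

lemma rb_While':
  assumes "\<And>i. i < n \<Longrightarrow> rb x c (st (Suc i)) T (st i)" "\<And>i. i \<le> n \<Longrightarrow> fst (snd (st i)) r = i"
    and "s = st n" "s' = st 0" "n * (T + 1) + 1 \<le> T'"
  shows "rb x (While r c) s T' s'"
  using rb_While[of n x c st T r] assms rb_mono by simp

lemma rb_While_le:
  assumes "\<And>i. i < n \<Longrightarrow> rb x c (st (Suc i)) T (st i)" "\<And>i. i \<le> n \<Longrightarrow> fst (snd (st i)) r = i"
    and "s = st n" "s' = st 0" "n \<le> N"
  shows "rb x (While r c) s (N * (T + 1) + 1) s'"
  using assms by (intro rb_While'[of n x c st T r]) (auto intro!: add_mono)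

definition clear :: "nat \<Rightarrow> cmd" where "clear r = While r (Dec r)"

lemma rb_clear: "rb x (clear r) (h, v, w) (2 * v r + 1) (h, v(r := 0), w)"
  unfolding clear_def
  by (rule rb_While'[where st = "\<lambda>i. (h, v(r := i), w)" and n = "v r" and T = 1]) (auto intro!: rb_Dec[unfolded One_nat_def])

text \<open>A counter can be read only by emptying it, hence the detour through \<open>d\<close>,
  from which \<open>a\<close> is restored while \<open>r\<close> grows.\<close>

definition copy :: "nat \<Rightarrow> nat \<Rightarrow> nat \<Rightarrow> cmd" where
  "copy a r d = Seq (While a (Seq (Dec a) (Inc d))) (While d (Seq (Dec d) (Seq (Inc a) (Inc r))))"

lemma rb_copy:
  assumes "a \<noteq> r" "a \<noteq> d" "r \<noteq> d" "v d = 0" "v a \<le> M"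
  shows "rb x (copy a r d) (h, v, w) (10 * M + 3) (h, v(r := v r + v a), w)"
proof -
  let ?n = "v a"
  have 1: "rb x (While a (Seq (Dec a) (Inc d))) (h, v, w) (?n * 4 + 1) (h, v(a := 0, d := ?n), w)"
    by (rule rb_While'[where st = "\<lambda>i. (h, v(a := i, d := ?n - i), w)" and n = ?n and T = "1 + 1 + 1"],
        rule rb_Seq, rule rb_Dec, rule refl, rule rb_Inc) (use assms in \<open>auto simp: fun_eq_iff\<close>)
  have 2: "rb x (While d (Seq (Dec d) (Seq (Inc a) (Inc r)))) (h, v(a := 0, d := ?n), w) (?n * 6 + 1)
      (h, v(r := v r + v a), w)"
    by (rule rb_While'[where st = "\<lambda>i. (h, v(d := i, a := ?n - i, r := v r + (?n - i)), w)" and n = ?n and T = "1 + (1 + 1 + 1) + 1"],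
        rule rb_Seq, rule rb_Dec, rule refl, rule rb_Seq, rule rb_Inc, rule refl, rule rb_Inc)
      (use assms in \<open>auto simp: fun_eq_iff\<close>)
  show ?thesis unfolding copy_def
    by (rule rb_mono[OF rb_Seq[OF 1 2]]) (use assms in auto)
qed

section \<open>Bounded arithmetic and its compilation to counter programs\<close>

datatype trm = Var nat | Len | Cst nat | Plus trm trm | Times trm trm
datatype fml = Lt trm trm | Bit trm | Neg fml | Conj fml fml | Exi trm fml

fun val :: "bool list \<Rightarrow> nat list \<Rightarrow> trm \<Rightarrow> nat" where
  "val x e (Var i) = (if i < length e then e ! i else 0)"
| "val x e Len = length x"
| "val x e (Cst n) = n"
| "val x e (Plus a b) = val x e a + val x e b"
| "val x e (Times a b) = val x e a * val x e b"

fun sat :: "bool list \<Rightarrow> nat list \<Rightarrow> fml \<Rightarrow> bool" where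
  "sat x e (Lt a b) = (val x e a < val x e b)"
| "sat x e (Bit a) = (val x e a < length x \<and> x ! val x e a)"
| "sat x e (Neg p) = (\<not> sat x e p)"
| "sat x e (Conj p q) = (sat x e p \<and> sat x e q)"
| "sat x e (Exi a p) = (\<exists>k < val x e a. sat x (k # e) p)"

fun vmax :: "trm \<Rightarrow> nat \<Rightarrow> nat" where
  "vmax (Cst n) M = n"
| "vmax (Plus a b) M = vmax a M + vmax b M"
| "vmax (Times a b) M = vmax a M * vmax b M"
| "vmax _ M = M"

lemma val_le_vmax: "\<forall>q\<in>set e. q \<le> M \<Longrightarrow> length x \<le> M \<Longrightarrow> val x e t \<le> vmax t M"
  by (induction t) (auto intro: add_mono mult_mono)

fun incs :: "nat \<Rightarrow> nat \<Rightarrow> cmd" where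
  "incs 0 r = Skip"
| "incs (Suc n) r = Seq (Inc r) (incs n r)"

text \<open>The compiled programs add their result to register \<open>r\<close> and use the registers from \<open>d\<close> on as scratch space,
  leaving them zero; \<open>\<rho>\<close> lists the registers of the variables and register 0 holds the input length.\<close>

fun ct :: "trm \<Rightarrow> nat list \<Rightarrow> nat \<Rightarrow> nat \<Rightarrow> cmd" where
  "ct (Var i) \<rho> r d = (if i < length \<rho> then copy (\<rho> ! i) r d else Skip)"
| "ct Len \<rho> r d = copy 0 r d"
| "ct (Cst n) \<rho> r d = incs n r"
| "ct (Plus a b) \<rho> r d = Seq (ct a \<rho> r d) (ct b \<rho> r d)"
| "ct (Times a b) \<rho> r d = Seq (ct a \<rho> d (d + 1)) (While d (Seq (Dec d) (ct b \<rho> r (d + 1))))"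

fun ctime :: "trm \<Rightarrow> nat \<Rightarrow> nat" where
  "ctime (Cst n) M = 2 * n + 1"
| "ctime (Plus a b) M = ctime a M + ctime b M + 1"
| "ctime (Times a b) M = ctime a M + (vmax a M * (1 + ctime b M + 1 + 1) + 1) + 1"
| "ctime _ M = 10 * M + 3"

lemma rb_incs: "rb x (incs n r) (h, v, w) (2 * n + 1) (h, v(r := v r + n), w)"
proof (induction n arbitrary: v)
  case (Suc n)
  show ?case unfolding incs.simps
    using rb_Seq[OF rb_Inc[OF refl, of x r h v w] Suc[of "v(r := v r + 1)"]] by (simp cong: if_cong)
qed (simp add: rb_Skip[unfolded One_nat_def])

lemma rb_ct:
  assumes "set \<rho> \<subseteq> {..<d}" "r < d" "r \<notin> set \<rho>" "0 < r" "\<forall>q\<ge>d. v q = 0" "v 0 = length x"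
    "\<forall>q\<in>set \<rho>. v q \<le> M" "length x \<le> M"
  shows "rb x (ct t \<rho> r d) (h, v, w) (ctime t M) (h, v(r := v r + val x (map v \<rho>) t), w)"
  using assms
proof (induction t arbitrary: r d v)
  case (Var i)
  show ?case
  proof (cases "i < length \<rho>")
    case True
    have m: "\<rho> ! i \<in> set \<rho>" using True by simp
    then have "\<rho> ! i \<noteq> r" "\<rho> ! i \<noteq> d" using Var by auto
    then have "rb x (copy (\<rho> ! i) r d) (h, v, w) (10 * M + 3) (h, v(r := v r + v (\<rho> ! i)), w)"
      using Var m by (intro rb_copy) auto
    then show ?thesis unfolding ct.simps ctime.simps if_P[OF True]
      by (rule rb_post) (use True in auto)
  next
    case False
    show ?thesis unfolding ct.simps ctime.simps if_not_P[OF False]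
      by (rule rb_post[OF rb_Skip]) (use False in auto)
  qed
next
  case Len
  have "rb x (copy 0 r d) (h, v, w) (10 * M + 3) (h, v(r := v r + v 0), w)"
    using Len by (intro rb_copy) auto
  then show ?case unfolding ct.simps ctime.simps by (rule rb_post) (use Len in auto)
next
  case (Cst n)
  show ?case unfolding ct.simps ctime.simps by (rule rb_post[OF rb_incs]) auto
next
  case (Plus a b)
  let ?v = "v(r := v r + val x (map v \<rho>) a)"
  have m: "map ?v \<rho> = map v \<rho>" using Plus.prems by auto
  have "rb x (ct b \<rho> r d) (h, ?v, w) (ctime b M) (h, ?v(r := ?v r + val x (map ?v \<rho>) b), w)"
    by (rule Plus.IH(2)) (use Plus.prems in auto)
  from rb_Seq[OF Plus.IH(1)[OF Plus.prems] this] show ?case unfolding ct.simps ctime.simps m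
    by (rule rb_post) (auto simp: fun_eq_iff)
next
  case (Times a b)
  let ?n = "val x (map v \<rho>) a" and ?m = "val x (map v \<rho>) b"
  have 1: "rb x (ct a \<rho> d (d + 1)) (h, v, w) (ctime a M) (h, v(d := v d + ?n), w)"
    by (rule Times.IH(1)) (use Times.prems in \<open>auto simp: less_Suc_eq\<close>)
  have 2: "rb x (Seq (Dec d) (ct b \<rho> r (d + 1))) (h, v(d := Suc i, r := v r + (?n - Suc i) * ?m), w)
     (1 + ctime b M + 1) (h, v(d := i, r := v r + (?n - i) * ?m), w)" if "i < ?n" for i
  proof (rule rb_Seq, rule rb_Dec, rule refl)
    let ?v = "(v(d := Suc i, r := v r + (?n - Suc i) * ?m))(d := (v(d := Suc i, r := v r + (?n - Suc i) * ?m)) d - 1)"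
    have m: "map ?v \<rho> = map v \<rho>" using Times.prems by auto
    have "rb x (ct b \<rho> r (d + 1)) (h, ?v, w) (ctime b M) (h, ?v(r := ?v r + val x (map ?v \<rho>) b), w)"
      by (rule Times.IH(2)) (use Times.prems in \<open>auto simp: less_Suc_eq\<close>)
    moreover have "?v(r := ?v r + val x (map ?v \<rho>) b) = v(d := i, r := v r + (?n - i) * ?m)"
      unfolding m using Times.prems that by (auto simp: fun_eq_iff Suc_diff_Suc[symmetric, of i ?n])
    ultimately show "rb x (ct b \<rho> r (d + 1)) (h, ?v, w) (ctime b M) (h, v(d := i, r := v r + (?n - i) * ?m), w)" by (simp only:)
  qed
  have n: "?n \<le> vmax a M" by (rule val_le_vmax) (use Times.prems in auto)
  have 3: "rb x (While d (Seq (Dec d) (ct b \<rho> r (d + 1)))) (h, v(d := v d + ?n), w)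
      (vmax a M * (1 + ctime b M + 1 + 1) + 1) (h, v(r := v r + ?n * ?m), w)"
    by (rule rb_While_le[where st = "\<lambda>i. (h, v(d := i, r := v r + (?n - i) * ?m), w)" and n = ?n, OF 2])
      (use Times.prems n in \<open>auto simp: fun_eq_iff\<close>)
  show ?case unfolding ct.simps ctime.simps by (rule rb_post[OF rb_Seq[OF 1 3]]) auto
qed

text \<open>For a quantifier, \<open>d\<close> counts the values still to be tried,
  \<open>d + 1\<close> holds the bound variable and \<open>d + 2\<close> counts the witnesses. For a
  bit test the head walks to the cell and \<open>d + 1\<close> remembers the way back, so that the
  head is at 0 between tests. In a comparison truncated subtraction leaves a nonzero rest exactly
  when the first value is smaller.\<close>

fun cf :: "fml \<Rightarrow> nat list \<Rightarrow> nat \<Rightarrow> nat \<Rightarrow> cmd" where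
  "cf (Lt a b) \<rho> r d = Seq (ct a \<rho> d (d + 2)) (Seq (ct b \<rho> (d + 1) (d + 2))
     (Seq (While d (Seq (Dec d) (Dec (d + 1)))) (Seq (IfZ (d + 1) Skip (Inc r)) (clear (d + 1)))))"
| "cf (Bit a) \<rho> r d = Seq (ct a \<rho> d (d + 2)) (Seq (While d (Seq (Dec d) (Seq (Inc (d + 1)) GoR)))
     (Seq (IfSym 2 (Inc r) Skip) (While (d + 1) (Seq (Dec (d + 1)) GoL))))"
| "cf (Neg p) \<rho> r d = Seq (cf p \<rho> d (d + 1)) (IfZ d (Inc r) (Dec d))"
| "cf (Conj p q) \<rho> r d = Seq (cf p \<rho> d (d + 1)) (IfZ d Skip (Seq (Dec d) (cf q \<rho> r d)))"
| "cf (Exi a p) \<rho> r d = Seq (ct a \<rho> d (d + 3))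
     (Seq (While d (Seq (Dec d) (Seq (cf p ((d + 1) # \<rho>) (d + 2) (d + 3)) (Inc (d + 1)))))
     (Seq (IfZ (d + 2) Skip (Inc r)) (Seq (clear (d + 1)) (clear (d + 2)))))"

text \<open>Under a quantifier the bound on the variables grows to \<open>M + vmax a M\<close>, as
  the new variable ranges below the value of \<open>a\<close>. The nesting depth is fixed by the
  formula, so the total stays polynomial in \<open>M\<close>.\<close>

fun ftime :: "fml \<Rightarrow> nat \<Rightarrow> nat" where
  "ftime (Lt a b) M = ctime a M + (ctime b M + ((vmax a M * 4 + 1) + (2 + (2 * vmax b M + 1) + 1) + 1) + 1) + 1"
| "ftime (Bit a) M = ctime a M + ((vmax a M * 6 + 1) + (2 + (vmax a M * 4 + 1) + 1) + 1) + 1"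
| "ftime (Neg p) M = ftime p M + 2 + 1"
| "ftime (Conj p q) M = ftime p M + (1 + ftime q M + 1 + 1) + 1"
| "ftime (Exi a p) M = ctime a M + ((vmax a M * (1 + (ftime p (M + vmax a M) + 1 + 1) + 1 + 1) + 1)
     + (2 + ((2 * vmax a M + 1) + (2 * vmax a M + 1) + 1) + 1) + 1) + 1"

lemma rb_cf:
  assumes "set \<rho> \<subseteq> {..<d}" "r < d" "r \<notin> set \<rho>" "0 < r" "\<forall>q\<ge>d. v q = 0" "v 0 = length x"
    "\<forall>q\<in>set \<rho>. v q \<le> M" "length x \<le> M"
  shows "rb x (cf p \<rho> r d) (0, v, w) (ftime p M) (0, v(r := v r + of_bool (sat x (map v \<rho>) p)), w)"
  using assms
proof (induction p arbitrary: \<rho> r d v M)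
  case (Lt a b)
  let ?n = "val x (map v \<rho>) a" and ?m = "val x (map v \<rho>) b"
  have nm: "?n \<le> vmax a M" "?m \<le> vmax b M" by (rule val_le_vmax; use Lt.prems in auto)+
  have 1: "rb x (ct a \<rho> d (d + 2)) (0, v, w) (ctime a M) (0, v(d := v d + ?n), w)"
    by (rule rb_ct) (use Lt.prems in \<open>auto simp: less_Suc_eq\<close>)
  let ?v = "v(d := v d + ?n)"
  have m: "map ?v \<rho> = map v \<rho>" using Lt.prems by auto
  have "rb x (ct b \<rho> (d + 1) (d + 2)) (0, ?v, w) (ctime b M) (0, ?v(d + 1 := ?v (d + 1) + val x (map ?v \<rho>) b), w)"
    by (rule rb_ct) (use Lt.prems in \<open>auto simp: less_Suc_eq\<close>)
  then have 2: "rb x (ct b \<rho> (d + 1) (d + 2)) (0, ?v, w) (ctime b M) (0, v(d := ?n, d + 1 := ?m), w)"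
    unfolding m by (rule rb_post) (use Lt.prems in \<open>auto simp: fun_eq_iff\<close>)
  have 3: "rb x (While d (Seq (Dec d) (Dec (d + 1)))) (0, v(d := ?n, d + 1 := ?m), w) (vmax a M * 4 + 1)
      (0, v(d + 1 := ?m - ?n), w)"
    by (rule rb_While'[where st = "\<lambda>i. (0, v(d := i, d + 1 := ?m - (?n - i)), w)" and n = ?n and T = "1 + 1 + 1"],
        rule rb_Seq, rule rb_Dec, rule refl, rule rb_Dec)
      (use Lt.prems nm in \<open>auto simp: fun_eq_iff\<close>)
  let ?w = "v(d + 1 := ?m - ?n, r := v r + of_bool (?n < ?m))"
  have 4: "rb x (IfZ (d + 1) Skip (Inc r)) (0, v(d + 1 := ?m - ?n), w) (1 + 1) (0, ?w, w)"
    by (rule rb_IfZ; (rule rb_Skip_eq | rule rb_Inc | rule rb_Dec))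
      (use Lt.prems in \<open>auto simp: fun_eq_iff\<close>)
  have 5: "rb x (clear (d + 1)) (0, ?w, w) (2 * vmax b M + 1) (0, v(r := v r + of_bool (?n < ?m)), w)"
    by (rule rb_post[OF rb_clear]) (use nm Lt.prems in \<open>auto simp: fun_eq_iff\<close>)
  show ?case unfolding cf.simps ftime.simps
    by (rule rb_post[OF rb_Seq[OF 1 rb_Seq[OF 2 rb_Seq[OF 3 rb_Seq[OF 4 5]]]]]) auto
next
  case (Bit a)
  let ?n = "val x (map v \<rho>) a"
  have nm: "?n \<le> vmax a M" by (rule val_le_vmax; use Bit.prems in auto)
  have 1: "rb x (ct a \<rho> d (d + 2)) (0, v, w) (ctime a M) (0, v(d := ?n), w)"
    by (rule rb_post[OF rb_ct]) (use Bit.prems in \<open>auto simp: less_Suc_eq\<close>)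
  have 2: "rb x (While d (Seq (Dec d) (Seq (Inc (d + 1)) GoR))) (0, v(d := ?n), w) (vmax a M * 6 + 1)
      (int ?n, v(d + 1 := ?n), w)"
    by (rule rb_While'[where st = "\<lambda>i. (int (?n - i), v(d := i, d + 1 := ?n - i), w)" and n = ?n and T = "1 + (1 + 1 + 1) + 1"],
        rule rb_Seq, rule rb_Dec, rule refl, rule rb_Seq, rule rb_Inc, rule refl, rule rb_GoR)
      (use Bit.prems nm in \<open>auto simp: fun_eq_iff\<close>)
  let ?w = "v(d + 1 := ?n, r := v r + of_bool (?n < length x \<and> x ! ?n))"
  have sc: "string_contents x (int ?n) = 2 \<longleftrightarrow> ?n < length x \<and> x ! ?n" by (simp add: string_contents_def)
  have 3: "rb x (IfSym 2 (Inc r) Skip) (int ?n, v(d + 1 := ?n), w) (1 + 1) (int ?n, ?w, w)"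
    by (rule rb_IfSym; (rule rb_Skip_eq | rule rb_Inc))
      (use sc Bit.prems in \<open>auto simp: fun_eq_iff\<close>)
  have 4: "rb x (While (d + 1) (Seq (Dec (d + 1)) GoL)) (int ?n, ?w, w) (vmax a M * 4 + 1)
      (0, v(r := v r + of_bool (?n < length x \<and> x ! ?n)), w)"
    by (rule rb_While'[where st = "\<lambda>i. (int i, ?w(d + 1 := i), w)" and n = ?n and T = "1 + 1 + 1"],
        rule rb_Seq, rule rb_Dec, rule refl, rule rb_GoL)
      (use Bit.prems nm in \<open>auto simp: fun_eq_iff\<close>)
  show ?case unfolding cf.simps ftime.simps
    by (rule rb_post[OF rb_Seq[OF 1 rb_Seq[OF 2 rb_Seq[OF 3 4]]]]) auto
next
  case (Neg p)
  have 1: "rb x (cf p \<rho> d (d + 1)) (0, v, w) (ftime p M) (0, v(d := of_bool (sat x (map v \<rho>) p)), w)"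
    by (rule rb_post[OF Neg.IH]) (use Neg.prems in \<open>auto simp: less_Suc_eq\<close>)
  have 2: "rb x (IfZ d (Inc r) (Dec d)) (0, v(d := of_bool (sat x (map v \<rho>) p)), w) (1 + 1)
      (0, v(r := v r + of_bool (\<not> sat x (map v \<rho>) p)), w)"
    by (rule rb_IfZ; (rule rb_Skip_eq | rule rb_Inc | rule rb_Dec))
      (use Neg.prems in \<open>auto simp: fun_eq_iff\<close>)
  show ?case unfolding cf.simps ftime.simps by (rule rb_post[OF rb_Seq[OF 1 2]]) auto
next
  case (Conj p q)
  have 1: "rb x (cf p \<rho> d (d + 1)) (0, v, w) (ftime p M) (0, v(d := of_bool (sat x (map v \<rho>) p)), w)"
    by (rule rb_post[OF Conj.IH(1)]) (use Conj.prems in \<open>auto simp: less_Suc_eq\<close>)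
  have q: "rb x (cf q \<rho> r d) (0, v, w) (ftime q M) (0, v(r := v r + of_bool (sat x (map v \<rho>) q)), w)"
    using Conj.IH(2)[OF Conj.prems] .
  have d: "rb x (Dec d) (0, v(d := 1), w) 1 (0, v, w)" using Conj.prems by (intro rb_Dec) (auto simp: fun_eq_iff)
  have 2: "rb x (IfZ d Skip (Seq (Dec d) (cf q \<rho> r d))) (0, v(d := of_bool (sat x (map v \<rho>) p)), w) (1 + ftime q M + 1 + 1)
      (0, v(r := v r + of_bool (sat x (map v \<rho>) (Conj p q))), w)"
  proof (rule rb_IfZ)
    assume "(v(d := of_bool (sat x (map v \<rho>) p))) d = 0"
    then show "rb x Skip (0, v(d := of_bool (sat x (map v \<rho>) p)), w) (1 + ftime q M + 1)
      (0, v(r := v r + of_bool (sat x (map v \<rho>) (Conj p q))), w)"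
      by (intro rb_mono[OF rb_Skip_eq]) (use Conj.prems in \<open>auto simp: fun_eq_iff\<close>)
  next
    assume "(v(d := of_bool (sat x (map v \<rho>) p))) d \<noteq> 0"
    then have p: "sat x (map v \<rho>) p" by (auto split: if_splits)
    show "rb x (Seq (Dec d) (cf q \<rho> r d)) (0, v(d := of_bool (sat x (map v \<rho>) p)), w) (1 + ftime q M + 1)
      (0, v(r := v r + of_bool (sat x (map v \<rho>) (Conj p q))), w)"
      unfolding of_bool_def if_P[OF p] by (rule rb_post[OF rb_Seq[OF d q]]) (use p in auto)
  qed
  show ?case unfolding cf.simps ftime.simps by (rule rb_post[OF rb_Seq[OF 1 2]]) auto
next
  case (Exi a p)
  let ?n = "val x (map v \<rho>) a" and ?c = "\<lambda>j. card {k. k < j \<and> sat x (k # map v \<rho>) p}"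
  have nm: "?n \<le> vmax a M" by (rule val_le_vmax; use Exi.prems in auto)
  have cle: "?c j \<le> j" for j using card_mono[of "{..<j}" "{k. k < j \<and> sat x (k # map v \<rho>) p}"] by force
  have 1: "rb x (ct a \<rho> d (d + 3)) (0, v, w) (ctime a M) (0, v(d := ?n), w)"
    by (rule rb_post[OF rb_ct]) (use Exi.prems in \<open>auto simp: less_Suc_eq\<close>)
  define st where "st i = (0 :: int, v(d := i, d + 1 := ?n - i, d + 2 := ?c (?n - i)), w)" for i
  have 2: "rb x (Seq (Dec d) (Seq (cf p ((d + 1) # \<rho>) (d + 2) (d + 3)) (Inc (d + 1)))) (st (Suc i))
     (1 + (ftime p (M + vmax a M) + 1 + 1) + 1) (st i)" if "i < ?n" for i
    unfolding st_def
  proof (rule rb_Seq, rule rb_Dec, rule refl)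
    let ?v = "v(d := i, d + 1 := ?n - Suc i, d + 2 := ?c (?n - Suc i))"
    have m: "map ?v ((d + 1) # \<rho>) = (?n - Suc i) # map v \<rho>" using Exi.prems by auto
    have "rb x (cf p ((d + 1) # \<rho>) (d + 2) (d + 3)) (0, ?v, w) (ftime p (M + vmax a M))
       (0, ?v(d + 2 := ?v (d + 2) + of_bool (sat x (map ?v ((d + 1) # \<rho>)) p)), w)"
      by (rule Exi.IH) (use Exi.prems nm in \<open>auto simp: less_Suc_eq intro: trans_le_add1\<close>)
    moreover have "?v (d + 2) + of_bool (sat x (map ?v ((d + 1) # \<rho>)) p) = ?c (?n - i)"
    proof -
      have "?n - i = Suc (?n - Suc i)" using that by simp
      moreover have "{k. k < Suc j \<and> sat x (k # map v \<rho>) p} = {k. k < j \<and> sat x (k # map v \<rho>) p} \<union>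
        (if sat x (j # map v \<rho>) p then {j} else {})" for j by (auto simp: less_Suc_eq)
      ultimately show ?thesis unfolding m by (simp)
    qed
    ultimately have p: "rb x (cf p ((d + 1) # \<rho>) (d + 2) (d + 3)) (0, ?v, w) (ftime p (M + vmax a M))
       (0, ?v(d + 2 := ?c (?n - i)), w)" by (simp only:)
    have i: "rb x (Inc (d + 1)) (0, ?v(d + 2 := ?c (?n - i)), w) 1 (0, v(d := i, d + 1 := ?n - i, d + 2 := ?c (?n - i)), w)"
      by (rule rb_Inc) (use that in \<open>auto simp: fun_eq_iff\<close>)
    have v: "(v(d := Suc i, d + 1 := ?n - Suc i, d + 2 := ?c (?n - Suc i)))
       (d := (v(d := Suc i, d + 1 := ?n - Suc i, d + 2 := ?c (?n - Suc i))) d - 1) = ?v" by (auto simp: fun_eq_iff)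
    show "rb x (Seq (cf p ((d + 1) # \<rho>) (d + 2) (d + 3)) (Inc (d + 1)))
      (0, (v(d := Suc i, d + 1 := ?n - Suc i, d + 2 := ?c (?n - Suc i)))
       (d := (v(d := Suc i, d + 1 := ?n - Suc i, d + 2 := ?c (?n - Suc i))) d - 1), w) (ftime p (M + vmax a M) + 1 + 1)
      (0, v(d := i, d + 1 := ?n - i, d + 2 := ?c (?n - i)), w)"
      unfolding v by (rule rb_Seq[OF p i])
  qed
  have 3: "rb x (While d (Seq (Dec d) (Seq (cf p ((d + 1) # \<rho>) (d + 2) (d + 3)) (Inc (d + 1))))) (0, v(d := ?n), w)
      (vmax a M * (1 + (ftime p (M + vmax a M) + 1 + 1) + 1 + 1) + 1) (0, v(d + 1 := ?n, d + 2 := ?c ?n), w)"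
    by (rule rb_While_le[where st = st and n = ?n, OF 2])
      (use Exi.prems nm in \<open>auto simp: fun_eq_iff st_def\<close>)
  have s: "?c ?n = 0 \<longleftrightarrow> \<not> sat x (map v \<rho>) (Exi a p)" by auto
  let ?w = "v(d + 1 := ?n, d + 2 := ?c ?n, r := v r + of_bool (sat x (map v \<rho>) (Exi a p)))"
  have 4: "rb x (IfZ (d + 2) Skip (Inc r)) (0, v(d + 1 := ?n, d + 2 := ?c ?n), w) (1 + 1) (0, ?w, w)"
    by (rule rb_IfZ; (rule rb_Skip_eq | rule rb_Inc | rule rb_Dec))
      (use Exi.prems s in \<open>auto simp: fun_eq_iff\<close>)
  have 5: "rb x (clear (d + 1)) (0, ?w, w) (2 * vmax a M + 1) (0, ?w(d + 1 := 0), w)"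
    by (rule rb_post[OF rb_clear]) (use nm Exi.prems in auto)
  have 6: "rb x (clear (d + 2)) (0, ?w(d + 1 := 0), w) (2 * vmax a M + 1) (0, ?w(d + 1 := 0, d + 2 := 0), w)"
    by (rule rb_post[OF rb_clear]) (use nm Exi.prems cle[of ?n] in auto)
  have w: "?w(d + 1 := 0, d + 2 := 0) = v(r := v r + of_bool (sat x (map v \<rho>) (Exi a p)))"
    using Exi.prems by (auto simp: fun_eq_iff)
  show ?case using rb_Seq[OF 1 rb_Seq[OF 3 rb_Seq[OF 4 rb_Seq[OF 5 6]]]] unfolding w cf.simps ftime.simps
    by (rule rb_post) (auto simp del: sat.simps)
qed

section \<open>Polynomially bounded functions\<close>

definition pb :: "(nat \<Rightarrow> nat) \<Rightarrow> bool" where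
  "pb g \<longleftrightarrow> (\<exists>p :: nat poly. \<forall>n. g n \<le> poly p n)"

lemma poly_nat_mono: "m \<le> n \<Longrightarrow> poly p m \<le> poly p (n :: nat)"
  by (induction p) (auto intro!: add_mono mult_mono)

lemma pb_const: "pb (\<lambda>_. c)"
  unfolding pb_def by (rule exI[of _ "[:c:]"]) simp

lemma pb_id: "pb (\<lambda>n. n)"
  unfolding pb_def by (rule exI[of _ "[:0, 1:]"]) simp

lemma pb_add: "pb f \<Longrightarrow> pb g \<Longrightarrow> pb (\<lambda>n. f n + g n)"
  unfolding pb_def by clarify (metis add_mono poly_add)

lemma pb_mult: "pb f \<Longrightarrow> pb g \<Longrightarrow> pb (\<lambda>n. f n * g n)"
  unfolding pb_def by clarify (metis mult_le_mono poly_mult)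

lemma pb_Suc: "pb f \<Longrightarrow> pb (\<lambda>n. Suc (f n))"
  using pb_add[OF pb_const[of 1]] by simp

lemma pb_comp: assumes "pb f" "pb g" shows "pb (\<lambda>n. f (g n))"
proof -
  obtain p q where p: "\<And>n. f n \<le> poly p n" and q: "\<And>n. g n \<le> poly q n" using assms unfolding pb_def by blast
  have "f (g n) \<le> poly (pcompose p q) n" for n
    using p[of "g n"] poly_nat_mono[OF q[of n], of p] by (simp add: poly_pcompose)
  then show ?thesis unfolding pb_def by blast
qed

lemmas pb_intros = pb_const pb_id pb_add pb_mult pb_Suc

lemma pb_vmax: "pb (vmax t)"
  by (induction t) (auto simp: fun_eq_iff[symmetric] intro!: pb_intros)

lemma pb_ctime: "pb (ctime t)"
  by (induction t) (auto intro!: pb_intros pb_vmax)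

lemma pb_ftime: "pb (ftime p)"
proof (induction p)
  case (Exi a p)
  have "pb (\<lambda>M. ftime p (M + vmax a M))" by (intro pb_comp[OF Exi] pb_intros pb_vmax)
  then show ?case by (auto intro!: pb_intros pb_vmax pb_ctime)
qed (auto intro!: pb_intros pb_vmax pb_ctime)

section \<open>Complete programs: measuring the input, deciding a formula, printing a matrix\<close>

lemma polytime_rb:
  assumes "\<And>x. \<exists>h v. rb x c (0, \<lambda>_. 0, []) (T (length x)) (h, v, f x)" and "pb T"
  shows "polytime f"
proof -
  obtain p where p: "\<And>n. T n \<le> poly p n" using assms(2) unfolding pb_def by blast
  show ?thesis
  proof (rule polytime_prog)
    fix x
    obtain h v t where "t \<le> T (length x)" "\<And>k. (cstep x ^^ t) (c # k, (0, \<lambda>_. 0, [])) = (k, (h, v, f x))"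
      using assms(1)[of x] unfolding rb_def by blast
    then show "\<exists>t h v. t \<le> poly p (length x) \<and> (cstep x ^^ t) ([c], (0, \<lambda>_. 0, [])) = ([], (h, v, f x))"
      using p[of "length x"] order_trans by blast
  qed
qed

text \<open>Register 1 is a flag that keeps the loop alive until the head meets a blank; the bits
  are the symbols 1 and 2, so the first blank is the end of the input.\<close>

definition scan :: cmd where
  "scan = While 1 (IfSym 0 (Dec 1) (Seq GoR (Inc 0)))"

lemma rb_scan:
  assumes "i \<le> length x"
  shows "rb x scan (int i, v(0 := i, 1 := 1), w) (5 * (length x - i) + 4) (int (length x), v(0 := length x, 1 := 0), w)"
  using assms
proof (induction "length x - i" arbitrary: i)
  case 0
  then have i: "i = length x" by simp
  have b: "rb x (IfSym 0 (Dec 1) (Seq GoR (Inc 0))) (int i, v(0 := i, 1 := 1), w) (1 + 1) (int i, v(0 := i, 1 := 0), w)"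
    by (rule rb_IfSym, rule rb_Dec) (auto simp: string_contents_def i fun_eq_iff)
  have "rb x scan (int i, v(0 := i, 1 := 0), w) 1 (int i, v(0 := i, 1 := 0), w)"
    unfolding scan_def by (rule rb_While_0) simp
  from rb_While_step[OF _ b this[unfolded scan_def], folded scan_def] show ?case
    unfolding i[symmetric] by (rule rb_mono) simp_all
next
  case (Suc m)
  then have i: "i < length x" by simp
  have b: "rb x (IfSym 0 (Dec 1) (Seq GoR (Inc 0))) (int i, v(0 := i, 1 := 1), w) (1 + 1 + 1 + 1) (int (Suc i), v(0 := Suc i, 1 := 1), w)"
  proof (rule rb_IfSym)
    show "rb x (Seq GoR (Inc 0)) (int i, v(0 := i, 1 := 1), w) (1 + 1 + 1) (int (Suc i), v(0 := Suc i, 1 := 1), w)"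
      by (rule rb_Seq, rule rb_GoR, rule refl, rule refl, rule back_subst[of "\<lambda>h. rb x _ (h, _) _ _", OF rb_Inc])
        (auto simp: fun_eq_iff)
  qed (use i in \<open>simp add: string_contents_def split: if_splits\<close>)
  have "m = length x - Suc i" "Suc i \<le> length x" using Suc by auto
  from Suc(1)[OF this] have "rb x scan (int (Suc i), v(0 := Suc i, 1 := 1), w) (5 * (length x - Suc i) + 4)
    (int (length x), v(0 := length x, 1 := 0), w)" .
  from rb_While_step[OF _ b this[unfolded scan_def], folded scan_def]
  show ?case by (rule rb_mono) (use i in auto)
qed

definition getlen :: cmd where
  "getlen = Seq (Inc 1) (Seq scan (Seq (While 0 (Seq (Dec 0) (Seq (Inc 1) GoL))) (While 1 (Seq (Dec 1) (Inc 0)))))"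

definition lenreg :: "bool list \<Rightarrow> nat \<Rightarrow> nat" where
  "lenreg x = (\<lambda>_. 0)(0 := length x)"

lemma rb_getlen: "rb x getlen (0, \<lambda>_. 0, []) (15 * length x + 10) (0, lenreg x, [])"
proof -
  let ?n = "length x"
  have 1: "rb x (Inc 1) (0, \<lambda>_. 0, []) 1 (int 0, (\<lambda>_. 0)(0 := 0, 1 := 1), [])"
    unfolding of_nat_0 by (rule rb_Inc) (auto simp: fun_eq_iff)
  have 2: "rb x scan (int 0, (\<lambda>_. 0)(0 := 0, 1 := 1), []) (5 * ?n + 4) (int ?n, (\<lambda>_. 0)(0 := ?n, 1 := 0), [])"
    by (rule rb_mono[OF rb_scan]) auto
  have 3: "rb x (While 0 (Seq (Dec 0) (Seq (Inc 1) GoL))) (int ?n, (\<lambda>_. 0)(0 := ?n, 1 := 0), []) (?n * 6 + 1) (0, (\<lambda>_. 0)(0 := 0, 1 := ?n), [])"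
    by (rule rb_While'[where st = "\<lambda>i. (int i, (\<lambda>_. 0)(0 := i, 1 := ?n - i), [])" and n = ?n and T = "1 + (1 + 1 + 1) + 1"],
        rule rb_Seq, rule rb_Dec, rule refl, rule rb_Seq, rule rb_Inc, rule refl, rule rb_GoL) (auto simp: fun_eq_iff)
  have 4: "rb x (While 1 (Seq (Dec 1) (Inc 0))) (0, (\<lambda>_. 0)(0 := 0, 1 := ?n), []) (?n * 4 + 1) (0, lenreg x, [])"
    by (rule rb_While'[where st = "\<lambda>i. (0, (\<lambda>_. 0)(0 := ?n - i, 1 := i), [])" and n = ?n and T = "1 + 1 + 1"],
        rule rb_Seq, rule rb_Dec, rule refl, rule rb_Inc) (auto simp: fun_eq_iff lenreg_def)
  show ?thesis unfolding getlen_def by (rule rb_post[OF rb_Seq[OF 1 rb_Seq[OF 2 rb_Seq[OF 3 4]]]]) auto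
qed

theorem polytime_decide: "polytime (\<lambda>x. [sat x [] p])"
proof (rule polytime_rb)
  let ?c = "Seq getlen (Seq (cf p [] 1 2) (IfZ 1 (Out False) (Out True)))"
  let ?T = "\<lambda>n. 15 * n + 10 + (ftime p n + (1 + 1) + 1) + 1"
  fix x
  have 1: "rb x (cf p [] 1 2) (0, lenreg x, []) (ftime p (length x)) (0, (lenreg x)(1 := of_bool (sat x [] p)), [])"
    by (rule rb_post[OF rb_cf]) (auto simp: lenreg_def)
  have 2: "rb x (IfZ 1 (Out False) (Out True)) (0, (lenreg x)(1 := of_bool (sat x [] p)), []) (1 + 1)
     (0, (lenreg x)(1 := of_bool (sat x [] p)), [sat x [] p])"
    by (rule rb_IfZ) (use rb_Out[of x _ 0 "(lenreg x)(1 := of_bool (sat x [] p))" "[]"] in \<open>auto split: if_splits\<close>)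
  show "\<exists>h v. rb x ?c (0, \<lambda>_. 0, []) (?T (length x)) (h, v, [sat x [] p])"
    using rb_Seq[OF rb_getlen rb_Seq[OF 1 2]] by blast
qed (auto intro!: pb_intros pb_ftime)

text \<open>Registers of the matrix printer: 2 and 4 count the rows and columns still to come, 3 and
  5 hold the current row and column, which are the two variables of \<open>p\<close>, and 6 receives
  the truth value.\<close>

definition bitprog :: "fml \<Rightarrow> cmd" where
  "bitprog p = Seq (Dec 4) (Seq (cf p [3, 5] 6 7) (Seq (IfZ 6 (Out False) (Seq (Dec 6) (Out True))) (Inc 5)))"

definition rowprog :: "trm \<Rightarrow> fml \<Rightarrow> cmd" where
  "rowprog N p = Seq (Dec 2) (Seq (ct N [] 4 7) (Seq (While 4 (bitprog p)) (Seq (clear 5) (Inc 3))))"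

theorem polytime_matrix:
  fixes N :: trm and p :: fml
  defines "f \<equiv> \<lambda>x. let n = val x [] N in replicate n True @ False #
     concat (map (\<lambda>i. map (\<lambda>j. sat x [i, j] p) [0..<n]) [0..<n])"
  shows "polytime f"
proof (rule polytime_rb)
  let ?c = "Seq getlen (Seq (ct N [] 2 7) (Seq (While 2 (Seq (Dec 2) (Out True))) (Seq (Out False)
      (Seq (ct N [] 2 7) (While 2 (rowprog N p))))))"
  let ?B = "\<lambda>n. 1 + (ftime p (n + vmax N n) + ((1 + 1 + 1 + 1) + 1 + 1) + 1) + 1"
  let ?R = "\<lambda>n. 1 + (ctime N n + ((vmax N n * (?B n + 1) + 1) + ((2 * vmax N n + 1) + 1 + 1) + 1) + 1) + 1"
  let ?T = "\<lambda>n. (15 * n + 10) + (ctime N n + ((vmax N n * (1 + 1 + 1 + 1) + 1) + (1 +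
      (ctime N n + (vmax N n * (?R n + 1) + 1) + 1) + 1) + 1) + 1) + 1"
  show "pb ?T" by (intro pb_intros pb_vmax pb_ctime pb_comp[OF pb_ftime])
  fix x
  let ?n = "length x" and ?N = "val x [] N"
  define V where "V a i b j = (lenreg x)(2 := a, 3 := i, 4 := b, 5 := j)" for a i b j :: nat
  have V: "V a i b j 0 = ?n" "V a i b j 2 = a" "V a i b j 3 = i" "V a i b j 4 = b" "V a i b j 5 = j"
    "q \<ge> 6 \<Longrightarrow> V a i b j q = 0" for a i b j q
    by (auto simp: V_def lenreg_def)
  have Vu: "(V a i b j)(2 := c) = V c i b j" "(V a i b j)(3 := c) = V a c b j"
    "(V a i b j)(4 := c) = V a i c j" "(V a i b j)(5 := c) = V a i b c" for a i b j c
    by (auto simp: V_def fun_eq_iff)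
  have Nle: "?N \<le> vmax N ?n" by (rule val_le_vmax) auto
  have bit: "rb x (bitprog p) (0, V a i (Suc b) j, w) (?B ?n) (0, V a i b (Suc j), w @ [sat x [i, j] p])"
    if "i < ?N" "j < ?N" for a i b j w
  proof -
    have 1: "rb x (Dec 4) (0, V a i (Suc b) j, w) 1 (0, V a i b j, w)"
      by (rule rb_Dec) (simp add: V Vu)
    have 2: "rb x (cf p [3, 5] 6 7) (0, V a i b j, w) (ftime p (?n + vmax N ?n)) (0, (V a i b j)(6 := of_bool (sat x [i, j] p)), w)"
      by (rule rb_post[OF rb_cf[where M = "?n + vmax N ?n"]]) (use that Nle in \<open>auto simp: V\<close>)
    have 3: "rb x (IfZ 6 (Out False) (Seq (Dec 6) (Out True))) (0, (V a i b j)(6 := of_bool (sat x [i, j] p)), w) (1 + 1 + 1 + 1)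
        (0, V a i b j, w @ [sat x [i, j] p])"
    proof (rule rb_IfZ)
      assume "((V a i b j)(6 := of_bool (sat x [i, j] p))) 6 = 0"
      then have *: "\<not> sat x [i, j] p" by (auto split: if_splits)
      show "rb x (Out False) (0, (V a i b j)(6 := of_bool (sat x [i, j] p)), w) (1 + 1 + 1) (0, V a i b j, w @ [sat x [i, j] p])"
        using rb_post[OF rb_Out, of "V a i b j" "V a i b j" "1 + 1 + 1" x False 0 w] * V(6)[of 6 a i b j]
        by (simp add: fun_upd_idem)
    next
      assume "((V a i b j)(6 := of_bool (sat x [i, j] p))) 6 \<noteq> 0"
      then have *: "sat x [i, j] p" by (auto split: if_splits)
      show "rb x (Seq (Dec 6) (Out True)) (0, (V a i b j)(6 := of_bool (sat x [i, j] p)), w) (1 + 1 + 1) (0, V a i b j, w @ [sat x [i, j] p])"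
        by (rule rb_Seq, rule rb_Dec, rule refl) (use * V(6)[of 6 a i b j] rb_Out[of x True 0 "V a i b j" w] in \<open>simp add: fun_upd_idem\<close>)
    qed
    have 4: "rb x (Inc 5) (0, V a i b j, w @ [sat x [i, j] p]) 1 (0, V a i b (Suc j), w @ [sat x [i, j] p])"
      by (rule rb_Inc) (simp add: V Vu)
    show ?thesis unfolding bitprog_def using rb_Seq[OF 1 rb_Seq[OF 2 rb_Seq[OF 3 4]]] .
  qed
  have getN: "rb x (ct N [] r 7) (0, V a i b j, w) (ctime N ?n) (0, (V a i b j)(r := ?N), w)"
    if "V a i b j r = 0" "0 < r" "r < 7" for a i b j w r
    by (rule rb_post[OF rb_ct[where M = ?n]]) (use that in \<open>auto simp: V\<close>)
  have row: "rb x (rowprog N p) (0, V (Suc a) i 0 0, w) (?R ?n) (0, V a (Suc i) 0 0, w @ map (\<lambda>j. sat x [i, j] p) [0..<?N])"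
    if "i < ?N" for a i w
  proof -
    have 1: "rb x (Dec 2) (0, V (Suc a) i 0 0, w) 1 (0, V a i 0 0, w)"
      by (rule rb_Dec) (simp add: V Vu)
    have 2: "rb x (ct N [] 4 7) (0, V a i 0 0, w) (ctime N ?n) (0, V a i ?N 0, w)"
      using getN[of a i 0 0 4 w] by (simp add: V Vu)
    have 3: "rb x (While 4 (bitprog p)) (0, V a i ?N 0, w) (vmax N ?n * (?B ?n + 1) + 1)
       (0, V a i 0 ?N, w @ map (\<lambda>j. sat x [i, j] p) [0..<?N])"
    proof (rule rb_While_le[where st = "\<lambda>k. (0, V a i k (?N - k), w @ map (\<lambda>j. sat x [i, j] p) [0..<?N - k])" and n = ?N])
      fix k assume k: "k < ?N"
      then have "Suc (?N - Suc k) = ?N - k" by simp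
      moreover from this have "[0..<?N - k] = [0..<?N - Suc k] @ [?N - Suc k]"
        using upt_Suc_append[of 0 "?N - Suc k"] by simp
      ultimately show "rb x (bitprog p) (0, V a i (Suc k) (?N - Suc k), w @ map (\<lambda>j. sat x [i, j] p) [0..<?N - Suc k]) (?B ?n)
         (0, V a i k (?N - k), w @ map (\<lambda>j. sat x [i, j] p) [0..<?N - k])"
        using bit[OF that, of "?N - Suc k" a k "w @ map (\<lambda>j. sat x [i, j] p) [0..<?N - Suc k]"] k by simp
    qed (use Nle in \<open>auto simp: V\<close>)
    have 4: "rb x (clear 5) (0, V a i 0 ?N, w') (2 * vmax N ?n + 1) (0, V a i 0 0, w')" for w'
      by (rule rb_post[OF rb_clear]) (use Nle in \<open>auto simp: V Vu\<close>)
    have 5: "rb x (Inc 3) (0, V a i 0 0, w') 1 (0, V a (Suc i) 0 0, w')" for w'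
      by (rule rb_Inc) (simp add: V Vu)
    show ?thesis unfolding rowprog_def using rb_Seq[OF 1 rb_Seq[OF 2 rb_Seq[OF 3 rb_Seq[OF 4 5]]]] .
  qed
  have l: "lenreg x = V 0 0 0 0" by (auto simp: V_def lenreg_def fun_eq_iff)
  have 1: "rb x getlen (0, \<lambda>_. 0, []) (15 * ?n + 10) (0, V 0 0 0 0, [])" unfolding l[symmetric] by (rule rb_getlen)
  have 2: "rb x (ct N [] 2 7) (0, V 0 0 0 0, w) (ctime N ?n) (0, V ?N 0 0 0, w)" for w
    using getN[of 0 0 0 0 2] by (simp add: V Vu)
  have 3: "rb x (While 2 (Seq (Dec 2) (Out True))) (0, V ?N 0 0 0, []) (vmax N ?n * (1 + 1 + 1 + 1) + 1) (0, V 0 0 0 0, replicate ?N True)"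
  proof (rule rb_While_le[where st = "\<lambda>k. (0, V k 0 0 0, replicate (?N - k) True)" and n = ?N])
    fix k assume k: "k < ?N"
    have d: "rb x (Dec 2) (0, V (Suc k) 0 0 0, replicate (?N - Suc k) True) 1 (0, V k 0 0 0, replicate (?N - Suc k) True)"
      by (rule rb_Dec) (simp add: V Vu)
    have "replicate (?N - k) True = replicate (?N - Suc k) True @ [True]"
      using k by (simp add: replicate_append_same Suc_diff_Suc flip: replicate_Suc)
    then show "rb x (Seq (Dec 2) (Out True)) (0, V (Suc k) 0 0 0, replicate (?N - Suc k) True) (1 + 1 + 1) (0, V k 0 0 0, replicate (?N - k) True)"
      using rb_Seq[OF d rb_Out] by metis
  qed (use Nle in \<open>auto simp: V\<close>)
  let ?w = "replicate ?N True @ [False]" and ?f = "\<lambda>i. map (\<lambda>j. sat x [i, j] p) [0..<?N]"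
  have 4: "rb x (Out False) (0, V 0 0 0 0, replicate ?N True) 1 (0, V 0 0 0 0, ?w)" by (rule rb_Out)
  have 5: "rb x (While 2 (rowprog N p)) (0, V ?N 0 0 0, ?w) (vmax N ?n * (?R ?n + 1) + 1)
     (0, V 0 ?N 0 0, ?w @ concat (map ?f [0..<?N]))"
  proof (rule rb_While_le[where st = "\<lambda>k. (0, V k (?N - k) 0 0, ?w @ concat (map ?f [0..<?N - k]))" and n = ?N])
    fix k assume k: "k < ?N"
    then have "Suc (?N - Suc k) = ?N - k" by simp
    moreover from this have "[0..<?N - k] = [0..<?N - Suc k] @ [?N - Suc k]"
      using upt_Suc_append[of 0 "?N - Suc k"] by simp
    ultimately show "rb x (rowprog N p) (0, V (Suc k) (?N - Suc k) 0 0, ?w @ concat (map ?f [0..<?N - Suc k])) (?R ?n)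
       (0, V k (?N - k) 0 0, ?w @ concat (map ?f [0..<?N - k]))"
      using row[of "?N - Suc k" k "?w @ concat (map ?f [0..<?N - Suc k])"] k by simp
  qed (use Nle in \<open>auto simp: V\<close>)
  have fx: "f x = ?w @ concat (map ?f [0..<?N])" by (simp add: f_def Let_def)
  show "\<exists>h v. rb x ?c (0, \<lambda>_. 0, []) (?T ?n) (h, v, f x)"
    unfolding fx using rb_Seq[OF 1 rb_Seq[OF 2 rb_Seq[OF 3 rb_Seq[OF 4 rb_Seq[OF 2 5]]]]] by blast
qed

section \<open>A shallow calculus of definable predicates\<close>

text \<open>Total environments instead of lists: substitution and weakening become plain renaming of
  indices, with no side condition on lengths.\<close>

fun valf :: "bool list \<Rightarrow> (nat \<Rightarrow> nat) \<Rightarrow> trm \<Rightarrow> nat" where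
  "valf x e (Var i) = e i"
| "valf x e Len = length x"
| "valf x e (Cst n) = n"
| "valf x e (Plus a b) = valf x e a + valf x e b"
| "valf x e (Times a b) = valf x e a * valf x e b"

fun satf :: "bool list \<Rightarrow> (nat \<Rightarrow> nat) \<Rightarrow> fml \<Rightarrow> bool" where
  "satf x e (Lt a b) = (valf x e a < valf x e b)"
| "satf x e (Bit a) = (valf x e a < length x \<and> x ! valf x e a)"
| "satf x e (Neg p) = (\<not> satf x e p)"
| "satf x e (Conj p q) = (satf x e p \<and> satf x e q)"
| "satf x e (Exi a p) = (\<exists>k < valf x e a. satf x (case_nat k e) p)"

definition env :: "nat list \<Rightarrow> nat \<Rightarrow> nat" where
  "env e i = (if i < length e then e ! i else 0)"

lemma env_Cons: "env (k # e) = case_nat k (env e)"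
  by (auto simp: env_def fun_eq_iff split: nat.splits)

lemma val_env: "val x e t = valf x (env e) t"
  by (induction t) (auto simp: env_def)

lemma sat_env: "sat x e p = satf x (env e) p"
  by (induction p arbitrary: e) (auto simp: val_env env_Cons)

fun rent :: "(nat \<Rightarrow> nat) \<Rightarrow> trm \<Rightarrow> trm" where
  "rent f (Var i) = Var (f i)"
| "rent f (Plus a b) = Plus (rent f a) (rent f b)"
| "rent f (Times a b) = Times (rent f a) (rent f b)"
| "rent f t = t"

fun renf :: "(nat \<Rightarrow> nat) \<Rightarrow> fml \<Rightarrow> fml" where
  "renf f (Lt a b) = Lt (rent f a) (rent f b)"
| "renf f (Bit a) = Bit (rent f a)"
| "renf f (Neg p) = Neg (renf f p)"
| "renf f (Conj p q) = Conj (renf f p) (renf f q)"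
| "renf f (Exi a p) = Exi (rent f a) (renf (case_nat 0 (\<lambda>i. Suc (f i))) p)"

lemma valf_rent: "valf x e (rent f t) = valf x (\<lambda>i. e (f i)) t"
  by (induction t) auto

lemma satf_renf: "satf x e (renf f p) = satf x (\<lambda>i. e (f i)) p"
proof (induction p arbitrary: e f)
  case (Exi a p)
  have "(\<lambda>i. case_nat k e (case_nat 0 (\<lambda>i. Suc (f i)) i)) = case_nat k (\<lambda>i. e (f i))" for k
    by (auto simp: fun_eq_iff split: nat.splits)
  then show ?case by (simp add: Exi valf_rent)
qed (auto simp: valf_rent)

type_synonym 'a ctx = "bool list \<Rightarrow> (nat \<Rightarrow> nat) \<Rightarrow> 'a"

definition PF :: "bool ctx \<Rightarrow> bool" where
  "PF P \<longleftrightarrow> (\<exists>p. \<forall>x e. satf x e p = P x e)"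

text \<open>The bound by a term lets a bounded quantifier name the value.\<close>

definition PT :: "nat ctx \<Rightarrow> bool" where
  "PT t \<longleftrightarrow> (\<exists>b. \<forall>x e. t x e \<le> valf x e b) \<and> PF (\<lambda>x e. e 0 = t x (\<lambda>i. e (Suc i)))"

lemma PFI: "(\<And>x e. satf x e p = P x e) \<Longrightarrow> PF P"
  unfolding PF_def by blast

lemma PF_not: assumes "PF P" shows "PF (\<lambda>x e. \<not> P x e)"
proof -
  obtain p where "\<And>x e. satf x e p = P x e" using assms unfolding PF_def by blast
  then show ?thesis by (intro PFI[of "Neg p"]) simp
qed

lemma PF_conj: assumes "PF P" "PF Q" shows "PF (\<lambda>x e. P x e \<and> Q x e)"
proof -
  obtain p q where "\<And>x e. satf x e p = P x e" "\<And>x e. satf x e q = Q x e" using assms unfolding PF_def by blast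
  then show ?thesis by (intro PFI[of "Conj p q"]) simp
qed

lemma PF_ren: assumes "PF P" shows "PF (\<lambda>x e. P x (\<lambda>i. e (f i)))"
proof -
  obtain p where "\<And>x e. satf x e p = P x e" using assms unfolding PF_def by blast
  then show ?thesis by (intro PFI[of "renf f p"]) (simp add: satf_renf)
qed

lemma PF_disj: assumes "PF P" "PF Q" shows "PF (\<lambda>x e. P x e \<or> Q x e)"
proof -
  have "PF (\<lambda>x e. \<not> (\<not> P x e \<and> \<not> Q x e))" by (intro PF_not PF_conj assms)
  then show ?thesis by simp
qed

lemma PF_imp: "PF P \<Longrightarrow> PF Q \<Longrightarrow> PF (\<lambda>x e. P x e \<longrightarrow> Q x e)"
  unfolding imp_conv_disj by (intro PF_disj PF_not)

lemma PF_iff: "PF P \<Longrightarrow> PF Q \<Longrightarrow> PF (\<lambda>x e. P x e = Q x e)"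
  unfolding iff_conv_conj_imp by (intro PF_conj PF_imp)

lemma PF_const: "PF (\<lambda>x e. c)"
  by (rule PFI[of "Lt (Cst 0) (Cst (of_bool c))"]) simp

text \<open>Terms with a definable graph are eliminated by a bounded quantifier: some
  \<open>k\<close> below the bounding term equals the value of \<open>t\<close> and satisfies
  \<open>Q\<close>. Everything that is not an atom of the formula language enters through
  this.\<close>

lemma PF_bind:
  assumes t: "PT t" and Q: "PF (\<lambda>x e. Q x (e 0) (\<lambda>i. e (Suc i)))"
  shows "PF (\<lambda>x e. Q x (t x e) e)"
proof -
  obtain b p where b: "\<And>x e. t x e \<le> valf x e b" and p: "\<And>x e. satf x e p = (e 0 = t x (\<lambda>i. e (Suc i)))"
    using t unfolding PT_def PF_def by blast
  obtain q where q: "\<And>x e. satf x e q = Q x (e 0) (\<lambda>i. e (Suc i))" using Q unfolding PF_def by blast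
  show ?thesis
    by (rule PFI[of "Exi (Plus b (Cst 1)) (Conj p q)"]) (use b in \<open>auto simp: p q less_Suc_eq_le\<close>)
qed

lemma PT_ren: assumes "PT t" shows "PT (\<lambda>x e. t x (\<lambda>i. e (f i)))"
proof -
  obtain b where b: "\<And>x e. t x e \<le> valf x e b" using assms unfolding PT_def by blast
  have "PF (\<lambda>x e. e 0 = t x (\<lambda>i. e (Suc i)))" using assms unfolding PT_def by blast
  from PF_ren[OF this, of "case_nat 0 (\<lambda>i. Suc (f i))"]
  have "PF (\<lambda>x e. e 0 = t x (\<lambda>i. e (Suc (f i))))" by simp
  moreover have "t x (\<lambda>i. e (f i)) \<le> valf x e (rent f b)" for x e using b by (simp add: valf_rent)
  ultimately show ?thesis unfolding PT_def by auto
qed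

lemma PT_I:
  assumes "\<And>x e. t x e \<le> valf x e b" "PF (\<lambda>x e. e 0 = t x (\<lambda>i. e (Suc i)))" shows "PT t"
  using assms unfolding PT_def by blast

lemma eq_atom: "satf x e (Conj (Neg (Lt a b)) (Neg (Lt b a))) = (valf x e a = valf x e b)"
  by auto

lemma PT_val: "PT (\<lambda>x e. valf x e a)"
proof (rule PT_I[of _ a])
  show "PF (\<lambda>x e. e 0 = valf x (\<lambda>i. e (Suc i)) a)"
    by (rule PFI[of "Conj (Neg (Lt (Var 0) (rent Suc a))) (Neg (Lt (rent Suc a) (Var 0)))"])
      (auto simp: valf_rent)
qed simp

lemma PT_var: "PT (\<lambda>x e. e i)"
  using PT_val[of "Var i"] by simp

lemma PT_const: "PT (\<lambda>x e. c)"
  using PT_val[of "Cst c"] by simp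

lemma PT_len: "PT (\<lambda>x e. length x)"
  using PT_val[of Len] by simp

lemma PF_bind2:
  assumes s: "PT s" and t: "PT t" and Q: "PF (\<lambda>x e. Q x (e 0) (e 1))"
  shows "PF (\<lambda>x e. Q x (s x e) (t x e))"
proof (rule PF_bind[OF t, of "\<lambda>x k e. Q x (s x e) k"])
  show "PF (\<lambda>x e. Q x (s x (\<lambda>i. e (Suc i))) (e 0))"
    by (rule PF_bind[OF PT_ren[OF s], of "\<lambda>x k e. Q x k (e 0)" Suc])
      (use PF_ren[OF Q, of "case_nat 0 (\<lambda>_. Suc 0)"] in simp)
qed

lemma PF_less: "PT s \<Longrightarrow> PT t \<Longrightarrow> PF (\<lambda>x e. s x e < t x e)"
  by (rule PF_bind2[where Q = "\<lambda>x a b. a < b"]) (auto intro: PFI[of "Lt (Var 0) (Var 1)"])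

lemma PF_le: "PT s \<Longrightarrow> PT t \<Longrightarrow> PF (\<lambda>x e. s x e \<le> t x e)"
  unfolding not_less[symmetric] by (intro PF_not PF_less)

lemma PF_eq: "PT s \<Longrightarrow> PT t \<Longrightarrow> PF (\<lambda>x e. s x e = t x e)"
  unfolding order_eq_iff by (intro PF_conj PF_le)

definition bitat :: "bool list \<Rightarrow> nat \<Rightarrow> bool" where
  "bitat x i \<longleftrightarrow> i < length x \<and> x ! i"

lemma PF_bit: "PT t \<Longrightarrow> PF (\<lambda>x e. bitat x (t x e))"
  by (rule PF_bind[where Q = "\<lambda>x k e. bitat x k"]) (auto intro: PFI[of "Bit (Var 0)"] simp: bitat_def)

lemma PF_ex:
  assumes "PT t" "PF (\<lambda>x e. R x (e 0) (\<lambda>i. e (Suc i)))"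
  shows "PF (\<lambda>x e. \<exists>k<t x e. R x k e)"
proof (rule PF_bind[OF assms(1), of "\<lambda>x m e. \<exists>k<m. R x k e"])
  have "PF (\<lambda>x e. R x (e 0) (\<lambda>i. e (Suc (Suc i))))"
    using PF_ren[OF assms(2), of "case_nat 0 (\<lambda>i. Suc (Suc i))"] by simp
  then obtain p where "\<And>x e. satf x e p = R x (e 0) (\<lambda>i. e (Suc (Suc i)))" unfolding PF_def by blast
  then show "PF (\<lambda>x e. \<exists>k<e 0. R x k (\<lambda>i. e (Suc i)))"
    by (intro PFI[of "Exi (Var 0) p"]) simp
qed

lemma PF_all:
  assumes "PT t" "PF (\<lambda>x e. R x (e 0) (\<lambda>i. e (Suc i)))"
  shows "PF (\<lambda>x e. \<forall>k<t x e. R x k e)"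
proof -
  have "PF (\<lambda>x e. \<not> (\<exists>k<t x e. \<not> R x k e))" by (intro PF_not PF_ex assms)
  then show ?thesis by simp
qed

lemma PF_graph2:
  assumes "PT s" "PT t" "PF (\<lambda>x e. e 0 = f (e 1) (e 2))"
  shows "PF (\<lambda>x e. e 0 = f (s x (\<lambda>i. e (Suc i))) (t x (\<lambda>i. e (Suc i))))"
proof (rule PF_bind[OF PT_ren[OF assms(1)], of "\<lambda>x a e. e 0 = f a (t x (\<lambda>i. e (Suc i)))" Suc])
  show "PF (\<lambda>x e. e (Suc 0) = f (e 0) (t x (\<lambda>i. e (Suc (Suc i)))))"
    by (rule PF_bind[OF PT_ren[OF assms(2)], of "\<lambda>x b e. e (Suc 0) = f (e 0) b" "\<lambda>i. Suc (Suc i)"])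
      (use PF_ren[OF assms(3), of "\<lambda>i. [2, 1, 0] ! i"] in \<open>simp add: numeral_2_eq_2\<close>)
qed

text \<open>The bound \<open>m + n + m * n\<close> is crude but covers all arithmetic operations
  used here and is itself a term, so definability of the graph is all that remains to be checked for
  each operation.\<close>

lemma PT_op:
  assumes "PT s" "PT t" "PF (\<lambda>x e. e 0 = f (e 1) (e 2))"
    and b: "\<And>m n. f m n \<le> m + n + m * n"
  shows "PT (\<lambda>x e. f (s x e) (t x e))"
proof -
  obtain c d where c: "\<And>x e. s x e \<le> valf x e c" and d: "\<And>x e. t x e \<le> valf x e d"
    using assms(1,2) unfolding PT_def by blast
  show ?thesis
  proof (rule PT_I[of _ "Plus (Plus c d) (Times c d)"])
    fix x e
    have "f (s x e) (t x e) \<le> s x e + t x e + s x e * t x e" by (rule b)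
    also have "\<dots> \<le> valf x e c + valf x e d + valf x e c * valf x e d"
      by (intro add_mono mult_mono c d) auto
    finally show "f (s x e) (t x e) \<le> valf x e (Plus (Plus c d) (Times c d))" by simp
  qed (rule PF_graph2[OF assms(1-3)])
qed

lemma PT_plus: "PT s \<Longrightarrow> PT t \<Longrightarrow> PT (\<lambda>x e. s x e + t x e)"
  by (rule PT_op) (auto intro: PFI[OF eq_atom, of "Var 0" "Plus (Var 1) (Var 2)", simplified])

lemma PT_times: "PT s \<Longrightarrow> PT t \<Longrightarrow> PT (\<lambda>x e. s x e * t x e)"
  by (rule PT_op) (auto intro: PFI[OF eq_atom, of "Var 0" "Times (Var 1) (Var 2)", simplified])

lemma PT_Suc: "PT s \<Longrightarrow> PT (\<lambda>x e. Suc (s x e))"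
  unfolding Suc_eq_plus1 by (intro PT_plus PT_const)

lemmas PF_basic = PF_not PF_conj PF_disj PF_imp PF_iff PF_const PF_less PF_le PF_eq PF_ex PF_all PF_bit
  PT_var PT_const PT_len PT_plus PT_times PT_Suc

lemma PT_minus: "PT s \<Longrightarrow> PT t \<Longrightarrow> PT (\<lambda>x e. s x e - t x e)"
proof (erule (1) PT_op)
  have "(k = m - n) = (m = n + k \<or> (m \<le> n \<and> k = 0))" for k m n :: nat by auto
  then show "PF (\<lambda>x e. e 0 = e 1 - e 2)" by (simp only:) (intro PF_basic)
qed simp

lemma PT_div: "PT s \<Longrightarrow> PT t \<Longrightarrow> PT (\<lambda>x e. s x e div t x e)"
proof (erule (1) PT_op)
  \<comment> \<open>Division by zero yields 0, hence the separate disjunct.\<close>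
  have "(k = m div n) = ((n = 0 \<and> k = 0) \<or> (k * n \<le> m \<and> m < Suc k * n))" for k m n :: nat
  proof (cases "n = 0")
    case False
    have "(k = m div n) = (k \<le> m div n \<and> m div n < Suc k)" by auto
    then show ?thesis
      using False by (simp only: less_eq_div_iff_mult_less_eq div_less_iff_less_mult neq0_conv) auto
  qed auto
  then show "PF (\<lambda>x e. e 0 = e 1 div e 2)" by (simp only:) (intro PF_basic)
qed (simp add: trans_le_add1 div_le_dividend)

lemma PT_mod: "PT s \<Longrightarrow> PT t \<Longrightarrow> PT (\<lambda>x e. s x e mod t x e)"
  unfolding minus_mult_div_eq_mod[symmetric] by (intro PT_minus PT_times PT_div)

lemma PT_If:
  assumes P: "PF P" and s: "PT s" and t: "PT t"
  shows "PT (\<lambda>x e. if P x e then s x e else t x e)"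
proof -
  obtain c d where c: "\<And>x e. s x e \<le> valf x e c" and d: "\<And>x e. t x e \<le> valf x e d"
    using s t unfolding PT_def by blast
  show ?thesis
  proof (rule PT_I[of _ "Plus c d"])
    show "(if P x e then s x e else t x e) \<le> valf x e (Plus c d)" for x e
      using c[of x e] d[of x e] by auto
    have "(k = (if b then m else n)) = ((b \<and> k = m) \<or> (\<not> b \<and> k = n))" for b and k m n :: nat by auto
    then show "PF (\<lambda>x e. e 0 = (if P x (\<lambda>i. e (Suc i)) then s x (\<lambda>i. e (Suc i)) else t x (\<lambda>i. e (Suc i))))"
      by (simp only:) (intro PF_basic PF_ren[OF P] PT_ren[OF s] PT_ren[OF t])
  qed
qed

lemma PF_even: "PT t \<Longrightarrow> PF (\<lambda>x e. even (t x e))"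
  unfolding even_iff_mod_2_eq_zero by (intro PF_eq PT_mod PT_const)

lemma PF_list_ex: "(\<And>a. a \<in> set l \<Longrightarrow> PF (P a)) \<Longrightarrow> PF (\<lambda>x e. \<exists>a\<in>set l. P a x e)"
proof (induction l)
  case (Cons a l)
  then have "PF (\<lambda>x e. P a x e \<or> (\<exists>a\<in>set l. P a x e))" by (intro PF_disj) auto
  then show ?case by simp
qed (simp add: PF_const)

lemmas PF_intros = PF_basic PT_minus PT_div PT_mod PT_If PF_even

lemma PT_poly: "PT (\<lambda>x e. poly p (length x))"
  by (induction p) (auto intro!: PF_intros)

lemma poly_trm: "\<exists>t. \<forall>x e. val x e t = poly p (length x)"
proof (induction p)
  case 0 show ?case by (auto intro: exI[of _ "Cst 0"])
next
  case (pCons a p)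
  then obtain t where "\<forall>x e. val x e t = poly p (length x)" by blast
  then show ?case by (auto intro!: exI[of _ "Plus (Cst a) (Times Len t)"])
qed

theorem classP_PF:
  assumes "PF P" shows "{x. P x (env [])} \<in> classP"
proof -
  obtain p where "\<And>x e. satf x e p = P x e" using assms unfolding PF_def by blast
  then show ?thesis using polytime_decide[of p] by (simp add: classP_def sat_env)
qed

theorem polytime_graph:
  assumes "PF P" and n: "\<And>x. n x = poly p (length x)"
    and E: "\<And>x i j. i < n x \<Longrightarrow> j < n x \<Longrightarrow> ({i, j} \<in> E x) = P x (env [i, j])"
  shows "polytime (\<lambda>x. enc_graph (n x) (E x))"
proof -
  obtain q where q: "\<And>x e. satf x e q = P x e" using assms(1) unfolding PF_def by blast
  obtain t where t: "\<And>x. val x [] t = n x" using poly_trm[of p] n by metis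
  have "(\<lambda>x. enc_graph (n x) (E x)) = (\<lambda>x. let n = val x [] t in replicate n True @ False #
     concat (map (\<lambda>i. map (\<lambda>j. sat x [i, j] q) [0..<n]) [0..<n]))"
    by (auto simp: enc_graph_def t E sat_env q Let_def fun_eq_iff intro!: arg_cong[of _ _ concat])
  then show ?thesis using polytime_matrix[of t q] by simp
qed

section \<open>Choosability with bounded palette is in the class\<close>

lemma length_pair: "length (pair x y) = 2 * length x + 1 + length y"
  by (induction x y rule: pair.induct) auto

lemma bitat_Cons: "bitat (b # x) i = (if i = 0 then b else bitat x (i - 1))"
  by (cases i) (auto simp: bitat_def)

lemma bitat_pair_flag: "i < length x \<Longrightarrow> bitat (pair x y) (2 * i)"
proof (induction x arbitrary: i)
  case (Cons b x) then show ?case by (cases i) (auto simp: bitat_Cons)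
qed simp

lemma bitat_pair_bit: "i < length x \<Longrightarrow> bitat (pair x y) (Suc (2 * i)) = x ! i"
proof (induction x arbitrary: i)
  case (Cons b x) then show ?case by (cases i) (auto simp: bitat_Cons)
qed simp

lemma bitat_pair_end: "\<not> bitat (pair x y) (2 * length x)"
  by (induction x) (auto simp: bitat_Cons)

lemma bitat_pair_snd: "bitat (pair x y) (2 * length x + 1 + i) = bitat y i"
  by (induction x) (auto simp: bitat_Cons)

text \<open>Reads off the length \<open>a\<close> of the first component of a pair that starts at
  position \<open>s\<close> of \<open>w\<close>: even offsets are continuation flags, and the first
  flag that is not set ends the component.\<close>

definition fst_end :: "bool list \<Rightarrow> nat \<Rightarrow> nat \<Rightarrow> bool" where
  "fst_end w s a \<longleftrightarrow> (\<forall>i<a. bitat w (s + 2 * i)) \<and> \<not> bitat w (s + 2 * a)"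

lemma fst_end_iff:
  assumes "\<And>i. bitat w (s + i) = bitat (pair x y) i" shows "fst_end w s a \<longleftrightarrow> a = length x"
  unfolding fst_end_def assms
  using bitat_pair_flag[of _ x y] bitat_pair_end[of x y] by (metis linorder_neqE_nat)

lemma nth_concat_rows:
  "u < m \<Longrightarrow> v < n \<Longrightarrow> concat (map (\<lambda>i. map (g i) [0..<n]) [0..<m]) ! (u * n + v) = g u v"
proof (induction m)
  case (Suc m)
  have l: "length (concat (map (\<lambda>i. map (g i) [0..<n]) [0..<m])) = m * n" for m
    by (induction m) auto
  show ?case
  proof (cases "u = m")
    case True then show ?thesis using Suc.prems by (simp add: nth_append l)
  next
    case False
    then have "u < m" using Suc.prems by simp
    moreover have "u * n + v < m * n"
    proof -
      have "u * n + v < Suc u * n" using Suc.prems by simp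
      also have "\<dots> \<le> m * n" using \<open>u < m\<close> by (intro mult_le_mono1) auto
      finally show ?thesis .
    qed
    ultimately show ?thesis using Suc by (simp add: nth_append l)
  qed
qed simp

lemma length_concat_rows: "length (concat (map (\<lambda>i. map (g i) [0..<n]) [0..<m])) = m * n"
  by (induction m) auto

lemma length_enc_graph: "length (enc_graph n E) = n + 1 + n * n"
  by (simp add: enc_graph_def length_concat_rows)

lemma enc_graph_nth:
  assumes "u < n" "v < n" shows "enc_graph n E ! (n + 1 + (u * n + v)) = ({u, v} \<in> E)"
  unfolding enc_graph_def using nth_concat_rows[OF assms, of "\<lambda>i j. {i, j} \<in> E"] by (simp add: nth_append)

lemma enc_graph_bit_less:
  fixes u v n :: nat assumes "u < n" "v < n" shows "n + 1 + (u * n + v) < n + 1 + n * n"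
proof -
  have "u * n + v < Suc u * n" using assms by simp
  also have "\<dots> \<le> n * n" using assms by (intro mult_le_mono1) auto
  finally show ?thesis by simp
qed

text \<open>The code length is strictly increasing in the number of vertices, so the number can be
  recovered from the length alone.\<close>

lemma square_size_inj: "(m :: nat) + 1 + m * m = n + 1 + n * n \<longleftrightarrow> m = n"
proof
  assume *: "m + 1 + m * m = n + 1 + n * n"
  show "m = n"
  proof (rule ccontr)
    assume "m \<noteq> n"
    then consider "m < n" | "n < m" by linarith
    then show False using * mult_le_mono[of m n m n] mult_le_mono[of n m n m] by cases auto
  qed
qed simp

lemma enc_graph_inj:
  assumes "enc_graph m D = enc_graph n E" "simple_graph {..<m} D" "simple_graph {..<n} E"
  shows "m = n" "D = E"
proof -
  show mn: "m = n" using arg_cong[OF assms(1), of length] by (simp only: length_enc_graph square_size_inj)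
  have *: "({u, v} \<in> D) = ({u, v} \<in> E)" if "u < n" "v < n" for u v
    using enc_graph_nth[OF that, of D] enc_graph_nth[OF that, of E] assms(1) mn by simp
  have "e \<in> D \<longleftrightarrow> e \<in> E" for e
  proof -
    have "\<exists>u v. e = {u, v} \<and> u < n \<and> v < n" if "e \<in> D \<union> E"
    proof -
      have "card e = 2" "e \<subseteq> {..<n}" using that assms(2,3) mn by (auto simp: simple_graph_def)
      then show ?thesis by (auto simp: card_2_iff)
    qed
    then show ?thesis using * by blast
  qed
  then show "D = E" by blast
qed

text \<open>Here \<open>w\<close> is read as \<open>pair x (pair y z)\<close> with \<open>a\<close>
  and \<open>b\<close> the lengths of \<open>x\<close> and \<open>y\<close>: the inner pair starts
  at \<open>2 * a + 1\<close>, the bits of \<open>y\<close> stand at its odd offsets, and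
  \<open>z\<close> begins after a further \<open>2 * b + 1\<close> places.\<close>

definition ybit :: "bool list \<Rightarrow> nat \<Rightarrow> nat \<Rightarrow> nat \<Rightarrow> bool" where
  "ybit w a b i \<longleftrightarrow> i < b \<and> bitat w (2 * a + 1 + (2 * i + 1))"

text \<open>A mark of \<open>z\<close> counts only where \<open>y\<close> has one as well; this
  builds the condition that a colour belongs to the list into the marks.\<close>

definition zbit :: "bool list \<Rightarrow> nat \<Rightarrow> nat \<Rightarrow> nat \<Rightarrow> bool" where
  "zbit w a b i \<longleftrightarrow> ybit w a b i \<and> bitat w (2 * a + 1 + (2 * b + 1) + i)"

text \<open>Bit \<open>5 * v + k\<close> stands for the colour \<open>k + 1\<close> at the vertex
  \<open>v\<close>; the increasing triple expresses that a list has exactly three colours.\<close>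

definition lists_ok :: "nat \<Rightarrow> (nat \<Rightarrow> bool) \<Rightarrow> bool" where
  "lists_ok n Y \<longleftrightarrow> (\<forall>v<n. \<exists>k1<5. \<exists>k2<5. \<exists>k3<5. k1 < k2 \<and> k2 < k3 \<and>
     (\<forall>k<5. Y (5 * v + k) = (k = k1 \<or> k = k2 \<or> k = k3)))"

definition colours_ok :: "nat \<Rightarrow> (nat \<Rightarrow> nat \<Rightarrow> bool) \<Rightarrow> (nat \<Rightarrow> bool) \<Rightarrow> bool" where
  "colours_ok n X Z \<longleftrightarrow> (\<forall>v<n. \<exists>k<5. Z (5 * v + k)) \<and>
     (\<forall>u<n. \<forall>v<n. X u v \<longrightarrow> (\<forall>k<5. \<not> (Z (5 * u + k) \<and> Z (5 * v + k))))"

text \<open>A string \<open>y\<close> that does not encode lists of size 3 is accepted, as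
  \<open>y\<close> is universally quantified. The number of vertices is found as the unique solution
  of \<open>a = n + 1 + n * n\<close>.\<close>

definition verifier :: "bool list set" where
  "verifier = {w. \<exists>a<length w. \<exists>b<length w. fst_end w 0 a \<and> fst_end w (2 * a + 1) b \<and>
     (\<exists>n<a. a = n + 1 + n * n \<and> (lists_ok n (ybit w a b) \<longrightarrow>
        colours_ok n (\<lambda>u v. bitat w (2 * (n + 1 + (u * n + v)) + 1)) (zbit w a b)))}"

lemma verifier_classP: "verifier \<in> classP"
  unfolding verifier_def fst_end_def lists_ok_def colours_ok_def ybit_def zbit_def
  by (rule classP_PF) (intro PF_intros)

lemma verifier_pair:
  assumes x: "x = enc_graph n E"
  shows "pair x (pair y z) \<in> verifier \<longleftrightarrow>
    (lists_ok n (bitat y) \<longrightarrow> colours_ok n (\<lambda>u v. {u, v} \<in> E) (\<lambda>i. bitat y i \<and> bitat z i))"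
proof -
  let ?w = "pair x (pair y z)" and ?a = "length x" and ?b = "length y"
  have a: "?a = n + 1 + n * n" by (simp add: x length_enc_graph)
  have ea: "fst_end ?w 0 a \<longleftrightarrow> a = ?a" for a by (rule fst_end_iff) simp
  have eb: "fst_end ?w (2 * ?a + 1) b \<longleftrightarrow> b = ?b" for b by (rule fst_end_iff) (rule bitat_pair_snd)
  have Y: "ybit ?w ?a ?b i = bitat y i" for i
    unfolding ybit_def bitat_pair_snd using bitat_pair_bit[of i y z] by (auto simp: bitat_def)
  have Z: "zbit ?w ?a ?b i = (bitat y i \<and> bitat z i)" for i
    unfolding zbit_def Y using bitat_pair_snd[of x "pair y z" "2 * ?b + 1 + i"] bitat_pair_snd[of y z i]
    by (simp only: add.assoc)
  have X: "bitat ?w (2 * (n + 1 + (u * n + v)) + 1) = ({u, v} \<in> E)" if "u < n" "v < n" for u v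
    using bitat_pair_bit[of "n + 1 + (u * n + v)" x "pair y z"] enc_graph_bit_less[OF that]
      enc_graph_nth[OF that, of E] a x by simp
  have "pair x (pair y z) \<in> verifier \<longleftrightarrow> (lists_ok n (ybit ?w ?a ?b) \<longrightarrow>
        colours_ok n (\<lambda>u v. bitat ?w (2 * (n + 1 + (u * n + v)) + 1)) (zbit ?w ?a ?b))"
  proof -
    have l: "?a < length ?w" "?b < length ?w" by (auto simp: length_pair)
    have an: "?a = m + 1 + m * m \<longleftrightarrow> m = n" for m unfolding a using square_size_inj[of n m] by auto
    have "n < ?a" using a by simp
    have "(\<exists>a<length ?w. \<exists>b<length ?w. fst_end ?w 0 a \<and> fst_end ?w (2 * a + 1) b \<and>
      (\<exists>n<a. a = n + 1 + n * n \<and> Q a b n)) \<longleftrightarrow> Q ?a ?b n" (is "?A \<longleftrightarrow> _") for Q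
    proof
      assume ?A
      then obtain a b m where *: "fst_end ?w 0 a" "fst_end ?w (2 * a + 1) b" "a = m + 1 + m * m" "Q a b m" by blast
      from *(1) have a: "a = ?a" using ea by simp
      have "b = ?b" using *(2) eb unfolding a by simp
      moreover have "m = n" using *(3) an[of m] unfolding a by blast
      ultimately show "Q ?a ?b n" using *(4) a by simp
    next
      assume "Q ?a ?b n"
      moreover have "fst_end ?w 0 ?a" "fst_end ?w (2 * ?a + 1) ?b" "?a = n + 1 + n * n" using ea eb an by auto
      ultimately show ?A using l \<open>n < ?a\<close> by blast
    qed
    then show ?thesis unfolding verifier_def mem_Collect_eq .
  qed
  also have "\<dots> = (lists_ok n (bitat y) \<longrightarrow> colours_ok n (\<lambda>u v. {u, v} \<in> E) (\<lambda>i. bitat y i \<and> bitat z i))"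
    unfolding colours_ok_def using X by (simp add: Y Z lists_ok_def)
  finally show ?thesis .
qed

lemma bitat_map: "bitat (map f [0..<m]) i = (i < m \<and> f i)"
  by (auto simp: bitat_def)

lemma card3_less5:
  assumes "S \<subseteq> {..<5::nat}" "card S = 3"
  shows "\<exists>k1<5. \<exists>k2<5. \<exists>k3<5. k1 < k2 \<and> k2 < k3 \<and> (\<forall>k<5. (k \<in> S) = (k = k1 \<or> k = k2 \<or> k = k3))"
proof -
  have fin: "finite S" using assms finite_subset by blast
  obtain l where l: "set l = S" "sorted_wrt (<) l" "length l = 3"
    using fin assms(2) by (metis set_sorted_list_of_set strict_sorted_list_of_set length_sorted_list_of_set)
  then obtain k1 k2 k3 where "l = [k1, k2, k3]"
    by (auto simp: numeral_3_eq_3 length_Suc_conv)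
  with l assms(1) have "k1 < 5 \<and> k2 < 5 \<and> k3 < 5 \<and> k1 < k2 \<and> k2 < k3 \<and> (\<forall>k<5. (k \<in> S) = (k = k1 \<or> k = k2 \<or> k = k3))"
    by auto
  then show ?thesis by blast
qed

lemma choosable_iff_verifier:
  assumes x: "x = enc_graph n E" and G: "simple_graph {..<n} E"
  shows "choosable 3 5 {..<n} E \<longleftrightarrow> (\<forall>y. length y \<le> 5 * length x \<longrightarrow>
     (\<exists>z. length z \<le> 5 * length x \<and> pair x (pair y z) \<in> verifier))" (is "?L \<longleftrightarrow> ?R")
proof
  have nx: "5 * n \<le> 5 * length x" by (simp add: x length_enc_graph)
  have idx: "5 * v + k < 5 * n" if "v < n" "k < 5" for v k using that by linarith
  have dm: "(5 * v + k) div 5 = v" "(5 * v + k) mod 5 = k" if "k < 5" for v k :: nat using that by auto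
  {
    assume L: ?L
    show ?R
    proof (intro allI impI)
      fix y :: "bool list" assume "length y \<le> 5 * length x"
      define Lv where "Lv v = {Suc k | k. k < 5 \<and> bitat y (5 * v + k)}" for v
      show "\<exists>z. length z \<le> 5 * length x \<and> pair x (pair y z) \<in> verifier"
      proof (cases "lists_ok n (bitat y)")
        case True
        have "Lv v \<subseteq> {1..5} \<and> card (Lv v) = 3" if "v < n" for v
        proof -
          obtain k1 k2 k3 where k: "k1 < 5" "k2 < 5" "k3 < 5" "k1 < k2" "k2 < k3"
            "\<And>k. k < 5 \<Longrightarrow> bitat y (5 * v + k) = (k = k1 \<or> k = k2 \<or> k = k3)"
            using True \<open>v < n\<close> unfolding lists_ok_def by blast
          then have "Lv v = {Suc k1, Suc k2, Suc k3}" unfolding Lv_def by auto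
          then show ?thesis using k by auto
        qed
        then obtain c where c: "proper_coloring E c" "\<And>v. v < n \<Longrightarrow> c v \<in> Lv v"
          using L unfolding choosable_def by (metis lessThan_iff)
        define z where "z = map (\<lambda>i. c (i div 5) = Suc (i mod 5)) [0..<5 * n]"
        have z: "bitat z (5 * v + k) = (c v = Suc k)" if "v < n" "k < 5" for v k
          using idx[OF that] dm[OF that(2)] by (simp add: z_def bitat_map)
        have "colours_ok n (\<lambda>u v. {u, v} \<in> E) (\<lambda>i. bitat y i \<and> bitat z i)"
          unfolding colours_ok_def
        proof (intro conjI allI impI)
          fix v assume v: "v < n"
          from c(2)[OF v] obtain k where "c v = Suc k" "k < 5" "bitat y (5 * v + k)" unfolding Lv_def by auto
          then show "\<exists>k<5. bitat y (5 * v + k) \<and> bitat z (5 * v + k)" using z[OF v] by blast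
        next
          fix u v k assume uv: "u < n" "v < n" "{u, v} \<in> E" "k < (5 :: nat)"
          have "u \<noteq> v" using G uv(3) by (auto simp: simple_graph_def)
          then have "c u \<noteq> c v" using c(1) uv(3) by (auto simp: proper_coloring_def)
          then show "\<not> ((bitat y (5 * u + k) \<and> bitat z (5 * u + k)) \<and> (bitat y (5 * v + k) \<and> bitat z (5 * v + k)))"
            using z uv by auto
        qed
        then show ?thesis using verifier_pair[OF x, of y z] nx by (intro exI[of _ z]) (auto simp: z_def)
      next
        case False
        then show ?thesis using verifier_pair[OF x, of y "[]"] by (intro exI[of _ "[]"]) auto
      qed
    qed
  next
    assume R: ?R
    show ?L unfolding choosable_def
    proof (intro allI impI)
      fix L :: "nat \<Rightarrow> nat set" assume L: "\<forall>v\<in>{..<n}. L v \<subseteq> {1..5} \<and> card (L v) = 3"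
      define y where "y = map (\<lambda>i. Suc (i mod 5) \<in> L (i div 5)) [0..<5 * n]"
      have y: "bitat y (5 * v + k) = (Suc k \<in> L v)" if "v < n" "k < 5" for v k
        using idx[OF that] dm[OF that(2)] by (simp add: y_def bitat_map)
      have "lists_ok n (bitat y)" unfolding lists_ok_def
      proof (intro allI impI)
        fix v assume v: "v < n"
        let ?S = "{k. k < 5 \<and> Suc k \<in> L v}"
        have "Suc ` ?S = L v"
        proof (intro equalityI subsetI)
          fix c assume "c \<in> L v"
          moreover from this have "c \<in> {1..5}" using L v by blast
          ultimately show "c \<in> Suc ` ?S" by (cases c) auto
        qed auto
        then have "card ?S = 3" using L v card_image[of Suc ?S] by auto
        from card3_less5[OF _ this]
        show "\<exists>k1<5. \<exists>k2<5. \<exists>k3<5. k1 < k2 \<and> k2 < k3 \<and> (\<forall>k<5. bitat y (5 * v + k) = (k = k1 \<or> k = k2 \<or> k = k3))"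
          using y[OF v] by auto
      qed
      moreover have "length y \<le> 5 * length x" using nx by (simp add: y_def)
      ultimately obtain z where z: "colours_ok n (\<lambda>u v. {u, v} \<in> E) (\<lambda>i. bitat y i \<and> bitat z i)"
        using R verifier_pair[OF x] by blast
      \<comment> \<open>A vertex may carry several marks. Adjacent vertices have none in common, so
        an arbitrary choice gives a proper colouring.\<close>
      define k where "k v = (SOME k. k < 5 \<and> bitat y (5 * v + k) \<and> bitat z (5 * v + k))" for v
      have k: "k v < 5 \<and> bitat y (5 * v + k v) \<and> bitat z (5 * v + k v)" if "v < n" for v
        unfolding k_def by (rule someI_ex) (use z that in \<open>auto simp: colours_ok_def\<close>)
      show "\<exists>c. proper_coloring E c \<and> (\<forall>v\<in>{..<n}. c v \<in> L v)"
      proof (intro exI conjI ballI)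
        show "proper_coloring E (\<lambda>v. Suc (k v))" unfolding proper_coloring_def
        proof (intro allI impI notI)
          fix u v assume uv: "{u, v} \<in> E" "u \<noteq> v" "Suc (k u) = Suc (k v)"
          then have "u < n" "v < n" using G by (auto simp: simple_graph_def)
          with k[of u] k[of v] uv z show False unfolding colours_ok_def by auto
        qed
        show "Suc (k v) \<in> L v" if "v \<in> {..<n}" for v using k[of v] y that by auto
      qed
    qed
  }
qed

theorem choosability_in_Pi2p:
  "\<exists>A\<in>Pi2p. \<forall>x\<in>graph_problem P. x \<in> A \<longleftrightarrow> x \<in> CH 3 5"
proof -
  define A where "A = {x. \<forall>y. length y \<le> poly [:0, 5:] (length x) \<longrightarrow>
     (\<exists>z. length z \<le> poly [:0, 5:] (length x) \<and> pair x (pair y z) \<in> verifier)}"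
  have "A \<in> Pi2p" unfolding Pi2p_def A_def using verifier_classP by blast
  moreover have "x \<in> A \<longleftrightarrow> x \<in> CH 3 5" if px: "x \<in> graph_problem P" for x
  proof -
    obtain n E where x: "x = enc_graph n E" "simple_graph {..<n} E"
      using px unfolding graph_problem_def by blast
    have "x \<in> CH 3 5 \<longleftrightarrow> choosable 3 5 {..<n} E"
      unfolding graph_problem_def using x enc_graph_inj[OF _ _ x(2)] by blast
    also have "\<dots> \<longleftrightarrow> x \<in> A" using choosable_iff_verifier[OF x] by (simp add: A_def mult.commute)
    finally show ?thesis by simp
  qed
  ultimately show ?thesis by blast
qed

section \<open>Uniform quantified CNF formulas\<close>

text \<open>Literal \<open>2 * v\<close> is the variable \<open>v\<close>, literal \<open>2 * v + 1\<close> its negation. The variables in \<open>U\<close> are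
  universally quantified and precede the others.\<close>

definition qcnf :: "nat \<Rightarrow> nat \<Rightarrow> (nat \<Rightarrow> bool) \<Rightarrow> (nat \<Rightarrow> nat \<Rightarrow> bool) \<Rightarrow> bool" where
  "qcnf nv nc U Occ \<longleftrightarrow> (\<forall>\<sigma> :: nat \<Rightarrow> bool. \<exists>\<tau>. (\<forall>v<nv. U v \<longrightarrow> \<tau> v = \<sigma> v) \<and>
     (\<forall>c<nc. \<exists>l<2 * nv. Occ c l \<and> \<tau> (l div 2) = even l))"

type_synonym 'a ctx3 = "bool list \<Rightarrow> nat \<Rightarrow> nat \<Rightarrow> nat \<Rightarrow> 'a"
text \<open>A literal \<open>(p, l, a, b)\<close> refers to the variable with label \<open>l\<close>
  and indices \<open>a\<close> and \<open>b\<close>, computed from the input and the three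
  parameters of the clause; \<open>p\<close> is the truth value that makes it true.\<close>

type_synonym 'l lit = "bool \<times> 'l \<times> nat ctx3 \<times> nat ctx3"

definition PF3 :: "bool ctx3 \<Rightarrow> bool" where
  "PF3 G \<longleftrightarrow> PF (\<lambda>x e. G x (e 0) (e 1) (e 2))"

definition PT3 :: "nat ctx3 \<Rightarrow> bool" where
  "PT3 a \<longleftrightarrow> PT (\<lambda>x e. a x (e 0) (e 1) (e 2))"

definition clause_ok :: "('l \<Rightarrow> nat \<Rightarrow> nat \<Rightarrow> bool) \<Rightarrow> bool list \<Rightarrow> nat \<Rightarrow> nat \<Rightarrow> nat \<Rightarrow> 'l lit list \<Rightarrow> bool" where
  "clause_ok \<tau> x t i j ls \<longleftrightarrow> (\<exists>(p, l, a, b)\<in>set ls. \<tau> l (a x t i j) (b x t i j) = p)"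

lemma clause_ok_mono:
  assumes "clause_ok \<tau> x t i j ls"
    and "\<And>p l a b. (p, l, a, b) \<in> set ls \<Longrightarrow> \<tau>' l (a x t i j) (b x t i j) = \<tau> l (a x t i j) (b x t i j)"
  shows "clause_ok \<tau>' x t i j ls"
  using assms unfolding clause_ok_def by (auto intro!: bexI simp: case_prod_beta)

definition family_wf :: "(bool list \<Rightarrow> nat) \<Rightarrow> 'l list \<Rightarrow> bool ctx3 \<times> 'l lit list \<Rightarrow> bool" where
  "family_wf W lbs F \<longleftrightarrow> PF3 (fst F) \<and> (\<forall>(p, l, a, b)\<in>set (snd F). l \<in> set lbs \<and> PT3 a \<and> PT3 b \<and>
     (\<forall>x t i j. t < W x \<longrightarrow> i < W x \<longrightarrow> j < W x \<longrightarrow> fst F x t i j \<longrightarrow> a x t i j < W x \<and> b x t i j < W x))"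

lemma code3_less: "f < n \<Longrightarrow> i < m \<Longrightarrow> f * m + i < n * (m :: nat)"
proof -
  assume "f < n" "i < m"
  then have "f * m + i < Suc f * m" by simp
  also have "\<dots> \<le> n * m" using \<open>f < n\<close> by (intro mult_le_mono1) auto
  finally show ?thesis .
qed

lemma code_inj:
  assumes "a * W + b = c * W + d" "b < W" "d < (W :: nat)" shows "a = c \<and> b = d"
proof -
  have "(a * W + b) div W = a" "(a * W + b) mod W = b" "(c * W + d) div W = c" "(c * W + d) mod W = d"
    using assms(2,3) by auto
  then show ?thesis using assms(1) by metis
qed

text \<open>Variables (label, two indices) and clauses (family, three parameters) are numbered in
  base \<open>W x\<close>. Since there are finitely many labels and families, quantification over
  them is a finite disjunction, and universality and occurrence become definable in the
  numbers.\<close>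

theorem families_qcnf:
  fixes Fs :: "(bool ctx3 \<times> 'l lit list) list" and lbs :: "'l list" and UL :: "'l set"
  assumes wf: "\<And>F. F \<in> set Fs \<Longrightarrow> family_wf W lbs F"
    and W: "\<And>x. W x = poly pW (length x)" "\<And>x. 0 < W x" and lbs: "lbs \<noteq> []"
    and A: "\<And>x. x \<in> A \<longleftrightarrow> (\<forall>\<sigma> :: 'l \<Rightarrow> nat \<Rightarrow> nat \<Rightarrow> bool. \<exists>\<tau>. (\<forall>l\<in>UL. \<forall>a b. \<tau> l a b = \<sigma> l a b) \<and>
       (\<forall>(G, ls)\<in>set Fs. \<forall>t<W x. \<forall>i<W x. \<forall>j<W x. G x t i j \<longrightarrow> clause_ok \<tau> x t i j ls))"
  shows "\<exists>pv pc U Occ. PF (\<lambda>x e. U x (e 0)) \<and> PF (\<lambda>x e. Occ x (e 0) (e 1)) \<and>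
    (\<forall>x. x \<in> A \<longleftrightarrow> qcnf (poly pv (length x)) (poly pc (length x)) (U x) (Occ x))"
proof -
  define \<Lambda> nf where "\<Lambda> = length lbs" and "nf = length Fs"
  define ix where "ix l = (SOME n. n < \<Lambda> \<and> lbs ! n = l)" for l
  have ix: "ix l < \<Lambda>" "lbs ! ix l = l" if "l \<in> set lbs" for l
    using someI_ex[of "\<lambda>n. n < \<Lambda> \<and> lbs ! n = l"] that unfolding ix_def \<Lambda>_def in_set_conv_nth by blast+
  define pv pc where "pv = [:\<Lambda>:] * pW * pW" and "pc = [:nf:] * pW * pW * pW"
  have pv: "poly pv (length x) = \<Lambda> * W x * W x" and pc: "poly pc (length x) = nf * W x * W x * W x" for x
    by (simp_all add: pv_def pc_def W)
  have PTW: "PT (\<lambda>x e. W x)" unfolding W by (rule PT_poly)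
  define vcode where "vcode x l a b = (ix l * W x + a) * W x + b" for x l a b
  define U where "U x v \<longleftrightarrow> (\<exists>n\<in>set [0..<\<Lambda>]. lbs ! n \<in> UL \<and> v div W x div W x = n)" for x v
  \<comment> \<open>A clause number whose guard fails is filled with the literals 0 and 1, that is,
    a variable and its negation: the clause becomes a tautology and every number below the bound
    denotes a clause.\<close>
  define Occ where "Occ x c q \<longleftrightarrow> (\<exists>f\<in>set [0..<nf]. \<exists>t<W x. \<exists>i<W x. \<exists>j<W x.
     c = ((f * W x + t) * W x + i) * W x + j \<and>
     (fst (Fs ! f) x t i j \<and> (\<exists>L\<in>set (snd (Fs ! f)).
        q = 2 * vcode x (fst (snd L)) (fst (snd (snd L)) x t i j) (snd (snd (snd L)) x t i j) + (if fst L then 0 else 1))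
      \<or> \<not> fst (Fs ! f) x t i j \<and> q < 2))" for x c q
  have PU: "PF (\<lambda>x e. U x (e 0))"
    unfolding U_def by (intro PF_list_ex PF_intros PTW)
  have "PF (\<lambda>x e. Occ x (e 0) (e 1))"
    unfolding Occ_def vcode_def
  proof (intro PF_list_ex PF_ex PF_conj PF_disj PF_not PF_less PF_eq PT_plus PT_times PTW PT_var PT_const)
    fix f assume "f \<in> set [0..<nf]"
    then have F: "family_wf W lbs (Fs ! f)" using wf by (auto simp: nf_def)
    then have G: "PF (\<lambda>x e. fst (Fs ! f) x (e 0) (e 1) (e 2))" by (simp add: family_wf_def PF3_def)
    show G': "PF (\<lambda>x e. fst (Fs ! f) x (e (Suc (Suc 0))) (e (Suc 0)) (e 0))"
      using PF_ren[OF G, of "\<lambda>i. [2, 1, 0] ! i"] by (simp add: numeral_2_eq_2)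
    show "PF (\<lambda>x e. fst (Fs ! f) x (e (Suc (Suc 0))) (e (Suc 0)) (e 0))" by (rule G')
    fix L assume L: "L \<in> set (snd (Fs ! f))"
    then have a: "PT (\<lambda>x e. fst (snd (snd L)) x (e 0) (e 1) (e 2))" "PT (\<lambda>x e. snd (snd (snd L)) x (e 0) (e 1) (e 2))"
      using F by (auto simp: family_wf_def PT3_def case_prod_beta)
    show "PT (\<lambda>x e. fst (snd (snd L)) x (e (Suc (Suc 0))) (e (Suc 0)) (e 0))"
      "PT (\<lambda>x e. snd (snd (snd L)) x (e (Suc (Suc 0))) (e (Suc 0)) (e 0))"
      using PT_ren[OF a(1), of "\<lambda>i. [2, 1, 0] ! i"] PT_ren[OF a(2), of "\<lambda>i. [2, 1, 0] ! i"]
      by (simp_all add: numeral_2_eq_2)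
  qed
  moreover have "x \<in> A \<longleftrightarrow> qcnf (poly pv (length x)) (poly pc (length x)) (U x) (Occ x)" for x
  proof -
    let ?W = "W x"
    have W0: "0 < ?W" by (rule W)
    have vdec: "vcode x l a b mod ?W = b" "vcode x l a b div ?W mod ?W = a" "lbs ! (vcode x l a b div ?W div ?W) = l"
      "vcode x l a b div ?W div ?W < \<Lambda>" "vcode x l a b < \<Lambda> * ?W * ?W"
      if "l \<in> set lbs" "a < ?W" "b < ?W" for l a b
    proof -
      have 1: "vcode x l a b div ?W = ix l * ?W + a" "vcode x l a b mod ?W = b"
        using that by (auto simp: vcode_def)
      then show "vcode x l a b mod ?W = b" "vcode x l a b div ?W mod ?W = a" using that by auto
      have "vcode x l a b div ?W div ?W = ix l" unfolding 1(1) using that by auto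
      then show "lbs ! (vcode x l a b div ?W div ?W) = l" "vcode x l a b div ?W div ?W < \<Lambda>"
        using ix[OF that(1)] by auto
      show "vcode x l a b < \<Lambda> * ?W * ?W"
        unfolding vcode_def using ix[OF that(1)] that by (intro code3_less)
    qed
    define ok where "ok \<tau> \<longleftrightarrow> (\<forall>(G, ls)\<in>set Fs. \<forall>t<?W. \<forall>i<?W. \<forall>j<?W. G x t i j \<longrightarrow> clause_ok \<tau> x t i j ls)" for \<tau>
    define cnf where "cnf \<tau> \<longleftrightarrow> (\<forall>c<nf * ?W * ?W * ?W. \<exists>l<2 * (\<Lambda> * ?W * ?W). Occ x c l \<and> \<tau> (l div 2) = even l)" for \<tau> :: "nat \<Rightarrow> bool"
    have bounds: "l \<in> set lbs \<and> a x t i j < ?W \<and> b x t i j < ?W"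
      if "F \<in> set Fs" "(p, l, a, b) \<in> set (snd F)" "t < ?W" "i < ?W" "j < ?W" "fst F x t i j" for F p l a b t i j
      using bspec[OF conjunct2[OF wf[OF that(1), unfolded family_wf_def]] that(2)] that(3-) by simp
    have ok_cnf: "ok (\<lambda>l a b. \<tau> (vcode x l a b)) \<Longrightarrow> cnf \<tau>" for \<tau>
      unfolding cnf_def
    proof (intro allI impI)
      fix c assume ok: "ok (\<lambda>l a b. \<tau> (vcode x l a b))" and c: "c < nf * ?W * ?W * ?W"
      define f t i j where "f = c div ?W div ?W div ?W" and "t = c div ?W div ?W mod ?W" and "i = c div ?W mod ?W" and "j = c mod ?W"
      have tij: "t < ?W" "i < ?W" "j < ?W" using W0 by (auto simp: t_def i_def j_def)
      have cc: "c = ((f * ?W + t) * ?W + i) * ?W + j" by (simp add: f_def t_def i_def j_def)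
      have f: "f < nf" using c unfolding f_def by (intro less_mult_imp_div_less)
      have nf: "f \<in> set [0..<nf]" "Fs ! f \<in> set Fs" using f by (auto simp: nf_def)
      show "\<exists>l<2 * (\<Lambda> * ?W * ?W). Occ x c l \<and> \<tau> (l div 2) = even l"
      proof (cases "fst (Fs ! f) x t i j")
        case True
        then have "clause_ok (\<lambda>l a b. \<tau> (vcode x l a b)) x t i j (snd (Fs ! f))"
          using ok nf(2) tij unfolding ok_def by (auto simp: case_prod_beta)
        then obtain p l a b where L: "(p, l, a, b) \<in> set (snd (Fs ! f))" "\<tau> (vcode x l (a x t i j) (b x t i j)) = p"
          unfolding clause_ok_def by auto
        have "vcode x l (a x t i j) (b x t i j) < \<Lambda> * ?W * ?W"
          using bounds[OF nf(2) L(1) tij True] vdec(5) by blast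
        moreover have "Occ x c (2 * vcode x l (a x t i j) (b x t i j) + (if p then 0 else 1))"
          unfolding Occ_def
          by (rule bexI[OF _ nf(1)], intro exI[of _ t] exI[of _ i] exI[of _ j] conjI tij cc disjI1 True
              bexI[OF _ L(1)]) simp
        ultimately show ?thesis using L(2)
          by (intro exI[of _ "2 * vcode x l (a x t i j) (b x t i j) + (if p then 0 else 1)"]) auto
      next
        case False
        have "Occ x c q" if "q < 2" for q unfolding Occ_def using nf(1) tij cc False that by blast
        moreover have pos: "0 < \<Lambda> * ?W * ?W" using W0 lbs by (simp add: \<Lambda>_def)
        have "(if \<tau> 0 then 0 else 1) < 2 * (\<Lambda> * ?W * ?W)" using pos by (simp only: split: if_split) linarith
        ultimately show ?thesis by (intro exI[of _ "if \<tau> 0 then 0 else 1"]) auto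
      qed
    qed
    have cnf_ok: "cnf \<tau> \<Longrightarrow> ok (\<lambda>l a b. \<tau> (vcode x l a b))" for \<tau>
      unfolding ok_def
    proof (intro ballI, clarify)
      fix G ls t i j assume cnf: "cnf \<tau>" and F: "(G, ls) \<in> set Fs" and tij: "t < ?W" "i < ?W" "j < ?W" and G: "G x t i j"
      obtain f where f: "f < nf" "Fs ! f = (G, ls)" using F unfolding nf_def in_set_conv_nth by blast
      let ?c = "((f * ?W + t) * ?W + i) * ?W + j"
      have "?c < nf * ?W * ?W * ?W" by (intro code3_less f tij)
      then obtain q where q: "Occ x ?c q" "\<tau> (q div 2) = even q" using cnf unfolding cnf_def by blast
      from q(1) obtain f' t' i' j' where *: "t' < ?W" "i' < ?W" "j' < ?W" "?c = ((f' * ?W + t') * ?W + i') * ?W + j'"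
        and d: "fst (Fs ! f') x t' i' j' \<and> (\<exists>L\<in>set (snd (Fs ! f')).
        q = 2 * vcode x (fst (snd L)) (fst (snd (snd L)) x t' i' j') (snd (snd (snd L)) x t' i' j') + (if fst L then 0 else 1))
        \<or> \<not> fst (Fs ! f') x t' i' j' \<and> q < 2"
        unfolding Occ_def by blast
      from code_inj[OF *(4) tij(3) *(3)] have e: "j = j'" "(f * ?W + t) * ?W + i = (f' * ?W + t') * ?W + i'" by auto
      from code_inj[OF e(2) tij(2) *(2)] have e2: "i = i'" "f * ?W + t = f' * ?W + t'" by auto
      from code_inj[OF e2(2) tij(1) *(1)] have "f = f'" "t = t'" by auto
      then obtain L where L: "L \<in> set ls"
        "q = 2 * vcode x (fst (snd L)) (fst (snd (snd L)) x t i j) (snd (snd (snd L)) x t i j) + (if fst L then 0 else 1)"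
        using d G f(2) e(1) e2(1) by auto
      show "clause_ok (\<lambda>l a b. \<tau> (vcode x l a b)) x t i j ls"
        unfolding clause_ok_def by (rule bexI[OF _ L(1)]) (use L(2) q(2) in \<open>auto split: prod.splits if_splits\<close>)
    qed
    have "x \<in> A \<longleftrightarrow> (\<forall>\<sigma>. \<exists>\<tau>. (\<forall>l\<in>UL. \<forall>a b. \<tau> l a b = \<sigma> l a b) \<and> ok \<tau>)"
      unfolding A ok_def ..
    also have "\<dots> \<longleftrightarrow> (\<forall>\<sigma>. \<exists>\<tau>. (\<forall>v<\<Lambda> * ?W * ?W. U x v \<longrightarrow> \<tau> v = \<sigma> v) \<and> cnf \<tau>)" (is "?L \<longleftrightarrow> ?R")
    proof
      assume L: ?L
      show ?R
      proof
        fix \<sigma> :: "nat \<Rightarrow> bool"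
        obtain \<tau> where \<tau>: "\<forall>l\<in>UL. \<forall>a b. \<tau> l a b = \<sigma> (vcode x l a b)" "ok \<tau>"
          using L[rule_format, of "\<lambda>l a b. \<sigma> (vcode x l a b)"] by blast
        define \<tau>' where "\<tau>' v = (if U x v then \<sigma> v else \<tau> (lbs ! (v div ?W div ?W)) (v div ?W mod ?W) (v mod ?W))" for v
        have *: "\<tau>' (vcode x l a b) = \<tau> l a b" if "l \<in> set lbs" "a < ?W" "b < ?W" for l a b
          using vdec[OF that] \<tau>(1) by (auto simp: \<tau>'_def U_def)
        have "ok (\<lambda>l a b. \<tau>' (vcode x l a b))"
          unfolding ok_def
        proof (intro ballI, clarify)
          fix G ls t i j assume F: "(G, ls) \<in> set Fs" and tij: "t < ?W" "i < ?W" "j < ?W" and G: "G x t i j"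
          have "clause_ok \<tau> x t i j ls" using \<tau>(2) F tij G unfolding ok_def by auto
          then show "clause_ok (\<lambda>l a b. \<tau>' (vcode x l a b)) x t i j ls"
            by (rule clause_ok_mono) (use bounds[OF F _ tij] G * in auto)
        qed
        then show "\<exists>\<tau>. (\<forall>v<\<Lambda> * ?W * ?W. U x v \<longrightarrow> \<tau> v = \<sigma> v) \<and> cnf \<tau>"
          by (intro exI[of _ \<tau>'] conjI ok_cnf) (auto simp: \<tau>'_def)
      qed
    next
      assume R: ?R
      show ?L
      proof
        fix \<sigma> :: "'l \<Rightarrow> nat \<Rightarrow> nat \<Rightarrow> bool"
        obtain \<tau> where \<tau>: "\<forall>v<\<Lambda> * ?W * ?W. U x v \<longrightarrow> \<tau> v = \<sigma> (lbs ! (v div ?W div ?W)) (v div ?W mod ?W) (v mod ?W)" "cnf \<tau>"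
          using R[rule_format, of "\<lambda>v. \<sigma> (lbs ! (v div ?W div ?W)) (v div ?W mod ?W) (v mod ?W)"] by blast
        \<comment> \<open>On universal labels the assignment must agree with \<open>\<sigma>\<close>
          for all indices, also for those that have no code, so it cannot simply be pulled back
          along \<open>vcode\<close>.\<close>
        define \<tau>' where "\<tau>' l a b = (if l \<in> UL then \<sigma> l a b else \<tau> (vcode x l a b))" for l a b
        have *: "\<tau>' l a b = \<tau> (vcode x l a b)" if "l \<in> set lbs" "a < ?W" "b < ?W" for l a b
          using vdec[OF that] \<tau>(1) by (auto simp: \<tau>'_def U_def)
        have "ok \<tau>'"
          unfolding ok_def
        proof (intro ballI, clarify)
          fix G ls t i j assume F: "(G, ls) \<in> set Fs" and tij: "t < ?W" "i < ?W" "j < ?W" and G: "G x t i j"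
          have "clause_ok (\<lambda>l a b. \<tau> (vcode x l a b)) x t i j ls" using cnf_ok[OF \<tau>(2)] F tij G unfolding ok_def by auto
          then show "clause_ok \<tau>' x t i j ls"
            by (rule clause_ok_mono) (use bounds[OF F _ tij] G * in auto)
        qed
        then show "\<exists>\<tau>. (\<forall>l\<in>UL. \<forall>a b. \<tau> l a b = \<sigma> l a b) \<and> ok \<tau>"
          by (intro exI[of _ \<tau>'] conjI) (auto simp: \<tau>'_def)
      qed
    qed
    finally show ?thesis unfolding qcnf_def pv pc cnf_def .
  qed
  ultimately show ?thesis using PU by blast
qed

section \<open>The computation tableau\<close>

text \<open>Besides the tableau variables (state, cells, heads, scanned symbols) there are the universal variables
  \<open>Vflag\<close> and \<open>Vbit\<close>: the universal string has the bits \<open>Vbit\<close> up to the first false \<open>Vflag\<close>. \<open>Al i\<close> says that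
  all flags below \<open>i\<close> are true, \<open>En i\<close> that \<open>i\<close> is the length of this string. \<open>NHd\<close> says that the head is elsewhere.
  Tableau position \<open>i\<close> is tape cell \<open>i - T\<close>; the existential string is the unconstrained part of the initial tape.\<close>

datatype lab = St nat | Cell nat nat | Hd nat | NHd nat | Rd nat nat | Vflag | Vbit | Al | En

section \<open>Configurations along a machine run\<close>

definition conf :: "tm \<Rightarrow> bool list \<Rightarrow> nat \<Rightarrow> nat \<times> tape list" where
  "conf M w t = (step M ^^ t) (init_config M w)"

definition cstate :: "tm \<Rightarrow> bool list \<Rightarrow> nat \<Rightarrow> nat" where
  "cstate M w t = fst (conf M w t)"

definition ccell :: "tm \<Rightarrow> bool list \<Rightarrow> nat \<Rightarrow> nat \<Rightarrow> int \<Rightarrow> nat" where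
  "ccell M w t k = fst (snd (conf M w t) ! k)"

definition chead :: "tm \<Rightarrow> bool list \<Rightarrow> nat \<Rightarrow> nat \<Rightarrow> int" where
  "chead M w t k = snd (snd (conf M w t) ! k)"

definition cread :: "tm \<Rightarrow> bool list \<Rightarrow> nat \<Rightarrow> nat list" where
  "cread M w t = map (\<lambda>k. ccell M w t k (chead M w t k)) [0..<tapes M]"

lemma conf_Suc: "conf M w (Suc t) = step M (conf M w t)"
  by (simp add: conf_def)

lemma conf_halted:
  "cstate M w t = states M \<Longrightarrow> conf M w (Suc t) = conf M w t"
  unfolding conf_Suc cstate_def by (cases "conf M w t") simp

lemma conf_init:
  assumes "wf_tm M" shows "cstate M w 0 = 0" "length (snd (conf M w 0)) = tapes M"
    "k < tapes M \<Longrightarrow> ccell M w 0 k = (if k = 0 then string_contents w else (\<lambda>_. 0))"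
    "k < tapes M \<Longrightarrow> chead M w 0 k = 0"
  using assms by (auto simp: conf_def init_config_def cstate_def ccell_def chead_def wf_tm_def nth_Cons string_contents_Nil split: nat.splits)

lemma conf_running:
  assumes wf: "wf_tm M" and s: "cstate M w t < states M" and len: "length (snd (conf M w t)) = tapes M"
    and sym: "\<forall>k<tapes M. \<forall>i. ccell M w t k i < symbols M"
    and d: "delta M (cstate M w t) (cread M w t) = (s', as)"
  shows "cstate M w (Suc t) = s'" "s' \<le> states M" "length (snd (conf M w (Suc t))) = tapes M" "length as = tapes M"
    "k < tapes M \<Longrightarrow> ccell M w (Suc t) k = (ccell M w t k)(chead M w t k := fst (as ! k))"
    "k < tapes M \<Longrightarrow> chead M w (Suc t) k = move (snd (as ! k)) (chead M w t k)"
    "k < tapes M \<Longrightarrow> fst (as ! k) < symbols M"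
proof -
  obtain s tps where c: "conf M w t = (s, tps)" by (cases "conf M w t")
  have ys: "cread M w t = map (\<lambda>(t, i). t i) tps"
    using len by (auto simp: cread_def ccell_def chead_def c case_prod_beta intro!: nth_equalityI)
  have ylen: "length (cread M w t) = tapes M" by (simp add: cread_def)
  have "\<forall>y\<in>set (cread M w t). y < symbols M" using sym by (auto simp: cread_def)
  then have *: "s' \<le> states M \<and> length as = tapes M \<and> (\<forall>(y, d)\<in>set as. y < symbols M)"
    using wf s ylen d unfolding wf_tm_def by fastforce
  then show "s' \<le> states M" "length as = tapes M" by auto
  have c': "conf M w (Suc t) = (s', map2 act as tps)"
    using s d by (simp add: conf_Suc c cstate_def ys)
  then show "cstate M w (Suc t) = s'" "length (snd (conf M w (Suc t))) = tapes M"
    using * len c by (auto simp: cstate_def)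
  have k: "map2 act as tps ! k = act (as ! k) (tps ! k)" if "k < tapes M"
    using that * len c by simp
  have a: "act z tp = ((fst tp)(snd tp := fst z), move (snd z) (snd tp))" for z tp
    by (cases z; cases tp) simp
  show "k < tapes M \<Longrightarrow> ccell M w (Suc t) k = (ccell M w t k)(chead M w t k := fst (as ! k))"
    "k < tapes M \<Longrightarrow> chead M w (Suc t) k = move (snd (as ! k)) (chead M w t k)"
    by (simp_all only: ccell_def chead_def c' c k snd_conv) (simp_all add: a)
  show "k < tapes M \<Longrightarrow> fst (as ! k) < symbols M" using * by (auto simp: case_prod_beta)
qed

lemma conf_inv:
  assumes wf: "wf_tm M"
  shows "cstate M w t \<le> states M \<and> length (snd (conf M w t)) = tapes M \<and>
    (\<forall>k<tapes M. (\<forall>i. ccell M w t k i < symbols M) \<and> \<bar>chead M w t k\<bar> \<le> int t)"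
proof (induction t)
  case 0
  have "string_contents w i < symbols M" "0 < symbols M" for i
    using string_contents_less[of w i] wf by (auto simp: wf_tm_def)
  then show ?case using conf_init[OF wf] by (auto simp: fun_eq_iff)
next
  case (Suc t)
  show ?case
  proof (cases "cstate M w t = states M")
    case True
    then have e: "cstate M w (Suc t) = cstate M w t" "snd (conf M w (Suc t)) = snd (conf M w t)"
      "ccell M w (Suc t) = ccell M w t" "chead M w (Suc t) = chead M w t"
      using conf_halted[OF True] by (auto simp: cstate_def ccell_def chead_def)
    have "\<bar>chead M w t k\<bar> \<le> int (Suc t)" if "k < tapes M" for k using Suc.IH that by fastforce
    then show ?thesis using Suc.IH unfolding e by auto
  next
    case False
    obtain s' as where d: "delta M (cstate M w t) (cread M w t) = (s', as)" by (meson surj_pair)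
    note r = conf_running[OF wf _ _ _ d]
    have mv: "\<bar>move dd h\<bar> \<le> \<bar>h\<bar> + 1" for dd h by (cases dd) auto
    have "\<bar>chead M w (Suc t) k\<bar> \<le> int (Suc t)" if "k < tapes M" for k
    proof -
      have "\<bar>chead M w t k\<bar> \<le> int t" using Suc.IH that by blast
      then show ?thesis using r(6)[of k] mv[of "snd (as ! k)" "chead M w t k"] Suc.IH False that by auto
    qed
    moreover have "ccell M w (Suc t) k i < symbols M" if "k < tapes M" for k i
      using r(5)[of k] r(7)[of k] Suc.IH False that by auto
    ultimately show ?thesis using r(1,2,3) Suc.IH False by auto
  qed
qed

locale tableau =
  fixes M :: tm and p q :: "nat poly"
  assumes wf: "wf_tm M"
begin

definition m :: "bool list \<Rightarrow> nat" where "m x = poly p (length x)"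
definition ofs :: "bool list \<Rightarrow> nat" where "ofs x = 2 * length x + 1"
definition lmax :: "bool list \<Rightarrow> nat" where "lmax x = ofs x + (2 * m x + 1) + m x"
text \<open>The summand \<open>lmax x\<close> makes the window of \<open>W x\<close> cells contain
  the whole input besides all cells that the heads can reach; the 2 in \<open>W\<close> leaves room
  for the neighbours of every scanned cell.\<close>

definition T :: "bool list \<Rightarrow> nat" where "T x = poly q (lmax x) + lmax x"
definition W :: "bool list \<Rightarrow> nat" where "W x = 2 * T x + 2"

definition plm :: "nat poly" where "plm = [:2, 2:] + [:3:] * p"

lemma lmax_poly: "lmax x = poly plm (length x)"
  by (simp add: lmax_def plm_def ofs_def m_def)

lemma T_poly: "T x = poly (pcompose q plm + plm) (length x)"
  by (simp add: T_def poly_pcompose flip: lmax_poly)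

lemma W_poly: "W x = poly ([:2:] * (pcompose q plm + plm) + [:2:]) (length x)"
  by (simp add: W_def T_poly)

lemma PT_T: "PT (\<lambda>x e. T x)" unfolding T_poly by (rule PT_poly)
lemma PT_m: "PT (\<lambda>x e. m x)" unfolding m_def by (rule PT_poly)
lemma PT_W: "PT (\<lambda>x e. W x)" unfolding W_poly by (rule PT_poly)

lemma T_bound: "ofs x + 3 * m x + 1 \<le> T x"
  by (simp add: T_def lmax_def)

text \<open>The part of \<open>pair x v\<close> that depends on \<open>x\<close> alone: flags at
  even places, bits of \<open>x\<close> at odd ones. The strict bound makes the terminating bit at
  \<open>2 * length x\<close> false.\<close>

definition pre :: "bool list \<Rightarrow> nat \<Rightarrow> bool" where
  "pre x i \<longleftrightarrow> i < 2 * length x \<and> (even i \<or> bitat x (i div 2))"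

abbreviation (input) "z \<equiv> (\<lambda>x t i j. 0) :: nat ctx3"
abbreviation (input) "vt \<equiv> (\<lambda>x t i j. t) :: nat ctx3"
abbreviation (input) "vi \<equiv> (\<lambda>x t i j. i) :: nat ctx3"
abbreviation (input) "vj \<equiv> (\<lambda>x t i j. j) :: nat ctx3"
abbreviation (input) "st \<equiv> (\<lambda>x t i j. Suc t) :: nat ctx3"
abbreviation (input) "yp c \<equiv> (\<lambda>x t i j. T x + ofs x + 2 * i + c) :: nat ctx3"

definition input_fams :: "(bool ctx3 \<times> lab lit list) list" where
  "input_fams = [
    (\<lambda>x t i j. i < T x, [(True, Cell 0 0, z, vi)]),
    (\<lambda>x t i j. i < ofs x \<and> pre x i, [(True, Cell 0 2, z, \<lambda>x t i j. T x + i)]),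
    (\<lambda>x t i j. i < ofs x \<and> \<not> pre x i, [(True, Cell 0 1, z, \<lambda>x t i j. T x + i)]),
    (\<lambda>x t i j. True, [(True, Al, z, z)]),
    (\<lambda>x t i j. i < m x, [(False, Al, z, vi), (False, Vflag, z, vi), (True, Al, z, \<lambda>x t i j. Suc i)]),
    (\<lambda>x t i j. i < m x, [(False, Al, z, vi), (False, Vflag, z, vi), (True, Cell 0 2, z, yp 0)]),
    (\<lambda>x t i j. i < m x, [(False, Al, z, vi), (False, Vflag, z, vi), (False, Vbit, z, vi), (True, Cell 0 2, z, yp 1)]),
    (\<lambda>x t i j. i < m x, [(False, Al, z, vi), (False, Vflag, z, vi), (True, Vbit, z, vi), (True, Cell 0 1, z, yp 1)]),
    (\<lambda>x t i j. i < m x, [(False, Al, z, vi), (True, Vflag, z, vi), (True, En, z, vi)]),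
    (\<lambda>x t i j. i = m x, [(False, Al, z, vi), (True, En, z, vi)]),
    (\<lambda>x t i j. i \<le> m x, [(False, En, z, vi), (True, Cell 0 1, z, yp 0)]),
    (\<lambda>x t i j. i \<le> m x, [(False, En, z, vi), (True, Cell 0 0, z, \<lambda>x t i j. T x + ofs x + 2 * i + 1 + m x)]),
    (\<lambda>x t i j. i \<le> m x \<and> T x + ofs x + 2 * i < j,
      [(False, En, z, vi), (True, Cell 0 0, z, vj), (True, Cell 0 1, z, vj), (True, Cell 0 2, z, vj)]),
    (\<lambda>x t i j. i \<le> m x \<and> T x + ofs x + 2 * i < j \<and> Suc j < W x,
      [(False, En, z, vi), (False, Cell 0 0, z, vj), (True, Cell 0 0, z, \<lambda>x t i j. Suc j)])]"

definition tape_fams :: "nat \<Rightarrow> (bool ctx3 \<times> lab lit list) list" where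
  "tape_fams k = [
    (\<lambda>x t i j. True, [(True, Hd k, z, \<lambda>x t i j. T x)]),
    (\<lambda>x t i j. k \<noteq> 0, [(True, Cell k 0, z, vi)]),
    (\<lambda>x t i j. i \<noteq> j, [(False, Hd k, vt, vi), (True, NHd k, vt, vj)])]"

definition cell_fams :: "nat \<times> nat \<Rightarrow> (bool ctx3 \<times> lab lit list) list" where
  "cell_fams ka = (case ka of (k, a) \<Rightarrow> [
    (\<lambda>x t i j. True, [(False, Hd k, vt, vi), (False, Cell k a, vt, vi), (True, Rd k a, vt, z)]),
    (\<lambda>x t i j. t < T x, [(False, NHd k, vt, vi), (False, Cell k a, vt, vi), (True, Cell k a, st, vi)]),
    (\<lambda>x t i j. t < T x, [(False, St (states M), vt, z), (False, Cell k a, vt, vi), (True, Cell k a, st, vi)])])"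

definition mv :: "direction \<Rightarrow> nat \<Rightarrow> nat" where
  "mv d i = (case d of Lft \<Rightarrow> i - 1 | Stay \<Rightarrow> i | Rgt \<Rightarrow> Suc i)"

definition body :: "nat \<Rightarrow> nat list \<Rightarrow> lab lit list" where
  "body s ys = (False, St s, vt, z) # map (\<lambda>k. (False, Rd k (ys ! k), vt, z)) [0..<tapes M]"

definition trans_fams :: "nat \<times> nat list \<Rightarrow> (bool ctx3 \<times> lab lit list) list" where
  "trans_fams sy = (case sy of (s, ys) \<Rightarrow>
    (\<lambda>x t i j. t < T x, body s ys @ [(True, St (fst (delta M s ys)), st, z)]) #
    concat (map (\<lambda>k. let a = snd (delta M s ys) ! k in [
      (\<lambda>x t i j. t < T x, body s ys @ [(False, Hd k, vt, vi), (True, Cell k (fst a), st, vi)]),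
      (\<lambda>x t i j. t < T x \<and> 0 < i \<and> Suc i < W x,
        body s ys @ [(False, Hd k, vt, vi), (True, Hd k, st, \<lambda>x t i j. mv (snd a) i)])]) [0..<tapes M]))"

definition run_fams :: "(bool ctx3 \<times> lab lit list) list" where
  "run_fams = [
    (\<lambda>x t i j. True, [(True, St 0, z, z)]),
    (\<lambda>x t i j. t < T x, [(False, St (states M), vt, z), (True, St (states M), st, z)]),
    (\<lambda>x t i j. True, [(False, Cell (tapes M - 1) 1, \<lambda>x t i j. T x, \<lambda>x t i j. T x)])]"

definition fams :: "(bool ctx3 \<times> lab lit list) list" where
  "fams = input_fams @ run_fams @ concat (map tape_fams [0..<tapes M]) @
    concat (map cell_fams (List.product [0..<tapes M] [0..<symbols M])) @
    concat (map trans_fams (List.product [0..<states M] (List.n_lists (tapes M) [0..<symbols M])))"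

definition labs :: "lab list" where
  "labs = concat (map (\<lambda>F. map (\<lambda>L. fst (snd L)) (snd F)) fams)"

definition okf :: "(lab \<Rightarrow> nat \<Rightarrow> nat \<Rightarrow> bool) \<Rightarrow> bool list \<Rightarrow> bool ctx3 \<times> lab lit list \<Rightarrow> bool" where
  "okf \<tau> x F \<longleftrightarrow> (\<forall>t<W x. \<forall>i<W x. \<forall>j<W x. fst F x t i j \<longrightarrow> clause_ok \<tau> x t i j (snd F))"

definition fam_defn :: "bool ctx3 \<times> lab lit list \<Rightarrow> bool" where
  "fam_defn F \<longleftrightarrow> PF3 (fst F) \<and> (\<forall>(sg, l, a, b)\<in>set (snd F). PT3 a \<and> PT3 b \<and>
     (\<forall>x t i j. t < W x \<longrightarrow> i < W x \<longrightarrow> j < W x \<longrightarrow> fst F x t i j \<longrightarrow> a x t i j < W x \<and> b x t i j < W x))"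

lemma PT_mv: "PT s \<Longrightarrow> PT (\<lambda>x e. mv d (s x e))"
  by (cases d) (auto simp: mv_def intro!: PT_minus PT_Suc PT_const)

lemma PT_ofs: "PT (\<lambda>x e. ofs x)"
  unfolding ofs_def by (intro PF_intros)

lemma PF_pre: "PT s \<Longrightarrow> PF (\<lambda>x e. pre x (s x e))"
  unfolding pre_def by (intro PF_intros)

lemmas tab_intros = PF_pre PT_ofs PT_mv PT_T PT_m PT_W

lemma fam_defn_body: "(sg, l, a, b) \<in> set (body s ys) \<Longrightarrow> PT3 a \<and> PT3 b \<and>
     (\<forall>x t i j. t < W x \<longrightarrow> i < W x \<longrightarrow> j < W x \<longrightarrow> a x t i j < W x \<and> b x t i j < W x)"
  by (auto simp: body_def PT3_def intro!: PF_intros)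

lemma fam_defn_input: "F \<in> set input_fams \<Longrightarrow> fam_defn F"
proof -
  have l: "ofs x + 3 * m x + 1 \<le> T x" "W x = 2 * T x + 2" for x by (rule T_bound, rule W_def)
  have b: "T x + i < W x" if "i < ofs x" for x i using l[of x] that by linarith
  have c: "T x + ofs x + 2 * i < W x" "Suc (T x + ofs x + 2 * i) < W x" "T x + ofs x + 2 * i + m x < W x"
     "Suc (T x + ofs x + 2 * i + m x) < W x" if "i \<le> m x" for x i
    using l[of x] that by linarith+
  have d: "Suc i < W x" if "i < m x" for x i using l[of x] that by linarith
  show "F \<in> set input_fams \<Longrightarrow> fam_defn F"
    by (auto simp: input_fams_def fam_defn_def PF3_def PT3_def b c d intro!: PF_intros tab_intros)
qed

lemma fam_defn_rest:
  "F \<in> set run_fams \<Longrightarrow> fam_defn F" "F \<in> set (tape_fams k) \<Longrightarrow> fam_defn F" "F \<in> set (cell_fams ka) \<Longrightarrow> fam_defn F"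
  by (auto simp: run_fams_def tape_fams_def cell_fams_def fam_defn_def PF3_def PT3_def W_def
      intro!: PF_intros tab_intros split: prod.splits)

lemma W_bounds: "0 < W x" "t < T x \<Longrightarrow> Suc t < W x" "0 < i \<Longrightarrow> Suc i < W x \<Longrightarrow> mv d i < W x"
  by (auto simp: W_def mv_def split: direction.splits)

lemma fam_defn_trans: "F \<in> set (trans_fams sy) \<Longrightarrow> fam_defn F"
  using fam_defn_body
  by (auto simp: trans_fams_def fam_defn_def PF3_def PT3_def W_bounds Let_def
      intro!: PF_intros tab_intros split: prod.splits)

lemma fam_defn_all: "F \<in> set fams \<Longrightarrow> fam_defn F"
  using fam_defn_input fam_defn_rest fam_defn_trans unfolding fams_def set_append set_concat set_map by blast

lemma family_wf_all: assumes "F \<in> set fams" shows "family_wf W labs F"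
proof -
  have "l \<in> set labs" if "(sg, l, a, b) \<in> set (snd F)" for sg l a b
    unfolding labs_def using assms that by force
  then show ?thesis using fam_defn_all[OF assms] unfolding fam_defn_def family_wf_def by fastforce
qed

lemma sc_bitat: "string_contents w (int i) = (if bitat w i then 2 else if i < length w then 1 else 0)"
  by (auto simp: string_contents_def bitat_def)

lemma sc_pre: "i < ofs x \<Longrightarrow> string_contents (pair x v) (int i) = (if pre x i then 2 else 1)"
proof -
  assume i: "i < ofs x"
  have "bitat (pair x v) i = pre x i"
  proof (cases "i = 2 * length x")
    case True then show ?thesis using bitat_pair_end[of x v] by (simp add: pre_def)
  next
    case False
    then have l: "i < 2 * length x" using i by (simp add: ofs_def)
    show ?thesis
    proof (cases "even i")
      case True
      then show ?thesis using bitat_pair_flag[of "i div 2" x v] l by (auto simp: pre_def)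
    next
      case False
      then obtain j where "i = Suc (2 * j)" by (auto elim: oddE)
      then show ?thesis using bitat_pair_bit[of j x v] l by (auto simp: pre_def bitat_def)
    qed
  qed
  then show ?thesis using i by (simp add: sc_bitat length_pair ofs_def)
qed

lemma sc_snd: "string_contents (pair x v) (int (ofs x + i)) = string_contents v (int i)"
  using bitat_pair_snd[of x v i] unfolding sc_bitat ofs_def by (simp add: length_pair)

lemma sc_y:
  "l < length y \<Longrightarrow> string_contents (pair x (pair y v)) (int (ofs x + 2 * l)) = 2"
  "l < length y \<Longrightarrow> string_contents (pair x (pair y v)) (int (ofs x + 2 * l + 1)) = (if y ! l then 2 else 1)"
  "string_contents (pair x (pair y v)) (int (ofs x + 2 * length y)) = 1"
  "string_contents (pair x (pair y v)) (int (ofs x + 2 * length y + 1 + k)) = string_contents v (int k)"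
proof -
  show "l < length y \<Longrightarrow> string_contents (pair x (pair y v)) (int (ofs x + 2 * l)) = 2"
    using bitat_pair_flag[of l y v] unfolding sc_snd unfolding sc_bitat by simp
  show "l < length y \<Longrightarrow> string_contents (pair x (pair y v)) (int (ofs x + 2 * l + 1)) = (if y ! l then 2 else 1)"
    using bitat_pair_bit[of l y v] unfolding sc_snd add.assoc unfolding sc_bitat by (simp add: length_pair)
  show "string_contents (pair x (pair y v)) (int (ofs x + 2 * length y)) = 1"
    using bitat_pair_end[of y v] unfolding sc_snd unfolding sc_bitat by (simp add: length_pair)
  show "string_contents (pair x (pair y v)) (int (ofs x + 2 * length y + 1 + k)) = string_contents v (int k)"
    using bitat_pair_snd[of y v k] unfolding sc_snd add.assoc unfolding sc_bitat by (simp add: length_pair)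
qed

lemma body_true:
  assumes "clause_ok \<tau> x t i j (body s ys @ ls)" "\<tau> (St s) t 0" "\<And>k. k < tapes M \<Longrightarrow> \<tau> (Rd k (ys ! k)) t 0"
  shows "clause_ok \<tau> x t i j ls"
  using assms by (auto simp: clause_ok_def body_def)

lemma fams_sub:
  "set input_fams \<subseteq> set fams" "set run_fams \<subseteq> set fams" "k < tapes M \<Longrightarrow> set (tape_fams k) \<subseteq> set fams"
  "k < tapes M \<Longrightarrow> a < symbols M \<Longrightarrow> set (cell_fams (k, a)) \<subseteq> set fams"
  "s < states M \<Longrightarrow> length ys = tapes M \<Longrightarrow> \<forall>a\<in>set ys. a < symbols M \<Longrightarrow> set (trans_fams (s, ys)) \<subseteq> set fams"
proof -
  assume "s < states M" "length ys = tapes M" "\<forall>a\<in>set ys. a < symbols M"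
  then have "(s, ys) \<in> set (List.product [0..<states M] (List.n_lists (tapes M) [0..<symbols M]))"
    by (auto simp: set_n_lists)
  then show "set (trans_fams (s, ys)) \<subseteq> set fams" unfolding fams_def set_append set_concat set_map by blast
qed (auto simp: fams_def)

text \<open>No clause says that a cell holds only one symbol or that there is only one state. The
  clauses just propagate truth, so that the variables describing the actual run are all forced to be
  true. The last family of \<open>run_fams\<close> then excludes symbol 1, the answer False, from
  the output cell.\<close>

lemma tableau_sound:
  assumes H: "\<And>F. F \<in> set fams \<Longrightarrow> okf \<tau> x F" and y: "length y \<le> m x"
    and flag: "\<And>l. l < m x \<Longrightarrow> \<tau> Vflag 0 l = (l < length y)" and bit: "\<And>l. l < length y \<Longrightarrow> \<tau> Vbit 0 l = y ! l"
  shows "\<exists>z. length z \<le> m x \<and> ccell M (pair x (pair y z)) (T x) (tapes M - 1) 0 \<noteq> 1"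
proof -
  have C: "clause_ok \<tau> x t i j ls" if "(G, ls) \<in> set fams" "t < W x" "i < W x" "j < W x" "G x t i j" for G ls t i j
    using H[OF that(1)] that unfolding okf_def by auto
  have CI: "clause_ok \<tau> x 0 i j ls" if "(G, ls) \<in> set input_fams" "i < W x" "j < W x" "G x 0 i j" for G ls i j
    by (rule C[OF subsetD[OF fams_sub(1) that(1)]]) (use that W_bounds in auto)
  have CR: "clause_ok \<tau> x t 0 0 ls" if "(G, ls) \<in> set run_fams" "t < W x" "G x t 0 0" for G ls t
    by (rule C[OF subsetD[OF fams_sub(2) that(1)]]) (use that W_bounds in auto)
  have CT: "clause_ok \<tau> x t i j ls" if "(G, ls) \<in> set (tape_fams k)" "k < tapes M" "t < W x" "i < W x" "j < W x" "G x t i j" for G ls t i j k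
    by (rule C[OF subsetD[OF fams_sub(3) that(1)]]) (use that W_bounds in auto)
  have CC: "clause_ok \<tau> x t i 0 ls" if "(G, ls) \<in> set (cell_fams (k, a))" "k < tapes M" "a < symbols M" "t < W x" "i < W x" "G x t i 0" for G ls t i k a
    by (rule C[OF subsetD[OF fams_sub(4) that(1)]]) (use that W_bounds in auto)
  have CS: "clause_ok \<tau> x t i 0 ls" if "(G, ls) \<in> set (trans_fams (s, ys))" "s < states M" "length ys = tapes M" "\<forall>a\<in>set ys. a < symbols M"
      "t < W x" "i < W x" "G x t i 0" for G ls t i s ys
    by (rule C[OF subsetD[OF fams_sub(5) that(1)]]) (use that W_bounds in auto)
  have l: "ofs x + 3 * m x + 1 \<le> T x" "W x = 2 * T x + 2" by (rule T_bound, rule W_def)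
  have W0: "0 < W x" by (rule W_bounds)
  let ?o = "T x + ofs x" and ?n = "length y"
  have K: "0 < tapes M" "2 < symbols M" using wf by (auto simp: wf_tm_def)
  have al: "\<tau> Al 0 i" if "i \<le> ?n" for i
    using that
  proof (induction i)
    case 0 show ?case using CI[of "\<lambda>x t i j. True" "[(True, Al, z, z)]" 0 0] W0
      by (simp add: input_fams_def clause_ok_def)
  next
    case (Suc i)
    have "i < m x" "i < W x" using Suc.prems y l by auto
    then show ?case using CI[of "\<lambda>x t i j. i < m x" "[(False, Al, z, vi), (False, Vflag, z, vi), (True, Al, z, \<lambda>x t i j. Suc i)]" i 0]
      W0 flag[of i] Suc by (simp add: input_fams_def clause_ok_def)
  qed
  have y0: "\<tau> (Cell 0 2) 0 (?o + 2 * i)" if "i < ?n" for i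
    using CI[of "\<lambda>x t i j. i < m x" "[(False, Al, z, vi), (False, Vflag, z, vi), (True, Cell 0 2, z, yp 0)]" i 0]
      W0 flag[of i] al[of i] that y l by (simp add: input_fams_def clause_ok_def)
  have y1: "\<tau> (Cell 0 (if y ! i then 2 else 1)) 0 (?o + 2 * i + 1)" if "i < ?n" for i
    using CI[of "\<lambda>x t i j. i < m x" "[(False, Al, z, vi), (False, Vflag, z, vi), (False, Vbit, z, vi), (True, Cell 0 2, z, yp 1)]" i 0]
      CI[of "\<lambda>x t i j. i < m x" "[(False, Al, z, vi), (False, Vflag, z, vi), (True, Vbit, z, vi), (True, Cell 0 1, z, yp 1)]" i 0]
      W0 flag[of i] al[of i] bit[of i] that y l by (cases "y ! i") (simp_all add: input_fams_def clause_ok_def)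
  have en: "\<tau> En 0 ?n"
  proof (cases "?n = m x")
    case True
    then show ?thesis using CI[of "\<lambda>x t i j. i = m x" "[(False, Al, z, vi), (True, En, z, vi)]" ?n 0] W0 al[of ?n] l
      by (simp add: input_fams_def clause_ok_def)
  next
    case False
    then show ?thesis using CI[of "\<lambda>x t i j. i < m x" "[(False, Al, z, vi), (True, Vflag, z, vi), (True, En, z, vi)]" ?n 0]
      W0 al[of ?n] flag[of ?n] y l by (simp add: input_fams_def clause_ok_def)
  qed
  have nW: "?n < W x" using y l by simp
  have e1: "\<tau> (Cell 0 1) 0 (?o + 2 * ?n)"
    using CI[of "\<lambda>x t i j. i \<le> m x" "[(False, En, z, vi), (True, Cell 0 1, z, yp 0)]" ?n 0] W0 en y nW
    by (simp add: input_fams_def clause_ok_def)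
  let ?b = "?o + 2 * ?n + 1"
  have e2: "\<tau> (Cell 0 0) 0 (?b + m x)"
    using CI[of "\<lambda>x t i j. i \<le> m x" "[(False, En, z, vi), (True, Cell 0 0, z, \<lambda>x t i j. T x + ofs x + 2 * i + 1 + m x)]" ?n 0] W0 en y nW
    by (simp add: input_fams_def clause_ok_def)
  have zc: "\<tau> (Cell 0 0) 0 (?b + k) \<or> \<tau> (Cell 0 1) 0 (?b + k) \<or> \<tau> (Cell 0 2) 0 (?b + k)" if "?b + k < W x" for k
    using CI[of "\<lambda>x t i j. i \<le> m x \<and> T x + ofs x + 2 * i < j"
        "[(False, En, z, vi), (True, Cell 0 0, z, vj), (True, Cell 0 1, z, vj), (True, Cell 0 2, z, vj)]" ?n "?b + k"] en y nW that
    by (simp add: input_fams_def clause_ok_def)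
  have zs: "\<tau> (Cell 0 0) 0 (?b + Suc k)" if "?b + Suc k < W x" "\<tau> (Cell 0 0) 0 (?b + k)" for k
    using CI[of "\<lambda>x t i j. i \<le> m x \<and> T x + ofs x + 2 * i < j \<and> Suc j < W x"
        "[(False, En, z, vi), (False, Cell 0 0, z, vj), (True, Cell 0 0, z, \<lambda>x t i j. Suc j)]" ?n "?b + k"] en y nW that
    by (simp add: input_fams_def clause_ok_def)
  \<comment> \<open>The length of the existential string: its cells are those before the first
    blank, which comes after at most \<open>m x\<close> cells by \<open>e2\<close>; blanks propagate
    to the right of it.\<close>
  define r where "r = (LEAST r. \<tau> (Cell 0 0) 0 (?b + r))"
  have r: "\<tau> (Cell 0 0) 0 (?b + r)" "r \<le> m x" "\<And>k. k < r \<Longrightarrow> \<not> \<tau> (Cell 0 0) 0 (?b + k)"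
    unfolding r_def by (rule LeastI[of "\<lambda>r. \<tau> (Cell 0 0) 0 (?b + r)", OF e2], rule Least_le[of "\<lambda>r. \<tau> (Cell 0 0) 0 (?b + r)", OF e2])
      (rule not_less_Least[of _ "\<lambda>r. \<tau> (Cell 0 0) 0 (?b + r)"])
  have rr: "\<tau> (Cell 0 0) 0 (?b + (r + k))" if "?b + (r + k) < W x" for k
    using that
  proof (induction k)
    case (Suc k) then show ?case using zs[of "r + k"] by simp
  qed (use r in simp)
  define zz where "zz = map (\<lambda>i. \<tau> (Cell 0 2) 0 (?b + i)) [0..<r]"
  define w where "w = pair x (pair y zz)"
  have inp: "\<tau> (Cell 0 (string_contents w (int P - int (T x)))) 0 P" if P: "P < W x" for P
  proof -
    consider "P < T x" | i where "P = T x + i" "i < ofs x" | l where "P = ?o + 2 * l" "l < ?n"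
      | l where "P = ?o + 2 * l + 1" "l < ?n" | "P = ?o + 2 * ?n" | k where "P = ?b + k"
    proof -
      consider "P < T x" | i where "P = T x + i" "i < ofs x" | i where "P = ?o + i" "i < 2 * ?n" | "P = ?o + 2 * ?n" | k where "P = ?b + k"
      proof -
        have "P < T x \<or> (\<exists>i. P = T x + i \<and> i < ofs x) \<or> (\<exists>i. P = ?o + i \<and> i < 2 * ?n) \<or> P = ?o + 2 * ?n \<or> (\<exists>k. P = ?b + k)"
          by presburger
        then show thesis using that by blast
      qed
      then show thesis
      proof cases
        case (3 i)
        have "i = 2 * (i div 2) \<or> i = 2 * (i div 2) + 1" by presburger
        moreover have "i div 2 < ?n" using 3 by simp
        ultimately show thesis using that(3)[of "i div 2"] that(4)[of "i div 2"] 3(1) by (metis add.assoc)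
      qed (use that in blast)+
    qed
    then show ?thesis
    proof cases
      case 1
      then have "string_contents w (int P - int (T x)) = 0" by (simp add: string_contents_def)
      then show ?thesis using CI[of "\<lambda>x t i j. i < T x" "[(True, Cell 0 0, z, vi)]" P 0] 1 P W0
        by (simp add: input_fams_def clause_ok_def)
    next
      case (2 i)
      have "int P - int (T x) = int i" using 2 by simp
      then show ?thesis
        using 2 P W0 sc_pre[OF 2(2), of "pair y zz"]
          CI[of "\<lambda>x t i j. i < ofs x \<and> pre x i" "[(True, Cell 0 2, z, \<lambda>x t i j. T x + i)]" i 0]
          CI[of "\<lambda>x t i j. i < ofs x \<and> \<not> pre x i" "[(True, Cell 0 1, z, \<lambda>x t i j. T x + i)]" i 0]
        by (simp add: input_fams_def clause_ok_def w_def)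
    next
      case (3 l)
      have "int P - int (T x) = int (ofs x + 2 * l)" using 3 by simp
      then show ?thesis using sc_y(1)[OF 3(2), of x zz] y0[OF 3(2)] 3 by (simp add: w_def)
    next
      case (4 l)
      have "int P - int (T x) = int (ofs x + 2 * l + 1)" using 4 by simp
      then show ?thesis using sc_y(2)[OF 4(2), of x zz] y1[OF 4(2)] 4(1) by (simp only: w_def)
    next
      case 5
      have "int P - int (T x) = int (ofs x + 2 * ?n)" using 5 by simp
      then show ?thesis using sc_y(3)[of x y zz] e1 5 by (simp only: w_def)
    next
      case (6 k)
      have "int P - int (T x) = int (ofs x + 2 * ?n + 1 + k)" using 6 by simp
      then have e: "string_contents w (int P - int (T x)) = string_contents zz (int k)"
        unfolding w_def by (simp only: sc_y(4))
      show ?thesis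
      proof (cases "k < r")
        case True
        then show ?thesis unfolding e using r(3)[OF True] zc[of k] P 6 by (auto simp: string_contents_def zz_def)
      next
        case False
        then show ?thesis unfolding e using rr[of "k - r"] P 6 by (simp add: string_contents_def zz_def)
      qed
    qed
  qed
  note inv = conf_inv[OF wf, of w]
  \<comment> \<open>Heads are tracked only while the machine runs; in the halting state the cells
    are copied without reference to them.\<close>
  have main: "t \<le> T x \<Longrightarrow> \<tau> (St (cstate M w t)) t 0 \<and> (\<forall>k<tapes M. \<forall>P<W x. \<tau> (Cell k (ccell M w t k (int P - int (T x)))) t P) \<and>
     (cstate M w t < states M \<longrightarrow> (\<forall>k<tapes M. \<tau> (Hd k) t (nat (chead M w t k + int (T x)))))" for t
  proof (induction t)
    case 0
    have "\<tau> (St 0) 0 0" using CR[of "\<lambda>x t i j. True" "[(True, St 0, z, z)]" 0] W0 by (simp add: run_fams_def clause_ok_def)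
    moreover have "\<tau> (Hd k) 0 (T x)" if "k < tapes M" for k
      using CT[of "\<lambda>x t i j. True" "[(True, Hd k, z, \<lambda>x t i j. T x)]" k 0 0 0] W0 that by (simp add: tape_fams_def clause_ok_def)
    moreover have "\<tau> (Cell k 0) 0 P" if "k < tapes M" "k \<noteq> 0" "P < W x" for k P
      using CT[of "\<lambda>x t i j. k \<noteq> 0" "[(True, Cell k 0, z, vi)]" k 0 P 0] W0 that by (simp add: tape_fams_def clause_ok_def)
    ultimately show ?case using conf_init[OF wf, where w = w] inp by (auto simp: fun_eq_iff)
  next
    case (Suc t)
    then have t: "t < T x" "t < W x" "Suc t < W x" using l by auto
    have IH: "\<tau> (St (cstate M w t)) t 0" "\<And>k P. k < tapes M \<Longrightarrow> P < W x \<Longrightarrow> \<tau> (Cell k (ccell M w t k (int P - int (T x)))) t P"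
      "\<And>k. cstate M w t < states M \<Longrightarrow> k < tapes M \<Longrightarrow> \<tau> (Hd k) t (nat (chead M w t k + int (T x)))"
      using Suc by auto
    have sym: "\<And>k i. k < tapes M \<Longrightarrow> ccell M w t k i < symbols M" using inv[of t] by blast
    show ?case
    proof (cases "cstate M w t = states M")
      case True
      have "conf M w (Suc t) = conf M w t" using conf_halted[OF True] .
      then have e: "cstate M w (Suc t) = states M" "ccell M w (Suc t) = ccell M w t"
        using True by (auto simp: cstate_def ccell_def)
      have "\<tau> (St (states M)) (Suc t) 0"
        using CR[of "\<lambda>x t i j. t < T x" "[(False, St (states M), vt, z), (True, St (states M), st, z)]" t] t IH(1) True
        by (simp add: run_fams_def clause_ok_def)
      moreover have "\<tau> (Cell k (ccell M w t k (int P - int (T x)))) (Suc t) P" if "k < tapes M" "P < W x" for k P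
        using CC[of "\<lambda>x t i j. t < T x" "[(False, St (states M), vt, z), (False, Cell k (ccell M w t k (int P - int (T x))), vt, vi),
           (True, Cell k (ccell M w t k (int P - int (T x))), st, vi)]" k "ccell M w t k (int P - int (T x))" t P]
          t IH(1) IH(2)[OF that] sym that True by (simp add: cell_fams_def clause_ok_def)
      ultimately show ?thesis unfolding e by auto
    next
      case False
      then have s: "cstate M w t < states M" using inv[of t] by simp
      let ?s = "cstate M w t" and ?ys = "cread M w t"
      obtain s' as where d: "delta M ?s ?ys = (s', as)" by (meson surj_pair)
      have len: "length (snd (conf M w t)) = tapes M" using inv by blast
      have "\<forall>k<tapes M. \<forall>i. ccell M w t k i < symbols M" using sym by blast
      note run = conf_running[OF wf s len this d]
      define hp where "hp k = nat (chead M w t k + int (T x))" for k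
      have hp: "int (hp k) = chead M w t k + int (T x)" "0 < hp k" "Suc (hp k) < W x" if "k < tapes M" for k
      proof -
        have "\<bar>chead M w t k\<bar> \<le> int t" using inv[of t] that by blast
        then show "int (hp k) = chead M w t k + int (T x)" "0 < hp k" "Suc (hp k) < W x"
          using t l(2) by (auto simp: hp_def)
      qed
      have ys: "length ?ys = tapes M" "\<forall>a\<in>set ?ys. a < symbols M" using sym by (auto simp: cread_def)
      have rd: "\<tau> (Rd k (?ys ! k)) t 0" if k: "k < tapes M" for k
      proof -
        have y: "?ys ! k = ccell M w t k (int (hp k) - int (T x))" using k hp(1)[OF k] by (simp add: cread_def)
        have "hp k < W x" using hp(3)[OF k] by simp
        then show ?thesis
          using CC[of "\<lambda>x t i j. True" "[(False, Hd k, vt, vi), (False, Cell k (?ys ! k), vt, vi), (True, Rd k (?ys ! k), vt, z)]" k "?ys ! k" t "hp k"]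
            IH(2)[of k "hp k"] IH(3)[OF s k] sym[OF k] k t unfolding y hp_def[symmetric] by (simp add: cell_fams_def clause_ok_def)
      qed
      have "\<tau> (St s') (Suc t) 0"
        using body_true[OF CS[of "\<lambda>x t i j. t < T x" "body ?s ?ys @ [(True, St s', st, z)]" ?s ?ys t 0, OF _ s ys]] IH(1) rd t W0 d
        by (simp add: trans_fams_def clause_ok_def)
      moreover have "\<tau> (Hd k) (Suc t) (nat (chead M w (Suc t) k + int (T x)))" if k: "k < tapes M" for k
      proof -
        have "mv (snd (as ! k)) (hp k) = nat (chead M w (Suc t) k + int (T x))"
          using hp[OF k] unfolding run(6)[OF k] mv_def by (cases "snd (as ! k)") auto
        moreover have "clause_ok \<tau> x t (hp k) 0 [(False, Hd k, vt, vi), (True, Hd k, st, \<lambda>x t i j. mv (snd (as ! k)) i)]"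
        proof (rule body_true[of _ _ _ _ _ ?s ?ys], rule CS[of "\<lambda>x t i j. t < T x \<and> 0 < i \<and> Suc i < W x" _ ?s ?ys, OF _ s ys])
          show "(\<lambda>x t i j. t < T x \<and> 0 < i \<and> Suc i < W x, body ?s ?ys @ [(False, Hd k, vt, vi), (True, Hd k, st, \<lambda>x t i j. mv (snd (as ! k)) i)])
            \<in> set (trans_fams (?s, ?ys))"
            unfolding trans_fams_def using k d by (auto simp: Let_def)
        qed (use t hp[OF k] IH(1) rd in auto)
        ultimately show ?thesis using IH(3)[OF s k] by (simp add: clause_ok_def hp_def)
      qed
      moreover have "\<tau> (Cell k (ccell M w (Suc t) k (int P - int (T x)))) (Suc t) P" if k: "k < tapes M" and P: "P < W x" for k P
      proof (cases "P = hp k")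
        case True
        have "clause_ok \<tau> x t P 0 [(False, Hd k, vt, vi), (True, Cell k (fst (as ! k)), st, vi)]"
        proof (rule body_true[of _ _ _ _ _ ?s ?ys], rule CS[of "\<lambda>x t i j. t < T x" _ ?s ?ys, OF _ s ys])
          show "(\<lambda>x t i j. t < T x, body ?s ?ys @ [(False, Hd k, vt, vi), (True, Cell k (fst (as ! k)), st, vi)])
            \<in> set (trans_fams (?s, ?ys))"
            unfolding trans_fams_def using k d by (auto simp: Let_def)
        qed (use t P IH(1) rd in auto)
        then show ?thesis using IH(3)[OF s k] True hp(1)[OF k] unfolding run(5)[OF k] by (simp add: clause_ok_def hp_def)
      next
        case False
        have "hp k < W x" using hp(3)[OF k] by simp
        then have "\<tau> (NHd k) t P"
          using CT[of "\<lambda>x t i j. i \<noteq> j" "[(False, Hd k, vt, vi), (True, NHd k, vt, vj)]" k t "hp k" P] k P False t IH(3)[OF s k]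
          by (simp add: tape_fams_def clause_ok_def hp_def)
        moreover have "ccell M w (Suc t) k (int P - int (T x)) = ccell M w t k (int P - int (T x))"
          using False hp(1)[OF k] unfolding run(5)[OF k] by auto
        ultimately show ?thesis
          using CC[of "\<lambda>x t i j. t < T x" "[(False, NHd k, vt, vi), (False, Cell k (ccell M w t k (int P - int (T x))), vt, vi),
             (True, Cell k (ccell M w t k (int P - int (T x))), st, vi)]" k "ccell M w t k (int P - int (T x))" t P]
            t IH(2)[OF k P] sym k P by (simp add: cell_fams_def clause_ok_def)
      qed
      ultimately show ?thesis unfolding run(1) by blast
    qed
  qed
  have "T x < W x" using l by simp
  then have "\<not> \<tau> (Cell (tapes M - 1) 1) (T x) (T x)"
    using CR[of "\<lambda>x t i j. True" "[(False, Cell (tapes M - 1) 1, \<lambda>x t i j. T x, \<lambda>x t i j. T x)]" 0] W0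
    by (simp add: run_fams_def clause_ok_def)
  moreover have "\<tau> (Cell (tapes M - 1) (ccell M w (T x) (tapes M - 1) (int (T x) - int (T x)))) (T x) (T x)"
    using main[of "T x"] K \<open>T x < W x\<close> by (metis diff_less zero_less_one order_refl)
  ultimately have "ccell M w (T x) (tapes M - 1) 0 \<noteq> 1" by auto
  then show ?thesis using r(2) unfolding w_def by (intro exI[of _ zz]) (simp add: zz_def)
qed

end

context tableau
begin

text \<open>The assignment is read off from the run on \<open>w\<close>. Universal flags after the
  first false one may be arbitrary: beyond \<open>length y\<close> both \<open>Al\<close> and
  \<open>En\<close> are false, so every clause mentioning them holds.\<close>

lemma tableau_complete:
  assumes y: "length y \<le> m x" and zz: "length zz \<le> m x" and w: "w = pair x (pair y zz)"
    and acc: "ccell M w (T x) (tapes M - 1) 0 \<noteq> 1"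
    and flag: "\<And>i. i < length y \<Longrightarrow> \<sigma> Vflag 0 i" "length y < m x \<Longrightarrow> \<not> \<sigma> Vflag 0 (length y)"
    and bit: "\<And>i. i < length y \<Longrightarrow> \<sigma> Vbit 0 i = y ! i"
  shows "\<exists>\<tau>. (\<forall>l\<in>{Vflag, Vbit}. \<forall>a b. \<tau> l a b = \<sigma> l a b) \<and> (\<forall>F\<in>set fams. okf \<tau> x F)"
proof -
  define \<tau> where "\<tau> l a b = (case l of St s \<Rightarrow> cstate M w a = s
    | Cell k c \<Rightarrow> ccell M w a k (int b - int (T x)) = c | Hd k \<Rightarrow> chead M w a k = int b - int (T x)
    | NHd k \<Rightarrow> chead M w a k \<noteq> int b - int (T x) | Rd k c \<Rightarrow> ccell M w a k (chead M w a k) = c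
    | Vflag \<Rightarrow> \<sigma> Vflag a b | Vbit \<Rightarrow> \<sigma> Vbit a b | Al \<Rightarrow> b \<le> length y | En \<Rightarrow> b = length y)" for l a b
  have ts: "\<tau> (St s) a b = (cstate M w a = s)" "\<tau> (Cell k c) a b = (ccell M w a k (int b - int (T x)) = c)"
    "\<tau> (Hd k) a b = (chead M w a k = int b - int (T x))" "\<tau> (NHd k) a b = (chead M w a k \<noteq> int b - int (T x))"
    "\<tau> (Rd k c) a b = (ccell M w a k (chead M w a k) = c)" "\<tau> Vflag a b = \<sigma> Vflag a b" "\<tau> Vbit a b = \<sigma> Vbit a b"
    "\<tau> Al a b = (b \<le> length y)" "\<tau> En a b = (b = length y)" for s k c a b
    by (simp_all add: \<tau>_def)
  have K: "0 < tapes M" using wf by (auto simp: wf_tm_def)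
  have c0: "ccell M w 0 0 = string_contents w" using conf_init(3)[OF wf K, of w] by simp
  have neg: "string_contents w (int i - int (T x)) = 0" if "i < T x" for i
    using that by (simp add: string_contents_def)
  have sc: "string_contents w (int (T x + i) - int (T x)) = string_contents w (int i)" for i by simp
  note cw = sc_y[where x = x and y = y and v = zz, folded w]
  have in0: "okf \<tau> x F" if "F \<in> set input_fams" for F
  proof -
    have pre: "string_contents w (int (T x + i) - int (T x)) = (if pre x i then 2 else 1)" if "i < ofs x" for i
      unfolding sc unfolding w using that by (rule sc_pre)
    have y0: "string_contents w (int (T x + ofs x + 2 * i + 0) - int (T x)) = 2" if "i < length y" for i
      using cw(1)[OF that] sc[of "ofs x + 2 * i"] by (simp only: add.assoc add_0_right)
    have y1: "string_contents w (int (T x + ofs x + 2 * i + 1) - int (T x)) = (if y ! i then 2 else 1)" if "i < length y" for i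
      using cw(2)[OF that] sc[of "ofs x + 2 * i + 1"] by (simp only: add.assoc)
    have y2: "string_contents w (int (T x + ofs x + 2 * length y + 0) - int (T x)) = 1"
      using cw(3) sc[of "ofs x + 2 * length y"] by (simp only: add.assoc add_0_right)
    have y3: "string_contents w (int (T x + ofs x + 2 * length y + 1 + k) - int (T x)) = string_contents zz (int k)" for k
      using cw(4)[of k] sc[of "ofs x + 2 * length y + 1 + k"] by (simp only: add.assoc)
    have y4: "string_contents w (int j - int (T x)) = string_contents zz (int (j - (T x + ofs x + 2 * length y + 1)))"
      if "T x + ofs x + 2 * length y < j" for j
    proof -
      have "T x + ofs x + 2 * length y + 1 + (j - (T x + ofs x + 2 * length y + 1)) = j" using that by simp
      then show ?thesis using y3[of "j - (T x + ofs x + 2 * length y + 1)"] by (simp only:)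
    qed
    have z0: "string_contents zz (int (m x)) = 0" using zz by (simp add: string_contents_def)
    have z1: "string_contents zz (int k) = 0 \<Longrightarrow> string_contents zz (int (Suc k)) = 0" for k
      by (auto simp: string_contents_def split: if_splits)
    have z2: "string_contents zz k = 0 \<or> string_contents zz k = 1 \<or> string_contents zz k = 2" for k
      by (auto simp: string_contents_def)
    have "length input_fams = 14" by (simp add: input_fams_def)
    then obtain n where F: "n < 14" "F = input_fams ! n" using \<open>F \<in> set input_fams\<close> by (metis in_set_conv_nth)
    have fl: "i < length y \<longleftrightarrow> i \<le> length y \<and> i < m x \<and> \<sigma> Vflag 0 i" for i
      using flag(1)[of i] flag(2) y by (cases "i = length y") auto
    have c: "clause_ok \<tau> x t i j (snd F)" if G: "fst F x t i j" "t < W x" "i < W x" "j < W x" for t i j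
    proof -
      consider "F = input_fams ! 0" | "F = input_fams ! 1" | "F = input_fams ! 2" | "F = input_fams ! 3" | "F = input_fams ! 4"
        | "F = input_fams ! 5" | "F = input_fams ! 6" | "F = input_fams ! 7" | "F = input_fams ! 8" | "F = input_fams ! 9"
        | "F = input_fams ! 10" | "F = input_fams ! 11" | "F = input_fams ! 12" | "F = input_fams ! 13"
      proof -
        have "n = 0 \<or> n = 1 \<or> n = 2 \<or> n = 3 \<or> n = 4 \<or> n = 5 \<or> n = 6 \<or> n = 7 \<or> n = 8 \<or> n = 9 \<or> n = 10
          \<or> n = 11 \<or> n = 12 \<or> n = 13" using F(1) by presburger
        then show thesis using that F(2) by (elim disjE) auto
      qed
      then show ?thesis
      proof cases
        case 1 then show ?thesis using G neg by (simp add: input_fams_def clause_ok_def ts c0)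
      next
        case 2 then show ?thesis using G pre[of i] by (simp add: input_fams_def clause_ok_def ts c0)
      next
        case 3 then show ?thesis using G pre[of i] by (simp add: input_fams_def clause_ok_def ts c0)
      next
        case 4 then show ?thesis by (simp add: input_fams_def clause_ok_def ts)
      next
        case 5 then show ?thesis using G fl[of i] by (auto simp add: input_fams_def clause_ok_def ts)
      next
        case 6 then show ?thesis using G fl[of i] y0[of i] by (auto simp add: input_fams_def clause_ok_def ts c0)
      next
        case 7 then show ?thesis using G fl[of i] y1[of i] bit[of i] by (auto simp add: input_fams_def clause_ok_def ts c0)
      next
        case 8 then show ?thesis using G fl[of i] y1[of i] bit[of i] by (auto simp add: input_fams_def clause_ok_def ts c0)
      next
        case 9 then show ?thesis using G fl[of i] by (auto simp add: input_fams_def clause_ok_def ts)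
      next
        case 10 then show ?thesis using G y by (auto simp add: input_fams_def clause_ok_def ts)
      next
        case 11 then show ?thesis using y2 by (auto simp add: input_fams_def clause_ok_def ts c0)
      next
        case 12 then show ?thesis using y3[of "m x"] z0 by (auto simp add: input_fams_def clause_ok_def ts c0)
      next
        case 13 then show ?thesis using G y4[of j] z2[of "int (j - (T x + ofs x + 2 * length y + 1))"]
          by (auto simp add: input_fams_def clause_ok_def ts c0)
      next
        case 14
        show ?thesis
        proof (cases "i = length y")
          case True
          then have j: "T x + ofs x + 2 * length y < j" using G 14 by (simp add: input_fams_def)
          define k where "k = j - (T x + ofs x + 2 * length y + 1)"
          have k: "j = T x + ofs x + 2 * length y + 1 + k" "Suc j = T x + ofs x + 2 * length y + 1 + Suc k"
            using j by (simp_all add: k_def)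
          have "string_contents w (int j - int (T x)) = string_contents zz (int k)" unfolding k(1) by (rule y3)
          moreover have "string_contents w (int (Suc j) - int (T x)) = string_contents zz (int (Suc k))" unfolding k(2) by (rule y3)
          ultimately have "string_contents w (int j - int (T x)) \<noteq> 0 \<or> string_contents w (int (Suc j) - int (T x)) = 0"
            using z1[of k] by metis
          then show ?thesis using 14 by (auto simp add: input_fams_def clause_ok_def ts c0)
        next
          case False then show ?thesis using 14 by (auto simp add: input_fams_def clause_ok_def ts)
        qed
      qed
    qed
    then show ?thesis unfolding okf_def by blast
  qed
  note inv = conf_inv[OF wf, of w]
  have halted: "cstate M w (Suc t) = states M" "ccell M w (Suc t) = ccell M w t" if "cstate M w t = states M" for t
    using conf_halted[OF that] that by (auto simp: cstate_def ccell_def)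
  have stay: "ccell M w (Suc t) k h = ccell M w t k h" if "chead M w t k \<noteq> h" "k < tapes M" for t k h
  proof (cases "cstate M w t = states M")
    case False
    obtain s' as where d: "delta M (cstate M w t) (cread M w t) = (s', as)" by (meson surj_pair)
    have "cstate M w t < states M" "length (snd (conf M w t)) = tapes M" "\<forall>k<tapes M. \<forall>i. ccell M w t k i < symbols M"
      using inv[of t] False by auto
    from conf_running(5)[OF wf this d that(2)] show ?thesis using that by simp
  qed (simp add: halted)
  have run: "okf \<tau> x F" if "F \<in> set run_fams" for F
    using that halted(1) conf_init(1)[OF wf, of w] acc by (auto simp: run_fams_def okf_def clause_ok_def ts)
  have tape: "okf \<tau> x F" if "F \<in> set (tape_fams k)" "k < tapes M" for F k
  proof -
    have h: "chead M w 0 k = 0" and c: "k \<noteq> 0 \<Longrightarrow> ccell M w 0 k = (\<lambda>_. 0)"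
      using conf_init(3,4)[OF wf that(2), of w] by auto
    have "F = tape_fams k ! 0 \<or> F = tape_fams k ! 1 \<or> F = tape_fams k ! 2"
      using that(1) by (auto simp: tape_fams_def)
    then consider "F = tape_fams k ! 0" | "F = tape_fams k ! 1" | "F = tape_fams k ! 2" by blast
    then show ?thesis
    proof cases
      case 1 then show ?thesis using h by (simp add: tape_fams_def okf_def clause_ok_def ts)
    next
      case 2 then show ?thesis using c by (simp add: tape_fams_def okf_def clause_ok_def ts)
    next
      case 3 then show ?thesis by (auto simp add: tape_fams_def okf_def clause_ok_def ts)
    qed
  qed
  have cell: "okf \<tau> x F" if "F \<in> set (cell_fams (k, a))" "k < tapes M" for F k a
  proof -
    have "F = cell_fams (k, a) ! 0 \<or> F = cell_fams (k, a) ! 1 \<or> F = cell_fams (k, a) ! 2"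
      using that(1) by (auto simp: cell_fams_def)
    then consider "F = cell_fams (k, a) ! 0" | "F = cell_fams (k, a) ! 1" | "F = cell_fams (k, a) ! 2" by blast
    then show ?thesis
    proof cases
      case 1 then show ?thesis by (auto simp add: cell_fams_def okf_def clause_ok_def ts)
    next
      case 2 then show ?thesis using stay[OF _ that(2)] by (auto simp add: cell_fams_def okf_def clause_ok_def ts)
    next
      case 3 then show ?thesis using halted(2) by (auto simp add: cell_fams_def okf_def clause_ok_def ts)
    qed
  qed
  have trans: "okf \<tau> x F" if F: "F \<in> set (trans_fams (s, ys))" and s: "s < states M" and ys: "length ys = tapes M" for F s ys
    unfolding okf_def
  proof (intro allI impI)
    fix t i j assume *: "t < W x" "i < W x" "j < W x" and G: "fst F x t i j"
    obtain ls where ls: "snd F = body s ys @ ls" using F by (auto simp: trans_fams_def Let_def)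
    show "clause_ok \<tau> x t i j (snd F)"
    proof (cases "cstate M w t = s \<and> (\<forall>k<tapes M. ccell M w t k (chead M w t k) = ys ! k)")
      case False
      then have "\<exists>L\<in>set (body s ys). case L of (p, l, a, b) \<Rightarrow> \<tau> l (a x t i j) (b x t i j) = p"
      proof (cases "cstate M w t = s")
        case True
        then obtain k where "k < tapes M" "ccell M w t k (chead M w t k) \<noteq> ys ! k" using False by blast
        then show ?thesis unfolding body_def by (intro bexI[of _ "(False, Rd k (ys ! k), vt, z)"]) (auto simp: ts)
      qed (auto simp: body_def ts)
      then show ?thesis unfolding ls clause_ok_def by auto
    next
      case True
      then have cr: "cread M w t = ys" using ys by (auto simp: cread_def intro!: nth_equalityI)
      obtain s' as where d: "delta M s ys = (s', as)" by (meson surj_pair)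
      have "cstate M w t < states M" "length (snd (conf M w t)) = tapes M" "\<forall>k<tapes M. \<forall>i. ccell M w t k i < symbols M"
        "delta M (cstate M w t) (cread M w t) = (s', as)"
        using inv[of t] s True cr d by auto
      note r = conf_running[OF wf this]
      have mv: "int (mv dd i) = move dd (int i)" if "0 < i" for dd using that by (cases dd) (auto simp: mv_def)
      have mv': "move dd (a - b) = move dd a - b" for dd and a b :: int by (cases dd) auto
      consider "F = (\<lambda>x t i j. t < T x, body s ys @ [(True, St s', st, z)])"
        | k where "k < tapes M" "F = (\<lambda>x t i j. t < T x, body s ys @ [(False, Hd k, vt, vi), (True, Cell k (fst (as ! k)), st, vi)])"
        | k where "k < tapes M" "F = (\<lambda>x t i j. t < T x \<and> 0 < i \<and> Suc i < W x,
             body s ys @ [(False, Hd k, vt, vi), (True, Hd k, st, \<lambda>x t i j. mv (snd (as ! k)) i)])"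
        using F d by (auto simp: trans_fams_def Let_def)
      then show ?thesis
      proof cases
        case 1 then show ?thesis using r(1) by (simp add: clause_ok_def ts)
      next
        case (2 k) then show ?thesis using r(5)[of k] by (auto simp add: clause_ok_def ts)
      next
        case (3 k) then show ?thesis using r(6)[of k] G mv mv' by (auto simp add: clause_ok_def ts)
      qed
    qed
  qed
  have "\<forall>F\<in>set fams. okf \<tau> x F"
    using in0 run tape cell trans unfolding fams_def by (auto simp: set_n_lists)
  then show ?thesis by (intro exI[of _ \<tau>]) (auto simp: ts)
qed

end

theorem Pi2p_qcnf:
  assumes "A \<in> Pi2p"
  shows "\<exists>pv pc U Occ. PF (\<lambda>x e. U x (e 0)) \<and> PF (\<lambda>x e. Occ x (e 0) (e 1)) \<and>
    (\<forall>x. x \<in> A \<longleftrightarrow> qcnf (poly pv (length x)) (poly pc (length x)) (U x) (Occ x))"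
proof -
  obtain R p where R: "R \<in> classP" and A: "\<And>x. x \<in> A \<longleftrightarrow> (\<forall>y. length y \<le> poly p (length x) \<longrightarrow>
         (\<exists>z. length z \<le> poly p (length x) \<and> pair x (pair y z) \<in> R))"
    using assms unfolding Pi2p_def by blast
  obtain M q where M: "wf_tm M" "\<And>w. computes_within M w [w \<in> R] (poly q (length w))"
    using R unfolding classP_def polytime_def by blast
  interpret tableau M p q by unfold_locales (rule M)
  have K: "0 < tapes M" using M(1) by (auto simp: wf_tm_def)
  have acc: "ccell M w (T x) (tapes M - 1) 0 = (if w \<in> R then 2 else 1)"
    if "w = pair x (pair y z)" "length y \<le> m x" "length z \<le> m x" for w x y z
  proof -
    have "length w \<le> lmax x" using that by (simp add: length_pair lmax_def ofs_def)
    then have "poly q (length w) \<le> T x" unfolding T_def using poly_nat_mono[of "length w" "lmax x" q] by linarith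
    moreover have "cstate M w (poly q (length w)) = states M" "fst (last (snd (conf M w (poly q (length w))))) = string_contents [w \<in> R]"
      using M(2)[of w] by (auto simp: computes_within_def conf_def cstate_def split: prod.splits)
    moreover have "conf M w (t + d) = conf M w t" if "cstate M w t = states M" for t d
    proof (induction d)
      case (Suc d)
      then have "cstate M w (t + d) = states M" using that by (simp add: cstate_def)
      from conf_halted[OF this] Suc show ?case by simp
    qed simp
    ultimately have "fst (last (snd (conf M w (T x)))) = string_contents [w \<in> R]"
      by (metis le_add_diff_inverse)
    moreover have "last (snd (conf M w (T x))) = snd (conf M w (T x)) ! (tapes M - 1)"
      using conf_inv[OF M(1), of w "T x"] K by (subst last_conv_nth) auto
    ultimately show ?thesis by (simp add: ccell_def string_contents_def)
  qed
  have "x \<in> A \<longleftrightarrow> (\<forall>\<sigma> :: lab \<Rightarrow> nat \<Rightarrow> nat \<Rightarrow> bool. \<exists>\<tau>. (\<forall>l\<in>{Vflag, Vbit}. \<forall>a b. \<tau> l a b = \<sigma> l a b) \<and>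
       (\<forall>F\<in>set fams. okf \<tau> x F))" (is "_ \<longleftrightarrow> ?R") for x
  proof
    assume xA: "x \<in> A"
    show ?R
    proof
      fix \<sigma> :: "lab \<Rightarrow> nat \<Rightarrow> nat \<Rightarrow> bool"
      define n where "n = (LEAST l. l = m x \<or> \<not> \<sigma> Vflag 0 l)"
      have n1: "n = m x \<or> \<not> \<sigma> Vflag 0 n" unfolding n_def by (rule LeastI[of _ "m x"]) simp
      have n2: "n \<le> m x" unfolding n_def by (rule Least_le) simp
      have n3: "i < n \<Longrightarrow> \<sigma> Vflag 0 i" for i unfolding n_def using not_less_Least by blast
      define y where "y = map (\<sigma> Vbit 0) [0..<n]"
      have ly: "length y = n" by (simp add: y_def)
      obtain zz where zz: "length zz \<le> m x" "pair x (pair y zz) \<in> R"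
        using xA n2 unfolding A m_def ly[symmetric] by blast
      have "ccell M (pair x (pair y zz)) (T x) (tapes M - 1) 0 \<noteq> 1"
        using acc[OF refl _ zz(1), of y] zz n2 ly by simp
      then show "\<exists>\<tau>. (\<forall>l\<in>{Vflag, Vbit}. \<forall>a b. \<tau> l a b = \<sigma> l a b) \<and> (\<forall>F\<in>set fams. okf \<tau> x F)"
        by (intro tableau_complete[OF _ zz(1) refl]) (use n1 n2 n3 ly in \<open>auto simp: y_def\<close>)
    qed
  next
    assume R: ?R
    show "x \<in> A" unfolding A
    proof (intro allI impI)
      fix y :: "bool list" assume y: "length y \<le> poly p (length x)"
      obtain \<tau> where \<tau>: "\<And>l a b. l \<in> {Vflag, Vbit} \<Longrightarrow> \<tau> l a b = (if l = Vflag then b < length y else y ! b)" "\<forall>F\<in>set fams. okf \<tau> x F"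
        using R[rule_format, of "\<lambda>l a b. if l = Vflag then b < length y else y ! b"] by blast
      obtain zz where zz: "length zz \<le> m x" "ccell M (pair x (pair y zz)) (T x) (tapes M - 1) 0 \<noteq> 1"
        using tableau_sound[of \<tau> x y] \<tau> y unfolding m_def by auto
      then have "pair x (pair y zz) \<in> R"
        using acc[OF refl _ zz(1), of y] y by (auto simp: m_def split: if_splits)
      then show "\<exists>z. length z \<le> poly p (length x) \<and> pair x (pair y z) \<in> R" using zz(1) unfolding m_def by blast
    qed
  qed
  then have "x \<in> A \<longleftrightarrow> (\<forall>\<sigma> :: lab \<Rightarrow> nat \<Rightarrow> nat \<Rightarrow> bool. \<exists>\<tau>. (\<forall>l\<in>{Vflag, Vbit}. \<forall>a b. \<tau> l a b = \<sigma> l a b) \<and>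
       (\<forall>(G, ls)\<in>set fams. \<forall>t<W x. \<forall>i<W x. \<forall>j<W x. G x t i j \<longrightarrow> clause_ok \<tau> x t i j ls))" for x
    by (simp add: okf_def case_prod_beta)
  moreover have "labs \<noteq> []" by (simp add: labs_def fams_def run_fams_def)
  ultimately show ?thesis
    by (intro families_qcnf[OF family_wf_all W_poly W_bounds(1)])
qed

section \<open>Five-cycles and the colour-killing gadget\<close>

lemma ex_in_Diff1: "2 \<le> card A \<Longrightarrow> \<exists>x\<in>A. x \<noteq> a"
proof -
  assume "2 \<le> card A"
  then have "\<not> A \<subseteq> {a}" using card_mono[of "{a}" A] by auto
  then show ?thesis by blast
qed

lemma ex_in_Diff2: "3 \<le> card A \<Longrightarrow> \<exists>x\<in>A. x \<noteq> a \<and> x \<noteq> b"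
proof -
  assume "3 \<le> card A"
  then have "\<not> A \<subseteq> {a, b}" using card_mono[of "{a, b}" A] by (auto simp: card_insert_if split: if_splits)
  then show ?thesis by blast
qed

lemma card_Diff1_ge: "3 \<le> card A \<Longrightarrow> 2 \<le> card (A - {a})"
  using card_Diff1_le[of A a] by (cases "finite A"; cases "a \<in> A") (auto simp: card_Diff_singleton)

definition cyc5 :: "'a \<Rightarrow> 'a \<Rightarrow> 'a \<Rightarrow> 'a \<Rightarrow> 'a \<Rightarrow> bool" where
  "cyc5 a b c d e \<longleftrightarrow> a \<noteq> b \<and> b \<noteq> c \<and> c \<noteq> d \<and> d \<noteq> e \<and> e \<noteq> a"

lemma cyc5_two_colours: "{a, b, c, d, e} \<subseteq> {p, q} \<Longrightarrow> \<not> cyc5 a b c d e"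
  by (auto simp: cyc5_def)

text \<open>Greedy choice against the direction of the cycle: start with a colour of vertex 0 that
  vertex 1 does not have, continue with 4, 3, 2; vertex 1 comes last and has to avoid only one
  colour.\<close>

lemma cyc5_aux:
  assumes "x0 \<in> A0" "x0 \<notin> A1" "2 \<le> card A1" "2 \<le> card A2" "2 \<le> card A3" "2 \<le> card A4"
  shows "\<exists>x0\<in>A0. \<exists>x1\<in>A1. \<exists>x2\<in>A2. \<exists>x3\<in>A3. \<exists>x4\<in>A4. cyc5 x0 x1 x2 x3 x4"
proof -
  obtain x4 where 4: "x4 \<in> A4" "x4 \<noteq> x0" using ex_in_Diff1[OF assms(6)] by blast
  obtain x3 where 3: "x3 \<in> A3" "x3 \<noteq> x4" using ex_in_Diff1[OF assms(5)] by blast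
  obtain x2 where 2: "x2 \<in> A2" "x2 \<noteq> x3" using ex_in_Diff1[OF assms(4)] by blast
  obtain x1 where 1: "x1 \<in> A1" "x1 \<noteq> x2" using ex_in_Diff1[OF assms(3)] by blast
  have "cyc5 x0 x1 x2 x3 x4" using 1 2 3 4 assms(1,2) by (auto simp: cyc5_def)
  then show ?thesis using assms(1) 1 2 3 4 by blast
qed

text \<open>If the lists are not all equal, the cyclic chain of inclusions breaks somewhere, and the
  greedy choice can start there. If they are equal, the common list has a third colour, which
  suffices for an odd cycle.\<close>

lemma cyc5_choose:
  assumes c: "2 \<le> card A0" "2 \<le> card A1" "2 \<le> card A2" "2 \<le> card A3" "2 \<le> card A4"
    and n: "\<not> (card A0 = 2 \<and> A1 = A0 \<and> A2 = A0 \<and> A3 = A0 \<and> A4 = A0)"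
  shows "\<exists>x0\<in>A0. \<exists>x1\<in>A1. \<exists>x2\<in>A2. \<exists>x3\<in>A3. \<exists>x4\<in>A4. cyc5 x0 x1 x2 x3 x4"
proof -
  show ?thesis
  proof (cases "A0 \<subseteq> A1 \<and> A1 \<subseteq> A2 \<and> A2 \<subseteq> A3 \<and> A3 \<subseteq> A4 \<and> A4 \<subseteq> A0")
    case True
    then have e: "A1 = A0" "A2 = A0" "A3 = A0" "A4 = A0" by blast+
    then have "3 \<le> card A0" using c(1) n by auto
    moreover obtain a where "a \<in> A0" using c(1) by fastforce
    moreover obtain b where "b \<in> A0" "b \<noteq> a" using ex_in_Diff1[OF c(1), of a] by blast
    ultimately obtain d where "d \<in> A0" "d \<noteq> a" "d \<noteq> b" using ex_in_Diff2[of A0 a b] by blast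
    then have "cyc5 a b a b d" using \<open>b \<noteq> a\<close> by (auto simp: cyc5_def)
    then show ?thesis unfolding e using \<open>a \<in> A0\<close> \<open>b \<in> A0\<close> \<open>d \<in> A0\<close> by blast
  next
    case False
    then consider x where "x \<in> A0" "x \<notin> A1" | x where "x \<in> A1" "x \<notin> A2" | x where "x \<in> A2" "x \<notin> A3"
      | x where "x \<in> A3" "x \<notin> A4" | x where "x \<in> A4" "x \<notin> A0" by blast
    then show ?thesis
    proof cases
      case 1 from cyc5_aux[OF 1 c(2-5)] show ?thesis .
    next
      case 2
      from cyc5_aux[OF 2 c(3-5) c(1)] obtain y1 y2 y3 y4 y0 where *: "y1 \<in> A1" "y2 \<in> A2" "y3 \<in> A3" "y4 \<in> A4" "y0 \<in> A0" "cyc5 y1 y2 y3 y4 y0" by blast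
      then have "cyc5 y0 y1 y2 y3 y4" by (auto simp: cyc5_def)
      with * show ?thesis by blast
    next
      case 3
      from cyc5_aux[OF 3 c(4,5) c(1,2)] obtain y2 y3 y4 y0 y1 where *: "y2 \<in> A2" "y3 \<in> A3" "y4 \<in> A4" "y0 \<in> A0" "y1 \<in> A1" "cyc5 y2 y3 y4 y0 y1" by blast
      then have "cyc5 y0 y1 y2 y3 y4" by (auto simp: cyc5_def)
      with * show ?thesis by blast
    next
      case 4
      from cyc5_aux[OF 4 c(5) c(1-3)] obtain y3 y4 y0 y1 y2 where *: "y3 \<in> A3" "y4 \<in> A4" "y0 \<in> A0" "y1 \<in> A1" "y2 \<in> A2" "cyc5 y3 y4 y0 y1 y2" by blast
      then have "cyc5 y0 y1 y2 y3 y4" by (auto simp: cyc5_def)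
      with * show ?thesis by blast
    next
      case 5
      from cyc5_aux[OF 5 c(1-4)] obtain y4 y0 y1 y2 y3 where *: "y4 \<in> A4" "y0 \<in> A0" "y1 \<in> A1" "y2 \<in> A2" "y3 \<in> A3" "cyc5 y4 y0 y1 y2 y3" by blast
      then have "cyc5 y0 y1 y2 y3 y4" by (auto simp: cyc5_def)
      with * show ?thesis by blast
    qed
  qed
qed

lemma card3_Diff1_eq:
  assumes "card U = 3" "card (U - {n}) = 2" shows "n \<in> U"
  using assms by (cases "n \<in> U") auto

text \<open>A region lies inside a 4-cycle \<open>b, v, a, v'\<close>. Its outer 5-cycle \<open>w\<close> is attached to the 4-cycle and the
  inner 5-cycle \<open>u\<close> to \<open>z\<close>, \<open>w5\<close>, \<open>z'\<close>, \<open>v'\<close>, \<open>y\<close>.\<close>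

definition region_sol :: "'a \<Rightarrow> 'a \<Rightarrow> 'a \<Rightarrow> 'a \<Rightarrow> 'a \<Rightarrow> 'a \<Rightarrow> 'a \<Rightarrow> 'a \<Rightarrow> 'a \<Rightarrow> 'a \<Rightarrow> 'a \<Rightarrow> 'a \<Rightarrow> 'a \<Rightarrow> 'a \<Rightarrow> 'a \<Rightarrow> 'a \<Rightarrow> 'a \<Rightarrow> bool" where
  "region_sol a b v v' w1 w2 w3 w4 w5 z z' y u1 u2 u3 u4 u5 \<longleftrightarrow>
     cyc5 w1 w2 w3 w4 w5 \<and> cyc5 u1 u2 u3 u4 u5 \<and> w1 \<noteq> b \<and> w2 \<noteq> v \<and> w3 \<noteq> a \<and> w4 \<noteq> v' \<and>
      z \<noteq> b \<and> z \<noteq> w5 \<and> z' \<noteq> v' \<and> z' \<noteq> w5 \<and> y \<noteq> z \<and> y \<noteq> v' \<and>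
      u1 \<noteq> z \<and> u2 \<noteq> w5 \<and> u3 \<noteq> z' \<and> u4 \<noteq> v' \<and> u5 \<noteq> y"

text \<open>The inner cycle can fail only if its five remaining pairs agree. As \<open>z\<close> and
  \<open>w5\<close> differ, this singles out one dangerous colour \<open>r\<close> for
  \<open>w5\<close>, the only element of \<open>U2 - U1\<close>. With \<open>r\<close> removed from
  \<open>W5\<close>, the outer cycle can fail only if the pair \<open>W5 - {r}\<close> is what
  \<open>W1\<close> and \<open>W3\<close> keep, and this determines both \<open>a\<close> and
  \<open>b\<close>. Where no such colour exists the choice operator returns an arbitrary value,
  which does no harm.\<close>

lemma region_choose:
  assumes W: "card W1 = 3" "card W2 = 3" "card W3 = 3" "card W4 = 3" "card W5 = 3"
    and Z: "card Z = 3" "card Z' = 3" "card Y = 3"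
    and U: "card U1 = 3" "card U2 = 3" "card U3 = 3" "card U4 = 3" "card U5 = 3"
  shows "\<exists>\<kappa>a \<kappa>b. \<forall>a b v v'. \<not> (a = \<kappa>a \<and> b = \<kappa>b) \<longrightarrow>
    (\<exists>w1\<in>W1. \<exists>w2\<in>W2. \<exists>w3\<in>W3. \<exists>w4\<in>W4. \<exists>w5\<in>W5. \<exists>z\<in>Z. \<exists>z'\<in>Z'. \<exists>y\<in>Y.
      \<exists>u1\<in>U1. \<exists>u2\<in>U2. \<exists>u3\<in>U3. \<exists>u4\<in>U4. \<exists>u5\<in>U5.
      region_sol a b v v' w1 w2 w3 w4 w5 z z' y u1 u2 u3 u4 u5)"
proof -
  define r where "r = (SOME r. r \<in> U2 - U1)"
  have u: "\<exists>u1\<in>U1 - {n1}. \<exists>u2\<in>U2 - {n2}. \<exists>u3\<in>U3 - {n3}. \<exists>u4\<in>U4 - {n4}. \<exists>u5\<in>U5 - {n5}. cyc5 u1 u2 u3 u4 u5"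
    if "n2 \<noteq> r" "n1 \<noteq> n2" for n1 n2 n3 n4 n5
  proof (rule cyc5_choose)
    show "\<not> (card (U1 - {n1}) = 2 \<and> U2 - {n2} = U1 - {n1} \<and> U3 - {n3} = U1 - {n1} \<and> U4 - {n4} = U1 - {n1} \<and> U5 - {n5} = U1 - {n1})"
    proof
      assume *: "card (U1 - {n1}) = 2 \<and> U2 - {n2} = U1 - {n1} \<and> U3 - {n3} = U1 - {n1} \<and> U4 - {n4} = U1 - {n1} \<and> U5 - {n5} = U1 - {n1}"
      then have e: "card (U1 - {n1}) = 2" "U2 - {n2} = U1 - {n1}" by blast+
      have "n1 \<in> U1" by (rule card3_Diff1_eq[OF U(1) e(1)])
      moreover have "n2 \<in> U2" by (rule card3_Diff1_eq[OF U(2)]) (simp only: e)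
      ultimately have "U2 - U1 = {n2}" using e(2) that(2) by blast
      then have "r = n2" unfolding r_def by simp
      then show False using that by simp
    qed
  qed (simp_all add: U card_Diff1_ge)
  define \<kappa>a \<kappa>b where "\<kappa>a = (SOME c. c \<in> W3 - (W5 - {r}))" and "\<kappa>b = (SOME c. c \<in> W1 - (W5 - {r}))"
  show ?thesis
  proof (rule exI[of _ \<kappa>a], rule exI[of _ \<kappa>b], intro allI impI)
    fix a b v v' assume ab: "\<not> (a = \<kappa>a \<and> b = \<kappa>b)"
    have "\<exists>w1\<in>W1 - {b}. \<exists>w2\<in>W2 - {v}. \<exists>w3\<in>W3 - {a}. \<exists>w4\<in>W4 - {v'}. \<exists>w5\<in>W5 - {r}. cyc5 w1 w2 w3 w4 w5"
    proof (rule cyc5_choose)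
      show "\<not> (card (W1 - {b}) = 2 \<and> W2 - {v} = W1 - {b} \<and> W3 - {a} = W1 - {b} \<and> W4 - {v'} = W1 - {b} \<and> W5 - {r} = W1 - {b})"
      proof
        assume *: "card (W1 - {b}) = 2 \<and> W2 - {v} = W1 - {b} \<and> W3 - {a} = W1 - {b} \<and> W4 - {v'} = W1 - {b} \<and> W5 - {r} = W1 - {b}"
        then have e: "card (W1 - {b}) = 2" "W3 - {a} = W1 - {b}" "W5 - {r} = W1 - {b}" by blast+
        have "b \<in> W1" by (rule card3_Diff1_eq[OF W(1) e(1)])
        moreover have "a \<in> W3" by (rule card3_Diff1_eq[OF W(3)]) (simp only: e)
        ultimately have "W1 - (W5 - {r}) = {b}" "W3 - (W5 - {r}) = {a}" using e(2,3) by blast+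
        then have "a = \<kappa>a" "b = \<kappa>b" unfolding \<kappa>a_def \<kappa>b_def by simp_all
        then show False using ab by simp
      qed
    qed (simp_all add: W card_Diff1_ge)
    then obtain w1 w2 w3 w4 w5 where w: "w1 \<in> W1 - {b}" "w2 \<in> W2 - {v}" "w3 \<in> W3 - {a}" "w4 \<in> W4 - {v'}" "w5 \<in> W5 - {r}"
      "cyc5 w1 w2 w3 w4 w5" by blast
    obtain z where z: "z \<in> Z" "z \<noteq> b" "z \<noteq> w5" using ex_in_Diff2[of Z b w5] Z by auto
    obtain z' where z': "z' \<in> Z'" "z' \<noteq> v'" "z' \<noteq> w5" using ex_in_Diff2[of Z' v' w5] Z by auto
    obtain y where y: "y \<in> Y" "y \<noteq> z" "y \<noteq> v'" using ex_in_Diff2[of Y z v'] Z by auto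
    have "w5 \<noteq> r" using w by auto
    then obtain u1 u2 u3 u4 u5 where us: "u1 \<in> U1 - {z}" "u2 \<in> U2 - {w5}" "u3 \<in> U3 - {z'}" "u4 \<in> U4 - {v'}" "u5 \<in> U5 - {y}"
      "cyc5 u1 u2 u3 u4 u5" using u[of w5 z z' v' y] z by blast
    have c: "region_sol a b v v' w1 w2 w3 w4 w5 z z' y u1 u2 u3 u4 u5"
      unfolding region_sol_def using w us z z' y by blast
    have mem: "w1 \<in> W1" "w2 \<in> W2" "w3 \<in> W3" "w4 \<in> W4" "w5 \<in> W5" "u1 \<in> U1" "u2 \<in> U2" "u3 \<in> U3" "u4 \<in> U4" "u5 \<in> U5"
      using w us by blast+
    show "\<exists>w1\<in>W1. \<exists>w2\<in>W2. \<exists>w3\<in>W3. \<exists>w4\<in>W4. \<exists>w5\<in>W5. \<exists>z\<in>Z. \<exists>z'\<in>Z'. \<exists>y\<in>Y.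
      \<exists>u1\<in>U1. \<exists>u2\<in>U2. \<exists>u3\<in>U3. \<exists>u4\<in>U4. \<exists>u5\<in>U5.
      region_sol a b v v' w1 w2 w3 w4 w5 z z' y u1 u2 u3 u4 u5"
      using c mem z(1) z'(1) y(1) by blast
  qed
qed

text \<open>A chain of forced colours: \<open>w1\<close> to \<open>w4\<close> are left with
  \<open>g\<close> and \<open>d\<close>, so \<open>w5 = a\<close> since the cycle is odd; then
  \<open>z\<close> and \<open>z'\<close> must be \<open>g\<close>, \<open>y\<close> must be
  \<open>a\<close>, and the inner cycle is left with the two colours \<open>b\<close> and
  \<open>d\<close>.\<close>

lemma region_forced:
  assumes "region_sol a b v v' w1 w2 w3 w4 w5 z z' y u1 u2 u3 u4 u5"
    and "v = x" "v' = x"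
    and "w1 \<in> {g, d, b}" "w2 \<in> {g, d, x}" "w3 \<in> {g, d, a}" "w4 \<in> {g, d, x}" "w5 \<in> {g, d, a}"
      "z \<in> {b, a, g}" "z' \<in> {x, a, g}" "y \<in> {g, x, a}"
      "u1 \<in> {b, d, g}" "u2 \<in> {b, d, a}" "u3 \<in> {b, d, g}" "u4 \<in> {b, d, x}" "u5 \<in> {b, d, a}"
  shows False
proof -
  have c: "cyc5 w1 w2 w3 w4 w5" "cyc5 u1 u2 u3 u4 u5"
    and n: "w1 \<noteq> b" "w2 \<noteq> v" "w3 \<noteq> a" "w4 \<noteq> v'" "z \<noteq> b" "z \<noteq> w5" "z' \<noteq> v'" "z' \<noteq> w5" "y \<noteq> z" "y \<noteq> v'"
      "u1 \<noteq> z" "u2 \<noteq> w5" "u3 \<noteq> z'" "u4 \<noteq> v'" "u5 \<noteq> y"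
    using assms(1) by (simp_all add: region_sol_def)
  have w: "w1 \<in> {g, d}" "w2 \<in> {g, d}" "w3 \<in> {g, d}" "w4 \<in> {g, d}"
    using n(1-4) assms(2-7) by blast+
  then have w5: "w5 = a" using cyc5_two_colours[of w1 w2 w3 w4 w5 g d] c(1) assms(8) by blast
  have z: "z = g" "z' = g" using n(5-8) assms(3,9,10) w5 by blast+
  have y: "y = a" using n(9,10) assms(3,11) z by blast
  have "u1 \<in> {b, d}" "u2 \<in> {b, d}" "u3 \<in> {b, d}" "u4 \<in> {b, d}" "u5 \<in> {b, d}"
    using n(11-15) assms(3,12-16) w5 z y by blast+
  then show False using cyc5_two_colours[of u1 u2 u3 u4 u5 b d] c(2) by blast
qed

text \<open>The gadget has root 0 and contains three regions between 0 and 45. The numbering of its vertices is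
  their order along the spine of a book embedding.\<close>

definition region_edges :: "nat \<Rightarrow> (nat \<times> nat) list" where
  "region_edges s = [(0, s), (0, s+1), (0, s+14), (s, 45), (s+14, 45), (s+4, 45), (s+6, 45), (s, s+3),
    (s+1, s+2), (s+1, s+3), (s+2, s+5), (s+2, s+14), (s+3, s+4), (s+4, s+5), (s+5, s+6), (s+5, s+12),
    (s+5, s+13), (s+6, s+7), (s+6, s+11), (s+7, s+8), (s+7, s+14), (s+8, s+9), (s+8, s+11), (s+9, s+10),
    (s+9, s+14), (s+10, s+12), (s+10, s+13), (s+11, s+12), (s+13, s+14)]"

text \<open>The first two regions share the vertex 15; the third occupies 30 to 44. Three regions
  are needed to meet the three colours of vertex 45.\<close>

definition gadget :: "(nat \<times> nat) list" where
  "gadget = region_edges 1 @ region_edges 15 @ region_edges 30"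

definition gadget_proper :: "(nat \<Rightarrow> nat) \<Rightarrow> bool" where
  "gadget_proper f \<longleftrightarrow> (\<forall>(p, q)\<in>set gadget. f p \<noteq> f q)"

lemma region_proper:
  "(\<forall>(p, q)\<in>set (region_edges s). f p \<noteq> f q) \<longleftrightarrow>
    region_sol (f 0) (f 45) (f s) (f (s+14)) (f (s+4)) (f (s+3)) (f (s+1)) (f (s+2)) (f (s+5)) (f (s+6)) (f (s+13)) (f (s+7))
      (f (s+11)) (f (s+12)) (f (s+10)) (f (s+9)) (f (s+8)) \<and>
    f s \<noteq> f 0 \<and> f s \<noteq> f 45 \<and> f (s+14) \<noteq> f 0 \<and> f (s+14) \<noteq> f 45"
  unfolding region_edges_def cyc5_def region_sol_def by auto

text \<open>The inner colours \<open>g\<close> work for every \<open>f\<close> that agrees with them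
  and with the four corners, so the solutions of the three regions can be glued.\<close>

definition region_ext :: "(nat \<Rightarrow> nat set) \<Rightarrow> nat \<Rightarrow> nat \<Rightarrow> nat \<Rightarrow> nat \<Rightarrow> nat \<Rightarrow> bool" where
  "region_ext L s a b v v' \<longleftrightarrow> (\<exists>g. (\<forall>q\<in>{s+1..s+13}. g q \<in> L q) \<and>
      (\<forall>f. f 0 = a \<longrightarrow> f 45 = b \<longrightarrow> f s = v \<longrightarrow> f (s+14) = v' \<longrightarrow> (\<forall>q\<in>{s+1..s+13}. f q = g q) \<longrightarrow>
        (\<forall>(p, q)\<in>set (region_edges s). f p \<noteq> f q)))"

lemma region_choose':
  assumes L: "\<And>q. q \<in> {s+1..s+13} \<Longrightarrow> card (L q) = 3"
  shows "\<exists>\<kappa>a \<kappa>b. \<forall>a b v v' :: nat. \<not> (a = \<kappa>a \<and> b = \<kappa>b) \<longrightarrow> v \<noteq> a \<longrightarrow> v \<noteq> b \<longrightarrow> v' \<noteq> a \<longrightarrow> v' \<noteq> b \<longrightarrow>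
    region_ext L s a b v v'"
proof -
  obtain \<kappa>a \<kappa>b where k: "\<forall>a b v v'. \<not> (a = \<kappa>a \<and> b = \<kappa>b) \<longrightarrow>
    (\<exists>w1\<in>L (s+4). \<exists>w2\<in>L (s+3). \<exists>w3\<in>L (s+1). \<exists>w4\<in>L (s+2). \<exists>w5\<in>L (s+5). \<exists>z\<in>L (s+6). \<exists>z'\<in>L (s+13). \<exists>y\<in>L (s+7).
      \<exists>u1\<in>L (s+11). \<exists>u2\<in>L (s+12). \<exists>u3\<in>L (s+10). \<exists>u4\<in>L (s+9). \<exists>u5\<in>L (s+8).
      region_sol a b v v' w1 w2 w3 w4 w5 z z' y u1 u2 u3 u4 u5)"
    using region_choose[of "L (s+4)" "L (s+3)" "L (s+1)" "L (s+2)" "L (s+5)" "L (s+6)" "L (s+13)" "L (s+7)"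
      "L (s+11)" "L (s+12)" "L (s+10)" "L (s+9)" "L (s+8)"] L by auto
  show ?thesis
  proof (rule exI[of _ \<kappa>a], rule exI[of _ \<kappa>b], intro allI impI)
    fix a b v v' :: nat assume ab: "\<not> (a = \<kappa>a \<and> b = \<kappa>b)" and v: "v \<noteq> a" "v \<noteq> b" "v' \<noteq> a" "v' \<noteq> b"
    from k[rule_format, OF ab, of v v'] obtain w1 w2 w3 w4 w5 z z' y u1 u2 u3 u4 u5 where
      m: "w1 \<in> L (s+4)" "w2 \<in> L (s+3)" "w3 \<in> L (s+1)" "w4 \<in> L (s+2)" "w5 \<in> L (s+5)" "z \<in> L (s+6)" "z' \<in> L (s+13)" "y \<in> L (s+7)"
        "u1 \<in> L (s+11)" "u2 \<in> L (s+12)" "u3 \<in> L (s+10)" "u4 \<in> L (s+9)" "u5 \<in> L (s+8)" and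
      c: "region_sol a b v v' w1 w2 w3 w4 w5 z z' y u1 u2 u3 u4 u5" by blast
    define g where "g q = [w3, w4, w2, w1, w5, z, y, u5, u4, u3, u1, u2, z'] ! (q - (s+1))" for q
    have g: "g (s+1) = w3" "g (s+2) = w4" "g (s+3) = w2" "g (s+4) = w1" "g (s+5) = w5" "g (s+6) = z" "g (s+7) = y"
      "g (s+8) = u5" "g (s+9) = u4" "g (s+10) = u3" "g (s+11) = u1" "g (s+12) = u2" "g (s+13) = z'"
      by (simp_all add: g_def)
    have i: "{s+1..s+13} = {s+1, s+2, s+3, s+4, s+5, s+6, s+7, s+8, s+9, s+10, s+11, s+12, s+13}"
      by (rule set_eqI) (simp only: atLeastAtMost_iff insert_iff empty_iff, presburger)
    show "region_ext L s a b v v'" unfolding region_ext_def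
    proof (intro exI[of _ g] conjI allI impI)
      show "\<forall>q\<in>{s+1..s+13}. g q \<in> L q" unfolding i using m g by simp
      fix f :: "nat \<Rightarrow> nat"
      assume f: "f 0 = a" "f 45 = b" "f s = v" "f (s+14) = v'" "\<forall>q\<in>{s+1..s+13}. f q = g q"
      have "f (s+1) = w3" "f (s+2) = w4" "f (s+3) = w2" "f (s+4) = w1" "f (s+5) = w5" "f (s+6) = z" "f (s+7) = y"
      "f (s+8) = u5" "f (s+9) = u4" "f (s+10) = u3" "f (s+11) = u1" "f (s+12) = u2" "f (s+13) = z'"
        using f(5) g by simp_all
      then show "\<forall>(p, q)\<in>set (region_edges s). f p \<noteq> f q"
        unfolding region_proper using f(1-4) c v by (simp add: region_sol_def)
    qed
  qed
qed

text \<open>Each region is blocked by one pair of colours of 0 and 45 at most. A root colour other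
  than \<open>a1\<close> disarms the first region, and a colour of vertex 45 other than
  \<open>b2\<close> and \<open>b3\<close> disarms the others. The killed colour is therefore
  \<open>a1\<close>, whatever the other two regions do.\<close>

theorem gadget_kills_at_most_one:
  assumes L: "\<And>q. q \<in> {1..45} \<Longrightarrow> card (L q) = 3"
  shows "\<exists>\<kappa>. \<forall>\<alpha>. \<alpha> \<noteq> \<kappa> \<longrightarrow> (\<exists>f. f 0 = \<alpha> \<and> (\<forall>q\<in>{1..45}. f q \<in> L q) \<and> gadget_proper f)"
proof -
  have ex: "\<exists>\<kappa>a \<kappa>b. \<forall>a b v v'. \<not> (a = \<kappa>a \<and> b = \<kappa>b) \<longrightarrow> v \<noteq> a \<longrightarrow> v \<noteq> b \<longrightarrow> v' \<noteq> a \<longrightarrow> v' \<noteq> b \<longrightarrow> region_ext L s a b v v'"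
    if "s \<in> {1, 15, 30}" for s
    by (rule region_choose', rule L) (use that in auto)
  obtain a1 b1 where r1: "\<forall>a b v v'. \<not> (a = a1 \<and> b = b1) \<longrightarrow> v \<noteq> a \<longrightarrow> v \<noteq> b \<longrightarrow> v' \<noteq> a \<longrightarrow> v' \<noteq> b \<longrightarrow> region_ext L 1 a b v v'"
    using ex[of 1] by auto
  obtain a2 b2 where r2: "\<forall>a b v v'. \<not> (a = a2 \<and> b = b2) \<longrightarrow> v \<noteq> a \<longrightarrow> v \<noteq> b \<longrightarrow> v' \<noteq> a \<longrightarrow> v' \<noteq> b \<longrightarrow> region_ext L 15 a b v v'"
    using ex[of 15] by auto
  obtain a3 b3 where r3: "\<forall>a b v v'. \<not> (a = a3 \<and> b = b3) \<longrightarrow> v \<noteq> a \<longrightarrow> v \<noteq> b \<longrightarrow> v' \<noteq> a \<longrightarrow> v' \<noteq> b \<longrightarrow> region_ext L 30 a b v v'"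
    using ex[of 30] by auto
  show ?thesis
  proof (intro exI[of _ a1] allI impI)
    fix \<alpha> assume a: "\<alpha> \<noteq> a1"
    obtain \<beta> where b: "\<beta> \<in> L 45" "\<beta> \<noteq> b2" "\<beta> \<noteq> b3" using ex_in_Diff2[of "L 45" b2 b3] L[of 45] by auto
    have "\<exists>x\<in>L q. x \<noteq> \<alpha> \<and> x \<noteq> \<beta>" if "q \<in> {1..45}" for q using ex_in_Diff2[of "L q" \<alpha> \<beta>] L[OF that] by auto
    then obtain v where v: "\<And>q. q \<in> {1..45} \<Longrightarrow> v q \<in> L q \<and> v q \<noteq> \<alpha> \<and> v q \<noteq> \<beta>" by metis
    have "region_ext L 1 \<alpha> \<beta> (v 1) (v 15)" by (rule r1[rule_format]) (use a v[of 1] v[of 15] in auto)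
    then obtain g1 where g1: "\<forall>q\<in>{1+1..1+13}. g1 q \<in> L q" "\<And>f. f 0 = \<alpha> \<Longrightarrow> f 45 = \<beta> \<Longrightarrow> f 1 = v 1 \<Longrightarrow> f (1+14) = v 15 \<Longrightarrow>
        (\<forall>q\<in>{1+1..1+13}. f q = g1 q) \<Longrightarrow> (\<forall>(p, q)\<in>set (region_edges 1). f p \<noteq> f q)"
      unfolding region_ext_def by blast
    have "region_ext L 15 \<alpha> \<beta> (v 15) (v 29)" by (rule r2[rule_format]) (use b v[of 15] v[of 29] in auto)
    then obtain g2 where g2: "\<forall>q\<in>{15+1..15+13}. g2 q \<in> L q" "\<And>f. f 0 = \<alpha> \<Longrightarrow> f 45 = \<beta> \<Longrightarrow> f 15 = v 15 \<Longrightarrow> f (15+14) = v 29 \<Longrightarrow>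
        (\<forall>q\<in>{15+1..15+13}. f q = g2 q) \<Longrightarrow> (\<forall>(p, q)\<in>set (region_edges 15). f p \<noteq> f q)"
      unfolding region_ext_def by blast
    have "region_ext L 30 \<alpha> \<beta> (v 30) (v 44)" by (rule r3[rule_format]) (use b v[of 30] v[of 44] in auto)
    then obtain g3 where g3: "\<forall>q\<in>{30+1..30+13}. g3 q \<in> L q" "\<And>f. f 0 = \<alpha> \<Longrightarrow> f 45 = \<beta> \<Longrightarrow> f 30 = v 30 \<Longrightarrow> f (30+14) = v 44 \<Longrightarrow>
        (\<forall>q\<in>{30+1..30+13}. f q = g3 q) \<Longrightarrow> (\<forall>(p, q)\<in>set (region_edges 30). f p \<noteq> f q)"
      unfolding region_ext_def by blast
    define f where "f q = (if q = 0 then \<alpha> else if q = 45 then \<beta> else if q \<in> {2..14} then g1 q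
      else if q \<in> {16..28} then g2 q else if q \<in> {31..43} then g3 q else v q)" for q
    have "f q \<in> L q" if "q \<in> {1..45}" for q using that b g1(1) g2(1) g3(1) v[OF that] by (auto simp: f_def)
    moreover have "gadget_proper f"
      unfolding gadget_proper_def gadget_def set_append ball_Un
      by (intro conjI g1(2) g2(2) g3(2)) (auto simp: f_def)
    ultimately show "\<exists>f. f 0 = \<alpha> \<and> (\<forall>q\<in>{1..45}. f q \<in> L q) \<and> gadget_proper f"
      by (intro exI[of _ f]) (auto simp: f_def)
  qed
qed

definition region_lists :: "nat \<Rightarrow> nat \<Rightarrow> nat \<Rightarrow> nat \<Rightarrow> nat \<Rightarrow> nat set list" where
  "region_lists a b x g d = [{g, d, a}, {g, d, x}, {g, d, x}, {g, d, b}, {g, d, a}, {b, a, g}, {g, x, a},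
     {b, d, a}, {b, d, x}, {b, d, g}, {b, d, g}, {b, d, a}, {x, a, g}]"

text \<open>Lists that kill the root colour 1. Whichever colour 2, 3 or 4 vertex 45 takes, one
  region has it as its \<open>b\<close>, and the lists of the two ends of that region then leave
  only \<open>x\<close>. The entry at index 0 is a placeholder for the root.\<close>

definition gadget_lists :: "nat set list" where
  "gadget_lists = [{1, 2, 3}, {1, 2, 3}] @ region_lists 1 2 3 4 5 @ [{1, 2, 3}] @ region_lists 1 3 2 4 5 @ [{1, 2, 3}, {1, 2, 4}]
     @ region_lists 1 4 2 3 5 @ [{1, 2, 4}, {2, 3, 4}]"

lemma gadget_lists_kill:
  assumes f: "\<And>q. q \<in> {1..45} \<Longrightarrow> f q \<in> gadget_lists ! q" and p: "gadget_proper f"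
  shows "f 0 \<noteq> 1"
proof
  assume 0: "f 0 = 1"
  have r: "\<forall>(p, q)\<in>set (region_edges 1). f p \<noteq> f q" "\<forall>(p, q)\<in>set (region_edges 15). f p \<noteq> f q"
    "\<forall>(p, q)\<in>set (region_edges 30). f p \<noteq> f q"
    using p by (auto simp: gadget_proper_def gadget_def)
  note r1 = r(1)[unfolded region_proper] and r2 = r(2)[unfolded region_proper] and r3 = r(3)[unfolded region_proper]
  have l: "f (s+1) \<in> {g, d, f 0}" "f (s+2) \<in> {g, d, x}" "f (s+3) \<in> {g, d, x}" "f (s+4) \<in> {g, d, b}"
    "f (s+5) \<in> {g, d, f 0}" "f (s+6) \<in> {b, f 0, g}" "f (s+7) \<in> {g, x, f 0}" "f (s+8) \<in> {b, d, f 0}" "f (s+9) \<in> {b, d, x}"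
    "f (s+10) \<in> {b, d, g}" "f (s+11) \<in> {b, d, g}" "f (s+12) \<in> {b, d, f 0}" "f (s+13) \<in> {x, f 0, g}"
    if "s = 1 \<and> b = 2 \<and> x = 3 \<and> g = 4 \<and> d = 5 \<or> s = 15 \<and> b = 3 \<and> x = 2 \<and> g = 4 \<and> d = 5 \<or> s = 30 \<and> b = 4 \<and> x = 2 \<and> g = 3 \<and> d = 5"
    for s b x g d :: nat
    using f[of "s+1"] f[of "s+2"] f[of "s+3"] f[of "s+4"] f[of "s+5"] f[of "s+6"] f[of "s+7"] f[of "s+8"] f[of "s+9"]
      f[of "s+10"] f[of "s+11"] f[of "s+12"] f[of "s+13"] that
    unfolding 0 by (auto simp: gadget_lists_def region_lists_def)
  have v: "f 1 \<in> {1, 2, 3}" "f 15 \<in> {1, 2, 3}" "f 29 \<in> {1, 2, 3}" "f 30 \<in> {1, 2, 4}" "f 44 \<in> {1, 2, 4}" "f 45 \<in> {2, 3, 4}"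
    using f[of 1] f[of 15] f[of 29] f[of 30] f[of 44] f[of 45] by (simp_all add: gadget_lists_def region_lists_def)
  from v(6) consider "f 45 = 2" | "f 45 = 3" | "f 45 = 4" by blast
  then show False
  proof cases
    case 1
    then have x: "f 1 = 3" "f (1+14) = 3" using v r1 0 by auto
    show False by (rule region_forced[OF conjunct1[OF r1], of 3 4 5]) (use x 1 l[of 1 2 3 4 5] in simp_all)
  next
    case 2
    then have x: "f 15 = 2" "f (15+14) = 2" using v r2 0 by auto
    show False by (rule region_forced[OF conjunct1[OF r2], of 2 4 5]) (use x 2 l[of 15 3 2 4 5] in simp_all)
  next
    case 3
    then have x: "f 30 = 2" "f (30+14) = 2" using v r3 0 by auto
    show False by (rule region_forced[OF conjunct1[OF r3], of 2 3 5]) (use x 3 l[of 30 4 2 3 5] in simp_all)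
  qed
qed

lemma gadget_lists_card: "q \<in> {1..45} \<Longrightarrow> gadget_lists ! q \<subseteq> {1..5} \<and> card (gadget_lists ! q) = 3"
proof -
  assume "q \<in> {1..45}"
  moreover have "length gadget_lists = 46" by (simp add: gadget_lists_def region_lists_def)
  ultimately have "gadget_lists ! q \<in> set gadget_lists" by (intro nth_mem) simp
  moreover have "\<forall>S\<in>set gadget_lists. S \<subseteq> {1..5} \<and> card S = 3" by (simp add: gadget_lists_def region_lists_def)
  ultimately show ?thesis by blast
qed

text \<open>The palette is symmetric, so swapping the colours 1 and \<open>\<alpha>\<close> in the
  special lists is enough.\<close>

theorem gadget_kills_any:
  assumes "\<alpha> \<in> {1..5}"
  shows "\<exists>L. (\<forall>q\<in>{1..45}. L q \<subseteq> {1..5} \<and> card (L q) = 3) \<and>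
    (\<forall>f. (\<forall>q\<in>{1..45}. f q \<in> L q) \<longrightarrow> gadget_proper f \<longrightarrow> f 0 \<noteq> \<alpha>)"
proof -
  define tr where "tr c = (if c = 1 then \<alpha> else if c = \<alpha> then 1 else c)" for c
  have inv: "tr (tr c) = c" for c by (simp add: tr_def)
  then have inj: "inj tr" by (metis injI)
  have t: "tr ` S \<subseteq> {1..5}" if "S \<subseteq> {1..5}" for S
    using that assms by (auto simp: tr_def)
  show ?thesis
  proof (intro exI[of _ "\<lambda>q. tr ` (gadget_lists ! q)"] conjI ballI allI impI)
    fix q :: nat assume q: "q \<in> {1..45}"
    show "tr ` (gadget_lists ! q) \<subseteq> {1..5}" using t gadget_lists_card[OF q] by blast
    show "card (tr ` (gadget_lists ! q)) = 3" using gadget_lists_card[OF q] using card_image[OF inj_on_subset[OF inj], of "gadget_lists ! q"] by simp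
  next
    fix f assume f: "\<forall>q\<in>{1..45}. f q \<in> tr ` (gadget_lists ! q)" "gadget_proper f"
    have "(tr \<circ> f) 0 \<noteq> 1"
    proof (rule gadget_lists_kill)
      show "(tr \<circ> f) q \<in> gadget_lists ! q" if "q \<in> {1..45}" for q
      proof -
        obtain c where "c \<in> gadget_lists ! q" "f q = tr c" using f(1) \<open>q \<in> {1..45}\<close> by blast
        then show ?thesis by (simp add: inv)
      qed
      show "gadget_proper (tr \<circ> f)" using f(2) injD[OF inj] unfolding gadget_proper_def o_def by fast
    qed
    then show "f 0 \<noteq> \<alpha>" by (auto simp: tr_def split: if_splits)
  qed
qed

section \<open>Planarity from two-page book embeddings\<close>

text \<open>All arcs are graphs of quadratic functions with the same leading coefficient up to the
  page sign \<open>s\<close>. Thus an arc over a nested interval stays strictly inside the outer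
  one, even if they share an end point.\<close>

definition parab :: "real \<Rightarrow> real \<Rightarrow> real \<Rightarrow> real \<Rightarrow> complex" where
  "parab l h s t = Complex (l + t * (h - l)) (s * ((t * (h - l)) * ((1 - t) * (h - l))))"

lemma parab_arc:
  assumes "l < h"
  shows "arc (parab l h s)" "pathstart (parab l h s) = of_real l" "pathfinish (parab l h s) = of_real h"
    "z \<in> path_image (parab l h s) \<longleftrightarrow> l \<le> Re z \<and> Re z \<le> h \<and> Im z = s * ((Re z - l) * (h - Re z))"
proof -
  have "path (parab l h s)"
    unfolding path_def parab_def Complex_eq by (intro continuous_intros)
  moreover have "inj_on (parab l h s) {0..1}"
    using assms by (auto simp: inj_on_def parab_def)
  ultimately show "arc (parab l h s)" by (simp add: arc_def)
  show "pathstart (parab l h s) = of_real l" "pathfinish (parab l h s) = of_real h"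
    by (simp_all add: pathstart_def pathfinish_def parab_def complex_eq_iff)
  show "z \<in> path_image (parab l h s) \<longleftrightarrow> l \<le> Re z \<and> Re z \<le> h \<and> Im z = s * ((Re z - l) * (h - Re z))" (is "?L \<longleftrightarrow> ?R")
  proof
    assume ?L
    then obtain t where t: "0 \<le> t" "t \<le> 1" "z = parab l h s t" by (auto simp: path_image_def)
    have "t * (h - l) \<ge> 0" "(1 - t) * (h - l) \<ge> 0" using assms t by auto
    then show ?R using t(3) by (auto simp: parab_def algebra_simps)
  next
    assume R: ?R
    define t where "t = (Re z - l) / (h - l)"
    have e: "t * (h - l) = Re z - l" using assms by (simp add: t_def)
    then have e2: "(1 - t) * (h - l) = h - Re z" by (simp add: algebra_simps)
    have "0 \<le> t" "t \<le> 1" using R assms by (auto simp: t_def divide_simps)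
    moreover have "z = parab l h s t" unfolding parab_def e e2 using R by (simp add: complex_eq_iff)
    ultimately show ?L by (auto simp: path_image_def)
  qed
qed

lemma parab_nested:
  fixes a b c d x :: real
  assumes "a \<le> c" "d \<le> b" "c < x" "x < d" "a \<noteq> c \<or> b \<noteq> d"
  shows "(x - c) * (d - x) < (x - a) * (b - x)"
proof (cases "a = c")
  case True
  show ?thesis unfolding True using True assms by (intro mult_strict_left_mono) auto
next
  case False
  have "(x - c) * (d - x) < (x - a) * (d - x)" using False assms by (intro mult_strict_right_mono) auto
  also have "\<dots> \<le> (x - a) * (b - x)" using assms by (intro mult_left_mono) auto
  finally show ?thesis .
qed

theorem planar_two_page:
  fixes pos :: "'a \<Rightarrow> nat" and pg :: "'a set \<Rightarrow> bool"
  assumes inj: "inj_on pos V" and G: "simple_graph V E"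
    and nc: "\<And>a b c d. {a, b} \<in> E \<Longrightarrow> {c, d} \<in> E \<Longrightarrow> pg {a, b} = pg {c, d} \<Longrightarrow>
      pos a < pos c \<Longrightarrow> pos c < pos b \<Longrightarrow> pos b < pos d \<Longrightarrow> False"
  shows "planar V E"
proof -
  define pt where "pt v = complex_of_real (real (pos v))" for v
  define lo hi where "lo e = real (Min (pos ` e))" and "hi e = real (Max (pos ` e))" for e
  define \<gamma> where "\<gamma> e = parab (lo e) (hi e) (if pg e then 1 else -1)" for e
  have ends: "\<exists>a b. e = {a, b} \<and> pos a < pos b \<and> lo e = pos a \<and> hi e = pos b \<and> a \<in> V \<and> b \<in> V" if e: "e \<in> E" for e
  proof -
    have "card e = 2" "e \<subseteq> V" using G e by (auto simp: simple_graph_def)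
    then obtain a b where ab: "e = {a, b}" "a \<noteq> b" "a \<in> V" "b \<in> V" by (auto simp: card_2_iff)
    have "pos a \<noteq> pos b" using inj ab by (auto dest: inj_onD)
    then consider "pos a < pos b" | "pos b < pos a" by linarith
    then show ?thesis
    proof cases
      case 1 then show ?thesis using ab by (intro exI[of _ a] exI[of _ b]) (auto simp: lo_def hi_def min_def max_def)
    next
      case 2 then show ?thesis using ab by (intro exI[of _ b] exI[of _ a]) (auto simp: lo_def hi_def min_def max_def)
    qed
  qed
  have im: "z \<in> path_image (\<gamma> e) \<longleftrightarrow> lo e \<le> Re z \<and> Re z \<le> hi e \<and> Im z = (if pg e then 1 else -1) * ((Re z - lo e) * (hi e - Re z))"
    and arc: "arc (\<gamma> e)" "pathstart (\<gamma> e) = of_real (lo e)" "pathfinish (\<gamma> e) = of_real (hi e)" if "e \<in> E" for e z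
  proof -
    have "lo e < hi e" using ends[OF that] by auto
    from parab_arc[OF this] show "z \<in> path_image (\<gamma> e) \<longleftrightarrow> lo e \<le> Re z \<and> Re z \<le> hi e \<and> Im z = (if pg e then 1 else -1) * ((Re z - lo e) * (hi e - Re z))"
      "arc (\<gamma> e)" "pathstart (\<gamma> e) = of_real (lo e)" "pathfinish (\<gamma> e) = of_real (hi e)"
      unfolding \<gamma>_def by blast+
  qed
  have real_end: "z \<in> pt ` e" if e: "e \<in> E" and z: "z \<in> path_image (\<gamma> e)" and i: "Im z = 0" for e z
  proof -
    obtain a b where ab: "e = {a, b}" "lo e = pos a" "hi e = pos b" using ends[OF e] by blast
    have "Re z = pos a \<or> Re z = pos b" using z i im[OF e] ab by (auto split: if_splits)
    then show ?thesis using ab i by (auto simp: pt_def complex_eq_iff)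
  qed
  have pt_inj: "u = w" if "pt u = pt w" "u \<in> V" "w \<in> V" for u w
    using that inj by (auto simp: pt_def dest: inj_onD)
  have eV: "e \<subseteq> V" if "e \<in> E" for e using G that by (auto simp: simple_graph_def)
  show ?thesis unfolding planar_def
  proof (intro exI[of _ pt] exI[of _ \<gamma>] conjI ballI impI)
    show "inj_on pt V" using pt_inj by (auto simp: inj_on_def)
  next
    fix e assume e: "e \<in> E"
    show "arc (\<gamma> e)" using arc e by blast
    obtain a b where ab: "e = {a, b}" "pos a < pos b" "lo e = pos a" "hi e = pos b" using ends[OF e] by blast
    show p: "{pathstart (\<gamma> e), pathfinish (\<gamma> e)} = pt ` e" using arc[OF e] ab by (simp add: pt_def)
    show "path_image (\<gamma> e) \<inter> pt ` V = pt ` e"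
    proof (intro equalityI subsetI)
      fix z assume "z \<in> path_image (\<gamma> e) \<inter> pt ` V"
      then show "z \<in> pt ` e" using real_end[OF e] by (auto simp: pt_def)
    next
      fix z assume z: "z \<in> pt ` e"
      then have "z \<in> path_image (\<gamma> e)" using p pathstart_in_path_image pathfinish_in_path_image by (metis insertE singletonD)
      then show "z \<in> path_image (\<gamma> e) \<inter> pt ` V" using z eV[OF e] by blast
    qed
  next
    fix e f assume e: "e \<in> E" and f: "f \<in> E" and ef: "e \<noteq> f"
    show "path_image (\<gamma> e) \<inter> path_image (\<gamma> f) \<subseteq> pt ` (e \<inter> f)"
    proof
      fix z assume z: "z \<in> path_image (\<gamma> e) \<inter> path_image (\<gamma> f)"
      obtain a b where ab: "e = {a, b}" "pos a < pos b" "lo e = pos a" "hi e = pos b" "a \<in> V" "b \<in> V" using ends[OF e] by blast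
      obtain c d where cd: "f = {c, d}" "pos c < pos d" "lo f = pos c" "hi f = pos d" "c \<in> V" "d \<in> V" using ends[OF f] by blast
      let ?x = "Re z"
      have ze: "real (pos a) \<le> ?x" "?x \<le> pos b" "Im z = (if pg e then 1 else -1) * ((?x - pos a) * (pos b - ?x))"
        and zf: "real (pos c) \<le> ?x" "?x \<le> pos d" "Im z = (if pg f then 1 else -1) * ((?x - pos c) * (pos d - ?x))"
        using z im[OF e] im[OF f] ab cd by auto
      show "z \<in> pt ` (e \<inter> f)"
      proof (cases "Im z = 0")
        case True
        then obtain u w where "z = pt u" "u \<in> e" "z = pt w" "w \<in> f" using real_end[OF e] real_end[OF f] z by blast
        moreover from this have "u = w" using pt_inj eV[OF e] eV[OF f] by blast
        ultimately show ?thesis by blast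
      next
        case False
        have s: "real (pos a) < ?x" "?x < pos b" "real (pos c) < ?x" "?x < pos d"
          using False ze zf by (auto simp: less_le)
        then have pos: "(?x - pos a) * (pos b - ?x) > 0" "(?x - pos c) * (pos d - ?x) > 0" by simp_all
        \<comment> \<open>Away from the real axis the sign of the imaginary part reveals the
          page.\<close>
        have pg: "pg e = pg f" using ze(3) zf(3) pos by (auto split: if_splits)
        then have eq: "(?x - pos a) * (pos b - ?x) = (?x - pos c) * (pos d - ?x)" using ze(3) zf(3) by (auto split: if_splits)
        have ne: "real (pos a) \<noteq> pos c \<or> real (pos b) \<noteq> pos d"
        proof (rule ccontr)
          assume "\<not> ?thesis"
          then have "a = c" "b = d" using inj ab cd by (auto dest: inj_onD)
          then show False using ef ab cd by simp
        qed
        have cb: "pos c < pos b" "pos a < pos d" using s by linarith+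
        have n1: "\<not> (pos a < pos c \<and> pos b < pos d)" using nc[of a b c d] cb e f pg ab(1) cd(1) by blast
        have n2: "\<not> (pos c < pos a \<and> pos d < pos b)" using nc[of c d a b] cb e f pg ab(1) cd(1) by auto
        consider "pos a \<le> pos c" "pos d \<le> pos b" | "pos c \<le> pos a" "pos b \<le> pos d" using n1 n2 by linarith
        then show ?thesis
        proof cases
          case 1 then show ?thesis using parab_nested[of "pos a" "pos c" "pos d" "pos b" ?x] s ne eq by simp
        next
          case 2 then show ?thesis using parab_nested[of "pos c" "pos a" "pos b" "pos d" ?x] s ne eq by force
        qed
      qed
    qed
  qed
qed

section \<open>Constraint networks\<close>

text \<open>A network has keys and blocks. Each block is a 5-cycle; a position of a block is free, carries a
  colour-killing gadget, or is joined to a key. An adversary choosing lists makes each block forbid at most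
  one combination of colours of its keys, and may choose this combination.\<close>

datatype 'k att = Free | Kill | Key 'k
datatype ('k, 'b) bvx = K 'k | B 'b nat

lemma Suc_mod5: "Suc 0 mod 5 = 1" "Suc 1 mod 5 = 2" "Suc 2 mod 5 = 3" "Suc 3 mod 5 = 4" "Suc 4 mod 5 = 0"
  by simp_all

locale net =
  fixes Ks :: "'k set" and Bs :: "'b set" and att :: "'b \<Rightarrow> nat \<Rightarrow> 'k att"
  assumes att_Ks: "b \<in> Bs \<Longrightarrow> c < 5 \<Longrightarrow> att b c = Key k \<Longrightarrow> k \<in> Ks"
    and has_kill: "b \<in> Bs \<Longrightarrow> \<exists>c<5. att b c = Kill"
begin

definition FF :: "('k, 'b) bvx set" where
  "FF = K ` Ks \<union> {B b c | b c. b \<in> Bs \<and> c < 5 \<and> att b c = Kill}"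

definition VV :: "('k, 'b) bvx set" where
  "VV = K ` Ks \<union> {B b c | b c. b \<in> Bs \<and> c < 5}"

inductive badj :: "('k, 'b) bvx \<Rightarrow> ('k, 'b) bvx \<Rightarrow> bool" where
  badj_cyc: "b \<in> Bs \<Longrightarrow> c < 5 \<Longrightarrow> badj (B b c) (B b (Suc c mod 5))"
| badj_att: "b \<in> Bs \<Longrightarrow> c < 5 \<Longrightarrow> att b c = Key k \<Longrightarrow> badj (B b c) (K k)"

inductive nadj :: "('k, 'b) bvx \<times> nat \<Rightarrow> ('k, 'b) bvx \<times> nat \<Rightarrow> bool" where
  nadj_base: "badj x y \<Longrightarrow> nadj (x, 0) (y, 0)"
| nadj_gadget: "x \<in> FF \<Longrightarrow> (q, r) \<in> set gadget \<Longrightarrow> nadj (x, q) (x, r)"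

text \<open>Every base vertex receives 46 slots whether or not it carries a gadget, which keeps the
  numbering uniform; slots 1 to 45 of a vertex outside \<open>FF\<close> are isolated.\<close>

definition NV :: "(('k, 'b) bvx \<times> nat) set" where "NV = VV \<times> {..<46}"

definition proper :: "(('k, 'b) bvx \<times> nat \<Rightarrow> nat) \<Rightarrow> bool" where
  "proper col \<longleftrightarrow> (\<forall>u v. nadj u v \<longrightarrow> col u \<noteq> col v)"

lemma FF_VV: "FF \<subseteq> VV"
  by (auto simp: FF_def VV_def)

lemma proper_iff:
  "proper col \<longleftrightarrow> (\<forall>b\<in>Bs. cyc5 (col (B b 0, 0)) (col (B b 1, 0)) (col (B b 2, 0)) (col (B b 3, 0)) (col (B b 4, 0)) \<and>
     (\<forall>c<5. \<forall>k. att b c = Key k \<longrightarrow> col (B b c, 0) \<noteq> col (K k, 0))) \<and> (\<forall>x\<in>FF. gadget_proper (\<lambda>q. col (x, q)))"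
  (is "_ \<longleftrightarrow> ?R")
proof
  assume p: "proper col"
  have "cyc5 (col (B b 0, 0)) (col (B b 1, 0)) (col (B b 2, 0)) (col (B b 3, 0)) (col (B b 4, 0))" if "b \<in> Bs" for b
  proof -
    have "col (B b c, 0) \<noteq> col (B b (Suc c mod 5), 0)" if "c < 5" for c
      using p nadj_base[OF badj_cyc[OF \<open>b \<in> Bs\<close> that]] by (auto simp: proper_def)
    from this[of 0] this[of 1] this[of 2] this[of 3] this[of 4] show ?thesis unfolding Suc_mod5 cyc5_def by simp
  qed
  moreover have "gadget_proper (\<lambda>q. col (x, q))" if "x \<in> FF" for x
    using p nadj_gadget[OF that] by (auto simp: proper_def gadget_proper_def)
  moreover have "col (B b c, 0) \<noteq> col (K k, 0)" if "b \<in> Bs" "c < 5" "att b c = Key k" for b c k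
    using p nadj_base[OF badj_att[OF that]] by (auto simp: proper_def)
  ultimately show ?R by blast
next
  assume R: ?R
  show "proper col" unfolding proper_def
  proof (intro allI impI)
    fix u v assume "nadj u v"
    then show "col u \<noteq> col v"
    proof cases
      case (nadj_base x y)
      from nadj_base(3) show ?thesis
      proof cases
        case (badj_cyc b c)
        then have "cyc5 (col (B b 0, 0)) (col (B b 1, 0)) (col (B b 2, 0)) (col (B b 3, 0)) (col (B b 4, 0))" using R by blast
        moreover have "c = 0 \<or> c = 1 \<or> c = 2 \<or> c = 3 \<or> c = 4" using badj_cyc by linarith
        ultimately show ?thesis unfolding nadj_base badj_cyc by (elim disjE) (simp_all only: Suc_mod5 cyc5_def not_False_eq_True)
      next
        case (badj_att b c k) then show ?thesis using R nadj_base by blast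
      qed
    next
      case (nadj_gadget x q r)
      then show ?thesis using R by (auto simp: gadget_proper_def)
    qed
  qed
qed

lemma card3_Diff_eq: "card S = 3 \<Longrightarrow> S - {a} = P \<Longrightarrow> card P = 2 \<Longrightarrow> S - P = {a}"
  by (metis Diff_insert_absorb Diff_Diff_Int Int_insert_right_if1 card3_Diff1_eq inf_bot_right)

text \<open>What arbitrary lists can do at most. A gadget takes at most one colour from its root, so
  keys retain two. A block fails only if its five remaining lists equal the pair \<open>P b\<close>
  left at its \<open>Kill\<close> position, and then each joined key has the one colour
  \<open>\<kappa> b c\<close> of the list that is outside \<open>P b\<close>. A \<open>Free\<close>
  position keeps three colours and rescues its block.\<close>

theorem net_upper:
  assumes L: "\<forall>v\<in>NV. card (L v) = 3"
  shows "\<exists>A \<kappa>. (\<forall>k\<in>Ks. A k \<subseteq> L (K k, 0) \<and> 2 \<le> card (A k)) \<and>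
    (\<forall>f. (\<forall>k\<in>Ks. f k \<in> A k) \<longrightarrow> (\<forall>b\<in>Bs. \<exists>c<5. att b c = Free \<or> (\<exists>k. att b c = Key k \<and> f k \<noteq> \<kappa> b c)) \<longrightarrow>
      (\<exists>col. proper col \<and> (\<forall>v\<in>NV. col v \<in> L v)))"
proof -
  have L3: "card (L (x, q)) = 3" if "x \<in> VV" "q < 46" for x q using L that by (auto simp: NV_def)
  have "\<exists>\<kappa>. \<forall>\<alpha>. \<alpha> \<noteq> \<kappa> \<longrightarrow> (\<exists>g. g 0 = \<alpha> \<and> (\<forall>q\<in>{1..45}. g q \<in> L (x, q)) \<and> gadget_proper g)" if "x \<in> FF" for x
    by (rule gadget_kills_at_most_one) (use L3 FF_VV that in auto)
  then obtain \<kappa>H where \<kappa>H: "\<And>x \<alpha>. x \<in> FF \<Longrightarrow> \<alpha> \<noteq> \<kappa>H x \<Longrightarrow> \<exists>g. g 0 = \<alpha> \<and> (\<forall>q\<in>{1..45}. g q \<in> L (x, q)) \<and> gadget_proper g"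
    by metis
  define D where "D x = (if x \<in> FF then L (x, 0) - {\<kappa>H x} else L (x, 0))" for x
  have D: "2 \<le> card (D x)" "x \<notin> FF \<Longrightarrow> 3 \<le> card (D x)" "D x \<subseteq> L (x, 0)" if "x \<in> VV" for x
    using L3[OF that, of 0] card_Diff1_ge[of "L (x, 0)" "\<kappa>H x"] by (auto simp: D_def)
  define P where "P b = D (B b (SOME c. c < 5 \<and> att b c = Kill))" for b
  define \<kappa> where "\<kappa> b c = (SOME a. a \<in> L (B b c, 0) - P b)" for b c
  show ?thesis
  proof (rule exI[of _ "\<lambda>k. D (K k)"], rule exI[of _ \<kappa>], intro conjI allI impI)
    show "\<forall>k\<in>Ks. D (K k) \<subseteq> L (K k, 0) \<and> 2 \<le> card (D (K k))"
      using D by (auto simp: VV_def FF_def image_iff)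
    fix f assume f: "\<forall>k\<in>Ks. f k \<in> D (K k)" and sat: "\<forall>b\<in>Bs. \<exists>c<5. att b c = Free \<or> (\<exists>k. att b c = Key k \<and> f k \<noteq> \<kappa> b c)"
    define R where "R b c = (case att b c of Key k \<Rightarrow> L (B b c, 0) - {f k} | _ \<Rightarrow> D (B b c))" for b c
    have "\<exists>x0\<in>R b 0. \<exists>x1\<in>R b 1. \<exists>x2\<in>R b 2. \<exists>x3\<in>R b 3. \<exists>x4\<in>R b 4. cyc5 x0 x1 x2 x3 x4" if b: "b \<in> Bs" for b
    proof -
      have BV: "B b c \<in> VV" if "c < 5" for c using b that by (auto simp: VV_def)
      have R2: "2 \<le> card (R b c)" if "c < 5" for c
        using D(1)[OF BV[OF that]] L3[OF BV[OF that], of 0] card_Diff1_ge[of "L (B b c, 0)"] by (auto simp: R_def split: att.splits)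
      show ?thesis
      proof (rule cyc5_choose)
        show "\<not> (card (R b 0) = 2 \<and> R b 1 = R b 0 \<and> R b 2 = R b 0 \<and> R b 3 = R b 0 \<and> R b 4 = R b 0)"
        proof
          assume *: "card (R b 0) = 2 \<and> R b 1 = R b 0 \<and> R b 2 = R b 0 \<and> R b 3 = R b 0 \<and> R b 4 = R b 0"
          have eq: "R b c = R b 0" if "c < 5" for c
          proof -
            have "c = 0 \<or> c = 1 \<or> c = 2 \<or> c = 3 \<or> c = 4" using that by linarith
            then show ?thesis using * by (elim disjE) simp_all
          qed
          have "(SOME c. c < 5 \<and> att b c = Kill) < 5 \<and> att b (SOME c. c < 5 \<and> att b c = Kill) = Kill"
            by (rule someI_ex) (use has_kill[OF b] in blast)
          then have P: "P b = R b 0" using eq[of "SOME c. c < 5 \<and> att b c = Kill"] by (simp add: P_def R_def)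
          obtain c where c: "c < 5" "att b c = Free \<or> (\<exists>k. att b c = Key k \<and> f k \<noteq> \<kappa> b c)" using sat b by blast
          from c(2) show False
          proof
            assume "att b c = Free"
            then have "3 \<le> card (R b c)" using D(2)[OF BV[OF c(1)]] by (simp add: R_def FF_def image_iff)
            then show False using eq[OF c(1)] * by simp
          next
            assume "\<exists>k. att b c = Key k \<and> f k \<noteq> \<kappa> b c"
            then obtain k where k: "att b c = Key k" "f k \<noteq> \<kappa> b c" by blast
            then have "L (B b c, 0) - {f k} = P b" using eq[OF c(1)] P by (simp add: R_def)
            from card3_Diff_eq[OF L3[OF BV[OF c(1)]] this] have "L (B b c, 0) - P b = {f k}" using P * by simp
            then show False using k(2) by (simp add: \<kappa>_def)
          qed
        qed
      qed (use R2 in auto)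
    qed
    then obtain h where h: "\<And>b. b \<in> Bs \<Longrightarrow> h b 0 \<in> R b 0 \<and> h b 1 \<in> R b 1 \<and> h b 2 \<in> R b 2 \<and> h b 3 \<in> R b 3 \<and> h b 4 \<in> R b 4 \<and>
       cyc5 (h b 0) (h b 1) (h b 2) (h b 3) (h b (4::nat))"
    proof -
      assume g: "\<And>h. (\<And>b. b \<in> Bs \<Longrightarrow> h b 0 \<in> R b 0 \<and> h b 1 \<in> R b 1 \<and> h b 2 \<in> R b 2 \<and> h b 3 \<in> R b 3 \<and> h b 4 \<in> R b 4 \<and>
       cyc5 (h b 0) (h b 1) (h b 2) (h b 3) (h b (4::nat))) \<Longrightarrow> thesis"
      assume ex: "\<And>b. b \<in> Bs \<Longrightarrow> \<exists>x0\<in>R b 0. \<exists>x1\<in>R b 1. \<exists>x2\<in>R b 2. \<exists>x3\<in>R b 3. \<exists>x4\<in>R b 4. cyc5 x0 x1 x2 x3 x4"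
      have "\<exists>l. \<forall>b\<in>Bs. l b ! 0 \<in> R b 0 \<and> l b ! 1 \<in> R b 1 \<and> l b ! 2 \<in> R b 2 \<and> l b ! 3 \<in> R b 3 \<and> l b ! 4 \<in> R b 4 \<and>
       cyc5 (l b ! 0) (l b ! 1) (l b ! 2) (l b ! 3) (l b ! 4)"
      proof (rule bchoice, rule ballI)
        fix b assume "b \<in> Bs"
        from ex[OF this] obtain x0 x1 x2 x3 x4 where "x0 \<in> R b 0" "x1 \<in> R b 1" "x2 \<in> R b 2" "x3 \<in> R b 3" "x4 \<in> R b 4" "cyc5 x0 x1 x2 x3 x4" by blast
        then show "\<exists>l. l ! 0 \<in> R b 0 \<and> l ! 1 \<in> R b 1 \<and> l ! 2 \<in> R b 2 \<and> l ! 3 \<in> R b 3 \<and> l ! 4 \<in> R b 4 \<and> cyc5 (l ! 0) (l ! 1) (l ! 2) (l ! 3) (l ! 4)"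
          by (intro exI[of _ "[x0, x1, x2, x3, x4]"]) simp
      qed
      then obtain l where "\<forall>b\<in>Bs. l b ! 0 \<in> R b 0 \<and> l b ! 1 \<in> R b 1 \<and> l b ! 2 \<in> R b 2 \<and> l b ! 3 \<in> R b 3 \<and> l b ! 4 \<in> R b 4 \<and>
       cyc5 (l b ! 0) (l b ! 1) (l b ! 2) (l b ! 3) (l b ! 4)" by blast
      then show thesis by (intro g[of "\<lambda>b c. l b ! c"]) blast
    qed
    have hR: "h b c \<in> R b c" if "b \<in> Bs" "c < 5" for b c
    proof -
      have "c = 0 \<or> c = 1 \<or> c = 2 \<or> c = 3 \<or> c = 4" using that by linarith
      then show ?thesis using h[OF that(1)] by (elim disjE) simp_all
    qed
    define base where "base x = (case x of K k \<Rightarrow> f k | B b c \<Rightarrow> h b c)" for x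
    have baseD: "base x \<in> L (x, 0)" "x \<in> FF \<Longrightarrow> base x \<noteq> \<kappa>H x" if "x \<in> VV" for x
    proof -
      have "base x \<in> L (x, 0) \<and> (x \<in> FF \<longrightarrow> base x \<noteq> \<kappa>H x)"
      proof (cases x)
        case (K k)
        then have "f k \<in> D (K k)" using f that by (auto simp: VV_def)
        then show ?thesis using K by (auto simp: base_def D_def split: if_splits)
      next
        case (B b c)
        then have bc: "b \<in> Bs" "c < 5" using that by (auto simp: VV_def)
        show ?thesis
          using hR[OF bc] B by (auto simp: base_def R_def D_def FF_def split: att.splits if_splits)
      qed
      then show "base x \<in> L (x, 0)" "x \<in> FF \<Longrightarrow> base x \<noteq> \<kappa>H x" by auto
    qed
    have "\<exists>g. \<forall>x\<in>FF. g x 0 = base x \<and> (\<forall>q\<in>{1..45}. g x q \<in> L (x, q)) \<and> gadget_proper (g x)"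
      by (rule bchoice) (use \<kappa>H baseD(2) FF_VV in blast)
    then obtain g where g: "\<And>x. x \<in> FF \<Longrightarrow> g x 0 = base x \<and> (\<forall>q\<in>{1..45}. g x q \<in> L (x, q)) \<and> gadget_proper (g x)" by blast
    define col where "col v = (case v of (x, q) \<Rightarrow> if q = 0 then base x else if x \<in> FF then g x q else (SOME a. a \<in> L (x, q)))" for v
    show "\<exists>col. proper col \<and> (\<forall>v\<in>NV. col v \<in> L v)"
    proof (rule exI[of _ col], rule conjI)
      have "(\<lambda>q. col (x, q)) = g x" if "x \<in> FF" for x using g[OF that] that by (auto simp: col_def)
      then have "gadget_proper (\<lambda>q. col (x, q))" if "x \<in> FF" for x using g[OF that] that by simp
      moreover have "col (B b c, 0) \<noteq> col (K k, 0)" if "b \<in> Bs" "c < 5" "att b c = Key k" for b c k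
        using hR[OF that(1,2)] that by (auto simp: col_def base_def R_def)
      ultimately show "proper col" unfolding proper_iff using h by (auto simp: col_def base_def)
      show "\<forall>v\<in>NV. col v \<in> L v"
      proof
        fix v assume "v \<in> NV"
        then obtain x q where v: "v = (x, q)" "x \<in> VV" "q < 46" by (auto simp: NV_def)
        have "(SOME a. a \<in> L (x, q)) \<in> L (x, q)" using L3[OF v(2,3)] by (intro some_in_eq[THEN iffD2]) auto
        then show "col v \<in> L v" using v baseD(1)[OF v(2)] g[of x] by (auto simp: col_def)
      qed
    qed
  qed
qed

text \<open>Block vertices get the list \<open>{4, 5, \<kappa> b c}\<close>. If all keys of a block
  without \<open>Free\<close> positions show the forbidden colours, every vertex of the block is
  left with 4 and 5, which an odd cycle does not admit. The colours \<open>\<kappa>\<close> lie in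
  \<open>{1, 2, 3}\<close> so that these lists have three elements.\<close>

theorem net_lower:
  assumes Lk: "\<forall>k\<in>Ks. Lk k \<subseteq> {1..5} \<and> card (Lk k) = 3" and hk: "\<forall>k. hk k \<in> {1..5}"
    and \<kappa>: "\<forall>b c. \<kappa> b c \<in> {1, 2, 3}"
  shows "\<exists>L. (\<forall>v\<in>NV. L v \<subseteq> {1..5} \<and> card (L v) = 3) \<and>
    (\<forall>col. proper col \<longrightarrow> (\<forall>v\<in>NV. col v \<in> L v) \<longrightarrow>
      (\<forall>k\<in>Ks. col (K k, 0) \<in> Lk k) \<and> (\<forall>k\<in>Ks. col (K k, 0) \<noteq> hk k) \<and>
      (\<forall>b\<in>Bs. (\<forall>c<5. att b c \<noteq> Free) \<longrightarrow> (\<exists>c<5. \<exists>k. att b c = Key k \<and> col (K k, 0) \<noteq> \<kappa> b c)))"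
proof -
  define hx where "hx x = (case x of K k \<Rightarrow> hk k | B b c \<Rightarrow> \<kappa> b c)" for x
  have "hx x \<in> {1..5}" for x
  proof (cases x)
    case (K k) then show ?thesis using hk by (simp add: hx_def)
  next
    case (B b c) then show ?thesis using \<kappa>[rule_format, of b c] by (auto simp: hx_def)
  qed
  from gadget_kills_any[OF this] obtain G where
    G: "\<And>x q. q \<in> {1..45} \<Longrightarrow> G x q \<subseteq> {1..5} \<and> card (G x q) = 3"
      "\<And>x f. (\<forall>q\<in>{1..45}. f q \<in> G x q) \<Longrightarrow> gadget_proper f \<Longrightarrow> f 0 \<noteq> hx x"
    by metis
  define L where "L v = (case v of (x, q) \<Rightarrow> if q = 0 then (case x of K k \<Rightarrow> Lk k | B b c \<Rightarrow> {4, 5, \<kappa> b c}) else G x q)" for v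
  show ?thesis
  proof (rule exI[of _ L], intro conjI allI impI ballI)
    fix v assume "v \<in> NV"
    then obtain x q where v: "v = (x, q)" "x \<in> VV" "q < 46" by (auto simp: NV_def)
    have k: "{4, 5, \<kappa> b c} \<subseteq> {1..5} \<and> card {4, 5, \<kappa> b c} = 3" for b c using \<kappa>[rule_format, of b c] by auto
    have "L v \<subseteq> {1..5} \<and> card (L v) = 3"
      using v G(1)[of q x] Lk k by (cases x) (auto simp: L_def VV_def)
    then show "L v \<subseteq> {1..5}" "card (L v) = 3" by auto
  next
    fix col assume p: "proper col" and l: "\<forall>v\<in>NV. col v \<in> L v"
    have lx: "col (x, q) \<in> L (x, q)" if "x \<in> VV" "q < 46" for x q using l that by (auto simp: NV_def)
    have F: "col (x, 0) \<noteq> hx x" if "x \<in> FF" for x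
    proof -
      have "gadget_proper (\<lambda>q. col (x, q))" using p that unfolding proper_iff by blast
      moreover have "\<forall>q\<in>{1..45}. col (x, q) \<in> G x q"
      proof
        fix q :: nat assume q: "q \<in> {1..45}"
        then show "col (x, q) \<in> G x q" using lx[of x q] that FF_VV by (auto simp: L_def)
      qed
      ultimately show ?thesis using G(2)[of "\<lambda>q. col (x, q)" x] by blast
    qed
    show "col (K k, 0) \<in> Lk k" if "k \<in> Ks" for k using lx[of "K k" 0] that by (auto simp: L_def VV_def)
    show "col (K k, 0) \<noteq> hk k" if "k \<in> Ks" for k using F[of "K k"] that by (auto simp: FF_def hx_def)
    fix b assume b: "b \<in> Bs" and nf: "\<forall>c<5. att b c \<noteq> Free"
    show "\<exists>c<5. \<exists>k. att b c = Key k \<and> col (K k, 0) \<noteq> \<kappa> b c"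
    proof (rule ccontr)
      assume no: "\<not> ?thesis"
      have c: "col (B b c, 0) \<in> {4, 5}" if c: "c < 5" for c
      proof -
        have "col (B b c, 0) \<in> {4, 5, \<kappa> b c}" using lx[of "B b c" 0] b c by (auto simp: L_def VV_def)
        moreover have "col (B b c, 0) \<noteq> \<kappa> b c"
        proof (cases "att b c")
          case Free then show ?thesis using nf c by auto
        next
          case Kill
          then have "B b c \<in> FF" using b c by (auto simp: FF_def)
          then show ?thesis using F[of "B b c"] by (simp add: hx_def)
        next
          case (Key k)
          then have "col (B b c, 0) \<noteq> col (K k, 0)" using p b c unfolding proper_iff by blast
          then show ?thesis using no Key c by auto
        qed
        ultimately show ?thesis by blast
      qed
      have "cyc5 (col (B b 0, 0)) (col (B b 1, 0)) (col (B b 2, 0)) (col (B b 3, 0)) (col (B b 4, 0))"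
        using p b unfolding proper_iff by blast
      moreover have "{col (B b 0, 0), col (B b 1, 0), col (B b 2, 0), col (B b 3, 0), col (B b 4, 0)} \<subseteq> {4, 5}"
        using c[of 0] c[of 1] c[of 2] c[of 3] c[of 4] by simp
      ultimately show False using cyc5_two_colours[of "col (B b 0, 0)" "col (B b 1, 0)" "col (B b 2, 0)" "col (B b 3, 0)" "col (B b 4, 0)" 4 5] by simp
    qed
  qed
qed

end

section \<open>The cell network\<close>

text \<open>A cell \<open>(i, j)\<close> with \<open>i > 0\<close> belongs to clause \<open>i - 1\<close> and literal \<open>j\<close>; row 0 chooses the truth values.
  Eight arms \<open>X\<close> leave a cell in the directions N, NW, W, SW, S, SE, E, NE. Key 20 is the vertical wire leaving the
  cell to the south, key 21 the horizontal wire leaving it to the east, keys 16 to 19 are the inner ends of the four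
  diagonal arms. Arm \<open>X\<close> joins its root to the key \<open>X\<close> (block \<open>X\<close>), which is joined to the key \<open>8 + X\<close> (block
  \<open>8 + X\<close>); block \<open>16 + X\<close> joins both keys of arm \<open>X\<close> to both keys of the next arm, and block 24 joins the diagonal
  arms in the centre. Blocks 25 and 26 join the wires of a literal and of its negation; the latter is present for
  universal variables only.

  An arm is clean if the colour of its root differs from the one that its first block forbids. Each ring block demands a clean
  arm among its two arms, and the centre demands an unclean diagonal arm. So the vertical and the horizontal wire
  cross without interacting, unless the literal occurs in the clause: then the ring block between NW and W is
  satisfied for free, and a true literal makes the row true.\<close>

locale cells =
  fixes nv nc :: nat and U :: "nat \<Rightarrow> bool" and Occ :: "nat \<Rightarrow> nat \<Rightarrow> bool"
  assumes nv: "0 < nv"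
begin

text \<open>Arms in the even directions start at a wire on the border of the cell and grow inwards,
  diagonal arms start in the centre and grow outwards. So the key \<open>X\<close> next to the root
  is the outer one in the first case and the inner one in the second.\<close>

definition inner :: "nat \<Rightarrow> nat" where "inner X = (if even X then 8 + X else X)"
definition outer :: "nat \<Rightarrow> nat" where "outer X = (if even X then X else 8 + X)"

text \<open>At both ends of a row the wire is missing and a gadget replaces it; its forbidden colour
  makes the arm unclean at will. At the west end this says that no literal has satisfied the clause
  yet, at the east end it demands that the clause be satisfied.\<close>

definition root :: "nat \<Rightarrow> nat \<Rightarrow> nat \<Rightarrow> (nat \<times> nat \<times> nat) att" where
  "root i j X = (if X = 0 then Key (i - 1, j, 20) else if X = 2 then (if j = 0 then Kill else Key (i, j - 1, 21))
     else if X = 4 then Key (i, j, 20) else if X = 6 then (if Suc j = 2 * nv then Kill else Key (i, j, 21))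
     else Key (i, j, 16 + X div 2))"

fun att :: "nat \<times> nat \<times> nat \<Rightarrow> nat \<Rightarrow> (nat \<times> nat \<times> nat) att" where
  "att (i, j, b) c =
    (if i = 0 then (if c = 0 then Key (0, j, 20) else if c = 3 then Key (0, Suc j, 20) else Kill)
     else if b < 8 then (if c = 0 then root i j b else if c = 4 then Key (i, j, b) else Kill)
     else if b < 16 then (if c = 0 then Key (i, j, b - 8) else if c = 4 then Key (i, j, b) else Kill)
     else if b < 24 then
       (if c = 0 then (if b = 17 \<and> Occ (i - 1) j then Free else Key (i, j, inner (b - 16)))
        else if c = 1 then Key (i, j, outer (b - 16)) else if c = 3 then Key (i, j, outer ((b - 15) mod 8))
        else if c = 4 then Key (i, j, inner ((b - 15) mod 8)) else Kill)
     else if c = 0 then Key (i, j, 17) else if c = 1 then Key (i, j, 16) else if c = 2 then Key (i, j, 19)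
     else if c = 3 then Key (i, j, 18) else Kill)"

definition Ks :: "(nat \<times> nat \<times> nat) set" where
  "Ks = {(i, j, k). i \<le> nc \<and> j < 2 * nv \<and> k < 22 \<and> (i = 0 \<longrightarrow> k = 20)}"

definition Bs :: "(nat \<times> nat \<times> nat) set" where
  "Bs = {(i, j, b). i \<le> nc \<and> j < 2 * nv \<and> (if i = 0 then even j \<and> (b = 25 \<or> b = 26 \<and> U (j div 2)) else b < 25)}"

declare att.simps [simp del]

lemma att_top: "att (0, j, b) c = (if c = 0 then Key (0, j, 20) else if c = 3 then Key (0, Suc j, 20) else Kill)"
  by (simp add: att.simps)

lemma att_arm: "X < 8 \<Longrightarrow> att (Suc i, j, X) 0 = root (Suc i) j X" "X < 8 \<Longrightarrow> att (Suc i, j, X) 4 = Key (Suc i, j, X)"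
  "X < 8 \<Longrightarrow> c \<noteq> 0 \<Longrightarrow> c \<noteq> 4 \<Longrightarrow> att (Suc i, j, X) c = Kill"
  by (simp_all add: att.simps)

lemma att_arm': "X < 8 \<Longrightarrow> att (Suc i, j, 8 + X) 0 = Key (Suc i, j, X)" "X < 8 \<Longrightarrow> att (Suc i, j, 8 + X) 4 = Key (Suc i, j, 8 + X)"
  "X < 8 \<Longrightarrow> c \<noteq> 0 \<Longrightarrow> c \<noteq> 4 \<Longrightarrow> att (Suc i, j, 8 + X) c = Kill"
  by (simp_all add: att.simps)

lemma att_ring: assumes "X < 8"
  shows "att (Suc i, j, 16 + X) 0 = (if X = 1 \<and> Occ i j then Free else Key (Suc i, j, inner X))"
    "att (Suc i, j, 16 + X) 1 = Key (Suc i, j, outer X)" "att (Suc i, j, 16 + X) 2 = Kill"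
    "att (Suc i, j, 16 + X) 3 = Key (Suc i, j, outer (Suc X mod 8))"
    "att (Suc i, j, 16 + X) 4 = Key (Suc i, j, inner (Suc X mod 8))"
  using assms by (simp_all add: att.simps Suc_diff_le)

lemma att_centre: "att (Suc i, j, 24) 0 = Key (Suc i, j, 17)" "att (Suc i, j, 24) 1 = Key (Suc i, j, 16)"
  "att (Suc i, j, 24) 2 = Key (Suc i, j, 19)" "att (Suc i, j, 24) 3 = Key (Suc i, j, 18)" "att (Suc i, j, 24) 4 = Kill"
  by (simp_all add: att.simps)

lemma even_less: "even j \<Longrightarrow> j < 2 * m \<Longrightarrow> Suc j < 2 * m" for m :: nat
  by (elim evenE) simp

lemma Suc_mod8: "Suc 0 mod 8 = 1" "Suc 1 mod 8 = 2" "Suc 2 mod 8 = 3" "Suc 3 mod 8 = 4" "Suc 4 mod 8 = 5"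
  "Suc 5 mod 8 = 6" "Suc 6 mod 8 = 7" "Suc 7 mod 8 = 0"
  by simp_all

lemma body_cases:
  fixes b :: nat
  assumes "b < 25"
  obtains X where "X < 8" "b = X" | X where "X < 8" "b = 8 + X" | X where "X < 8" "b = 16 + X" | "b = 24"
proof -
  consider "b < 8" | "8 \<le> b \<and> b < 16" | "16 \<le> b \<and> b < 24" | "b = 24" using assms by linarith
  then show thesis
  proof cases
    case 2 then show thesis using that(2)[of "b - 8"] by simp
  next
    case 3 then show thesis using that(3)[of "b - 16"] by simp
  qed (use that in auto)
qed

lemma less5: "c < 5 \<Longrightarrow> c = 0 \<or> c = 1 \<or> c = 2 \<or> c = 3 \<or> c = (4::nat)"
  by linarith

lemma less8: "X < 8 \<Longrightarrow> X = 0 \<or> X = 1 \<or> X = 2 \<or> X = 3 \<or> X = 4 \<or> X = 5 \<or> X = 6 \<or> X = (7::nat)"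
  by linarith

sublocale net Ks Bs att
proof
  fix b c k assume b: "b \<in> Bs" and c: "c < 5" and k: "att b c = Key k"
  obtain i j b' where ijb: "b = (i, j, b')" by (cases b)
  have ij: "i \<le> nc" "j < 2 * nv" using b ijb by (auto simp: Bs_def split: if_splits)
  show "k \<in> Ks"
  proof (cases i)
    case 0
    then have "even j" using b ijb by (simp add: Bs_def)
    then have "Suc j < 2 * nv" using even_less ij by blast
    then show ?thesis using k ij unfolding ijb 0 att_top by (auto simp: Ks_def split: if_splits)
  next
    case (Suc i')
    then have "b' < 25" using b ijb by (simp add: Bs_def)
    then show ?thesis
    proof (cases rule: body_cases)
      case (1 X)
      show ?thesis using k ij c 1 unfolding ijb Suc by (auto simp: att.simps root_def Ks_def split: if_splits)
    next
      case (2 X)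
      show ?thesis using k ij c 2 unfolding ijb Suc by (auto simp: att.simps Ks_def split: if_splits)
    next
      case (3 X)
      have "inner Y < 22 \<and> outer Y < 22" if "Y < 8" for Y using that by (auto simp: inner_def outer_def)
      then have "inner X < 22 \<and> outer X < 22 \<and> inner (Suc X mod 8) < 22 \<and> outer (Suc X mod 8) < 22" using 3 by simp
      then show ?thesis using k ij less5[OF c] unfolding ijb Suc 3
        by (auto simp: att_ring[OF 3(1)] Ks_def simp del: One_nat_def split: if_splits)
    next
      case 4
      show ?thesis using k ij less5[OF c] unfolding ijb Suc 4 by (auto simp: att.simps Ks_def split: if_splits)
    qed
  qed
next
  fix b assume b: "b \<in> Bs"
  obtain i j b' where ijb: "b = (i, j, b')" by (cases b)
  show "\<exists>c<5. att b c = Kill"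
  proof (cases i)
    case 0
    then show ?thesis unfolding ijb by (intro exI[of _ 1]) (simp add: att_top)
  next
    case (Suc i')
    then have "b' < 25" using b ijb by (simp add: Bs_def)
    then show ?thesis
    proof (cases rule: body_cases)
      case (1 X)
      show ?thesis unfolding ijb Suc 1(2) by (rule exI[of _ 1]) (simp add: att_arm[OF 1(1)])
    next
      case (2 X)
      show ?thesis unfolding ijb Suc 2(2) by (rule exI[of _ 1]) (simp add: att_arm'[OF 2(1)])
    next
      case (3 X)
      show ?thesis unfolding ijb Suc 3(2) by (rule exI[of _ 2]) (simp add: att_ring[OF 3(1)])
    next
      case 4
      show ?thesis unfolding ijb Suc 4 by (rule exI[of _ 4]) (simp add: att_centre)
    qed
  qed
qed

definition sat :: "(nat \<times> nat \<times> nat \<Rightarrow> nat) \<Rightarrow> (nat \<times> nat \<times> nat \<Rightarrow> nat \<Rightarrow> nat) \<Rightarrow> nat \<times> nat \<times> nat \<Rightarrow> bool" where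
  "sat f \<kappa> b \<longleftrightarrow> (\<exists>c<5. att b c = Free \<or> (\<exists>k. att b c = Key k \<and> f k \<noteq> \<kappa> b c))"

lemma sat_Key: "att b c = Key k \<Longrightarrow> c < 5 \<Longrightarrow> f k \<noteq> \<kappa> b c \<Longrightarrow> sat f \<kappa> b"
  unfolding sat_def by blast

lemma sat_Free: "att b c = Free \<Longrightarrow> c < 5 \<Longrightarrow> sat f \<kappa> b"
  unfolding sat_def by blast

text \<open>The two keys of a clean arm have at least four pairs of colours, and only three blocks restrict them: this is why
  an arm has two keys.\<close>

lemma avoid3:
  assumes "2 \<le> card A" "2 \<le> card A'"
  shows "\<exists>x\<in>A. \<exists>y\<in>A'. (x, y) \<noteq> p \<and> (x, y) \<noteq> q \<and> (x, y) \<noteq> r"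
proof (rule ccontr)
  assume "\<not> ?thesis"
  then have "A \<times> A' \<subseteq> {p, q, r}" by blast
  then have "card (A \<times> A') \<le> card {p, q, r}" by (rule card_mono[rotated]) simp
  also have "\<dots> \<le> 3" by (simp add: card_insert_if)
  finally have "card A * card A' \<le> 3" by (simp add: card_cartesian_product)
  moreover have "2 * 2 \<le> card A * card A'" using assms by (rule mult_le_mono)
  ultimately show False by simp
qed

definition pick :: "nat set \<Rightarrow> nat \<Rightarrow> nat" where
  "pick A a = (SOME x. x \<in> A \<and> x \<noteq> a)"

lemma pick: "2 \<le> card A \<Longrightarrow> pick A a \<in> A" "2 \<le> card A \<Longrightarrow> pick A a \<noteq> a"
  using someI_ex[of "\<lambda>x. x \<in> A \<and> x \<noteq> a"] ex_in_Diff1[of A a] by (auto simp: pick_def)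

text \<open>For an existential variable (one block), either literal vertex can take a colour that is good for its
  column; for a universal one at least one of them can.\<close>

lemma top_choose:
  assumes "2 \<le> card A" "2 \<le> card A'"
  shows "\<exists>x\<in>A. \<exists>y\<in>A'. x \<noteq> p \<and> (x, y) \<noteq> k" "\<exists>x\<in>A. \<exists>y\<in>A'. y \<noteq> p \<and> (x, y) \<noteq> k"
    "(\<exists>x\<in>A. \<exists>y\<in>A'. x \<noteq> p \<and> (x, y) \<noteq> k \<and> (x, y) \<noteq> l) \<or> (\<exists>x\<in>A. \<exists>y\<in>A'. y \<noteq> q \<and> (x, y) \<noteq> k \<and> (x, y) \<noteq> l)"
proof -
  obtain a where a: "a \<in> A" "a \<noteq> p" using ex_in_Diff1[OF assms(1)] by blast
  obtain b where b: "b \<in> A'" "b \<noteq> snd k" using ex_in_Diff1[OF assms(2)] by blast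
  show "\<exists>x\<in>A. \<exists>y\<in>A'. x \<noteq> p \<and> (x, y) \<noteq> k" using a b by (intro bexI[of _ a] bexI[of _ b]) auto
  obtain a' where a': "a' \<in> A" "a' \<noteq> fst k" using ex_in_Diff1[OF assms(1)] by blast
  obtain b' where b': "b' \<in> A'" "b' \<noteq> p" using ex_in_Diff1[OF assms(2)] by blast
  show "\<exists>x\<in>A. \<exists>y\<in>A'. y \<noteq> p \<and> (x, y) \<noteq> k" using a' b' by (intro bexI[of _ a'] bexI[of _ b']) auto
  show "(\<exists>x\<in>A. \<exists>y\<in>A'. x \<noteq> p \<and> (x, y) \<noteq> k \<and> (x, y) \<noteq> l) \<or> (\<exists>x\<in>A. \<exists>y\<in>A'. y \<noteq> q \<and> (x, y) \<noteq> k \<and> (x, y) \<noteq> l)"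
  proof (cases "fst k = a \<and> fst l = a")
    case False
    then consider "fst k \<noteq> a" | "fst l \<noteq> a" by blast
    then show ?thesis
    proof cases
      case 1
      obtain b where "b \<in> A'" "b \<noteq> snd l" using ex_in_Diff1[OF assms(2)] by blast
      then show ?thesis using a 1 by (intro disjI1 bexI[of _ a] bexI[of _ b]) auto
    next
      case 2
      then show ?thesis using a b by (intro disjI1 bexI[of _ a] bexI[of _ b]) auto
    qed
  next
    case True
    obtain c where c: "c \<in> A" "c \<noteq> a" using ex_in_Diff1[OF assms(1)] by blast
    obtain d where d: "d \<in> A'" "d \<noteq> q" using ex_in_Diff1[OF assms(2)] by blast
    show ?thesis using c d True by (intro disjI2 bexI[of _ c] bexI[of _ d]) auto
  qed
qed

text \<open>The solver knows the lists and plays a satisfying assignment: vertical wires carry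
  \<open>T j\<close>, horizontal wires carry \<open>\<rho>\<close>, the truth of the clause
  restricted to the literals so far. Every wire and arm spends its freedom where this value requires
  it.\<close>

lemma upper:
  assumes q: "qcnf nv nc U Occ" and A: "\<forall>k\<in>Ks. 2 \<le> card (A k)"
  shows "\<exists>f. (\<forall>k\<in>Ks. f k \<in> A k) \<and> (\<forall>b\<in>Bs. sat f \<kappa> b)"
proof -
  define good where "good v b x y \<longleftrightarrow> x \<in> A (0, 2 * v, 20) \<and> y \<in> A (0, Suc (2 * v), 20) \<and>
      (if b then x \<noteq> \<kappa> (1, 2 * v, 0) 0 else y \<noteq> \<kappa> (1, Suc (2 * v), 0) 0) \<and>
      (x, y) \<noteq> (\<kappa> (0, 2 * v, 25) 0, \<kappa> (0, 2 * v, 25) 3) \<and>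
      (U v \<longrightarrow> (x, y) \<noteq> (\<kappa> (0, 2 * v, 26) 0, \<kappa> (0, 2 * v, 26) 3))" for v b x y
  have A0: "2 \<le> card (A (0, 2 * v, 20))" "2 \<le> card (A (0, Suc (2 * v), 20))" if "v < nv" for v
    using that by (auto intro!: A[rule_format] simp: Ks_def)
  \<comment> \<open>The lists are fixed first: for each variable \<open>\<sigma>\<close> is a value
    that they permit even with both blocks present. The quantified formula answers it with values
    for the existential variables, where either value can be realised.\<close>
  define \<sigma> where "\<sigma> v \<longleftrightarrow> (\<exists>x y. good v True x y)" for v
  have \<sigma>: "\<exists>x y. good v (\<sigma> v) x y" if "v < nv" for v
  proof -
    from top_choose(3)[OF A0[OF that], of "\<kappa> (1, 2 * v, 0) 0" "(\<kappa> (0, 2 * v, 25) 0, \<kappa> (0, 2 * v, 25) 3)"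
      "(\<kappa> (0, 2 * v, 26) 0, \<kappa> (0, 2 * v, 26) 3)" "\<kappa> (1, Suc (2 * v), 0) 0"]
    have "(\<exists>x y. good v True x y) \<or> (\<exists>x y. good v False x y)" unfolding good_def if_True if_False by meson
    then show ?thesis by (cases "\<sigma> v") (auto simp: \<sigma>_def)
  qed
  obtain \<tau> where \<tau>: "\<And>v. v < nv \<Longrightarrow> U v \<Longrightarrow> \<tau> v = \<sigma> v" "\<And>c. c < nc \<Longrightarrow> \<exists>l<2 * nv. Occ c l \<and> \<tau> (l div 2) = even l"
    using q unfolding qcnf_def by blast
  have "\<exists>x y. good v (\<tau> v) x y" if v: "v < nv" for v
  proof (cases "U v")
    case True then show ?thesis using \<sigma>[OF v] \<tau>(1)[OF v] by simp
  next
    case False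
    then show ?thesis
      using top_choose(1)[OF A0[OF v], of "\<kappa> (1, 2 * v, 0) 0" "(\<kappa> (0, 2 * v, 25) 0, \<kappa> (0, 2 * v, 25) 3)"]
        top_choose(2)[OF A0[OF v], of "\<kappa> (1, Suc (2 * v), 0) 0" "(\<kappa> (0, 2 * v, 25) 0, \<kappa> (0, 2 * v, 25) 3)"]
      unfolding good_def by (cases "\<tau> v"; simp only: if_True if_False simp_thms) meson+
  qed
  then obtain rp rm where r: "\<And>v. v < nv \<Longrightarrow> good v (\<tau> v) (rp v) (rm v)" by metis
  define T where "T j \<longleftrightarrow> \<tau> (j div 2) = even j" for j
  define \<rho> where "\<rho> i j \<longleftrightarrow> (\<exists>j'\<le>j. Occ (i - 1) j' \<and> T j')" for i j
  define lft where "lft i j \<longleftrightarrow> 0 < j \<and> \<rho> i (j - 1)" for i j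
  \<comment> \<open>A wire is the root of two arms and can avoid the forbidden colour of one of
    them. True is passed on: the north arm of the next cell becomes clean. Otherwise the south arm
    of the own cell does. The horizontal wire \<open>h6\<close> is treated likewise.\<close>
  define h4 where "h4 i j = (if i = 0 then if even j then rp (j div 2) else rm (j div 2)
     else if T j then pick (A (i, j, 20)) (\<kappa> (Suc i, j, 0) 0) else pick (A (i, j, 20)) (\<kappa> (i, j, 4) 0))" for i j
  define h6 where "h6 i j = (if \<rho> i j then pick (A (i, j, 21)) (\<kappa> (i, Suc j, 2) 0) else pick (A (i, j, 21)) (\<kappa> (i, j, 6) 0))" for i j
  \<comment> \<open>the diagonal arm that need not be clean, because its neighbours are\<close>
  define free where "free i j = (if T j then if Occ (i - 1) j \<or> lft i j then 1 else 7 else if lft i j then 3 else (5::nat))" for i j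
  define zp where "zp X = (if X = 3 then 0 else if X = 1 then 1 else if X = 7 then 2 else (3::nat))" for X :: nat
  define hd where "hd i j X = (if X = free i j then pick (A (i, j, 16 + X div 2)) (\<kappa> (i, j, 24) (zp X))
     else pick (A (i, j, 16 + X div 2)) (\<kappa> (i, j, X) 0))" for i j X
  define clean where "clean i j X \<longleftrightarrow> (if X = 0 then T j else if X = 2 then lft i j else if X = 4 then \<not> T j
     else if X = 6 then \<not> \<rho> i j else X \<noteq> free i j)" for i j X
  \<comment> \<open>The root of a clean arm settles block \<open>X\<close>, so the two keys are free
    to settle block \<open>8 + X\<close> and the adjoining ring blocks \<open>16 + X\<close> and
    \<open>16 + (X + 7) mod 8\<close>. An arm that is not clean must settle block \<open>X\<close>
    with its first key and block \<open>8 + X\<close> with its second, and is of no help to the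
    ring.\<close>
  define ok where "ok i j X x y \<longleftrightarrow> x \<in> A (i, j, X) \<and> y \<in> A (i, j, 8 + X) \<and> (x, y) \<noteq> (\<kappa> (i, j, 8 + X) 0, \<kappa> (i, j, 8 + X) 4) \<and>
     (if clean i j X then (x, y) \<noteq> (\<kappa> (i, j, 16 + X) (if even X then 1 else 0), \<kappa> (i, j, 16 + X) (if even X then 0 else 1)) \<and>
        (x, y) \<noteq> (\<kappa> (i, j, 16 + (X + 7) mod 8) (if even X then 3 else 4), \<kappa> (i, j, 16 + (X + 7) mod 8) (if even X then 4 else 3))
      else x \<noteq> \<kappa> (i, j, X) 4)" for i j X x y
  have "\<exists>x y. ok i j X x y" if c: "2 \<le> card (A (i, j, X))" "2 \<le> card (A (i, j, 8 + X))" for i j X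
  proof (cases "clean i j X")
    case True
    from avoid3[OF c, of "(\<kappa> (i, j, 8 + X) 0, \<kappa> (i, j, 8 + X) 4)"
        "(\<kappa> (i, j, 16 + X) (if even X then 1 else 0), \<kappa> (i, j, 16 + X) (if even X then 0 else 1))"
        "(\<kappa> (i, j, 16 + (X + 7) mod 8) (if even X then 3 else 4), \<kappa> (i, j, 16 + (X + 7) mod 8) (if even X then 4 else 3))"]
    obtain x y where "ok i j X x y" unfolding ok_def if_P[OF True] by blast
    then show ?thesis by blast
  next
    case False
    obtain x where "x \<in> A (i, j, X)" "x \<noteq> \<kappa> (i, j, X) 4" using ex_in_Diff1[OF c(1)] by blast
    moreover obtain y where "y \<in> A (i, j, 8 + X)" "y \<noteq> \<kappa> (i, j, 8 + X) 4" using ex_in_Diff1[OF c(2)] by blast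
    ultimately show ?thesis using False unfolding ok_def by (rule_tac exI[of _ x], rule_tac exI[of _ y]) simp
  qed
  then obtain hx hy where xy: "\<And>i j X. 2 \<le> card (A (i, j, X)) \<Longrightarrow> 2 \<le> card (A (i, j, 8 + X)) \<Longrightarrow> ok i j X (hx i j X) (hy i j X)"
    by metis
  define f where "f = (\<lambda>(i, j, k). if k < 8 then hx i j k else if k < 16 then hy i j (k - 8) else if k = 20 then h4 i j
     else if k = 21 then h6 i j else hd i j (2 * (k - 16) + 1))"
  have f: "X < 8 \<Longrightarrow> f (i, j, X) = hx i j X" "X < 8 \<Longrightarrow> f (i, j, 8 + X) = hy i j X" "f (i, j, 20) = h4 i j" "f (i, j, 21) = h6 i j"
    "f (i, j, 16) = hd i j 1" "f (i, j, 17) = hd i j 3" "f (i, j, 18) = hd i j 5" "f (i, j, 19) = hd i j 7" for i j X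
    by (simp_all add: f_def)
  have body: "k < 22 \<Longrightarrow> 2 \<le> card (A (Suc i, j, k))" if "Suc i \<le> nc" "j < 2 * nv" for i j k
    using that by (intro A[rule_format]) (simp add: Ks_def)
  have oks: "ok (Suc i) j X (f (Suc i, j, X)) (f (Suc i, j, 8 + X))" if "Suc i \<le> nc" "j < 2 * nv" "X < 8" for i j X
    unfolding f(1,2)[OF that(3)] by (rule xy) (use body[OF that(1,2)] that(3) in auto)
  have gj: "good (j div 2) (\<tau> (j div 2)) (rp (j div 2)) (rm (j div 2))" if "j < 2 * nv" for j
    by (rule r) (use that in auto)
  have h4A: "h4 i j \<in> A (i, j, 20)" if "i \<le> nc" "j < 2 * nv" for i j
  proof (cases i)
    case 0
    have "j = 2 * (j div 2) \<or> j = Suc (2 * (j div 2))" by presburger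
    then show ?thesis using gj[OF that(2)] by (cases "even j") (auto simp: h4_def 0 good_def)
  next
    case (Suc i') then show ?thesis using body[of i' j 20] that by (auto simp: h4_def intro!: pick)
  qed
  have dpos: "X \<in> {1, 3, 5, 7} \<Longrightarrow> 16 + X div 2 < 22" for X :: nat by auto
  have "\<forall>k\<in>Ks. f k \<in> A k"
  proof
    fix k assume "k \<in> Ks"
    then obtain i j l where k: "k = (i, j, l)" "i \<le> nc" "j < 2 * nv" "l < 22" "i = 0 \<longrightarrow> l = 20" by (auto simp: Ks_def)
    show "f k \<in> A k"
    proof (cases i)
      case 0 then show ?thesis using h4A[OF k(2,3)] k by (simp add: f)
    next
      case (Suc i')
      note b = body[of i' j] 
      consider "l < 8" | "8 \<le> l \<and> l < 16" | "l = 16" | "l = 17" | "l = 18" | "l = 19" | "l = 20" | "l = 21" using k(4) by linarith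
      then show ?thesis
      proof cases
        case 1 then show ?thesis using oks[of i' j l] k Suc by (simp add: ok_def)
      next
        case 2
        then have "l - 8 < 8" by linarith
        then show ?thesis using oks[of i' j "l - 8"] k Suc 2 by (simp add: ok_def)
      next
        case 7 then show ?thesis using h4A[OF k(2,3)] k by (simp add: f)
      qed (use b k Suc in \<open>auto simp: f hd_def h6_def intro!: pick\<close>)
    qed
  qed
  moreover have "sat f \<kappa> b" if "b \<in> Bs" for b
  proof -
    obtain i j b' where b: "b = (i, j, b')" by (cases b)
    have ij: "i \<le> nc" "j < 2 * nv" using that b by (auto simp: Bs_def split: if_splits)
    show ?thesis
    proof (cases i)
      case 0
      then have j: "even j" "b' = 25 \<or> b' = 26 \<and> U (j div 2)" using that b by (auto simp: Bs_def)
      then have "f (0, j, 20) = rp (j div 2)" "f (0, Suc j, 20) = rm (j div 2)" "2 * (j div 2) = j" by (auto simp: f h4_def)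
      then have "f (0, j, 20) \<noteq> \<kappa> b 0 \<or> f (0, Suc j, 20) \<noteq> \<kappa> b 3" using j gj[OF ij(2)] by (auto simp: good_def b 0)
      then show ?thesis
      proof
        assume "f (0, j, 20) \<noteq> \<kappa> b 0" then show ?thesis by (intro sat_Key[of b 0]) (simp_all add: b 0 att_top)
      next
        assume "f (0, Suc j, 20) \<noteq> \<kappa> b 3" then show ?thesis by (intro sat_Key[of b 3]) (simp_all add: b 0 att_top)
      qed
    next
      case (Suc i')
      note i = Suc
      have si: "Suc i' \<le> nc" using ij i by simp
      note bd = body[OF si ij(2)]
      have root: "\<exists>k. root (Suc i') j X = Key k \<and> f k \<noteq> \<kappa> (Suc i', j, X) 0" if X: "X < 8" and cl: "clean (Suc i') j X" for X
      proof -
        have top: "h4 i' j \<noteq> \<kappa> (Suc i', j, 0) 0" if "T j"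
        proof (cases i')
          case 0
          have "j = 2 * (j div 2) \<or> j = Suc (2 * (j div 2))" by presburger
          then show ?thesis using gj[OF ij(2)] that by (cases "even j") (auto simp: 0 h4_def good_def T_def)
        next
          case (Suc i'') then show ?thesis using body[of i'' j 20] si ij(2) that by (auto simp: h4_def intro!: pick)
        qed
        have wrap: "\<rho> (Suc i') j" if "Suc j = 2 * nv"
        proof -
          obtain l where "l < 2 * nv" "Occ i' l" "\<tau> (l div 2) = even l" using \<tau>(2)[of i'] si by auto
          then show ?thesis using that by (auto simp: \<rho>_def T_def intro!: exI[of _ l])
        qed
        have w: "h6 (Suc i') (j - 1) \<noteq> \<kappa> (Suc i', j, 2) 0" if "lft (Suc i') j"
          using that body[of i' "j - 1" 21] si ij(2) by (auto simp: h6_def lft_def intro!: pick)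
        from less8[OF X] show ?thesis
        proof (elim disjE)
          assume "X = 0" then show ?thesis using cl top by (simp add: root_def clean_def f)
        next
          assume "X = 2" then show ?thesis using cl w by (auto simp: root_def clean_def f lft_def)
        next
          assume "X = 4" then show ?thesis using cl bd[of 20] by (auto simp: root_def clean_def f h4_def intro!: pick)
        next
          assume "X = 6" then show ?thesis using cl wrap bd[of 21] by (auto simp: root_def clean_def f h6_def intro!: pick)
        next
          assume "X = 1" then show ?thesis using cl bd[of 16] by (auto simp: root_def clean_def f hd_def intro!: pick)
        next
          assume "X = 3" then show ?thesis using cl bd[of 17] by (auto simp: root_def clean_def f hd_def intro!: pick)
        next
          assume "X = 5" then show ?thesis using cl bd[of 18] by (auto simp: root_def clean_def f hd_def intro!: pick)
        next
          assume "X = 7" then show ?thesis using cl bd[of 19] by (auto simp: root_def clean_def f hd_def intro!: pick)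
        qed
      qed
      have "b' < 25" using that b i by (simp add: Bs_def)
      then show ?thesis
      proof (cases rule: body_cases)
        case (1 X)
        note a = att_arm[OF 1(1), of i' j]
        show ?thesis
        proof (cases "clean (Suc i') j X")
          case True
          from root[OF 1(1) this] obtain k where k: "root (Suc i') j X = Key k" "f k \<noteq> \<kappa> (Suc i', j, X) 0" by blast
          then show ?thesis unfolding b i 1(2) using a(1) by (intro sat_Key[of "(Suc i', j, X)" 0 k]) auto
        next
          case False
          then show ?thesis using oks[OF si ij(2) 1(1)] unfolding b i 1(2) using a(2)
            by (intro sat_Key[of "(Suc i', j, X)" 4]) (auto simp: ok_def)
        qed
      next
        case (2 X)
        note a = att_arm'[OF 2(1), of i' j]
        have "f (Suc i', j, X) \<noteq> \<kappa> (Suc i', j, 8 + X) 0 \<or> f (Suc i', j, 8 + X) \<noteq> \<kappa> (Suc i', j, 8 + X) 4"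
          using oks[OF si ij(2) 2(1)] by (auto simp: ok_def)
        then show ?thesis unfolding b i 2(2) using sat_Key[OF a(1)] sat_Key[OF a(2)] by auto
      next
        case (3 X)
        note a = att_ring[OF 3(1), of i' j]
        have \<rho>S: "\<rho> (Suc i') j \<longleftrightarrow> lft (Suc i') j \<or> Occ i' j \<and> T j"
          by (cases j) (auto simp: \<rho>_def lft_def le_Suc_eq)
        have "clean (Suc i') j X \<or> clean (Suc i') j (Suc X mod 8) \<or> X = 1 \<and> Occ i' j"
          using less8[OF 3(1)] by (elim disjE) (auto simp: clean_def free_def \<rho>S)
        then show ?thesis
        proof (elim disjE)
          assume cl: "clean (Suc i') j X"
          have "f (Suc i', j, inner X) \<noteq> \<kappa> (Suc i', j, 16 + X) 0 \<or> f (Suc i', j, outer X) \<noteq> \<kappa> (Suc i', j, 16 + X) 1"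
            using oks[OF si ij(2) 3(1)] cl by (auto simp: ok_def inner_def outer_def split: if_splits)
          then show ?thesis unfolding b i 3(2)
          proof
            assume n: "f (Suc i', j, inner X) \<noteq> \<kappa> (Suc i', j, 16 + X) 0"
            show "sat f \<kappa> (Suc i', j, 16 + X)"
            proof (cases "X = 1 \<and> Occ i' j")
              case True
              then have "att (Suc i', j, 16 + X) 0 = Free" unfolding a(1) by (rule if_P)
              then show ?thesis by (rule sat_Free) simp
            next
              case False
              then have "att (Suc i', j, 16 + X) 0 = Key (Suc i', j, inner X)" unfolding a(1) by (rule if_not_P)
              from sat_Key[OF this, of f \<kappa>] n show ?thesis by simp
            qed
          qed (rule sat_Key[OF a(2)], simp)
        next
          define Y where "Y = Suc X mod 8"
          assume cl: "clean (Suc i') j (Suc X mod 8)"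
          have Y: "Y < 8" "(Y + 7) mod 8 = X" using 3(1) by (auto simp: Y_def mod_simps)
          have "f (Suc i', j, outer Y) \<noteq> \<kappa> (Suc i', j, 16 + X) 3 \<or> f (Suc i', j, inner Y) \<noteq> \<kappa> (Suc i', j, 16 + X) 4"
            using oks[OF si ij(2) Y(1)] cl unfolding Y_def[symmetric] ok_def Y(2) by (auto simp: inner_def outer_def split: if_splits)
          then show ?thesis unfolding b i 3(2) Y_def
          proof
            assume "f (Suc i', j, outer (Suc X mod 8)) \<noteq> \<kappa> (Suc i', j, 16 + X) 3"
            then show "sat f \<kappa> (Suc i', j, 16 + X)" by (rule sat_Key[OF a(4), rotated]) simp
          next
            assume "f (Suc i', j, inner (Suc X mod 8)) \<noteq> \<kappa> (Suc i', j, 16 + X) 4"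
            then show "sat f \<kappa> (Suc i', j, 16 + X)" by (rule sat_Key[OF a(5), rotated]) simp
          qed
        next
          assume "X = 1 \<and> Occ i' j"
          then show ?thesis unfolding b i 3(2) using a(1) by (intro sat_Free[of _ 0]) auto
        qed
      next
        case 4
        have "hd (Suc i') j (free (Suc i') j) \<noteq> \<kappa> (Suc i', j, 24) (zp (free (Suc i') j))"
          using bd[of 16] bd[of 17] bd[of 18] bd[of 19] by (auto simp: hd_def free_def intro!: pick)
        moreover have "free (Suc i') j = 1 \<or> free (Suc i') j = 3 \<or> free (Suc i') j = 5 \<or> free (Suc i') j = 7"
          by (simp add: free_def)
        ultimately show ?thesis
          using sat_Key[OF att_centre(1), where f = f and \<kappa> = \<kappa>] sat_Key[OF att_centre(2), where f = f and \<kappa> = \<kappa>]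
            sat_Key[OF att_centre(3), where f = f and \<kappa> = \<kappa>] sat_Key[OF att_centre(4), where f = f and \<kappa> = \<kappa>]
          unfolding b i 4 f by (elim disjE) (simp_all add: zp_def)
      qed
    qed
  qed
  ultimately show ?thesis by blast
qed

text \<open>The worst lists: all keys have the colours 1 and 2 left, and colour 1 of a wire means true.\<close>

definition bad :: "(nat \<Rightarrow> bool) \<Rightarrow> nat \<times> nat \<times> nat \<Rightarrow> nat \<Rightarrow> nat" where
  "bad \<sigma> = (\<lambda>(i, j, b) c. if i = 0 then (if b = 25 \<or> (c = 0) \<noteq> \<sigma> (j div 2) then 1 else 2)
     else if b < 8 then (if c = 0 \<and> (b = 0 \<or> b = 2) then 2 else 1) else if b < 16 then (if c = 0 then 2 else 1) else 2)"

text \<open>Against \<open>bad\<close>, an arm whose root shows the forbidden colour ends up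
  \<open>dirty\<close>, with both keys coloured 2, and a ring block without a free position rejects
  two consecutive dirty arms. The centre leaves some diagonal root with colour 1 and hence a dirty
  diagonal arm. What a cell can transmit then follows by propositional reasoning.\<close>

lemma lower:
  assumes f: "\<And>k. k \<in> Ks \<Longrightarrow> f k \<in> {1, 2}"
    and sat: "\<And>b. b \<in> Bs \<Longrightarrow> (\<forall>c<5. att b c \<noteq> Free) \<Longrightarrow> \<exists>c<5. \<exists>k. att b c = Key k \<and> f k \<noteq> bad \<sigma> b c"
  shows "\<exists>\<tau>. (\<forall>v<nv. U v \<longrightarrow> \<tau> v = \<sigma> v) \<and> (\<forall>c<nc. \<exists>l<2 * nv. Occ c l \<and> \<tau> (l div 2) = even l)"
proof -
  \<comment> \<open>Only one direction is needed: truth on a wire must be inherited, vertically from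
    above, horizontally from the left or from a true literal of the clause. It may get lost on the
    way. The end of a row behaves like a wire with colour 1.\<close>
  have cell: "(f (Suc i, j, 20) = 1 \<longrightarrow> f (i, j, 20) = 1) \<and> ((Suc j = 2 * nv \<or> f (Suc i, j, 21) = 1) \<longrightarrow>
      0 < j \<and> f (Suc i, j - 1, 21) = 1 \<or> Occ i j \<and> f (i, j, 20) = 1)"
    if ij: "Suc i \<le> nc" "j < 2 * nv" for i j
  proof -
    define dirty where "dirty X \<longleftrightarrow> f (Suc i, j, X) = 2 \<and> f (Suc i, j, 8 + X) = 2" for X
    have f2: "f (Suc i, j, k) = 1 \<or> f (Suc i, j, k) = 2" if "k < 22" for k
      using f[of "(Suc i, j, k)"] that ij by (auto simp: Ks_def)
    have B: "(Suc i, j, b) \<in> Bs" if "b < 25" for b using that ij by (simp add: Bs_def)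
    have d: "dirty X" if X: "X < 8" and k: "\<And>k. root (Suc i) j X = Key k \<Longrightarrow> f k = (if X = 0 \<or> X = 2 then 2 else 1)" for X
    proof -
      have "\<forall>c<5. att (Suc i, j, X) c \<noteq> Free" using X by (auto simp: att.simps root_def)
      from sat[OF B this] obtain c k' where c: "c < 5" "att (Suc i, j, X) c = Key k'" "f k' \<noteq> bad \<sigma> (Suc i, j, X) c" using X by auto
      then have "c = 0 \<or> c = 4" using att_arm(3)[OF X, of c i j] by fastforce
      then have x: "f (Suc i, j, X) \<noteq> 1"
      proof
        assume "c = 0"
        then have "root (Suc i) j X = Key k'" using c(2) att_arm(1)[OF X, of i j] by simp
        from k[OF this] have False using c(3) X \<open>c = 0\<close> by (simp add: bad_def split: if_splits)
        then show ?thesis ..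
      next
        assume "c = 4" then show ?thesis using c X att_arm(2)[OF X, of i j] by (auto simp: bad_def)
      qed
      have "\<forall>c<5. att (Suc i, j, 8 + X) c \<noteq> Free" using X by (auto simp: att.simps)
      from sat[OF B this] obtain c k' where c: "c < 5" "att (Suc i, j, 8 + X) c = Key k'" "f k' \<noteq> bad \<sigma> (Suc i, j, 8 + X) c"
        using X by auto
      then have "c = 0 \<or> c = 4" using att_arm'(3)[OF X, of c i j] by fastforce
      then have "f (Suc i, j, X) \<noteq> 2 \<or> f (Suc i, j, 8 + X) \<noteq> 1"
        using c X att_arm'(1,2)[OF X, of i j] by (auto simp: bad_def)
      then show ?thesis using x f2[of X] f2[of "8 + X"] X by (auto simp: dirty_def)
    qed
    have r: "\<not> (dirty X \<and> dirty Y)" if X: "X < 8" "\<not> (X = 1 \<and> Occ i j)" and Y: "Y = Suc X mod 8" for X Y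
    proof
      assume dd: "dirty X \<and> dirty Y"
      have io: "f (Suc i, j, inner Y) = 2 \<and> f (Suc i, j, outer Y) = 2" if "dirty Y" for Y
        using that by (auto simp: dirty_def inner_def outer_def)
      have a: "att (Suc i, j, 16 + X) 0 = Key (Suc i, j, inner X)" using att_ring(1)[OF X(1), of i j] if_not_P[OF X(2)] by metis
      have "\<forall>c<5. att (Suc i, j, 16 + X) c \<noteq> Free"
      proof (intro allI impI)
        fix c :: nat assume "c < 5"
        from less5[OF this] show "att (Suc i, j, 16 + X) c \<noteq> Free"
          by (elim disjE) (simp_all only: a att_ring(2-)[OF X(1)], simp_all)
      qed
      from sat[OF B this] obtain c k' where c: "c < 5" "att (Suc i, j, 16 + X) c = Key k'" "f k' \<noteq> bad \<sigma> (Suc i, j, 16 + X) c"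
        using X by auto
      have b: "bad \<sigma> (Suc i, j, 16 + X) c = 2" using X by (simp add: bad_def)
      from less5[OF c(1)] show False
      proof (elim disjE)
        assume "c = 0" then show False using c b a io dd by auto
      next
        assume "c = 1" then show False using c b att_ring(2)[OF X(1)] io dd by auto
      next
        assume "c = 2" then show False using c b att_ring(3)[OF X(1)] io dd by auto
      next
        assume "c = 3" then show False using c b att_ring(4)[OF X(1)] io dd unfolding Y by auto
      next
        assume "c = 4" then show False using c b att_ring(5)[OF X(1)] io dd unfolding Y by auto
      qed
    qed
    have "\<forall>c<5. att (Suc i, j, 24) c \<noteq> Free" by (auto simp: att.simps)
    from sat[OF B this] obtain c k' where c: "c < 5" "att (Suc i, j, 24) c = Key k'" "f k' \<noteq> bad \<sigma> (Suc i, j, 24) c" by auto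
    have "bad \<sigma> (Suc i, j, 24) c = 2" by (simp add: bad_def)
    then have z: "f (Suc i, j, 16) = 1 \<or> f (Suc i, j, 17) = 1 \<or> f (Suc i, j, 18) = 1 \<or> f (Suc i, j, 19) = 1"
      using c less5[OF c(1)] f2[of 16] f2[of 17] f2[of 18] f2[of 19] by (auto simp: att.simps)
    have d1: "f (Suc i, j, 16) = 1 \<Longrightarrow> dirty 1" "f (Suc i, j, 17) = 1 \<Longrightarrow> dirty 3" "f (Suc i, j, 18) = 1 \<Longrightarrow> dirty 5"
      "f (Suc i, j, 19) = 1 \<Longrightarrow> dirty 7" by (rule d; simp add: root_def)+
    have d0: "f (i, j, 20) \<noteq> 1 \<Longrightarrow> dirty 0"
      using f[of "(i, j, 20)"] ij by (intro d) (auto simp: root_def Ks_def)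
    have d2: "\<not> (0 < j \<and> f (Suc i, j - 1, 21) = 1) \<Longrightarrow> dirty 2"
      using f[of "(Suc i, j - 1, 21)"] ij by (intro d) (auto simp: root_def Ks_def split: if_splits)
    have d4: "f (Suc i, j, 20) = 1 \<Longrightarrow> dirty 4" by (rule d) (auto simp: root_def)
    have d6: "Suc j = 2 * nv \<or> f (Suc i, j, 21) = 1 \<Longrightarrow> dirty 6" by (rule d) (auto simp: root_def split: if_splits)
    have r': "\<not> (dirty 0 \<and> dirty 1)" "Occ i j \<or> \<not> (dirty 1 \<and> dirty 2)" "\<not> (dirty 2 \<and> dirty 3)" "\<not> (dirty 3 \<and> dirty 4)"
      "\<not> (dirty 4 \<and> dirty 5)" "\<not> (dirty 5 \<and> dirty 6)" "\<not> (dirty 6 \<and> dirty 7)" "\<not> (dirty 7 \<and> dirty 0)"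
      using r[of 0 1] r[of 1 2] r[of 2 3] r[of 3 4] r[of 4 5] r[of 5 6] r[of 6 7] r[of 7 0]
      by (simp_all only: Suc_mod8 simp_thms) auto
    show ?thesis using z d0 d1 d2 d4 d6 r' by satx
  qed
  have down: "f (i, j, 20) = 1 \<longrightarrow> f (0, j, 20) = 1" if "i \<le> nc" "j < 2 * nv" for i j
    using that by (induction i) (use cell in auto)
  have right: "Suc j = 2 * nv \<or> f (Suc i, j, 21) = 1 \<longrightarrow> (\<exists>l\<le>j. Occ i l \<and> f (i, l, 20) = 1)" if "Suc i \<le> nc" "j < 2 * nv" for i j
    using that(2)
  proof (induction j)
    case 0 then show ?case using cell[OF that(1), of 0] by auto
  next
    case (Suc j)
    then show ?case using cell[OF that(1), of "Suc j"] by (auto intro: le_SucI)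
  qed
  have top: "b = 25 \<or> b = 26 \<and> U v \<Longrightarrow> f (0, 2 * v, 20) \<noteq> bad \<sigma> (0, 2 * v, b) 0 \<or> f (0, Suc (2 * v), 20) \<noteq> bad \<sigma> (0, 2 * v, b) 3"
    if "v < nv" for v b
  proof -
    assume b: "b = 25 \<or> b = 26 \<and> U v"
    have "(0, 2 * v, b) \<in> Bs" using b that by (auto simp: Bs_def)
    moreover have "\<forall>c<5. att (0, 2 * v, b) c \<noteq> Free" by (simp add: att_top)
    ultimately obtain c k where c: "c < 5" "att (0, 2 * v, b) c = Key k" "f k \<noteq> bad \<sigma> (0, 2 * v, b) c" using sat by blast
    then show ?thesis by (auto simp: att_top split: if_splits)
  qed
  \<comment> \<open>Block 25 rules out that both literals of a variable are true, block 26 that the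
    literal chosen by \<open>\<sigma>\<close> is false while its negation is true. Both literals may
    be false; then neither satisfies a clause, and any value of the variable will do.\<close>
  define \<tau> where "\<tau> v \<longleftrightarrow> (if U v then \<sigma> v else f (0, 2 * v, 20) = 1)" for v
  have lit: "\<tau> (l div 2) = even l" if l: "l < 2 * nv" "f (0, l, 20) = 1" for l
  proof -
    define v where "v = l div 2"
    have v: "v < nv" using l by (auto simp: v_def)
    have k: "f (0, 2 * v, 20) \<in> {1, 2}" "f (0, Suc (2 * v), 20) \<in> {1, 2}" by (rule f; use v in \<open>simp add: Ks_def\<close>)+
    have t25: "f (0, 2 * v, 20) \<noteq> 1 \<or> f (0, Suc (2 * v), 20) \<noteq> 1" using top[OF v, of 25] by (simp add: bad_def)
    have t26: "U v \<Longrightarrow> f (0, 2 * v, 20) \<noteq> (if \<sigma> v then 2 else 1) \<or> f (0, Suc (2 * v), 20) \<noteq> (if \<sigma> v then 1 else 2)"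
      using top[OF v, of 26] by (auto simp: bad_def split: if_splits)
    have "l = 2 * v \<or> l = Suc (2 * v)" unfolding v_def by presburger
    then show ?thesis
    proof
      assume "l = 2 * v" then show ?thesis using l k t25 t26 by (auto simp: \<tau>_def split: if_splits)
    next
      assume "l = Suc (2 * v)" then show ?thesis using l k t25 t26 by (auto simp: \<tau>_def split: if_splits)
    qed
  qed
  show ?thesis
  proof (intro exI[of _ \<tau>] conjI allI impI)
    show "\<tau> v = \<sigma> v" if "v < nv" "U v" for v using that by (simp add: \<tau>_def)
    fix c assume c: "c < nc"
    have "\<exists>l\<le>2 * nv - 1. Occ c l \<and> f (c, l, 20) = 1" using right[of c "2 * nv - 1"] c nv by simp
    then obtain l where "l < 2 * nv" "Occ c l" "f (c, l, 20) = 1" using nv by (metis Suc_pred' le_imp_less_Suc nat_0_less_mult_iff zero_less_numeral)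
    then show "\<exists>l<2 * nv. Occ c l \<and> \<tau> (l div 2) = even l" using down[of c l] lit[of l] c by auto
  qed
qed

theorem network_choosable:
  "qcnf nv nc U Occ \<longleftrightarrow> (\<forall>L. (\<forall>v\<in>NV. L v \<subseteq> {1..5} \<and> card (L v) = 3) \<longrightarrow> (\<exists>col. proper col \<and> (\<forall>v\<in>NV. col v \<in> L v)))"
  (is "_ \<longleftrightarrow> ?R")
proof
  assume q: "qcnf nv nc U Occ"
  show ?R
  proof (intro allI impI)
    fix L :: "_ \<Rightarrow> nat set" assume L: "\<forall>v\<in>NV. L v \<subseteq> {1..5} \<and> card (L v) = (3::nat)"
    then have "\<forall>v\<in>NV. card (L v) = 3" by blast
    from net_upper[of L, OF this] obtain A \<kappa> where A: "\<forall>k\<in>Ks. A k \<subseteq> L (K k, 0) \<and> 2 \<le> card (A k)"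
      and *: "\<forall>f. (\<forall>k\<in>Ks. f k \<in> A k) \<longrightarrow> (\<forall>b\<in>Bs. \<exists>c<5. att b c = Free \<or> (\<exists>k. att b c = Key k \<and> f k \<noteq> \<kappa> b c)) \<longrightarrow>
        (\<exists>col. proper col \<and> (\<forall>v\<in>NV. col v \<in> L v))"
      by (elim exE conjE) (rule that)
    have "\<forall>k\<in>Ks. 2 \<le> card (A k)" using A by blast
    from upper[OF q this] obtain f where "\<forall>k\<in>Ks. f k \<in> A k" "\<forall>b\<in>Bs. sat f \<kappa> b" by blast
    then show "\<exists>col. proper col \<and> (\<forall>v\<in>NV. col v \<in> L v)" using * unfolding sat_def by blast
  qed
next
  assume R: ?R
  show "qcnf nv nc U Occ" unfolding qcnf_def
  proof
    fix \<sigma> :: "nat \<Rightarrow> bool"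
    have bad: "\<forall>b c. bad \<sigma> b c \<in> {1, 2, 3}" by (auto simp: bad_def split: prod.splits)
    \<comment> \<open>Key lists \<open>{1, 2, 3}\<close> whose gadgets kill 3 leave precisely the
      two truth values.\<close>
    have L123: "\<forall>k\<in>Ks. {1, 2, 3} \<subseteq> {1..5::nat} \<and> card {1, 2, 3::nat} = 3" and h3: "\<forall>k. 3 \<in> {1..5::nat}" by auto
    from net_lower[of "\<lambda>_. {1, 2, 3}" "\<lambda>_. 3" "bad \<sigma>", OF L123 h3 bad] obtain L where L: "\<forall>v\<in>NV. L v \<subseteq> {1..5} \<and> card (L v) = (3::nat)"
      and *: "\<forall>col. proper col \<longrightarrow> (\<forall>v\<in>NV. col v \<in> L v) \<longrightarrow>
        (\<forall>k\<in>Ks. col (K k, 0) \<in> {1, 2, 3}) \<and> (\<forall>k\<in>Ks. col (K k, 0) \<noteq> 3) \<and>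
        (\<forall>b\<in>Bs. (\<forall>c<5. att b c \<noteq> Free) \<longrightarrow> (\<exists>c<5. \<exists>k. att b c = Key k \<and> col (K k, 0) \<noteq> bad \<sigma> b c))"
      by (elim exE conjE) (rule that)
    from R L obtain col where col: "proper col" "\<forall>v\<in>NV. col v \<in> L v" by blast
    show "\<exists>\<tau>. (\<forall>v<nv. U v \<longrightarrow> \<tau> v = \<sigma> v) \<and> (\<forall>c<nc. \<exists>l<2 * nv. Occ c l \<and> \<tau> (l div 2) = even l)"
      by (rule lower[of "\<lambda>k. col (K k, 0)"]) (use *[rule_format, OF col(1) col(2)[rule_format]] in blast)+
  qed
qed

end

section \<open>The drawing of a cell\<close>

text \<open>Within a cell, the number of a key is at most 21, and position \<open>c\<close> of block \<open>b\<close> has number \<open>22 + 5 * b + c\<close>.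
  The tables were found by computer: \<open>places\<close> lists the positions of the 157 numbers along the spine of a two-page book
  embedding, \<open>template ! a\<close> the right ends of the edges with left end \<open>a\<close> and their pages (an end beyond 156 lies in the next
  cell), and \<open>labels\<close> is a homomorphism to the 5-cycle. The lists for the gadget are analogous. \<open>attachments\<close> has
  the edges between blocks and keys of the same cell.\<close>

definition attachments :: "(nat \<times> nat \<times> nat) list" where
  "attachments =
    [(0,4,0), (1,0,16), (1,4,1), (2,4,2), (3,0,17), (3,4,3), (4,0,20), (4,4,4), (5,0,18), (5,4,5), (6,0,21),
    (6,4,6), (7,0,19), (7,4,7), (8,0,0), (8,4,8), (9,0,1), (9,4,9), (10,0,2), (10,4,10), (11,0,3), (11,4,11),
    (12,0,4), (12,4,12), (13,0,5), (13,4,13), (14,0,6), (14,4,14), (15,0,7), (15,4,15), (16,0,8), (16,1,0),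
    (16,3,9), (16,4,1), (17,0,1), (17,1,9), (17,3,2), (17,4,10), (18,0,10), (18,1,2), (18,3,11), (18,4,3),
    (19,0,3), (19,1,11), (19,3,4), (19,4,12), (20,0,12), (20,1,4), (20,3,13), (20,4,5), (21,0,5), (21,1,13),
    (21,3,6), (21,4,14), (22,0,14), (22,1,6), (22,3,15), (22,4,7), (23,0,7), (23,1,15), (23,3,0), (23,4,8),
    (24,0,17), (24,1,16), (24,2,19), (24,3,18)]"

definition places :: "nat list" where
  "places =
    [111, 29, 117, 28, 22, 51, 73, 91, 105, 35, 128, 139, 16, 10, 62, 74, 104, 97, 98, 90, 145, 146, 4, 3, 2, 1,
    0, 45, 44, 43, 42, 41, 116, 115, 114, 113, 112, 50, 49, 48, 47, 46, 144, 143, 142, 141, 140, 92, 93, 94, 95,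
    96, 5, 6, 7, 8, 9, 89, 88, 87, 86, 85, 110, 109, 108, 107, 106, 30, 31, 32, 33, 34, 118, 119, 120, 121, 122,
    138, 137, 136, 135, 134, 21, 20, 19, 18, 17, 52, 53, 54, 55, 56, 72, 71, 70, 69, 68, 79, 78, 77, 76, 75, 40,
    39, 38, 37, 36, 127, 126, 125, 124, 123, 129, 130, 131, 132, 133, 27, 26, 25, 24, 23, 15, 14, 13, 12, 11,
    57, 58, 59, 60, 61, 67, 66, 65, 64, 63, 80, 81, 82, 83, 84, 103, 102, 101, 100, 99, 147, 148, 149, 150, 151,
    152, 153, 154, 155, 156]"

definition labels :: "nat list" where
  "labels =
    [1, 1, 4, 2, 1, 3, 2, 2, 0, 2, 0, 1, 0, 2, 1, 1, 0, 1, 0, 1, 0, 3, 4, 3, 2, 1, 0, 4, 3, 2, 1, 0, 4, 3, 2, 1,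
    0, 2, 3, 4, 0, 1, 1, 0, 4, 3, 2, 1, 0, 4, 3, 2, 2, 3, 4, 0, 1, 2, 3, 4, 0, 1, 0, 1, 2, 3, 4, 0, 4, 3, 2, 1,
    0, 4, 3, 2, 1, 1, 2, 3, 4, 0, 0, 1, 2, 3, 4, 2, 3, 4, 0, 1, 1, 2, 3, 4, 0, 1, 2, 3, 4, 0, 1, 0, 4, 3, 2, 0,
    1, 2, 3, 4, 4, 0, 1, 2, 3, 3, 2, 1, 0, 4, 1, 0, 4, 3, 2, 4, 3, 2, 1, 0, 2, 3, 4, 0, 1, 3, 2, 1, 0, 4, 2, 1,
    0, 4, 3, 1, 2, 3, 4, 0, 1, 2, 3, 4, 0]"

definition glabels :: "nat list" where
  "glabels =
    [0, 1, 1, 2, 0, 4, 3, 4, 0, 4, 0, 1, 3, 2, 2, 1, 1, 2, 0, 4, 3, 4, 0, 4, 0, 1, 3, 2, 2, 1, 1, 1, 2, 0, 4, 3,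
    4, 0, 4, 0, 1, 3, 2, 2, 1, 0]"

definition template :: "(nat \<times> bool) list list" where
  "template =
    [[(4,False), (111,False), (1,True)], [(2,True)], [(3,False)], [(4,True)], [], [(6,True), (9,True),
    (146,True)], [(7,False)], [(8,False)], [(9,False)], [(73,False)], [(56,False), (58,False), (12,True)],
    [(15,False), (51,False), (12,True)], [(13,True)], [(14,True)], [(15,True), (22,True)], [(16,True)],
    [(23,False), (17,True)], [(21,False), (18,True)], [(19,True)], [(20,False)], [(21,False)], [(22,True)],
    [(24,True), (140,True)], [(27,False), (24,True)], [(25,True)], [(26,True)], [(27,True), (139,True)],
    [(28,False)], [(46,False), (133,True), (138,True)], [(36,False), (41,False), (30,True), (127,True)],
    [(31,False), (34,False)], [(32,True)], [(33,True)], [(34,True)], [(35,True)], [(37,True), (126,True)],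
    [(40,False), (37,True)], [(38,True)], [(39,True)], [(40,True), (111,True)], [(105,True)], [(45,False),
    (42,True)], [(43,True)], [(44,True)], [(45,True)], [(104,True)], [(50,False), (47,True)], [(48,True)],
    [(49,True)], [(50,True)], [(97,True)], [(52,False), (57,True), (96,True)], [(56,False), (53,True)],
    [(54,True)], [(55,False)], [(56,False)], [], [(58,True), (61,True)], [(59,False)], [(60,False)],
    [(61,False), (73,False)], [(62,False)], [(67,False), (68,False)], [(64,False), (67,False), (91,True)],
    [(65,False), (74,True)], [(66,False)], [(67,True), (73,True)], [], [(69,False), (72,True)], [(70,False)],
    [(71,False)], [(72,True)], [(73,False)], [], [(75,False), (81,False)], [(76,False), (79,True)],
    [(77,False)], [(78,False)], [(79,True)], [(91,True)], [(81,False), (84,True), (91,True)], [(82,False)],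
    [(83,False)], [(84,False), (111,False)], [(105,False)], [(86,False), (89,True), (91,True)], [(87,False)],
    [(88,False)], [(89,False)], [(90,False)], [(101,False)], [], [(93,False), (96,False), (98,False)],
    [(94,True)], [(95,True)], [(96,True)], [], [(103,True)], [(100,False)], [(100,False), (103,True)],
    [(101,False)], [(102,True)], [(104,False), (103,True)], [], [], [(106,False)], [(110,False), (107,True)],
    [(108,True)], [(109,True)], [(110,True)], [(111,False)], [], [(116,False), (113,True), (117,True)],
    [(114,True)], [(115,True)], [(116,False)], [], [(130,False), (118,True), (124,True)], [(122,False),
    (119,True)], [(120,True)], [(121,True)], [(122,True)], [(128,False)], [(127,False), (128,False),
    (124,True)], [(125,True)], [(126,True)], [(127,True)], [], [(129,False)], [(130,False), (133,True)],
    [(131,False)], [(132,True)], [(139,False), (133,True)], [], [(138,False), (139,False), (135,True)],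
    [(136,True)], [(137,True)], [(138,True)], [], [], [(144,False), (141,True)], [(142,True)], [(143,True)],
    [(144,False)], [(145,False)], [], [(273,False)], [], [], [], [], [], [], [], [], [], []]"

definition top_template :: "(nat \<times> bool) list list" where
  "top_template = replicate 145 [] @ [[(147,False), (152,True)], [], [(148,False), (151,True)], [(149,False)], [(150,False)], [(151,False), (302,False)], [], [(156,False), (153,True)], [(154,True)], [(155,True)], [(156,True), (302,True)], []]"

definition gadget_template :: "(nat \<times> bool) list list" where
  "gadget_template =
    [[(1,False), (2,False), (15,False), (16,False), (29,False), (30,False), (31,False), (44,False)], [(4,True),
    (45,True)], [(3,False), (4,True)], [(6,False), (15,False)], [(5,False)], [(6,False), (45,True)], [(7,False),
    (13,False), (14,False)], [(8,False), (12,False), (45,True)], [(9,False), (15,True)], [(10,False),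
    (12,False)], [(11,False), (15,True)], [(13,True), (14,True)], [(13,False)], [], [(15,False)], [(18,True),
    (45,True)], [(17,False), (18,True)], [(20,False), (29,False)], [(19,False)], [(20,False), (45,True)],
    [(21,False), (27,False), (28,False)], [(22,False), (26,False), (45,True)], [(23,False), (29,True)],
    [(24,False), (26,False)], [(25,False), (29,True)], [(27,True), (28,True)], [(27,False)], [], [(29,False)],
    [(45,True)], [(33,True), (45,True)], [(32,False), (33,True)], [(35,False), (44,False)], [(34,False)],
    [(35,False), (45,True)], [(36,False), (42,False), (43,False)], [(37,False), (41,False), (45,True)],
    [(38,False), (44,True)], [(39,False), (41,False)], [(40,False), (44,True)], [(42,True), (43,True)],
    [(42,False)], [], [(44,False)], [(45,True)], []]"

text \<open>One rewrite rule per index: the table checks below look up entries thousands of times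
  and would otherwise unfold the lists each time.\<close>

lemma places_nth:
  "places ! 0 = 111" "places ! 1 = 29" "places ! 2 = 117" "places ! 3 = 28" "places ! 4 = 22" "places ! 5 = 51"
  "places ! 6 = 73" "places ! 7 = 91" "places ! 8 = 105" "places ! 9 = 35" "places ! 10 = 128" "places ! 11 =
  139" "places ! 12 = 16" "places ! 13 = 10" "places ! 14 = 62" "places ! 15 = 74" "places ! 16 = 104" "places !
  17 = 97" "places ! 18 = 98" "places ! 19 = 90" "places ! 20 = 145" "places ! 21 = 146" "places ! 22 = 4"
  "places ! 23 = 3" "places ! 24 = 2" "places ! 25 = 1" "places ! 26 = 0" "places ! 27 = 45" "places ! 28 = 44"
  "places ! 29 = 43" "places ! 30 = 42" "places ! 31 = 41" "places ! 32 = 116" "places ! 33 = 115" "places ! 34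
  = 114" "places ! 35 = 113" "places ! 36 = 112" "places ! 37 = 50" "places ! 38 = 49" "places ! 39 = 48"
  "places ! 40 = 47" "places ! 41 = 46" "places ! 42 = 144" "places ! 43 = 143" "places ! 44 = 142" "places ! 45
  = 141" "places ! 46 = 140" "places ! 47 = 92" "places ! 48 = 93" "places ! 49 = 94" "places ! 50 = 95" "places
  ! 51 = 96" "places ! 52 = 5" "places ! 53 = 6" "places ! 54 = 7" "places ! 55 = 8" "places ! 56 = 9" "places !
  57 = 89" "places ! 58 = 88" "places ! 59 = 87" "places ! 60 = 86" "places ! 61 = 85" "places ! 62 = 110"
  "places ! 63 = 109" "places ! 64 = 108" "places ! 65 = 107" "places ! 66 = 106" "places ! 67 = 30" "places !
  68 = 31" "places ! 69 = 32" "places ! 70 = 33" "places ! 71 = 34" "places ! 72 = 118" "places ! 73 = 119"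
  "places ! 74 = 120" "places ! 75 = 121" "places ! 76 = 122" "places ! 77 = 138" "places ! 78 = 137" "places !
  79 = 136" "places ! 80 = 135" "places ! 81 = 134" "places ! 82 = 21" "places ! 83 = 20" "places ! 84 = 19"
  "places ! 85 = 18" "places ! 86 = 17" "places ! 87 = 52" "places ! 88 = 53" "places ! 89 = 54" "places ! 90 =
  55" "places ! 91 = 56" "places ! 92 = 72" "places ! 93 = 71" "places ! 94 = 70" "places ! 95 = 69" "places !
  96 = 68" "places ! 97 = 79" "places ! 98 = 78" "places ! 99 = 77" "places ! 100 = 76" "places ! 101 = 75"
  "places ! 102 = 40" "places ! 103 = 39" "places ! 104 = 38" "places ! 105 = 37" "places ! 106 = 36" "places !
  107 = 127" "places ! 108 = 126" "places ! 109 = 125" "places ! 110 = 124" "places ! 111 = 123" "places ! 112 =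
  129" "places ! 113 = 130" "places ! 114 = 131" "places ! 115 = 132" "places ! 116 = 133" "places ! 117 = 27"
  "places ! 118 = 26" "places ! 119 = 25" "places ! 120 = 24" "places ! 121 = 23" "places ! 122 = 15" "places !
  123 = 14" "places ! 124 = 13" "places ! 125 = 12" "places ! 126 = 11" "places ! 127 = 57" "places ! 128 = 58"
  "places ! 129 = 59" "places ! 130 = 60" "places ! 131 = 61" "places ! 132 = 67" "places ! 133 = 66" "places !
  134 = 65" "places ! 135 = 64" "places ! 136 = 63" "places ! 137 = 80" "places ! 138 = 81" "places ! 139 = 82"
  "places ! 140 = 83" "places ! 141 = 84" "places ! 142 = 103" "places ! 143 = 102" "places ! 144 = 101" "places
  ! 145 = 100" "places ! 146 = 99" "places ! 147 = 147" "places ! 148 = 148" "places ! 149 = 149" "places ! 150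
  = 150" "places ! 151 = 151" "places ! 152 = 152" "places ! 153 = 153" "places ! 154 = 154" "places ! 155 =
  155" "places ! 156 = 156"
  by (simp_all add: places_def)

lemma labels_nth:
  "labels ! 0 = 1" "labels ! 1 = 1" "labels ! 2 = 4" "labels ! 3 = 2" "labels ! 4 = 1" "labels ! 5 = 3" "labels
  ! 6 = 2" "labels ! 7 = 2" "labels ! 8 = 0" "labels ! 9 = 2" "labels ! 10 = 0" "labels ! 11 = 1" "labels ! 12 =
  0" "labels ! 13 = 2" "labels ! 14 = 1" "labels ! 15 = 1" "labels ! 16 = 0" "labels ! 17 = 1" "labels ! 18 = 0"
  "labels ! 19 = 1" "labels ! 20 = 0" "labels ! 21 = 3" "labels ! 22 = 4" "labels ! 23 = 3" "labels ! 24 = 2"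
  "labels ! 25 = 1" "labels ! 26 = 0" "labels ! 27 = 4" "labels ! 28 = 3" "labels ! 29 = 2" "labels ! 30 = 1"
  "labels ! 31 = 0" "labels ! 32 = 4" "labels ! 33 = 3" "labels ! 34 = 2" "labels ! 35 = 1" "labels ! 36 = 0"
  "labels ! 37 = 2" "labels ! 38 = 3" "labels ! 39 = 4" "labels ! 40 = 0" "labels ! 41 = 1" "labels ! 42 = 1"
  "labels ! 43 = 0" "labels ! 44 = 4" "labels ! 45 = 3" "labels ! 46 = 2" "labels ! 47 = 1" "labels ! 48 = 0"
  "labels ! 49 = 4" "labels ! 50 = 3" "labels ! 51 = 2" "labels ! 52 = 2" "labels ! 53 = 3" "labels ! 54 = 4"
  "labels ! 55 = 0" "labels ! 56 = 1" "labels ! 57 = 2" "labels ! 58 = 3" "labels ! 59 = 4" "labels ! 60 = 0"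
  "labels ! 61 = 1" "labels ! 62 = 0" "labels ! 63 = 1" "labels ! 64 = 2" "labels ! 65 = 3" "labels ! 66 = 4"
  "labels ! 67 = 0" "labels ! 68 = 4" "labels ! 69 = 3" "labels ! 70 = 2" "labels ! 71 = 1" "labels ! 72 = 0"
  "labels ! 73 = 4" "labels ! 74 = 3" "labels ! 75 = 2" "labels ! 76 = 1" "labels ! 77 = 1" "labels ! 78 = 2"
  "labels ! 79 = 3" "labels ! 80 = 4" "labels ! 81 = 0" "labels ! 82 = 0" "labels ! 83 = 1" "labels ! 84 = 2"
  "labels ! 85 = 3" "labels ! 86 = 4" "labels ! 87 = 2" "labels ! 88 = 3" "labels ! 89 = 4" "labels ! 90 = 0"
  "labels ! 91 = 1" "labels ! 92 = 1" "labels ! 93 = 2" "labels ! 94 = 3" "labels ! 95 = 4" "labels ! 96 = 0"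
  "labels ! 97 = 1" "labels ! 98 = 2" "labels ! 99 = 3" "labels ! 100 = 4" "labels ! 101 = 0" "labels ! 102 = 1"
  "labels ! 103 = 0" "labels ! 104 = 4" "labels ! 105 = 3" "labels ! 106 = 2" "labels ! 107 = 0" "labels ! 108 =
  1" "labels ! 109 = 2" "labels ! 110 = 3" "labels ! 111 = 4" "labels ! 112 = 4" "labels ! 113 = 0" "labels !
  114 = 1" "labels ! 115 = 2" "labels ! 116 = 3" "labels ! 117 = 3" "labels ! 118 = 2" "labels ! 119 = 1"
  "labels ! 120 = 0" "labels ! 121 = 4" "labels ! 122 = 1" "labels ! 123 = 0" "labels ! 124 = 4" "labels ! 125 =
  3" "labels ! 126 = 2" "labels ! 127 = 4" "labels ! 128 = 3" "labels ! 129 = 2" "labels ! 130 = 1" "labels !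
  131 = 0" "labels ! 132 = 2" "labels ! 133 = 3" "labels ! 134 = 4" "labels ! 135 = 0" "labels ! 136 = 1"
  "labels ! 137 = 3" "labels ! 138 = 2" "labels ! 139 = 1" "labels ! 140 = 0" "labels ! 141 = 4" "labels ! 142 =
  2" "labels ! 143 = 1" "labels ! 144 = 0" "labels ! 145 = 4" "labels ! 146 = 3" "labels ! 147 = 1" "labels !
  148 = 2" "labels ! 149 = 3" "labels ! 150 = 4" "labels ! 151 = 0" "labels ! 152 = 1" "labels ! 153 = 2"
  "labels ! 154 = 3" "labels ! 155 = 4" "labels ! 156 = 0"
  by (simp_all add: labels_def)

lemma glabels_nth:
  "glabels ! 0 = 0" "glabels ! 1 = 1" "glabels ! 2 = 1" "glabels ! 3 = 2" "glabels ! 4 = 0" "glabels ! 5 = 4"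
  "glabels ! 6 = 3" "glabels ! 7 = 4" "glabels ! 8 = 0" "glabels ! 9 = 4" "glabels ! 10 = 0" "glabels ! 11 = 1"
  "glabels ! 12 = 3" "glabels ! 13 = 2" "glabels ! 14 = 2" "glabels ! 15 = 1" "glabels ! 16 = 1" "glabels ! 17 =
  2" "glabels ! 18 = 0" "glabels ! 19 = 4" "glabels ! 20 = 3" "glabels ! 21 = 4" "glabels ! 22 = 0" "glabels !
  23 = 4" "glabels ! 24 = 0" "glabels ! 25 = 1" "glabels ! 26 = 3" "glabels ! 27 = 2" "glabels ! 28 = 2"
  "glabels ! 29 = 1" "glabels ! 30 = 1" "glabels ! 31 = 1" "glabels ! 32 = 2" "glabels ! 33 = 0" "glabels ! 34 =
  4" "glabels ! 35 = 3" "glabels ! 36 = 4" "glabels ! 37 = 0" "glabels ! 38 = 4" "glabels ! 39 = 0" "glabels !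
  40 = 1" "glabels ! 41 = 3" "glabels ! 42 = 2" "glabels ! 43 = 2" "glabels ! 44 = 1" "glabels ! 45 = 0"
  by (simp_all add: glabels_def)

lemma template_nth:
  "template ! 0 = [(4,False), (111,False), (1,True)]" "template ! 1 = [(2,True)]" "template ! 2 = [(3,False)]"
  "template ! 3 = [(4,True)]" "template ! 4 = []" "template ! 5 = [(6,True), (9,True), (146,True)]" "template !
  6 = [(7,False)]" "template ! 7 = [(8,False)]" "template ! 8 = [(9,False)]" "template ! 9 = [(73,False)]"
  "template ! 10 = [(56,False), (58,False), (12,True)]" "template ! 11 = [(15,False), (51,False), (12,True)]"
  "template ! 12 = [(13,True)]" "template ! 13 = [(14,True)]" "template ! 14 = [(15,True), (22,True)]" "template
  ! 15 = [(16,True)]" "template ! 16 = [(23,False), (17,True)]" "template ! 17 = [(21,False), (18,True)]"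
  "template ! 18 = [(19,True)]" "template ! 19 = [(20,False)]" "template ! 20 = [(21,False)]" "template ! 21 =
  [(22,True)]" "template ! 22 = [(24,True), (140,True)]" "template ! 23 = [(27,False), (24,True)]" "template !
  24 = [(25,True)]" "template ! 25 = [(26,True)]" "template ! 26 = [(27,True), (139,True)]" "template ! 27 =
  [(28,False)]" "template ! 28 = [(46,False), (133,True), (138,True)]" "template ! 29 = [(36,False), (41,False),
  (30,True), (127,True)]" "template ! 30 = [(31,False), (34,False)]" "template ! 31 = [(32,True)]" "template !
  32 = [(33,True)]" "template ! 33 = [(34,True)]" "template ! 34 = [(35,True)]" "template ! 35 = [(37,True),
  (126,True)]" "template ! 36 = [(40,False), (37,True)]" "template ! 37 = [(38,True)]" "template ! 38 =
  [(39,True)]" "template ! 39 = [(40,True), (111,True)]" "template ! 40 = [(105,True)]" "template ! 41 =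
  [(45,False), (42,True)]" "template ! 42 = [(43,True)]" "template ! 43 = [(44,True)]" "template ! 44 =
  [(45,True)]" "template ! 45 = [(104,True)]" "template ! 46 = [(50,False), (47,True)]" "template ! 47 =
  [(48,True)]" "template ! 48 = [(49,True)]" "template ! 49 = [(50,True)]" "template ! 50 = [(97,True)]"
  "template ! 51 = [(52,False), (57,True), (96,True)]" "template ! 52 = [(56,False), (53,True)]" "template ! 53
  = [(54,True)]" "template ! 54 = [(55,False)]" "template ! 55 = [(56,False)]" "template ! 56 = []" "template !
  57 = [(58,True), (61,True)]" "template ! 58 = [(59,False)]" "template ! 59 = [(60,False)]" "template ! 60 =
  [(61,False), (73,False)]" "template ! 61 = [(62,False)]" "template ! 62 = [(67,False), (68,False)]" "template
  ! 63 = [(64,False), (67,False), (91,True)]" "template ! 64 = [(65,False), (74,True)]" "template ! 65 =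
  [(66,False)]" "template ! 66 = [(67,True), (73,True)]" "template ! 67 = []" "template ! 68 = [(69,False),
  (72,True)]" "template ! 69 = [(70,False)]" "template ! 70 = [(71,False)]" "template ! 71 = [(72,True)]"
  "template ! 72 = [(73,False)]" "template ! 73 = []" "template ! 74 = [(75,False), (81,False)]" "template ! 75
  = [(76,False), (79,True)]" "template ! 76 = [(77,False)]" "template ! 77 = [(78,False)]" "template ! 78 =
  [(79,True)]" "template ! 79 = [(91,True)]" "template ! 80 = [(81,False), (84,True), (91,True)]" "template ! 81
  = [(82,False)]" "template ! 82 = [(83,False)]" "template ! 83 = [(84,False), (111,False)]" "template ! 84 =
  [(105,False)]" "template ! 85 = [(86,False), (89,True), (91,True)]" "template ! 86 = [(87,False)]" "template !
  87 = [(88,False)]" "template ! 88 = [(89,False)]" "template ! 89 = [(90,False)]" "template ! 90 =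
  [(101,False)]" "template ! 91 = []" "template ! 92 = [(93,False), (96,False), (98,False)]" "template ! 93 =
  [(94,True)]" "template ! 94 = [(95,True)]" "template ! 95 = [(96,True)]" "template ! 96 = []" "template ! 97 =
  [(103,True)]" "template ! 98 = [(100,False)]" "template ! 99 = [(100,False), (103,True)]" "template ! 100 =
  [(101,False)]" "template ! 101 = [(102,True)]" "template ! 102 = [(104,False), (103,True)]" "template ! 103 =
  []" "template ! 104 = []" "template ! 105 = [(106,False)]" "template ! 106 = [(110,False), (107,True)]"
  "template ! 107 = [(108,True)]" "template ! 108 = [(109,True)]" "template ! 109 = [(110,True)]" "template !
  110 = [(111,False)]" "template ! 111 = []" "template ! 112 = [(116,False), (113,True), (117,True)]" "template
  ! 113 = [(114,True)]" "template ! 114 = [(115,True)]" "template ! 115 = [(116,False)]" "template ! 116 = []"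
  "template ! 117 = [(130,False), (118,True), (124,True)]" "template ! 118 = [(122,False), (119,True)]"
  "template ! 119 = [(120,True)]" "template ! 120 = [(121,True)]" "template ! 121 = [(122,True)]" "template !
  122 = [(128,False)]" "template ! 123 = [(127,False), (128,False), (124,True)]" "template ! 124 = [(125,True)]"
  "template ! 125 = [(126,True)]" "template ! 126 = [(127,True)]" "template ! 127 = []" "template ! 128 =
  [(129,False)]" "template ! 129 = [(130,False), (133,True)]" "template ! 130 = [(131,False)]" "template ! 131 =
  [(132,True)]" "template ! 132 = [(139,False), (133,True)]" "template ! 133 = []" "template ! 134 =
  [(138,False), (139,False), (135,True)]" "template ! 135 = [(136,True)]" "template ! 136 = [(137,True)]"
  "template ! 137 = [(138,True)]" "template ! 138 = []" "template ! 139 = []" "template ! 140 = [(144,False),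
  (141,True)]" "template ! 141 = [(142,True)]" "template ! 142 = [(143,True)]" "template ! 143 = [(144,False)]"
  "template ! 144 = [(145,False)]" "template ! 145 = []" "template ! 146 = [(273,False)]" "template ! 147 = []"
  "template ! 148 = []" "template ! 149 = []" "template ! 150 = []" "template ! 151 = []" "template ! 152 = []"
  "template ! 153 = []" "template ! 154 = []" "template ! 155 = []" "template ! 156 = []"
  by (simp_all add: template_def)

lemma gadget_template_nth:
  "gadget_template ! 0 = [(1,False), (2,False), (15,False), (16,False), (29,False), (30,False), (31,False),
  (44,False)]" "gadget_template ! 1 = [(4,True), (45,True)]" "gadget_template ! 2 = [(3,False), (4,True)]"
  "gadget_template ! 3 = [(6,False), (15,False)]" "gadget_template ! 4 = [(5,False)]" "gadget_template ! 5 =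
  [(6,False), (45,True)]" "gadget_template ! 6 = [(7,False), (13,False), (14,False)]" "gadget_template ! 7 =
  [(8,False), (12,False), (45,True)]" "gadget_template ! 8 = [(9,False), (15,True)]" "gadget_template ! 9 =
  [(10,False), (12,False)]" "gadget_template ! 10 = [(11,False), (15,True)]" "gadget_template ! 11 = [(13,True),
  (14,True)]" "gadget_template ! 12 = [(13,False)]" "gadget_template ! 13 = []" "gadget_template ! 14 =
  [(15,False)]" "gadget_template ! 15 = [(18,True), (45,True)]" "gadget_template ! 16 = [(17,False), (18,True)]"
  "gadget_template ! 17 = [(20,False), (29,False)]" "gadget_template ! 18 = [(19,False)]" "gadget_template ! 19
  = [(20,False), (45,True)]" "gadget_template ! 20 = [(21,False), (27,False), (28,False)]" "gadget_template ! 21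
  = [(22,False), (26,False), (45,True)]" "gadget_template ! 22 = [(23,False), (29,True)]" "gadget_template ! 23
  = [(24,False), (26,False)]" "gadget_template ! 24 = [(25,False), (29,True)]" "gadget_template ! 25 =
  [(27,True), (28,True)]" "gadget_template ! 26 = [(27,False)]" "gadget_template ! 27 = []" "gadget_template !
  28 = [(29,False)]" "gadget_template ! 29 = [(45,True)]" "gadget_template ! 30 = [(33,True), (45,True)]"
  "gadget_template ! 31 = [(32,False), (33,True)]" "gadget_template ! 32 = [(35,False), (44,False)]"
  "gadget_template ! 33 = [(34,False)]" "gadget_template ! 34 = [(35,False), (45,True)]" "gadget_template ! 35 =
  [(36,False), (42,False), (43,False)]" "gadget_template ! 36 = [(37,False), (41,False), (45,True)]"
  "gadget_template ! 37 = [(38,False), (44,True)]" "gadget_template ! 38 = [(39,False), (41,False)]"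
  "gadget_template ! 39 = [(40,False), (44,True)]" "gadget_template ! 40 = [(42,True), (43,True)]"
  "gadget_template ! 41 = [(42,False)]" "gadget_template ! 42 = []" "gadget_template ! 43 = [(44,False)]"
  "gadget_template ! 44 = [(45,True)]" "gadget_template ! 45 = []"
  by (simp_all add: gadget_template_def)


text \<open>A sweep from left to right with a stack of right end points: it succeeds only if no two intervals of the page
  interleave and no interval covers a point of the initial stack.\<close>

function sweep :: "bool \<Rightarrow> (nat \<times> bool) list list \<Rightarrow> nat \<Rightarrow> nat \<Rightarrow> nat list \<Rightarrow> bool" where
  "sweep p t n a st = (if a < n then sorted (map fst (filter (\<lambda>e. snd e = p) (t ! a)) @ dropWhile (\<lambda>r. r \<le> a) st) \<and>
     sweep p t n (a + 1) (map fst (filter (\<lambda>e. snd e = p) (t ! a)) @ dropWhile (\<lambda>r. r \<le> a) st) else True)"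
  by pat_completeness auto
termination by (relation "Wellfounded.measure (\<lambda>(p, t, n, a, st). n - a)") auto

declare sweep.simps [simp del]

lemma in_dropWhile_sorted: "sorted st \<Longrightarrow> r \<in> set st \<Longrightarrow> \<not> r \<le> a \<Longrightarrow> r \<in> set (dropWhile (\<lambda>r. r \<le> a) st)" for a :: nat
  by (induction st) auto

text \<open>The first conjunct is what the induction carries: a right end still open on the sorted
  stack is not covered by a later interval. Interleaving of an interval with a later one is the
  special case in which its own right end has been pushed. Applied to the initial stack, it also
  shows that chosen points are visible from outside.\<close>

lemma sweep_sound:
  assumes "sweep p t n a st" "sorted st"
  shows "(\<forall>k b r. a \<le> k \<longrightarrow> k < n \<longrightarrow> (b, p) \<in> set (t ! k) \<longrightarrow> r \<in> set st \<longrightarrow> \<not> (k < r \<and> r < b)) \<and>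
    (\<forall>k k' b b'. a \<le> k \<longrightarrow> k < k' \<longrightarrow> k' < n \<longrightarrow> (b, p) \<in> set (t ! k) \<longrightarrow> (b', p) \<in> set (t ! k') \<longrightarrow> \<not> (k' < b \<and> b < b'))"
  using assms
proof (induction p t n a st rule: sweep.induct)
  case (1 p t n a st)
  define E where "E = map fst (filter (\<lambda>e. snd e = p) (t ! a))"
  define st' where "st' = E @ dropWhile (\<lambda>r. r \<le> a) st"
  show ?case
  proof (cases "a < n")
    case True
    have s: "sorted st'" and r: "sweep p t n (a + 1) st'"
      using "1.prems"(1) True unfolding sweep.simps[of p t n a] st'_def E_def by simp_all
    note IH = "1.IH"[OF True, folded E_def, folded st'_def, OF r s]
    have E: "(b, p) \<in> set (t ! a) \<Longrightarrow> b \<in> set E" for b by (force simp: E_def)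
    show ?thesis
    proof (intro conjI allI impI)
      fix k b r assume k: "a \<le> k" "k < n" "(b, p) \<in> set (t ! k)" "r \<in> set st"
      show "\<not> (k < r \<and> r < b)"
      proof (cases "r \<le> a")
        case False
        then have d: "r \<in> set (dropWhile (\<lambda>r. r \<le> a) st)" using in_dropWhile_sorted "1.prems"(2) k(4) by blast
        show ?thesis
        proof (cases "k = a")
          case True
          then have "b \<in> set E" using k E by simp
          then have "b \<le> r" using s d by (auto simp: st'_def sorted_append)
          then show ?thesis by simp
        next
          case False
          then show ?thesis using conjunct1[OF IH, rule_format, of k b r] k d by (simp add: st'_def)
        qed
      qed (use k in simp)
    next
      fix k k' b b' assume k: "a \<le> k" "k < k'" "k' < n" "(b, p) \<in> set (t ! k)" "(b', p) \<in> set (t ! k')"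
      show "\<not> (k' < b \<and> b < b')"
      proof (cases "k = a")
        case True
        then have "b \<in> set st'" using k E by (simp add: st'_def)
        then show ?thesis using conjunct1[OF IH, rule_format, of k' b' b] k True by simp
      next
        case False
        then show ?thesis using conjunct2[OF IH, rule_format, of k k' b b'] k by simp
      qed
    qed
  qed simp
qed

definition cell_edges :: "(nat \<times> nat) list" where
  "cell_edges = concat (map (\<lambda>b. map (\<lambda>c. (22 + 5 * b + c, 22 + 5 * b + Suc c mod 5)) [0..<5]) [0..<25]) @
     map (\<lambda>(b, c, k). (22 + 5 * b + c, k)) attachments"

definition link :: "(nat \<times> bool) list list \<Rightarrow> nat \<Rightarrow> nat \<Rightarrow> bool" where
  "link t a b \<longleftrightarrow> max a b \<in> fst ` set (t ! min a b)"

definition label_step :: "nat \<Rightarrow> nat \<Rightarrow> bool" where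
  "label_step a b \<longleftrightarrow> b mod 5 = Suc a mod 5 \<or> a mod 5 = Suc b mod 5"

lemma upts: "[0..<5] = [0, 1, 2, 3, 4]" "[0..<25] = [0, 1, 2, 3, 4, 5, 6, 7, 8, 9, 10, 11, 12, 13, 14, 15, 16, 17, 18, 19, 20, 21, 22, 23, 24]"
  by (simp_all add: upt_rec)

lemmas cell_edges_eq = cell_edges_def[unfolded upts attachments_def list.map concat.simps append.simps prod.case]

lemma sweep_template: "sweep False template 157 0 [116, 145]" "sweep True template 157 0 [4]"
  by (simp_all add: template_nth sweep.simps del: One_nat_def)

lemma sweep_gadget: "sweep False gadget_template 46 0 []" "sweep True gadget_template 46 0 []"
  by (simp_all add: gadget_template_nth sweep.simps del: One_nat_def)

lemma gadget_labels: "\<forall>(q, r)\<in>set gadget. label_step (glabels ! q) (glabels ! r)"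
  by (simp add: gadget_def region_edges_def label_step_def glabels_nth del: One_nat_def)

lemma gadget_pages: "\<forall>(q, r)\<in>set gadget. link gadget_template q r"
  by (simp add: gadget_def region_edges_def link_def gadget_template_nth del: One_nat_def)

lemma cell_edges_labels: "\<forall>(s, t)\<in>set cell_edges. label_step (labels ! s) (labels ! t)"
  by (simp add: cell_edges_eq label_step_def labels_nth del: One_nat_def)

lemma cell_edges_template: "\<forall>(s, t)\<in>set cell_edges. link template (places ! s) (places ! t)"
  by (simp add: cell_edges_eq link_def places_nth template_nth del: One_nat_def)

section \<open>The graph of a network on the natural numbers\<close>

lemma gadget_range: "(q, r) \<in> set gadget \<Longrightarrow> q < 46 \<and> r < 46 \<and> q \<noteq> r"
  by (auto simp: gadget_def region_edges_def)

definition gadget_nbrs :: "nat list list" where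
  "gadget_nbrs =
    [[1, 2, 15, 16, 29, 30, 31, 44], [0, 4, 45], [0, 3, 4], [2, 6, 15], [1, 2, 5], [4, 6, 45], [3, 5, 7, 13,
    14], [6, 8, 12, 45], [7, 9, 15], [8, 10, 12], [9, 11, 15], [10, 13, 14], [7, 9, 13], [6, 11, 12], [6, 11,
    15], [0, 3, 8, 10, 14, 18, 45], [0, 17, 18], [16, 20, 29], [15, 16, 19], [18, 20, 45], [17, 19, 21, 27, 28],
    [20, 22, 26, 45], [21, 23, 29], [22, 24, 26], [23, 25, 29], [24, 27, 28], [21, 23, 27], [20, 25, 26], [20,
    25, 29], [0, 17, 22, 24, 28, 45], [0, 33, 45], [0, 32, 33], [31, 35, 44], [30, 31, 34], [33, 35, 45], [32,
    34, 36, 42, 43], [35, 37, 41, 45], [36, 38, 44], [37, 39, 41], [38, 40, 44], [39, 42, 43], [36, 38, 42],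
    [35, 40, 41], [35, 40, 44], [0, 32, 37, 39, 43, 45], [1, 5, 7, 15, 19, 21, 29, 30, 34, 36, 44]]"

lemma gadget_nbrs_nth:
  "gadget_nbrs ! 0 = [1, 2, 15, 16, 29, 30, 31, 44]" "gadget_nbrs ! 1 = [0, 4, 45]" "gadget_nbrs ! 2 = [0, 3,
  4]" "gadget_nbrs ! 3 = [2, 6, 15]" "gadget_nbrs ! 4 = [1, 2, 5]" "gadget_nbrs ! 5 = [4, 6, 45]" "gadget_nbrs !
  6 = [3, 5, 7, 13, 14]" "gadget_nbrs ! 7 = [6, 8, 12, 45]" "gadget_nbrs ! 8 = [7, 9, 15]" "gadget_nbrs ! 9 =
  [8, 10, 12]" "gadget_nbrs ! 10 = [9, 11, 15]" "gadget_nbrs ! 11 = [10, 13, 14]" "gadget_nbrs ! 12 = [7, 9,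
  13]" "gadget_nbrs ! 13 = [6, 11, 12]" "gadget_nbrs ! 14 = [6, 11, 15]" "gadget_nbrs ! 15 = [0, 3, 8, 10, 14,
  18, 45]" "gadget_nbrs ! 16 = [0, 17, 18]" "gadget_nbrs ! 17 = [16, 20, 29]" "gadget_nbrs ! 18 = [15, 16, 19]"
  "gadget_nbrs ! 19 = [18, 20, 45]" "gadget_nbrs ! 20 = [17, 19, 21, 27, 28]" "gadget_nbrs ! 21 = [20, 22, 26,
  45]" "gadget_nbrs ! 22 = [21, 23, 29]" "gadget_nbrs ! 23 = [22, 24, 26]" "gadget_nbrs ! 24 = [23, 25, 29]"
  "gadget_nbrs ! 25 = [24, 27, 28]" "gadget_nbrs ! 26 = [21, 23, 27]" "gadget_nbrs ! 27 = [20, 25, 26]"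
  "gadget_nbrs ! 28 = [20, 25, 29]" "gadget_nbrs ! 29 = [0, 17, 22, 24, 28, 45]" "gadget_nbrs ! 30 = [0, 33,
  45]" "gadget_nbrs ! 31 = [0, 32, 33]" "gadget_nbrs ! 32 = [31, 35, 44]" "gadget_nbrs ! 33 = [30, 31, 34]"
  "gadget_nbrs ! 34 = [33, 35, 45]" "gadget_nbrs ! 35 = [32, 34, 36, 42, 43]" "gadget_nbrs ! 36 = [35, 37, 41,
  45]" "gadget_nbrs ! 37 = [36, 38, 44]" "gadget_nbrs ! 38 = [37, 39, 41]" "gadget_nbrs ! 39 = [38, 40, 44]"
  "gadget_nbrs ! 40 = [39, 42, 43]" "gadget_nbrs ! 41 = [36, 38, 42]" "gadget_nbrs ! 42 = [35, 40, 41]"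
  "gadget_nbrs ! 43 = [35, 40, 44]" "gadget_nbrs ! 44 = [0, 32, 37, 39, 43, 45]" "gadget_nbrs ! 45 = [1, 5, 7,
  15, 19, 21, 29, 30, 34, 36, 44]"
  by (simp_all add: gadget_nbrs_def)

lemma gadget_nbrs: "\<forall>(q, r)\<in>set gadget. r \<in> set (gadget_nbrs ! q) \<and> q \<in> set (gadget_nbrs ! r)"
  by (simp add: gadget_def region_edges_def gadget_nbrs_nth del: One_nat_def)

lemma length_gadget_nbrs: "length gadget_nbrs = 46" "length (gadget_nbrs ! 0) = 8" "\<forall>l\<in>set gadget_nbrs. length l \<le> 11"
  by (simp_all add: gadget_nbrs_def)

text \<open>Two steps of plus or minus 1 add up to 0 or plus or minus 2 modulo 5, never to a single
  step.\<close>

lemma label_step_triangle: "\<not> (label_step a b \<and> label_step b c \<and> label_step a c)"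
proof -
  define f where "f m = int (m mod 5)" for m :: nat
  have s: "(f n - f m) mod 5 = 1 \<or> (f n - f m) mod 5 = 4" if "label_step m n" for m n
    using that unfolding label_step_def f_def mod_Suc by (auto split: if_splits)
  show ?thesis
  proof
    assume l: "label_step a b \<and> label_step b c \<and> label_step a c"
    have "(f c - f a) mod 5 = ((f b - f a) mod 5 + (f c - f b) mod 5) mod 5" by (simp add: mod_simps)
    then show False using s[of a b] s[of b c] s[of a c] l by auto
  qed
qed

context net
begin

lemma badj_VV: "badj x y \<Longrightarrow> x \<in> VV \<and> y \<in> VV \<and> x \<noteq> y"
proof (induction rule: badj.induct)
  case (badj_cyc b c)
  then have "Suc c mod 5 \<noteq> c" "Suc c mod 5 < 5" by presburger+
  then show ?case using badj_cyc by (auto simp: VV_def)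
next
  case (badj_att b c k)
  then show ?case using att_Ks by (auto simp: VV_def)
qed

lemma nadj_NV: "nadj u v \<Longrightarrow> u \<in> NV \<and> v \<in> NV \<and> u \<noteq> v"
proof (induction rule: nadj.induct)
  case (nadj_base x y) then show ?case using badj_VV[of x y] by (auto simp: NV_def)
next
  case (nadj_gadget x q r) then show ?case using FF_VV gadget_range[of q r] by (auto simp: NV_def)
qed

definition edges :: "(('k, 'b) bvx \<times> nat \<Rightarrow> nat) \<Rightarrow> nat set set" where
  "edges code = {{code u, code v} | u v. nadj u v}"

lemma edges_simple:
  assumes "inj_on code NV" "code ` NV \<subseteq> {..<n}"
  shows "simple_graph {..<n} (edges code)"
proof -
  have "{code u, code v} \<subseteq> {..<n} \<and> card {code u, code v} = 2" if "nadj u v" for u v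
  proof -
    have "u \<in> NV" "v \<in> NV" "u \<noteq> v" using nadj_NV[OF that] by auto
    moreover from this have "code u \<noteq> code v" using assms(1) by (meson inj_onD)
    ultimately show ?thesis using assms(2) by auto
  qed
  then show ?thesis unfolding simple_graph_def edges_def by blast
qed

lemma proper_edges:
  assumes "inj_on code NV"
  shows "proper_coloring (edges code) c \<longleftrightarrow> proper (c \<circ> code)"
proof
  assume p: "proper_coloring (edges code) c"
  show "proper (c \<circ> code)" unfolding proper_def comp_def
  proof (intro allI impI)
    fix u v assume n: "nadj u v"
    then have "code u \<noteq> code v" using nadj_NV[OF n] assms by (meson inj_onD)
    moreover have "{code u, code v} \<in> edges code" using n unfolding edges_def by blast
    ultimately show "c (code u) \<noteq> c (code v)" using p by (simp add: proper_coloring_def)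
  qed
next
  assume p: "proper (c \<circ> code)"
  show "proper_coloring (edges code) c" unfolding proper_coloring_def
  proof (intro allI impI)
    fix a b assume "{a, b} \<in> edges code"
    then obtain u v where "{a, b} = {code u, code v}" "nadj u v" unfolding edges_def by blast
    moreover from this(2) have "c (code u) \<noteq> c (code v)" using p unfolding proper_def comp_def by blast
    ultimately show "c a \<noteq> c b" by (auto simp: doubleton_eq_iff)
  qed
qed

lemma choosable_edges:
  assumes inj: "inj_on code NV" and sub: "code ` NV \<subseteq> V"
  shows "choosable 3 5 V (edges code) \<longleftrightarrow>
    (\<forall>L. (\<forall>v\<in>NV. L v \<subseteq> {1..5} \<and> card (L v) = 3) \<longrightarrow> (\<exists>col. proper col \<and> (\<forall>v\<in>NV. col v \<in> L v)))"
    (is "_ \<longleftrightarrow> ?R")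
proof
  assume ch: "choosable 3 5 V (edges code)"
  show ?R
  proof (intro allI impI)
    fix L :: "_ \<Rightarrow> nat set" assume L: "\<forall>v\<in>NV. L v \<subseteq> {1..5} \<and> card (L v) = 3"
    define M where "M m = (if m \<in> code ` NV then L (inv_into NV code m) else {1, 2, 3})" for m
    have "M m \<subseteq> {1..5} \<and> card (M m) = 3" for m using L inv_into_into[of m code NV] by (auto simp: M_def)
    then obtain c where c: "proper_coloring (edges code) c" "\<forall>m\<in>V. c m \<in> M m"
      using ch[unfolded choosable_def, rule_format, of M] by blast
    have "c (code v) \<in> L v" if "v \<in> NV" for v
      using c(2) sub that inv_into_f_f[OF inj that] by (force simp: M_def)
    then show "\<exists>col. proper col \<and> (\<forall>v\<in>NV. col v \<in> L v)"
      using c(1) unfolding proper_edges[OF inj] by (intro exI[of _ "c \<circ> code"]) simp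
  qed
next
  assume R: ?R
  show "choosable 3 5 V (edges code)" unfolding choosable_def
  proof (intro allI impI)
    fix L :: "nat \<Rightarrow> nat set" assume L: "\<forall>v\<in>V. L v \<subseteq> {1..5} \<and> card (L v) = 3"
    then have "\<forall>v\<in>NV. L (code v) \<subseteq> {1..5} \<and> card (L (code v)) = 3" using sub by blast
    then obtain col where col: "proper col" "\<forall>v\<in>NV. col v \<in> L (code v)" using R[rule_format, of "\<lambda>v. L (code v)"] by blast
    define c where "c m = (if m \<in> code ` NV then col (inv_into NV code m) else (SOME a. a \<in> L m))" for m
    have cc: "c (code v) = col v" if "v \<in> NV" for v using inv_into_f_f[OF inj that] that by (simp add: c_def)
    have "c m \<in> L m" if "m \<in> V" for m
    proof (cases "m \<in> code ` NV")
      case True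
      then show ?thesis using cc col by auto
    next
      case False
      have "L m \<noteq> {}" using L that by fastforce
      then show ?thesis using False by (simp add: c_def some_in_eq)
    qed
    moreover have "proper (c \<circ> code)"
      using col(1) cc nadj_NV unfolding proper_def comp_def by metis
    ultimately show "\<exists>c. proper_coloring (edges code) c \<and> (\<forall>v\<in>V. c v \<in> L v)"
      unfolding proper_edges[OF inj] by blast
  qed
qed

text \<open>A homomorphism to the 5-cycle excludes triangles.\<close>

lemma edges_triangle_free:
  assumes "\<And>u v. nadj u v \<Longrightarrow> label_step (lam (code u)) (lam (code v))"
  shows "triangle_free (edges code)"
proof -
  have "label_step (lam a) (lam b)" if "{a, b} \<in> edges code" for a b
  proof -
    from that obtain u v where "{a, b} = {code u, code v}" "nadj u v" unfolding edges_def by blast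
    then show ?thesis using assms[of u v] by (auto simp: doubleton_eq_iff label_step_def)
  qed
  then show ?thesis unfolding triangle_free_def using label_step_triangle by blast
qed

text \<open>A base vertex has at most eight neighbours in its gadget and four elsewhere; the other
  gadget vertices have at most eleven neighbours in all.\<close>

lemma edges_degree:
  assumes inj: "inj_on code NV"
    and d: "\<And>x. x \<in> VV \<Longrightarrow> \<exists>S. {y. badj x y \<or> badj y x} \<subseteq> S \<and> finite S \<and> card S \<le> 4"
  shows "vdegree (edges code) m \<le> 12"
proof (cases "m \<in> code ` NV")
  case False
  then have "{e \<in> edges code. m \<in> e} = {}" using nadj_NV by (fastforce simp: edges_def)
  then show ?thesis unfolding vdegree_def by (simp only: card.empty)
next
  case True
  then obtain x q where m: "m = code (x, q)" "x \<in> VV" "q < 46" by (auto simp: NV_def)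
  define G where "G = set (gadget_nbrs ! q)"
  have G: "r \<in> G" if "(q, r) \<in> set gadget \<or> (r, q) \<in> set gadget" for r
    using that gadget_nbrs unfolding G_def by blast
  obtain S where S: "{y. badj x y \<or> badj y x} \<subseteq> S" "finite S" "card S \<le> 4" using d[OF m(2)] by blast
  define N where "N = Pair x ` G \<union> (if q = 0 then (\<lambda>y. (y, 0)) ` S else {})"
  have "{e \<in> edges code. m \<in> e} \<subseteq> (\<lambda>u. {m, code u}) ` N"
  proof
    fix e assume "e \<in> {e \<in> edges code. m \<in> e}"
    then obtain u v where uv: "e = {code u, code v}" "nadj u v" "m = code u \<or> m = code v" unfolding edges_def by blast
    have "\<exists>w. e = {m, code w} \<and> (nadj (x, q) w \<or> nadj w (x, q))"
    proof -
      have eq: "w = (x, q)" if "m = code w" "w \<in> NV" for w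
        using that inj m by (metis (no_types, lifting) NV_def SigmaI inj_onD lessThan_iff)
      show ?thesis using uv nadj_NV[OF uv(2)] eq by (metis insert_commute)
    qed
    then obtain w where w: "e = {m, code w}" "nadj (x, q) w \<or> nadj w (x, q)" by blast
    have "w \<in> N" using w(2)
    proof
      assume "nadj (x, q) w" then show ?thesis using S(1) G by cases (auto simp: N_def)
    next
      assume "nadj w (x, q)" then show ?thesis using S(1) G by cases (auto simp: N_def)
    qed
    then show "e \<in> (\<lambda>u. {m, code u}) ` N" using w(1) by blast
  qed
  moreover have "finite N" using S by (simp add: N_def G_def)
  ultimately have "vdegree (edges code) m \<le> card N" unfolding vdegree_def
    by (meson card_image_le card_mono finite_imageI le_trans)
  also have "card N \<le> 12"
  proof (cases "q = 0")
    case True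
    have "card G \<le> 8" using card_length[of "gadget_nbrs ! 0"] length_gadget_nbrs(2) by (simp add: G_def True)
    then have "card (Pair x ` G) \<le> 8" using card_image_le[of G "Pair x"] by (simp add: G_def)
    moreover have "card ((\<lambda>y. (y, 0::nat)) ` S) \<le> 4" using card_image_le[OF S(2), of "\<lambda>y. (y, 0::nat)"] S(3) by linarith
    ultimately show ?thesis using card_Un_le[of "Pair x ` G" "(\<lambda>y. (y, 0::nat)) ` S"] True by (simp add: N_def)
  next
    case False
    have "gadget_nbrs ! q \<in> set gadget_nbrs" using m(3) length_gadget_nbrs(1) by simp
    then have "card G \<le> 12" using card_length[of "gadget_nbrs ! q"] length_gadget_nbrs(3) by (fastforce simp: G_def)
    then have "card (Pair x ` G) \<le> 12" using card_image_le[of G "Pair x"] by (simp add: G_def)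
    then show ?thesis using False by (simp add: N_def)
  qed
  finally show ?thesis .
qed

end

section \<open>Cells in numbers: coding of the vertices, labels and degrees\<close>

definition top_edges :: "(nat \<times> nat) list" where
  "top_edges = [(147, 148), (148, 149), (149, 150), (150, 151), (151, 147), (147, 20),
     (152, 153), (153, 154), (154, 155), (155, 156), (156, 152), (152, 20)]"

lemma length_attachments: "\<forall>k\<in>set [0..<22]. length (filter (\<lambda>t. snd (snd t) = k) attachments) \<le> (if k = 20 \<or> k = 21 then 1 else 4)"
  by (simp add: upt_rec attachments_def)

context cells
begin

lemma att_table:
  assumes "b < 25" "att (Suc i, j, b) c = Key k" "c < 5"
  shows "(\<exists>k'. (b, c, k') \<in> set attachments \<and> k = (Suc i, j, k')) \<or> b = 0 \<and> c = 0 \<and> k = (i, j, 20) \<or>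
    b = 2 \<and> c = 0 \<and> 0 < j \<and> k = (Suc i, j - 1, 21)"
  using assms(1)
proof (cases rule: body_cases)
  case (1 X)
  note a = att_arm(1,2)[OF 1(1), of i j] att_arm(3)[OF 1(1), of c i j]
  have "c = 0 \<or> c = 4" using a(3) assms(2) 1(2) by auto
  then show ?thesis
  proof
    assume "c = 0"
    then show ?thesis using assms(2) a(1) less8[OF 1(1)] unfolding 1(2)
      by (elim disjE) (auto simp: root_def attachments_def split: if_splits)
  next
    assume "c = 4"
    then show ?thesis using assms(2) a(2) less8[OF 1(1)] unfolding 1(2)
      by (elim disjE) (auto simp: attachments_def)
  qed
next
  case (2 X)
  note a = att_arm'(1,2)[OF 2(1), of i j] att_arm'(3)[OF 2(1), of c i j]
  have "c = 0 \<or> c = 4" using a(3) assms(2) 2(2) by auto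
  then show ?thesis
  proof
    assume "c = 0"
    then show ?thesis using assms(2) a(1) less8[OF 2(1)] unfolding 2(2)
      by (elim disjE) (auto simp: attachments_def)
  next
    assume "c = 4"
    then show ?thesis using assms(2) a(2) less8[OF 2(1)] unfolding 2(2)
      by (elim disjE) (auto simp: attachments_def)
  qed
next
  case (3 X)
  define Y where "Y = Suc X mod 8"
  have *: "(16 + X, 0, inner X) \<in> set attachments \<and> (16 + X, 1, outer X) \<in> set attachments \<and>
    (16 + X, 3, outer Y) \<in> set attachments \<and> (16 + X, 4, inner Y) \<in> set attachments"
    using less8[OF 3(1)] unfolding Y_def
    by (elim disjE) (simp_all only: Suc_mod8, simp_all add: inner_def outer_def attachments_def)
  show ?thesis using less5[OF assms(3)] att_ring[OF 3(1), of i j] assms(2) *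
    unfolding 3(2) Y_def by (elim disjE) (auto split: if_splits simp del: One_nat_def)
next
  case 4
  then show ?thesis using less5[OF assms(3)] assms(2) by (auto simp: att_centre attachments_def simp del: One_nat_def)
qed

lemma Ks_iff: "(i, j, k) \<in> Ks \<longleftrightarrow> i \<le> nc \<and> j < 2 * nv \<and> k < 22 \<and> (i = 0 \<longrightarrow> k = 20)"
  by (simp add: Ks_def)

lemma Bs_iff: "(i, j, b) \<in> Bs \<longleftrightarrow>
    i \<le> nc \<and> j < 2 * nv \<and> (if i = 0 then even j \<and> (b = 25 \<or> b = 26 \<and> U (j div 2)) else b < 25)"
  by (simp add: Bs_def)

lemma VV_cases:
  assumes "x \<in> VV"
  obtains i j k where "x = K (i, j, k)" "(i, j, k) \<in> Ks" | i j b c where "x = B (i, j, b) c" "(i, j, b) \<in> Bs" "c < 5"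
  using assms unfolding VV_def by auto

primrec symb :: "(nat \<times> nat \<times> nat, nat \<times> nat \<times> nat) bvx \<Rightarrow> nat \<times> nat \<times> nat" where
  "symb (K k) = k"
| "symb (B b c) = (fst b, fst (snd b), 22 + 5 * snd (snd b) + c)"

lemma symb_VV:
  assumes "x \<in> VV" "symb x = (i, j, s)"
  shows "i \<le> nc" "j < 2 * nv" "s < 157"
  using assms by (auto elim!: VV_cases simp: Ks_iff Bs_iff split: if_splits)

lemma symb_inj: "inj_on symb VV"
proof (rule inj_onI)
  have d: "k < 22 \<Longrightarrow> k \<noteq> 22 + 5 * b + c" "c < 5 \<Longrightarrow> c' < 5 \<Longrightarrow> 5 * b + c = 5 * b' + c' \<Longrightarrow> b = b' \<and> c = c'" for k b c b' c' :: nat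
    by presburger+
  fix x y assume "x \<in> VV" "y \<in> VV" "symb x = symb y"
  then show "x = y" using d by (auto elim!: VV_cases simp: Ks_iff)
qed

definition code :: "(nat \<times> nat \<times> nat, nat \<times> nat \<times> nat) bvx \<times> nat \<Rightarrow> nat" where
  "code u = (case symb (fst u) of (i, j, s) \<Rightarrow> ((i * (2 * nv) + j) * 157 + s) * 46 + snd u)"

definition total :: nat where "total = (nc + 1) * (2 * nv) * 157 * 46"

lemma decode:
  assumes "j < 2 * nv" "s < 157" "q < 46" and m: "m = ((i * (2 * nv) + j) * 157 + s) * 46 + q"
  shows "m mod 46 = q" "m div 46 mod 157 = s" "m div 46 div 157 mod (2 * nv) = j" "m div 46 div 157 div (2 * nv) = i"
proof -
  have dm: "b < w \<Longrightarrow> (a * w + b) mod w = b" "b < w \<Longrightarrow> (a * w + b) div w = a" for a b w :: nat by simp_all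
  have 1: "m div 46 = (i * (2 * nv) + j) * 157 + s" unfolding m by (rule dm(2)[OF assms(3)])
  have 2: "m div 46 div 157 = i * (2 * nv) + j" unfolding 1 by (rule dm(2)[OF assms(2)])
  show "m mod 46 = q" unfolding m by (rule dm(1)[OF assms(3)])
  show "m div 46 mod 157 = s" unfolding 1 by (rule dm(1)[OF assms(2)])
  show "m div 46 div 157 mod (2 * nv) = j" unfolding 2 by (rule dm(1)[OF assms(1)])
  show "m div 46 div 157 div (2 * nv) = i" unfolding 2 by (rule dm(2)[OF assms(1)])
qed

lemma code_inj_on: "inj_on code NV"
proof (rule inj_onI)
  fix u v assume u: "u \<in> NV" and v: "v \<in> NV" and e: "code u = code v"
  obtain x q y r where xy: "u = (x, q)" "v = (y, r)" by (cases u, cases v)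
  obtain i j s i' j' s' where s: "symb x = (i, j, s)" "symb y = (i', j', s')" by (metis prod.exhaust)
  have V: "x \<in> VV" "y \<in> VV" "q < 46" "r < 46" using u v xy by (auto simp: NV_def)
  have c: "code u = ((i * (2 * nv) + j) * 157 + s) * 46 + q" "code u = ((i' * (2 * nv) + j') * 157 + s') * 46 + r"
    using e s xy by (simp_all add: code_def)
  note d = decode[OF symb_VV(2,3)[OF V(1) s(1)] V(3) c(1)] and d' = decode[OF symb_VV(2,3)[OF V(2) s(2)] V(4) c(2)]
  have "symb x = symb y" "q = r" using d d' s by simp_all
  then show "u = v" using symb_inj V xy by (auto dest: inj_onD)
qed

lemma code_range: "code ` NV \<subseteq> {..<total}"
proof
  fix m assume "m \<in> code ` NV"
  then obtain x q i j s where x: "x \<in> VV" "q < 46" "symb x = (i, j, s)" "m = ((i * (2 * nv) + j) * 157 + s) * 46 + q"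
    by (auto simp: NV_def code_def split: prod.splits)
  note b = symb_VV[OF x(1,3)]
  have step: "a < n \<Longrightarrow> b < w \<Longrightarrow> a * w + b < n * w" for a b n w :: nat
  proof -
    assume "a < n" "b < w"
    then have "a * w + b < (a + 1) * w" "(a + 1) * w \<le> n * w" by (simp, intro mult_le_mono1) simp
    then show ?thesis by (rule less_le_trans)
  qed
  have "i < nc + 1" using b(1) by simp
  then show "m \<in> {..<total}" unfolding x(4) total_def lessThan_iff by (intro step b x)
qed

lemma badj_cases:
  assumes "badj x y"
  obtains i j s t where "symb x = (Suc i, j, s)" "symb y = (Suc i, j, t)" "(s, t) \<in> set cell_edges"
  | i j where "symb x = (Suc i, Suc j, 32)" "symb y = (Suc i, j, 21)"
  | i j where "symb x = (Suc i, j, 22)" "symb y = (i, j, 20)"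
  | j s t where "symb x = (0, j, s)" "symb y = (0, j, t)" "(s, t) \<in> set top_edges"
  | j s where "symb x = (0, j, s)" "symb y = (0, Suc j, 20)" "s = 150 \<or> s = 155"
  using assms
proof cases
  case (badj_cyc b c)
  obtain i j b' where b: "b = (i, j, b')" by (cases b)
  show thesis
  proof (cases i)
    case 0
    then have "b' = 25 \<or> b' = 26" using badj_cyc(3) b Bs_iff by auto
    then have "(22 + 5 * b' + c, 22 + 5 * b' + Suc c mod 5) \<in> set top_edges" using less5[OF badj_cyc(4)]
      by (elim disjE) (simp_all add: top_edges_def)
    then show thesis using badj_cyc(1,2) by (intro that(4)) (simp_all add: b 0)
  next
    case (Suc i')
    then have "b' < 25" using badj_cyc(3) b by (simp add: Bs_iff)
    then have "(22 + 5 * b' + c, 22 + 5 * b' + Suc c mod 5) \<in> set cell_edges"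
      using badj_cyc(4) unfolding cell_edges_def by (auto intro!: bexI[of _ b'] image_eqI[of _ _ c])
    then show thesis using badj_cyc(1,2) by (intro that(1)) (auto simp: b Suc)
  qed
next
  case (badj_att b c k)
  obtain i j b' where b: "b = (i, j, b')" by (cases b)
  show thesis
  proof (cases i)
    case 0
    then have b': "b' = 25 \<or> b' = 26" using badj_att(3) b Bs_iff by auto
    have "c = 0 \<and> k = (0, j, 20) \<or> c = 3 \<and> k = (0, Suc j, 20)" using badj_att(5) by (auto simp: b 0 att_top split: if_splits)
    then show thesis
    proof
      assume "c = 0 \<and> k = (0, j, 20)"
      moreover from this have "(22 + 5 * b' + c, 20) \<in> set top_edges" using b' by (elim disjE) (simp_all add: top_edges_def)
      ultimately show thesis using badj_att(1,2) by (intro that(4)[of j "22 + 5 * b' + c" 20]) (simp_all add: b 0)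
    next
      assume "c = 3 \<and> k = (0, Suc j, 20)"
      moreover from this have "22 + 5 * b' + c = 150 \<or> 22 + 5 * b' + c = 155" using b' by (elim disjE) simp_all
      ultimately show thesis using badj_att(1,2) by (intro that(5)[of j "22 + 5 * b' + c"]) (simp_all add: b 0)
    qed
  next
    case (Suc i')
    then have "b' < 25" using badj_att(3) b by (simp add: Bs_iff)
    from att_table[OF this badj_att(5)[unfolded b Suc] badj_att(4)] show thesis
    proof (elim disjE exE conjE)
      fix k' assume "(b', c, k') \<in> set attachments" "k = (Suc i', j, k')"
      moreover from this have "(22 + 5 * b' + c, k') \<in> set cell_edges" unfolding cell_edges_def by force
      ultimately show thesis using badj_att(1,2) by (intro that(1)) (auto simp: b Suc)
    next
      assume "b' = 0" "c = 0" "k = (i', j, 20)"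
      then show thesis using badj_att(1,2) by (intro that(3)) (auto simp: b Suc)
    next
      assume "b' = 2" "c = 0" "0 < j" "k = (Suc i', j - 1, 21)"
      then show thesis using badj_att(1,2) by (intro that(2)[of i' "j - 1"]) (auto simp: b Suc)
    qed
  qed
qed

text \<open>The gadget labelling starts with 0 at the root, so adding the label of the base vertex
  rotates it to fit, and rotations of the 5-cycle preserve adjacency.\<close>

definition lam :: "nat \<Rightarrow> nat" where
  "lam m = labels ! (m div 46 mod 157) + glabels ! (m mod 46)"

lemma lam_code:
  assumes "x \<in> VV" "q < 46" "symb x = (i, j, s)"
  shows "lam (code (x, q)) = labels ! s + glabels ! q"
  using decode[OF symb_VV(2,3)[OF assms(1,3)] assms(2) refl, of i] assms(3) by (simp add: lam_def code_def)

lemma label_step_add: "label_step a b \<Longrightarrow> label_step (c + a) (c + b)"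
  unfolding label_step_def by (metis add_Suc_right mod_add_right_eq)

lemma nadj_labels: "nadj u v \<Longrightarrow> label_step (lam (code u)) (lam (code v))"
proof (induction rule: nadj.induct)
  case (nadj_base x y)
  note V = badj_VV[OF nadj_base]
  have t: "\<forall>(s, t)\<in>set top_edges. label_step (labels ! s) (labels ! t)"
    by (simp add: top_edges_def label_step_def labels_nth del: One_nat_def)
  have "label_step (lam (code (x, 0))) (lam (code (y, 0)))"
    if "symb x = (i, j, s)" "symb y = (i', j', s')" "label_step (labels ! s) (labels ! s')" for i j s i' j' s'
    using V that(3) by (simp add: lam_code[OF _ _ that(1)] lam_code[OF _ _ that(2)] glabels_nth)
  note st = this
  from nadj_base(1) show ?case
  proof (cases rule: badj_cases)
    case (1 i j s t) then show ?thesis using st[OF 1(1,2)] cell_edges_labels by blast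
  next
    case (2 i j) then show ?thesis using st[OF 2] by (simp add: labels_nth label_step_def)
  next
    case (3 i j) then show ?thesis using st[OF 3] by (simp add: labels_nth label_step_def)
  next
    case (4 j s t') then show ?thesis using st[OF 4(1,2)] t by blast
  next
    case (5 j s) then show ?thesis using st[OF 5(1,2)] by (auto simp: labels_nth label_step_def)
  qed
next
  case (nadj_gadget x q r)
  obtain i j s where s: "symb x = (i, j, s)" by (cases "symb x")
  have "x \<in> VV" using nadj_gadget FF_VV by blast
  then show ?case using gadget_range[OF nadj_gadget(2)] gadget_labels nadj_gadget(2)
    by (auto simp: lam_code[OF _ _ s] intro!: label_step_add)
qed

lemma badj_degree:
  assumes "x \<in> VV"
  shows "\<exists>S. {y. badj x y \<or> badj y x} \<subseteq> S \<and> finite S \<and> card S \<le> 4"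
proof (cases x)
  case (B b c)
  define S where "S = {B b (Suc c mod 5), B b ((c + 4) mod 5)} \<union> (case att b c of Key k \<Rightarrow> {K k} | _ \<Rightarrow> {})"
  have "(Suc c' mod 5 + 4) mod 5 = c'" if "c' < 5" for c' :: nat using that by presburger
  then have "{y. badj x y \<or> badj y x} \<subseteq> S"
    unfolding B S_def by (auto elim!: badj.cases)
  moreover have "finite S" "card S \<le> 4" by (auto simp: S_def card_insert_if split: att.splits)
  ultimately show ?thesis by blast
next
  case (K k)
  obtain i j l where k: "k = (i, j, l)" by (cases k)
  have l: "l < 22" "i = 0 \<longrightarrow> l = 20" using assms by (auto simp: K k Ks_iff elim!: VV_cases)
  have nb: "\<exists>b c. y = B b c \<and> b \<in> Bs \<and> c < 5 \<and> att b c = Key k" if "badj x y \<or> badj y x" for y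
    using that unfolding K by (auto elim!: badj.cases)
  show ?thesis
  proof (cases i)
    case (Suc i')
    define F where "F = filter (\<lambda>t. snd (snd t) = l) attachments"
    define S :: "(nat \<times> nat \<times> nat, nat \<times> nat \<times> nat) bvx set" where "S = (\<lambda>t. B (i, j, fst t) (fst (snd t))) ` set F \<union>
      (if l = 20 then {B (Suc i, j, 0) 0} else if l = 21 then {B (i, Suc j, 2) 0} else {})"
    have "y \<in> S" if yb: "badj x y \<or> badj y x" for y
    proof -
      obtain i1 j1 b c where y: "y = B (i1, j1, b) c" "(i1, j1, b) \<in> Bs" "c < 5" "att (i1, j1, b) c = Key k"
        using nb[OF yb] by (metis prod.exhaust)
      obtain i2 where i2: "i1 = Suc i2" using y(4) k Suc by (cases i1) (auto simp: att_top split: if_splits)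
      have "b < 25" using y(2) i2 by (simp add: Bs_def)
      from att_table[OF this y(4)[unfolded i2] y(3)] show ?thesis
        using k Suc i2 y(1) by (force simp: S_def F_def)
    qed
    moreover have "finite S" by (simp add: S_def)
    moreover have "card S \<le> 4"
    proof -
      have "card ((\<lambda>t. B (i, j, fst t) (fst (snd t)) :: (nat \<times> nat \<times> nat, nat \<times> nat \<times> nat) bvx) ` set F) \<le> length F"
        by (meson card_image_le card_length finite_set le_trans)
      also have "\<dots> \<le> (if l = 20 \<or> l = 21 then 1 else 4)" using length_attachments l unfolding F_def by simp
      finally show ?thesis unfolding S_def
        by (intro order.trans[OF card_Un_le]) (auto split: if_splits)
    qed
    ultimately show ?thesis by blast
  next
    case 0
    define S :: "(nat \<times> nat \<times> nat, nat \<times> nat \<times> nat) bvx set" where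
      "S = {B (1, j, 0) 0} \<union> (if even j then {B (0, j, 25) 0, B (0, j, 26) 0} else {B (0, j - 1, 25) 3, B (0, j - 1, 26) 3})"
    have "y \<in> S" if yb: "badj x y \<or> badj y x" for y
    proof -
      obtain i1 j1 b c where y: "y = B (i1, j1, b) c" "(i1, j1, b) \<in> Bs" "c < 5" "att (i1, j1, b) c = Key k"
        using nb[OF yb] by (metis prod.exhaust)
      show ?thesis
      proof (cases i1)
        case (Suc i2)
        then have "b < 25" using y(2) by (simp add: Bs_def)
        from att_table[OF this y(4)[unfolded Suc] y(3)] show ?thesis using k 0 Suc y(1) by (auto simp: S_def)
      next
        case i1: 0
        then have "even j1" "b = 25 \<or> b = 26" using y(2) by (auto simp: Bs_def)
        then show ?thesis using y(1,4) k 0 i1 by (auto simp: S_def att_top split: if_splits)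
      qed
    qed
    moreover have "finite S" "card S \<le> 4" by (simp_all add: S_def card_insert_if)
    ultimately show ?thesis by blast
  qed
qed

end

section \<open>The two-page layout of a single row\<close>

lemma places: "length places = 157" "distinct places" "\<forall>p\<in>set places. p < 157"
  by (simp_all add: places_def)

lemma places_less: "s < 157 \<Longrightarrow> places ! s < 157"
  using places by simp

lemma sweep_top: "sweep False top_template 157 0 [145]" "sweep True top_template 157 0 [145]"
  by (simp_all add: top_template_def nth_append sweep.simps del: One_nat_def)

lemma template_wires: "\<forall>l\<in>set template. \<forall>(b, p)\<in>set l. b < 157 \<or> b = 273 \<and> \<not> p" "length template = 157"
  by (simp_all add: template_def)

lemma top_template_wires: "\<forall>l\<in>set top_template. \<forall>(b, p)\<in>set l. b < 157 \<or> b = 302" "length top_template = 157"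
  by (simp_all add: top_template_def)

lemma top_edges_template: "\<forall>(s, t)\<in>set top_edges. link top_template (places ! s) (places ! t)"
  by (simp add: top_edges_def link_def places_nth top_template_def nth_append del: One_nat_def)

definition tmpl :: "nat \<Rightarrow> (nat \<times> bool) list list" where
  "tmpl i = (if i = 0 then top_template else template)"

text \<open>Places where edges from outside the cell arrive or leave. For \<open>i > 0\<close> these
  are 4 (position 0 of block 0, the edge to the row above, page True), 145 (key 20, the edge to the
  row below, page False) and 116 (position 0 of block 2, the wire from the cell to the left, page
  False). In row 0, edges from the cell to the left reach 145 on both pages.\<close>

definition bounds :: "nat \<Rightarrow> bool \<Rightarrow> nat list" where
  "bounds i p = (if i = 0 then [145] else if p then [4] else [116, 145])"

lemma tmpl_sweep: "sweep p (tmpl i) 157 0 (bounds i p)" "sorted (bounds i p)"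
  using sweep_top sweep_template by (cases p; simp add: tmpl_def bounds_def)+

lemma tmpl_bounds: "a < 157 \<Longrightarrow> (b, p) \<in> set (tmpl i ! a) \<Longrightarrow> r \<in> set (bounds i p) \<Longrightarrow> \<not> (a < r \<and> r < b)"
  using sweep_sound[OF tmpl_sweep[where p = p and i = i]] by blast

lemma tmpl_noncrossing:
  assumes "(b, p) \<in> set (tmpl i ! a)" "(b', p) \<in> set (tmpl i ! a')" "a' < 157"
  shows "\<not> (a < a' \<and> a' < b \<and> b < b')"
  using conjunct2[OF sweep_sound[OF tmpl_sweep[where p = p and i = i]], rule_format, of a a' b b'] assms by auto

lemma tmpl_wires:
  assumes "a < 157" "(b, p) \<in> set (tmpl i ! a)"
  shows "b < 157 \<or> b - 157 \<in> set (bounds i p) \<and> 273 \<le> b \<and> b \<le> 302 \<and> (0 < i \<longrightarrow> \<not> p)"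
proof (cases "i = 0")
  case True
  then have "tmpl i ! a \<in> set top_template" using assms(1) top_template_wires(2) by (simp add: tmpl_def)
  then show ?thesis using top_template_wires(1) assms(2) True by (fastforce simp: bounds_def)
next
  case False
  then have "tmpl i ! a \<in> set template" using assms(1) template_wires(2) by (simp add: tmpl_def)
  then show ?thesis using template_wires(1) assms(2) False by (fastforce simp: bounds_def)
qed

lemma gadget_noncrossing:
  assumes "(b, p) \<in> set (gadget_template ! a)" "(b', p) \<in> set (gadget_template ! a')" "a' < 46"
  shows "\<not> (a < a' \<and> a' < b \<and> b < b')"
proof -
  have "sweep p gadget_template 46 0 []" using sweep_gadget by (cases p) auto
  from conjunct2[OF sweep_sound[OF this], rule_format, of a a' b b'] show ?thesis using assms by auto
qed

text \<open>Each place is widened to 46 consecutive positions with the base vertex first. A gadget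
  edge stays within one such stretch and has no multiple of 46 strictly inside, whereas all other
  edges end at multiples of 46; so the two kinds cannot interleave.\<close>

definition row_edge :: "nat \<Rightarrow> nat \<Rightarrow> nat \<Rightarrow> bool \<Rightarrow> bool" where
  "row_edge i z1 z2 p \<longleftrightarrow>
    (\<exists>x a b. a < 46 \<and> b < 46 \<and> a < b \<and> (b, p) \<in> set (gadget_template ! a) \<and> z1 = x * 46 + a \<and> z2 = x * 46 + b) \<or>
    (\<exists>j a b. a < 157 \<and> a < b \<and> (b, p) \<in> set (tmpl i ! a) \<and> z1 = (j * 157 + a) * 46 \<and> z2 = (j * 157 + b) * 46)"

lemma not_in_gadget_interval: "b < 46 \<Longrightarrow> \<not> (x * 46 + a < y * 46 \<and> y * 46 < x * 46 + b)" for a b x y :: nat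
  by (cases "y \<le> x") linarith+

lemma row_edge_noncrossing:
  assumes "row_edge i z1 z2 p" "row_edge i w1 w2 p"
  shows "\<not> (z1 < w1 \<and> w1 < z2 \<and> z2 < w2)"
proof
  assume *: "z1 < w1 \<and> w1 < z2 \<and> z2 < w2"
  from assms(1)[unfolded row_edge_def] show False
  proof (elim disjE exE conjE)
    fix x a b assume z: "a < 46" "b < 46" "a < b" "(b, p) \<in> set (gadget_template ! a)" "z1 = x * 46 + a" "z2 = x * 46 + b"
    from assms(2)[unfolded row_edge_def] show False
    proof (elim disjE exE conjE)
      fix y c d assume w: "c < 46" "d < 46" "(d, p) \<in> set (gadget_template ! c)" "w1 = y * 46 + c" "w2 = y * 46 + d"
      have "y = x" using * z w by linarith
      have "a < c" "c < b" "b < d" using * unfolding z(5,6) w(4,5) \<open>y = x\<close> by simp_all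
      then show False using gadget_noncrossing[OF z(4) w(3) w(1)] by simp
    next
      fix j c d assume w: "w1 = (j * 157 + c) * 46"
      define y where "y = j * 157 + c"
      have "w1 = y * 46" using w by (simp add: y_def)
      then show False using * z not_in_gadget_interval[OF z(2)] by blast
    qed
  next
    fix j a b assume z: "a < 157" "a < b" "(b, p) \<in> set (tmpl i ! a)" "z1 = (j * 157 + a) * 46" "z2 = (j * 157 + b) * 46"
    from assms(2)[unfolded row_edge_def] show False
    proof (elim disjE exE conjE)
      fix y c d assume w: "c < 46" "d < 46" "w1 = y * 46 + c" "w2 = y * 46 + d"
      define x where "x = j * 157 + b"
      have "z2 = x * 46" using z by (simp add: x_def)
      then show False using * w not_in_gadget_interval[OF w(2)] by blast
    next
      fix k c d assume w: "c < 157" "c < d" "(d, p) \<in> set (tmpl i ! c)" "w1 = (k * 157 + c) * 46" "w2 = (k * 157 + d) * 46"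
      have o: "j * 157 + a < k * 157 + c" "k * 157 + c < j * 157 + b" "j * 157 + b < k * 157 + d" using * z w by simp_all
      have b: "b < 314" using tmpl_wires[OF z(1,3)] by linarith
      have "k = j \<or> k = Suc j" using o b z(1) w(1) by linarith
      then show False
      proof
        assume "k = j"
        then show False using tmpl_noncrossing[OF z(3) w(3) w(1)] o by simp
      next
        assume k: "k = Suc j"
        then have "157 \<le> b" using o(2) by simp
        then have "b - 157 \<in> set (bounds i p)" using tmpl_wires[OF z(1,3)] by linarith
        moreover have "c < b - 157" using o \<open>157 \<le> b\<close> unfolding k by presburger
        moreover have "b - 157 < d" using o \<open>157 \<le> b\<close> unfolding k by presburger
        ultimately show False using tmpl_bounds[OF w(1,3)] by blast
      qed
    qed
  qed
qed

text \<open>The end points of the edges between consecutive rows are visible from the side on which these edges leave.\<close>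

lemma row_edge_cover:
  assumes e: "row_edge i z1 z2 p" and r: "r \<in> set (bounds i p)" "r = 145 \<or> 0 < i \<and> p"
  shows "\<not> (z1 < (j * 157 + r) * 46 \<and> (j * 157 + r) * 46 < z2)"
proof
  assume *: "z1 < (j * 157 + r) * 46 \<and> (j * 157 + r) * 46 < z2"
  from e[unfolded row_edge_def] show False
  proof (elim disjE exE conjE)
    fix x a b assume z: "a < 46" "b < 46" "z1 = x * 46 + a" "z2 = x * 46 + b"
    define y where "y = j * 157 + r"
    have "z1 < y * 46 \<and> y * 46 < z2" using * by (simp add: y_def)
    then show False using z not_in_gadget_interval[OF z(2)] by blast
  next
    fix k a b assume z: "a < 157" "a < b" "(b, p) \<in> set (tmpl i ! a)" "z1 = (k * 157 + a) * 46" "z2 = (k * 157 + b) * 46"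
    have o: "k * 157 + a < j * 157 + r" "j * 157 + r < k * 157 + b" using * z by simp_all
    have rb: "r < 157" using r(1) by (auto simp: bounds_def split: if_splits)
    note w = tmpl_wires[OF z(1,3)]
    have b: "b < 314" using w by linarith
    have "j = k \<or> j = Suc k" using o b z(1) rb by linarith
    then show False
    proof
      assume "j = k"
      then show False using tmpl_bounds[OF z(1,3) r(1)] o by simp
    next
      assume "j = Suc k"
      then have "157 \<le> b" "157 + r < b" using o by simp_all
      then show False using w r(2) by linarith
    qed
  qed
qed

context cells
begin

definition rw :: nat where "rw = (2 * nv) * 157 * 46"

text \<open>The rows are traversed alternately from left to right and from right to left.\<close>

definition ppos :: "nat \<Rightarrow> nat \<Rightarrow> nat" where
  "ppos i z = i * rw + (if even i then z else rw - 1 - z)"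

lemma ppos_div: "z < rw \<Longrightarrow> ppos i z div rw = i"
  by (simp add: ppos_def)

lemma ppos_less: "z < rw \<Longrightarrow> w < rw \<Longrightarrow> ppos i z < ppos i w \<longleftrightarrow> (if even i then z < w else w < z)"
  by (auto simp: ppos_def)

lemma ppos_eq: "z < rw \<Longrightarrow> w < rw \<Longrightarrow> ppos i z = ppos k w \<Longrightarrow> i = k \<and> z = w"
  using ppos_div[of z i] ppos_div[of w k] by (auto simp: ppos_def split: if_splits)

lemma less_rw: "j < 2 * nv \<Longrightarrow> a < 157 \<Longrightarrow> q < 46 \<Longrightarrow> (j * 157 + a) * 46 + q < rw"
proof -
  assume "j < 2 * nv" "a < 157" "q < 46"
  then have "Suc j \<le> 2 * nv" by simp
  then have "Suc j * (157 * 46) \<le> 2 * nv * (157 * 46)" by (rule mult_le_mono1)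
  then show ?thesis using \<open>a < 157\<close> \<open>q < 46\<close> unfolding rw_def by simp
qed

text \<open>Pages are exchanged in odd rows, so an edge between two rows leaves the upper one on its
  page False and enters the lower one on its page True although it lies on a single actual page.
  Because the direction of the rows alternates, the edges between two consecutive rows are
  nested.\<close>

inductive rep :: "nat \<Rightarrow> nat \<Rightarrow> bool \<Rightarrow> bool" where
  rep_row: "row_edge i z1 z2 p \<Longrightarrow> z1 < rw \<Longrightarrow> z2 < rw \<Longrightarrow> z1 < z2 \<Longrightarrow>
    rep (min (ppos i z1) (ppos i z2)) (max (ppos i z1) (ppos i z2)) (p \<noteq> odd i)"
| rep_down: "j < 2 * nv \<Longrightarrow> rep (ppos i ((j * 157 + 145) * 46)) (ppos (Suc i) ((j * 157 + 4) * 46)) (odd i)"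

text \<open>Division by the row width recovers the rows of the end points. Hence interleaving edges
  could only be two of the same row, a row edge against an edge that ends in this row, which
  \<open>row_edge_cover\<close> excludes, or two edges between rows. The latter are nested if they
  leave the same row and lie on different pages if they leave consecutive ones.\<close>

lemma rep_noncrossing:
  assumes "rep a b p" "rep c d p" and o: "a < c" "c < b" "b < d"
  shows False
proof -
  have mono: "x div rw \<le> y div rw" if "x < y" for x y using that by (simp add: div_le_mono)
  note m = mono[OF o(1)] mono[OF o(2)] mono[OF o(3)]
  from assms(1) show False
  proof cases
    case e: (rep_row i z1 z2 p1)
    have mm: "min (ppos i z1) (ppos i z2) = (if even i then ppos i z1 else ppos i z2)"
      "max (ppos i z1) (ppos i z2) = (if even i then ppos i z2 else ppos i z1)"
      using ppos_less[OF e(5,6), of i] ppos_less[OF e(6,5), of i] e(7) by auto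
    have dv: "a div rw = i" "b div rw = i" using e ppos_div unfolding e(1,2) mm by auto
    from assms(2) show ?thesis
    proof cases
      case f: (rep_row k w1 w2 p2)
      have mm': "min (ppos k w1) (ppos k w2) = (if even k then ppos k w1 else ppos k w2)"
        "max (ppos k w1) (ppos k w2) = (if even k then ppos k w2 else ppos k w1)"
        using ppos_less[OF f(5,6), of k] ppos_less[OF f(6,5), of k] f(7) by auto
      have "c div rw = k" using f ppos_div unfolding f(1,2) mm' by auto
      then have k: "k = i" using m dv by simp
      then have p: "p2 = p1" using e(3) f(3) by blast
      show ?thesis
      proof (cases "even i")
        case True
        then show ?thesis
          using row_edge_noncrossing[OF e(4) f(4)[unfolded k p]] o ppos_less[of _ _ i] e(5,6) f(5,6)
          unfolding e(1,2) f(1,2)[unfolded k] mm mm'[unfolded k] by simp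
      next
        case False
        then show ?thesis
          using row_edge_noncrossing[OF f(4)[unfolded k p] e(4)] o ppos_less[of _ _ i] e(5,6) f(5,6)
          unfolding e(1,2) f(1,2)[unfolded k] mm mm'[unfolded k] by simp
      qed
    next
      case f: (rep_down j k)
      have z: "(j * 157 + 145) * 46 < rw" using less_rw[OF f(4), of 145 0] by simp
      have "c div rw = k" using ppos_div[OF z] f(1) by simp
      then have k: "k = i" using m dv by simp
      have p: "p1 = False" using e(3) f(3) k by blast
      have "\<not> (z1 < (j * 157 + 145) * 46 \<and> (j * 157 + 145) * 46 < z2)"
        by (rule row_edge_cover[OF e(4)]) (simp_all add: p bounds_def)
      then show ?thesis using o(1,2) ppos_less[of _ _ i] e(5,6) z unfolding e(1,2) f(1) mm k by (simp split: if_splits)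
    qed
  next
    case e: (rep_down j i)
    have z: "(j * 157 + 145) * 46 < rw" "(j * 157 + 4) * 46 < rw" using less_rw[OF e(4), of 145 0] less_rw[OF e(4), of 4 0] by simp_all
    have dv: "a div rw = i" "b div rw = Suc i" using ppos_div z e(1,2) by simp_all
    from assms(2) show ?thesis
    proof cases
      case f: (rep_row k w1 w2 p2)
      have mm': "min (ppos k w1) (ppos k w2) = (if even k then ppos k w1 else ppos k w2)"
        "max (ppos k w1) (ppos k w2) = (if even k then ppos k w2 else ppos k w1)"
        using ppos_less[OF f(5,6), of k] ppos_less[OF f(6,5), of k] f(7) by auto
      have "c div rw = k" "d div rw = k" using f ppos_div unfolding f(1,2) mm' by auto
      then have k: "k = Suc i" using m dv by simp
      have p: "p2 = True" using e(3) f(3) k by (cases p2) auto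
      have "\<not> (w1 < (j * 157 + 4) * 46 \<and> (j * 157 + 4) * 46 < w2)"
        by (rule row_edge_cover[OF f(4)]) (simp_all add: p k bounds_def)
      then show ?thesis using o(2,3) ppos_less[of _ _ "Suc i"] f(5,6) z unfolding e(2) f(1,2)[unfolded k] mm'[unfolded k] by (simp split: if_splits)
    next
      case f: (rep_down l k)
      have w: "(l * 157 + 145) * 46 < rw" "(l * 157 + 4) * 46 < rw" using less_rw[OF f(4), of 145 0] less_rw[OF f(4), of 4 0] by simp_all
      have dv': "c div rw = k" "d div rw = Suc k" using ppos_div w f(1,2) by simp_all
      then have "k = i \<or> k = Suc i" using m dv by linarith
      moreover have "odd k = odd i" using e(3) f(3) by simp
      ultimately have k: "k = i" by auto
      have "(l * 157 + 145 < j * 157 + 145) = (l < j)" "(l * 157 + 4 < j * 157 + 4) = (l < j)" by auto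
      then show ?thesis using o(1,3) ppos_less[OF z(1) w(1), of i] ppos_less[OF z(2) w(2), of "Suc i"]
        unfolding e(1,2) f(1,2) k by (auto split: if_splits)
    qed
  qed
qed

definition pos :: "nat \<Rightarrow> nat" where
  "pos m = ppos (m div 46 div 157 div (2 * nv)) ((m div 46 div 157 mod (2 * nv) * 157 + places ! (m div 46 mod 157)) * 46 + m mod 46)"

lemma pos_inj: "inj pos"
proof (rule injI)
  fix m n assume e: "pos m = pos n"
  have lt: "(a div 46 div 157 mod (2 * nv) * 157 + places ! (a div 46 mod 157)) * 46 + a mod 46 < rw" for a
    by (rule less_rw) (use nv places_less in auto)
  define jm sm qm jn sn qn where d: "jm = m div 46 div 157 mod (2 * nv)" "sm = m div 46 mod 157" "qm = m mod 46"
    "jn = n div 46 div 157 mod (2 * nv)" "sn = n div 46 mod 157" "qn = n mod 46"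
  have b: "sm < 157" "sn < 157" "qm < 46" "qn < 46" by (simp_all add: d)
  have 1: "m div 46 div 157 div (2 * nv) = n div 46 div 157 div (2 * nv)"
    and 2: "(jm * 157 + places ! sm) * 46 + qm = (jn * 157 + places ! sn) * 46 + qn"
    using ppos_eq[OF lt lt e[unfolded pos_def]] by (simp_all add: d)
  have dm: "a * w + b = a' * w + b' \<Longrightarrow> b < w \<Longrightarrow> b' < w \<Longrightarrow> a = a' \<and> b = b'" for a a' b b' w :: nat
    using code_inj by blast
  have q: "jm * 157 + places ! sm = jn * 157 + places ! sn \<and> qm = qn" by (rule dm[OF 2 b(3,4)])
  have j: "jm = jn \<and> places ! sm = places ! sn" by (rule dm[OF conjunct1[OF q]]) (use places_less b in blast)+
  then have s: "sm = sn" using b places(1,2) nth_eq_iff_index_eq by metis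
  have "m div 46 div 157 = n div 46 div 157" using 1 j unfolding d by (metis div_mult_mod_eq)
  then have "m div 46 = n div 46" using s unfolding d by (metis div_mult_mod_eq)
  then show "m = n" using q unfolding d by (metis div_mult_mod_eq)
qed

lemma pos_code:
  assumes "x \<in> VV" "q < 46" "symb x = (i, j, s)"
  shows "pos (code (x, q)) = ppos i ((j * 157 + places ! s) * 46 + q)" "(j * 157 + places ! s) * 46 + q < rw"
proof -
  note b = symb_VV(2,3)[OF assms(1,3)]
  have c: "code (x, q) = ((i * (2 * nv) + j) * 157 + s) * 46 + q" using assms(3) by (simp add: code_def)
  show "pos (code (x, q)) = ppos i ((j * 157 + places ! s) * 46 + q)"
    unfolding pos_def decode[OF b assms(2) c] ..
  show "(j * 157 + places ! s) * 46 + q < rw" using less_rw b places_less assms(2) by blast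
qed

lemma rep_rowI:
  assumes "row_edge i (min z w) (max z w) p" "z < rw" "w < rw" "z \<noteq> w"
  shows "\<exists>p. rep (min (ppos i z) (ppos i w)) (max (ppos i z) (ppos i w)) p"
proof (cases "z < w")
  case True
  then show ?thesis using rep_row[of i z w p] assms by auto
next
  case False
  then show ?thesis using rep_row[of i w z p] assms by (auto simp: min.commute max.commute)
qed

lemma linkE:
  assumes "link t a b" "a \<noteq> b"
  obtains p where "(max a b, p) \<in> set (t ! min a b)"
  using assms by (auto simp: link_def)

lemma edge_rep:
  assumes "nadj u v"
  shows "\<exists>p. rep (min (pos (code u)) (pos (code v))) (max (pos (code u)) (pos (code v))) p"
  using assms
proof cases
  case (nadj_base x y)
  note V = badj_VV[OF nadj_base(3)]
  have row: ?thesis if s: "symb x = (i, j, s)" "symb y = (i, k, t)" and st: "places ! s \<noteq> places ! t"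
    and e: "row_edge i (min ((j * 157 + places ! s) * 46) ((k * 157 + places ! t) * 46))
      (max ((j * 157 + places ! s) * 46) ((k * 157 + places ! t) * 46)) p" for i j k s t p
  proof -
    note px = pos_code[OF conjunct1[OF V], of 0, OF _ s(1)] and py = pos_code[OF conjunct1[OF conjunct2[OF V]], of 0, OF _ s(2)]
    have b: "places ! s < 157" "places ! t < 157" using symb_VV(3) V s places_less by blast+
    have "(j * 157 + places ! s) * 46 \<noteq> (k * 157 + places ! t) * 46" using code_inj[OF _ b, of j k] st by auto
    from rep_rowI[OF e _ _ this] px py show ?thesis unfolding nadj_base(1,2) by simp
  qed
  have cell: ?thesis if s: "symb x = (i, j, s)" "symb y = (i, j, t)" and l: "link (tmpl i) (places ! s) (places ! t)" for i j s t
  proof -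
    have b: "s < 157" "t < 157" using symb_VV(3) V s by blast+
    have "s \<noteq> t" using V s symb_inj by (metis inj_onD)
    then have ne: "places ! s \<noteq> places ! t" using b places(1,2) nth_eq_iff_index_eq by metis
    from linkE[OF l ne] obtain p where p: "(max (places ! s) (places ! t), p) \<in> set (tmpl i ! min (places ! s) (places ! t))" .
    show ?thesis
      by (rule row[OF s ne], unfold row_edge_def, rule disjI2, rule exI[of _ j], rule exI[of _ "min (places ! s) (places ! t)"],
        rule exI[of _ "max (places ! s) (places ! t)"])
       (use p ne places_less[OF b(1)] places_less[OF b(2)] in \<open>auto simp: min_def max_def\<close>)
  qed
  have T: "(273, False) \<in> set (template ! 146)" "(302, False) \<in> set (top_template ! 150)" "(302, True) \<in> set (top_template ! 155)"
    by (simp_all add: template_nth top_template_def nth_append)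
  from nadj_base(3) show ?thesis
  proof (cases rule: badj_cases)
    case (1 i j s t)
    then show ?thesis using cell[OF 1(1,2)] cell_edges_template by (auto simp: tmpl_def)
  next
    case (2 i j)
    show ?thesis
      by (rule row[OF 2, of False], simp add: places_nth, unfold row_edge_def, rule disjI2, rule exI[of _ j], rule exI[of _ 146], rule exI[of _ 273])
       (use T in \<open>simp add: places_nth tmpl_def\<close>)
  next
    case (3 i j)
    have j: "j < 2 * nv" using symb_VV(2) V 3 by blast
    note px = pos_code[OF conjunct1[OF V], of 0, OF _ 3(1)] and py = pos_code[OF conjunct1[OF conjunct2[OF V]], of 0, OF _ 3(2)]
    have "ppos i ((j * 157 + 145) * 46) < ppos (Suc i) ((j * 157 + 4) * 46)"
    proof (rule ccontr)
      assume "\<not> ?thesis"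
      then have "ppos (Suc i) ((j * 157 + 4) * 46) div rw \<le> ppos i ((j * 157 + 145) * 46) div rw" by (simp add: div_le_mono)
      then show False using ppos_div px(2) py(2) by (simp add: places_nth)
    qed
    then show ?thesis using rep_down[OF j, of i] px py unfolding nadj_base(1,2) by (auto simp: places_nth)
  next
    case (4 j s t)
    then show ?thesis using cell[OF 4(1,2)] top_edges_template by (auto simp: tmpl_def)
  next
    case (5 j s)
    define p where "p = (s = 155)"
    have ps: "places ! s = (if p then 155 else 150)" "places ! 20 = 145" using 5(3) by (auto simp: p_def places_nth)
    have "row_edge 0 ((j * 157 + places ! s) * 46) ((j * 157 + 302) * 46) p"
      unfolding row_edge_def
      by (rule disjI2, rule exI[of _ j], rule exI[of _ "places ! s"], rule exI[of _ 302]) (use T in \<open>simp add: ps tmpl_def\<close>)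
    moreover have "min ((j * 157 + places ! s) * 46) ((Suc j * 157 + 145) * 46) = (j * 157 + places ! s) * 46"
      "max ((j * 157 + places ! s) * 46) ((Suc j * 157 + 145) * 46) = (j * 157 + 302) * 46" by (simp_all add: ps)
    ultimately show ?thesis by (intro row[OF 5(1,2), of p]) (simp_all only: ps, simp_all)
  qed
next
  case (nadj_gadget x q r)
  obtain i j s where s: "symb x = (i, j, s)" by (cases "symb x")
  have x: "x \<in> VV" using nadj_gadget FF_VV by blast
  note g = gadget_range[OF nadj_gadget(4)]
  have "link gadget_template q r" using gadget_pages nadj_gadget(4) by blast
  from linkE[OF this] g obtain p where p: "(max q r, p) \<in> set (gadget_template ! min q r)" by auto
  note px = pos_code[OF x _ s, of q] and py = pos_code[OF x _ s, of r]
  have "row_edge i (min ((j * 157 + places ! s) * 46 + q) ((j * 157 + places ! s) * 46 + r))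
      (max ((j * 157 + places ! s) * 46 + q) ((j * 157 + places ! s) * 46 + r)) p"
    unfolding row_edge_def
    by (rule disjI1, rule exI[of _ "j * 157 + places ! s"], rule exI[of _ "min q r"], rule exI[of _ "max q r"])
      (use g p in \<open>auto simp: min_def max_def\<close>)
  from rep_rowI[OF this] px py g show ?thesis unfolding nadj_gadget(1,2) by auto
qed

theorem graph_planar: "planar {..<total} (edges code)"
proof (rule planar_two_page)
  show "inj_on pos {..<total}" using pos_inj by (rule inj_on_subset) simp
  show "simple_graph {..<total} (edges code)" by (rule edges_simple[OF code_inj_on code_range])
  define pg where "pg e = rep (Min (pos ` e)) (Max (pos ` e)) True" for e
  have *: "rep (pos a) (pos b) (pg {a, b})" if "{a, b} \<in> edges code" "pos a < pos b" for a b
  proof -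
    obtain u v where uv: "{a, b} = {code u, code v}" "nadj u v" using \<open>{a, b} \<in> edges code\<close> unfolding edges_def by blast
    obtain p where "rep (min (pos (code u)) (pos (code v))) (max (pos (code u)) (pos (code v))) p" using edge_rep[OF uv(2)] by blast
    then have "rep (pos a) (pos b) p" using uv(1) that(2) by (auto simp: doubleton_eq_iff)
    moreover have "pg {a, b} \<longleftrightarrow> rep (pos a) (pos b) True" using that(2) by (simp add: pg_def)
    ultimately show ?thesis by (cases p; cases "pg {a, b}") auto
  qed
  fix a b c d assume e: "{a, b} \<in> edges code" "{c, d} \<in> edges code" "pg {a, b} = pg {c, d}"
    and o: "pos a < pos c" "pos c < pos b" "pos b < pos d"
  show False
    using rep_noncrossing[OF *[OF e(1)], of "pos c" "pos d"] *[OF e(2)] e(3) o by auto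
qed

end

section \<open>The reduction\<close>

context cells
begin

definition row where "row m = m div 46 div 157 div (2 * nv)"
definition col where "col m = m div 46 div 157 mod (2 * nv)"
definition sym where "sym m = m div 46 mod 157"

definition has_block :: "nat \<Rightarrow> nat \<Rightarrow> nat \<Rightarrow> bool" where
  "has_block i j b = (if i = 0 then even j \<and> (b = 25 \<or> b = 26 \<and> U (j div 2)) else b < 25)"

text \<open>An explicit list, so that \<open>att\<close> is always evaluated at a constant block
  number and position and unfolds into a case distinction on row and column.\<close>

definition block_places :: "(nat \<times> nat) list" where
  "block_places = List.product [0..<27] [0..<5]"

definition has_gadget :: "nat \<Rightarrow> nat \<Rightarrow> nat \<Rightarrow> bool" where
  "has_gadget i j s \<longleftrightarrow> s < 22 \<and> (i = 0 \<longrightarrow> s = 20) \<or>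
    (\<exists>a\<in>set block_places. s = 22 + 5 * fst a + snd a \<and> has_block i j (fst a) \<and> att (i, j, fst a) (snd a) = Kill)"

text \<open>The adjacency relation restated through division, remainder and finite lists, in a form
  that the definability rules can process. Like \<open>nadj\<close> it is oriented; the edge set
  needs both directions.\<close>

definition adj :: "nat \<Rightarrow> nat \<Rightarrow> bool" where
  "adj m n \<longleftrightarrow> m div 46 = n div 46 \<and> has_gadget (row m) (col m) (sym m) \<and> (\<exists>e\<in>set gadget. m mod 46 = fst e \<and> n mod 46 = snd e) \<or>
    m mod 46 = 0 \<and> n mod 46 = 0 \<and> (\<exists>a\<in>set block_places. sym m = 22 + 5 * fst a + snd a \<and> has_block (row m) (col m) (fst a) \<and>
      (row n = row m \<and> col n = col m \<and> sym n = 22 + 5 * fst a + Suc (snd a) mod 5 \<or>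
       (\<exists>k\<in>set [0..<22]. sym n = k \<and> att (row m, col m, fst a) (snd a) = Key (row n, col n, k))))"

lemma block_places: "(b, c) \<in> set block_places \<longleftrightarrow> b < 27 \<and> c < 5"
  by (auto simp: block_places_def)

lemma Bs_has_block: "i \<le> nc \<Longrightarrow> j < 2 * nv \<Longrightarrow> (i, j, b) \<in> Bs \<longleftrightarrow> has_block i j b"
  by (simp add: Bs_iff has_block_def)

lemma has_block_less: "has_block i j b \<Longrightarrow> b < 27"
  by (auto simp: has_block_def split: if_splits)

lemma has_gadget_iff:
  assumes "i \<le> nc" "j < 2 * nv"
  shows "has_gadget i j s \<longleftrightarrow> (\<exists>x\<in>FF. symb x = (i, j, s))"
proof
  assume "has_gadget i j s"
  then consider "s < 22" "i = 0 \<longrightarrow> s = 20"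
    | b c where "(b, c) \<in> set block_places" "s = 22 + 5 * b + c" "has_block i j b" "att (i, j, b) c = Kill"
    unfolding has_gadget_def by auto
  then show "\<exists>x\<in>FF. symb x = (i, j, s)"
  proof cases
    case 1
    then have "K (i, j, s) \<in> FF" using assms by (simp add: FF_def Ks_iff)
    then show ?thesis by force
  next
    case 2
    then have "B (i, j, b) c \<in> FF" using assms by (simp add: FF_def Bs_has_block block_places)
    then show ?thesis using 2(2) by force
  qed
next
  assume "\<exists>x\<in>FF. symb x = (i, j, s)"
  then obtain x where x: "x \<in> FF" "symb x = (i, j, s)" by blast
  from x(1)[unfolded FF_def] show "has_gadget i j s"
  proof
    assume "x \<in> K ` Ks"
    then show ?thesis using x(2) by (auto simp: has_gadget_def Ks_iff)
  next
    assume "x \<in> {B b c |b c. b \<in> Bs \<and> c < 5 \<and> att b c = Kill}"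
    then obtain b' c where bc: "x = B b' c" "b' \<in> Bs" "c < 5" "att b' c = Kill" by blast
    obtain i' j' b where "b' = (i', j', b)" by (cases b')
    then have b: "b' = (i, j, b)" "s = 22 + 5 * b + c" using x(2) bc(1) by auto
    then have "has_block i j b" using bc(2) assms Bs_has_block by simp
    then show ?thesis using b bc has_block_less block_places unfolding has_gadget_def by (intro disjI2 bexI[of _ "(b, c)"]) auto
  qed
qed

lemma code_eq:
  assumes "x \<in> VV" "q < 46"
  shows "code (x, q) = m \<longleftrightarrow> symb x = (row m, col m, sym m) \<and> q = m mod 46"
proof
  obtain i j s where s: "symb x = (i, j, s)" by (cases "symb x")
  assume "code (x, q) = m"
  then have "m = ((i * (2 * nv) + j) * 157 + s) * 46 + q" using s by (simp add: code_def)
  from decode[OF symb_VV(2,3)[OF assms(1) s] assms(2) this] show "symb x = (row m, col m, sym m) \<and> q = m mod 46"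
    using s by (simp add: row_def col_def sym_def)
next
  assume "symb x = (row m, col m, sym m) \<and> q = m mod 46"
  then show "code (x, q) = m" by (simp only: code_def row_def col_def sym_def prod.case fst_conv snd_conv div_mult_mod_eq)
qed

lemma adj_iff:
  assumes m: "m < total"
  shows "(\<exists>u v. nadj u v \<and> code u = m \<and> code v = n) \<longleftrightarrow> adj m n"
proof -
  have "m div 46 div 157 < (nc + 1) * (2 * nv)" using m by (simp add: total_def less_mult_imp_div_less mult.assoc)
  then have r: "row m \<le> nc" unfolding row_def by (metis add.commute less_Suc_eq_le less_mult_imp_div_less plus_1_eq_Suc)
  have c: "col m < 2 * nv" using nv by (simp add: col_def)
  show ?thesis
  proof
    assume "\<exists>u v. nadj u v \<and> code u = m \<and> code v = n"
    then obtain u v where uv: "nadj u v" "code u = m" "code v = n" by blast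
    from uv(1) show "adj m n"
    proof cases
      case (nadj_gadget x q r)
      have x: "x \<in> VV" using nadj_gadget FF_VV by blast
      note g = gadget_range[OF nadj_gadget(4)]
      have s: "symb x = (row m, col m, sym m)" "q = m mod 46" "symb x = (row n, col n, sym n)" "r = n mod 46"
        using code_eq[OF x, of q m] code_eq[OF x, of r n] g uv nadj_gadget by auto
      have "m div 46 = n div 46"
      proof -
        have "row m = row n" "col m = col n" "sym m = sym n" using s by auto
        then show ?thesis unfolding row_def col_def sym_def by (metis div_mult_mod_eq)
      qed
      moreover have "has_gadget (row m) (col m) (sym m)" using has_gadget_iff[OF r c] nadj_gadget(3) s by blast
      ultimately show ?thesis using s nadj_gadget(4) unfolding adj_def by (intro disjI1 conjI bexI[of _ "(q, r)"]) auto
    next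
      case (nadj_base x y)
      note V = badj_VV[OF nadj_base(3)]
      have s: "symb x = (row m, col m, sym m)" "0 = m mod 46" "symb y = (row n, col n, sym n)" "0 = n mod 46"
        using code_eq[of x 0 m] code_eq[of y 0 n] V uv nadj_base by auto
      from nadj_base(3) show ?thesis
      proof cases
        case (badj_cyc b' c')
        obtain b where b: "b' = (row m, col m, b)" "sym m = 22 + 5 * b + c'" using s(1) badj_cyc(1) by (cases b') auto
        have "has_block (row m) (col m) b" using badj_cyc(3) b Bs_has_block[OF r c] by simp
        then show ?thesis using s b badj_cyc has_block_less block_places unfolding adj_def
          by (rule_tac disjI2, intro conjI bexI[of _ "(b, c')"]) auto
      next
        case (badj_att b' c' k')
        obtain b where b: "b' = (row m, col m, b)" "sym m = 22 + 5 * b + c'" using s(1) badj_att(1) by (cases b') auto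
        have h: "has_block (row m) (col m) b" using badj_att(3) b Bs_has_block[OF r c] by simp
        have k: "k' = (row n, col n, sym n)" using s(3) badj_att(2) by simp
        have "k' \<in> Ks" using att_Ks badj_att by blast
        then have "sym n < 22" using k by (simp add: Ks_iff)
        then have "\<exists>k\<in>set [0..<22]. sym n = k \<and> att (row m, col m, b) c' = Key (row n, col n, k)"
          using badj_att(5) b(1) k by auto
        then show ?thesis using s b badj_att h has_block_less block_places unfolding adj_def
          by (rule_tac disjI2, intro conjI bexI[of _ "(b, c')"]) auto
      qed
    qed
  next
    assume "adj m n"
    then consider (gad) q' r' where "m div 46 = n div 46" "has_gadget (row m) (col m) (sym m)" "(q', r') \<in> set gadget" "m mod 46 = q'" "n mod 46 = r'"
      | (base) b c' where "m mod 46 = 0" "n mod 46 = 0" "(b, c') \<in> set block_places" "sym m = 22 + 5 * b + c'" "has_block (row m) (col m) b"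
        "row n = row m \<and> col n = col m \<and> sym n = 22 + 5 * b + Suc c' mod 5 \<or> sym n < 22 \<and> att (row m, col m, b) c' = Key (row n, col n, sym n)"
      unfolding adj_def by auto
    then show "\<exists>u v. nadj u v \<and> code u = m \<and> code v = n"
    proof cases
      case gad
      obtain x where x: "x \<in> FF" "symb x = (row m, col m, sym m)" using has_gadget_iff[OF r c] gad(2) by blast
      have "x \<in> VV" using x FF_VV by blast
      moreover have "row n = row m" "col n = col m" "sym n = sym m" using gad(1) by (simp_all add: row_def col_def sym_def)
      ultimately have "code (x, q') = m" "code (x, r') = n" using code_eq x gad gadget_range[OF gad(3)] by auto
      then show ?thesis using nadj_gadget[OF x(1) gad(3)] by blast
    next
      case base
      have b: "(row m, col m, b) \<in> Bs" "c' < 5" using Bs_has_block[OF r c] base block_places by auto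
      define x where "x = (B (row m, col m, b) c' :: (nat \<times> nat \<times> nat, nat \<times> nat \<times> nat) bvx)"
      have x: "symb x = (row m, col m, sym m)" using base(4) by (simp add: x_def)
      have "\<exists>y. badj x y \<and> symb y = (row n, col n, sym n)"
        using base(6)
      proof
        assume "row n = row m \<and> col n = col m \<and> sym n = 22 + 5 * b + Suc c' mod 5"
        then show ?thesis using badj_cyc[OF b] unfolding x_def by (intro exI[of _ "B (row m, col m, b) (Suc c' mod 5)"]) simp
      next
        assume "sym n < 22 \<and> att (row m, col m, b) c' = Key (row n, col n, sym n)"
        then show ?thesis using badj_att[OF b] unfolding x_def by (intro exI[of _ "K (row n, col n, sym n)"]) simp
      qed
      then obtain y where y: "badj x y" "symb y = (row n, col n, sym n)" by blast
      have "code (x, 0) = m" "code (y, 0) = n" using code_eq badj_VV[OF y(1)] x y(2) base by auto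
      then show ?thesis using nadj_base[OF y(1)] by blast
    qed
  qed
qed

lemma edges_adj:
  assumes "m < total" "n < total"
  shows "{m, n} \<in> edges code \<longleftrightarrow> adj m n \<or> adj n m"
proof -
  have "{m, n} \<in> edges code \<longleftrightarrow> (\<exists>u v. nadj u v \<and> code u = m \<and> code v = n) \<or> (\<exists>u v. nadj u v \<and> code u = n \<and> code v = m)"
    unfolding edges_def by (auto simp: doubleton_eq_iff) blast+
  then show ?thesis using adj_iff assms by blast
qed

definition graph :: "nat set set" where "graph = edges code"

lemma graph_adj: "m < total \<Longrightarrow> n < total \<Longrightarrow> {m, n} \<in> graph \<longleftrightarrow> adj m n \<or> adj n m"
  unfolding graph_def by (rule edges_adj)

lemma graph_simple: "simple_graph {..<total} graph"
  unfolding graph_def by (rule edges_simple[OF code_inj_on code_range])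

lemma graph_class: "triangle_free graph" "planar {..<total} graph" "vdegree graph m \<le> 12"
  unfolding graph_def
    by (rule edges_triangle_free[of lam code], erule nadj_labels)
      (rule graph_planar, rule edges_degree[OF code_inj_on], erule badj_degree)

lemma graph_choosable: "choosable 3 5 {..<total} graph \<longleftrightarrow> qcnf nv nc U Occ"
  unfolding graph_def choosable_edges[OF code_inj_on code_range] network_choosable ..

end

lemma PF_if: "PF P \<Longrightarrow> PF Q \<Longrightarrow> PF R \<Longrightarrow> PF (\<lambda>x e. if P x e then Q x e else R x e)"
  unfolding if_bool_eq_conj by (intro PF_intros)

lemma if_eq: "((if P then a else b) = c) = (if P then a = c else b = c)"
  by simp

lemma att_simps:
  "(Key k = Key l) = (k = l)" "(Kill = Key l) = False" "(Free = Key l) = False" "(Key l = Kill) = False"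
  "(Free = (Kill :: 'a att)) = False" "((Kill :: 'a att) = Kill) = True"
  by simp_all

lemma PF_adj:
  assumes U: "PF (\<lambda>x e. U x (e 0))" and Occ: "PF (\<lambda>x e. Occ x (e 0) (e 1))" and N: "PT (\<lambda>x e. nv x)"
    and pos: "\<And>x. 0 < nv x"
  shows "PF (\<lambda>x e. cells.adj (nv x) (U x) (Occ x) (e i) (e j))"
proof -
  have c: "cells (nv x)" for x using pos by (simp add: cells_def)
  have U': "PF (\<lambda>x e. U x (t x e))" if "PT t" for t
    by (rule PF_bind2[where Q = "\<lambda>x a b. U x a", OF that that U])
  have Occ': "PF (\<lambda>x e. Occ x (s x e) (t x e))" if "PT s" "PT t" for s t
    by (rule PF_bind2[OF that Occ])
  note defs = cells.row_def[OF c] cells.col_def[OF c] cells.sym_def[OF c]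
  have tm: "PT (\<lambda>x e. cells.row (nv x) (e i))" "PT (\<lambda>x e. cells.col (nv x) (e i))" "PT (\<lambda>x e. cells.sym (e i))" for i
    unfolding defs by (intro PF_intros N)+
  have att: "PF (\<lambda>x e. cells.att (nv x) (Occ x) (I x e, J x e, b) d = Key (I' x e, J' x e, k))"
    if "PT I" "PT J" "PT I'" "PT J'" for I J I' J' and b d k
    unfolding cells.att.simps[OF c] cells.root_def[OF c] if_eq att_simps prod.inject
    by (intro PF_intros PF_if Occ' N that)
  have att_Kill: "PF (\<lambda>x e. cells.att (nv x) (Occ x) (I x e, J x e, b) d = Kill)" if "PT I" "PT J" for I J and b d
    unfolding cells.att.simps[OF c] cells.root_def[OF c] if_eq att_simps
    by (intro PF_intros PF_if Occ' N that)
  have has_block: "PF (\<lambda>x e. cells.has_block (U x) (cells.row (nv x) (e i)) (cells.col (nv x) (e i)) b)" for b i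
    unfolding cells.has_block_def[OF c] by (intro PF_intros PF_if U' tm)
  have has_gadget: "PF (\<lambda>x e. cells.has_gadget (nv x) (U x) (Occ x) (cells.row (nv x) (e i)) (cells.col (nv x) (e i)) (cells.sym (e i)))" for i
    unfolding cells.has_gadget_def[OF c] by (intro PF_intros PF_list_ex att_Kill has_block tm)
  show ?thesis
    unfolding cells.adj_def[OF c] by (intro PF_intros PF_list_ex att has_block has_gadget tm)
qed

text \<open>The grid needs at least one column, so a variable that occurs in no clause is
  added.\<close>

lemma qcnf_pad: "qcnf (Suc nv) nc U (\<lambda>c l. Occ c l \<and> l < 2 * nv) \<longleftrightarrow> qcnf nv nc U Occ"
proof
  assume q: "qcnf (Suc nv) nc U (\<lambda>c l. Occ c l \<and> l < 2 * nv)"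
  show "qcnf nv nc U Occ" unfolding qcnf_def
  proof
    fix \<sigma> :: "nat \<Rightarrow> bool"
    obtain \<tau> where "\<forall>v<Suc nv. U v \<longrightarrow> \<tau> v = \<sigma> v" "\<forall>c<nc. \<exists>l<2 * Suc nv. (Occ c l \<and> l < 2 * nv) \<and> \<tau> (l div 2) = even l"
      using q unfolding qcnf_def by blast
    then show "\<exists>\<tau>. (\<forall>v<nv. U v \<longrightarrow> \<tau> v = \<sigma> v) \<and> (\<forall>c<nc. \<exists>l<2 * nv. Occ c l \<and> \<tau> (l div 2) = even l)"
      by (intro exI[of _ \<tau>]) (meson less_Suc_eq)
  qed
next
  assume q: "qcnf nv nc U Occ"
  show "qcnf (Suc nv) nc U (\<lambda>c l. Occ c l \<and> l < 2 * nv)" unfolding qcnf_def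
  proof
    fix \<sigma> :: "nat \<Rightarrow> bool"
    obtain \<tau> where t: "\<forall>v<nv. U v \<longrightarrow> \<tau> v = \<sigma> v" "\<forall>c<nc. \<exists>l<2 * nv. Occ c l \<and> \<tau> (l div 2) = even l"
      using q unfolding qcnf_def by blast
    have e: "(\<tau>(nv := \<sigma> nv)) (l div 2) = \<tau> (l div 2)" if "l < 2 * nv" for l using that by auto
    show "\<exists>\<tau>. (\<forall>v<Suc nv. U v \<longrightarrow> \<tau> v = \<sigma> v) \<and> (\<forall>c<nc. \<exists>l<2 * Suc nv. (Occ c l \<and> l < 2 * nv) \<and> \<tau> (l div 2) = even l)"
    proof (rule exI[of _ "\<tau>(nv := \<sigma> nv)"], intro conjI allI impI)
      fix v assume "v < Suc nv" "U v" then show "(\<tau>(nv := \<sigma> nv)) v = \<sigma> v" using t(1) by (auto simp: less_Suc_eq)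
    next
      fix c assume "c < nc"
      then obtain l where "l < 2 * nv" "Occ c l" "\<tau> (l div 2) = even l" using t(2) by blast
      then show "\<exists>l<2 * Suc nv. (Occ c l \<and> l < 2 * nv) \<and> (\<tau>(nv := \<sigma> nv)) (l div 2) = even l"
        using e[of l] by (intro exI[of _ l]) auto
    qed
  qed
qed

theorem theorem4p5:
  shows "Pi2p_complete_on
    (graph_problem (\<lambda>V E. triangle_free E \<and> planar V E \<and> (\<forall>v\<in>V. vdegree E v \<le> 12)))
    (CH 3 5)"
  unfolding Pi2p_complete_on_def
proof (intro conjI ballI)
  show "\<exists>A\<in>Pi2p. \<forall>x\<in>graph_problem (\<lambda>V E. triangle_free E \<and> planar V E \<and> (\<forall>v\<in>V. vdegree E v \<le> 12)). (x \<in> A) = (x \<in> CH 3 5)"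
    by (rule choosability_in_Pi2p)
next
  fix A assume "A \<in> Pi2p"
  from Pi2p_qcnf[OF this] obtain pv pc U Occ where PF: "PF (\<lambda>x e. U x (e 0))" "PF (\<lambda>x e. Occ x (e 0) (e 1))"
    and A: "\<And>x. x \<in> A \<longleftrightarrow> qcnf (poly pv (length x)) (poly pc (length x)) (U x) (Occ x)"
    by blast
  define nv where "nv x = Suc (poly pv (length x))" for x :: "bool list"
  define nc where "nc x = poly pc (length x)" for x :: "bool list"
  define Occ' where "Occ' x c l \<longleftrightarrow> Occ x c l \<and> l < 2 * poly pv (length x)" for x c l
  define n where "n x = cells.total (nv x) (nc x)" for x
  define E where "E x = cells.graph (nv x) (nc x) (U x) (Occ' x)" for x
  have c: "cells (nv x)" for x by (simp add: cells_def nv_def)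
  have n: "n x = poly ((pc + 1) * (2 * (pv + 1)) * 157 * 46) (length x)" for x
    unfolding n_def cells.total_def[OF c] by (simp add: nv_def nc_def algebra_simps)
  have "PF (\<lambda>x e. cells.adj (nv x) (U x) (Occ' x) (e i) (e j))" for i j
  proof (rule PF_adj)
    show "PF (\<lambda>x e. Occ' x (e 0) (e 1))" unfolding Occ'_def by (intro PF_intros PF PT_poly)
    show "PT (\<lambda>x e. nv x)" unfolding nv_def by (intro PF_intros PT_poly)
  qed (simp_all add: PF nv_def)
  then have adj: "PF (\<lambda>x e. cells.adj (nv x) (U x) (Occ' x) (e 0) (e 1) \<or> cells.adj (nv x) (U x) (Occ' x) (e 1) (e 0))"
    by (intro PF_disj)
  have "polytime (\<lambda>x. enc_graph (n x) (E x))"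
  proof (rule polytime_graph[OF adj n])
    fix x i j assume "i < n x" "j < n x"
    then show "({i, j} \<in> E x) = (cells.adj (nv x) (U x) (Occ' x) (env [i, j] 0) (env [i, j] 1) \<or>
        cells.adj (nv x) (U x) (Occ' x) (env [i, j] 1) (env [i, j] 0))"
      using cells.graph_adj[OF c] by (simp add: n_def E_def env_Cons)
  qed
  moreover have simple: "simple_graph {..<n x} (E x)" for x
    unfolding n_def E_def by (rule cells.graph_simple[OF c])
  moreover have "enc_graph (n x) (E x) \<in> graph_problem (\<lambda>V E. triangle_free E \<and> planar V E \<and> (\<forall>v\<in>V. vdegree E v \<le> 12))" for x
    using simple[of x] cells.graph_class[OF c] unfolding graph_problem_def n_def E_def by blast
  moreover have "x \<in> A \<longleftrightarrow> enc_graph (n x) (E x) \<in> CH 3 5" for x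
  proof -
    have "x \<in> A \<longleftrightarrow> qcnf (nv x) (nc x) (U x) (Occ' x)" unfolding A nv_def nc_def Occ'_def qcnf_pad ..
    also have "\<dots> \<longleftrightarrow> choosable 3 5 {..<n x} (E x)" unfolding n_def E_def by (rule cells.graph_choosable[OF c, symmetric])
    also have "\<dots> \<longleftrightarrow> enc_graph (n x) (E x) \<in> CH 3 5"
    proof
      assume "choosable 3 5 {..<n x} (E x)"
      then show "enc_graph (n x) (E x) \<in> CH 3 5" using simple[of x] unfolding graph_problem_def by blast
    next
      assume "enc_graph (n x) (E x) \<in> CH 3 5"
      then obtain m D where D: "enc_graph (n x) (E x) = enc_graph m D" "simple_graph {..<m} D" "choosable 3 5 {..<m} D"
        unfolding graph_problem_def by blast
      then show "choosable 3 5 {..<n x} (E x)" using enc_graph_inj[OF D(1) simple[of x] D(2)] by simp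
    qed
    finally show ?thesis .
  qed
  ultimately show "\<exists>f. polytime f \<and> (\<forall>x. f x \<in> graph_problem (\<lambda>V E. triangle_free E \<and> planar V E \<and> (\<forall>v\<in>V. vdegree E v \<le> 12)) \<and>
      (x \<in> A \<longleftrightarrow> f x \<in> CH 3 5))"
    by (intro exI[of _ "\<lambda>x. enc_graph (n x) (E x)"]) blast
qed

end
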